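(* Let $k\ge1$ be an integer. Suppose that $\theta$ is in the interior of $\Theta$, that $\hat\theta_n$ satisfies $\sqrt n\,|\hat\theta_n-\theta|=O_P(1)$, that $\varepsilon_0$ is a nondegenerate random variable, and that $\lim_{x\to 0}x^{-\zeta}P\{|\varepsilon_0|\le x\}=0$ for some $\zeta>0$. If $E|\varepsilon_0|^{\max\{k,2\}}<\infty$, then, as $n\to\infty$, $$\sup_{0\le u\le1}\frac1{\sqrt n}\left|\frac{\hat T_n^{(k)}(u)}{\hat\sigma_{(n)}^k}-\frac{T_n^{(k)}(u)}{\sigma_{(n)}^k}\right|=o_P(1).$$
   Context: Model. Let $p,q\ge 1$ be integers and $\theta=(\alpha_0,\alpha_1,\dots,\alpha_p,\beta_1,\dots,\beta_q)$ with $\alpha_0>0$, $\alpha_i\ge 0$, $\beta_j\ge 0$. Let $\{\varepsilon_t\}_{t\in\mathbb Z}$ be i.i.d. random variables with mean $0$ and variance $1$. $\{X_t\}_{t\in\mathbb Z}$ is a GARCH$(p,q)$ sequence: $X_t=\sigma_t\varepsilon_t$, $\sigma_t^2=\alpha_0+\sum_{i=1}^p\alpha_iX_{t-i}^2+\sum_{j=1}^q\beta_j\sigma_{t-j}^2$. Standing assumption: the Bougerol–Picard conditions hold, under which these equations have a unique strictly stationary solution, with $\sigma_t$ a function of $\varepsilon_{t-1},\varepsilon_{t-2},\dots$; $\{X_t\}$ is this solution. Notation. $|\cdot|$ is the maximum norm of vectors. For $\mathbf u=(s_0,\dots,s_p,t_1,\dots,t_q)\in\mathbb R^{p+q+1}$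 put $c_0(\mathbf u)=s_0/(1-(t_1+\cdots+t_q))$ and, recursively for $i\ge 1$, $c_i(\mathbf u)=s_i+\sum_{j=1}^{\min(i-1,q)}t_jc_{i-j}(\mathbf u)$ if $i\le p$, and $c_i(\mathbf u)=\sum_{j=1}^{\min(i-1,q)}t_jc_{i-j}(\mathbf u)$ if $i>p$. Fix $0<\underline u<\bar u$, $0<\rho_0<1$ with $q\underline u<\rho_0$, and let $\Theta$ be the set of $\mathbf u$ with $t_1+\cdots+t_q\le\rho_0$ and all coordinates of $\mathbf u$ in $[\underline u,\bar u]$. The conditional variance satisfies $\sigma_t^2=c_0(\theta)+\sum_{i=1}^\infty c_i(\theta)X_{t-i}^2$. Residuals. $\hat\theta_n$ is an estimator of $\theta$ based on $X_0,\dots,X_n$. For $1\le t\le n$, $\hat\sigma_t^2=c_0(\hat\theta_n)+\sum_{i=1}^tc_i(\hat\theta_n)X_{t-i}^2$ and $\hat\varepsilon_t=X_t/\hat\sigma_t$. Let $\bar{\hat\varepsilon}=\frac1n\sum_{t=1}^n\hat\varepsilon_t$ and $\bar\varepsilon=\frac1n\sum_{t=1}^n\varepsilon_t$. For $0\le u\le1$, $\hat T_n^{(k)}(u)=\sum_{t=1}^{[nu]}(\hat\varepsilon_t-\bar{\hat\varepsilon})^k$ and $T_n^{(k)}(u)=\sum_{t=1}^{[nu]}(\varepsilon_t-\bar\varepsilon)^k$. Finally $\hat\sigma_{(n)}=\bigl(\hat T_n^{(2)}(1)/n\bigr)^{1/2}$ and $\sigma_{(n)}=\bigl(T_n^{(2)}(1)/n\bigr)^{1/2}$.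 *)

theory Defs
  imports "HOL-Probability.Probability" "Jordan_Normal_Form.Matrix"
begin

(* Parameter vectors u = (s_0,...,s_p,t_1,...,t_q) are points of Euclidean_space (p + q + 1), i.e.
   functions nat => real vanishing from p + q + 1 on: s_i = u i for i <= p and t_j = u (p + j)
   for 1 <= j <= q.  For the GARCH parameter, alpha_i = theta i and beta_j = theta (p + j). *)

definition max_norm :: "nat \<Rightarrow> (nat \<Rightarrow> real) \<Rightarrow> real" where
  "max_norm d v = Max ((\<lambda>i. \<bar>v i\<bar>) ` {..<d})"

definition param_set :: "nat \<Rightarrow> nat \<Rightarrow> real \<Rightarrow> real \<Rightarrow> real \<Rightarrow> (nat \<Rightarrow> real) set" where
  "param_set p q u_lo u_hi \<rho> = {u \<in> topspace (Euclidean_space (p + q + 1)).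
     (\<Sum>j=1..q. u (p + j)) \<le> \<rho> \<and> (\<forall>i<p + q + 1. u i \<in> {u_lo..u_hi})}"

function garch_coeff :: "nat \<Rightarrow> nat \<Rightarrow> (nat \<Rightarrow> real) \<Rightarrow> nat \<Rightarrow> real" where
  "garch_coeff p q u i =
     (if i = 0 then u 0 / (1 - (\<Sum>j=1..q. u (p + j)))
      else (if i \<le> p then u i else 0) +
           (\<Sum>j=1..min (i - 1) q. u (p + j) * garch_coeff p q u (i - j)))"
  by auto
termination by (relation "Wellfounded.measure (\<lambda>(p, q, u, i). i)") auto

declare garch_coeff.simps [simp del]

definition iid_process :: "'a measure \<Rightarrow> (int \<Rightarrow> 'a \<Rightarrow> real) \<Rightarrow> bool" where
  "iid_process M \<epsilon> \<longleftrightarrow> prob_space.indep_vars M (\<lambda>_. borel) \<epsilon> UNIV \<and>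
     (\<forall>t. distr M borel (\<epsilon> t) = distr M borel (\<epsilon> 0))"

(* Equality of the laws on the product sigma-algebra is equality of all
   finite-dimensional distributions. *)
definition strictly_stationary :: "'a measure \<Rightarrow> 'b measure \<Rightarrow> (int \<Rightarrow> 'a \<Rightarrow> 'b) \<Rightarrow> bool" where
  "strictly_stationary M N Y \<longleftrightarrow> (\<forall>t. Y t \<in> measurable M N) \<and>
     (\<forall>h. distr M (\<Pi>\<^sub>M t\<in>UNIV. N) (\<lambda>\<omega> t. Y (t + h) \<omega>) = distr M (\<Pi>\<^sub>M t\<in>UNIV. N) (\<lambda>\<omega> t. Y t \<omega>))"

definition garch_equations ::
  "'a measure \<Rightarrow> nat \<Rightarrow> nat \<Rightarrow> (nat \<Rightarrow> real) \<Rightarrow> (int \<Rightarrow> 'a \<Rightarrow> real) \<Rightarrow>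
     (int \<Rightarrow> 'a \<Rightarrow> real) \<Rightarrow> (int \<Rightarrow> 'a \<Rightarrow> real) \<Rightarrow> bool" where
  "garch_equations M p q \<theta> \<epsilon> X \<sigma> \<longleftrightarrow>
     (AE \<omega> in M. \<forall>t. \<sigma> t \<omega> \<ge> 0 \<and> X t \<omega> = \<sigma> t \<omega> * \<epsilon> t \<omega> \<and>
        (\<sigma> t \<omega>)\<^sup>2 = \<theta> 0 + (\<Sum>i=1..p. \<theta> i * (X (t - int i) \<omega>)\<^sup>2)
                     + (\<Sum>j=1..q. \<theta> (p + j) * (\<sigma> (t - int j) \<omega>)\<^sup>2))"

definition stationary_garch ::
  "'a measure \<Rightarrow> nat \<Rightarrow> nat \<Rightarrow> (nat \<Rightarrow> real) \<Rightarrow> (int \<Rightarrow> 'a \<Rightarrow> real) \<Rightarrow>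
     (int \<Rightarrow> 'a \<Rightarrow> real) \<Rightarrow> (int \<Rightarrow> 'a \<Rightarrow> real) \<Rightarrow> bool" where
  "stationary_garch M p q \<theta> \<epsilon> X \<sigma> \<longleftrightarrow>
     garch_equations M p q \<theta> \<epsilon> X \<sigma> \<and>
     strictly_stationary M (borel \<Otimes>\<^sub>M borel) (\<lambda>t \<omega>. (X t \<omega>, \<sigma> t \<omega>)) \<and>
     (\<exists>f \<in> borel_measurable (\<Pi>\<^sub>M i\<in>(UNIV :: nat set). (borel :: real measure)).
        \<forall>t. AE \<omega> in M. \<sigma> t \<omega> = f (\<lambda>i. \<epsilon> (t - 1 - int i) \<omega>))"

(* The matrix of Bougerol and Picard: with
     Y_t = (sigma_{t+1}^2, ..., sigma_{t-q+2}^2, X_t^2, ..., X_{t-p+2}^2)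
   the GARCH equations read Y_t = A_t Y_{t-1} + (alpha_0, 0, ..., 0), where
   A_t = garch_matrix p q theta eps_t is square of size p + q - 1.  (For p = 1 the X-block of Y_t
   is empty.) *)
definition garch_matrix :: "nat \<Rightarrow> nat \<Rightarrow> (nat \<Rightarrow> real) \<Rightarrow> real \<Rightarrow> real mat" where
  "garch_matrix p q \<theta> e = Matrix.mat (p + q - 1) (p + q - 1) (\<lambda>(i, j).
     if i = 0 then
       (if j = 0 then \<theta> (p + 1) + \<theta> 1 * e\<^sup>2
        else if j < q then \<theta> (p + j + 1)
        else \<theta> (j - q + 2))
     else if i = q then (if j = 0 then e\<^sup>2 else 0)
     else (if i = j + 1 then 1 else 0))"

(* Operator norm induced by the maximum norm of vectors. *)
definition mat_norm :: "real mat \<Rightarrow> real" where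
  "mat_norm A = Max ((\<lambda>i. \<Sum>j<dim_col A. \<bar>A $$ (i, j)\<bar>) ` {..<dim_row A})"

definition ext_ln :: "real \<Rightarrow> ereal" where
  "ext_ln x = (if x \<le> 0 then -\<infinity> else ereal (ln x))"

(* e2ennreal maps negative arguments to 0, so this is E f^+ - E f^-. *)
definition ext_expectation :: "'a measure \<Rightarrow> ('a \<Rightarrow> ereal) \<Rightarrow> ereal" where
  "ext_expectation M f =
     enn2ereal (\<integral>\<^sup>+ \<omega>. e2ennreal (f \<omega>) \<partial>M) - enn2ereal (\<integral>\<^sup>+ \<omega>. e2ennreal (- f \<omega>) \<partial>M)"

(* A_0 A_{-1} ... A_{-n} *)
definition garch_matrix_prod ::
  "nat \<Rightarrow> nat \<Rightarrow> (nat \<Rightarrow> real) \<Rightarrow> (int \<Rightarrow> real) \<Rightarrow> nat \<Rightarrow> real mat" where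
  "garch_matrix_prod p q \<theta> e n =
     foldr (\<lambda>m B. garch_matrix p q \<theta> (e (- int m)) * B) [0..<Suc n] (1\<^sub>m (p + q - 1))"

definition lyapunov_exponent ::
  "'a measure \<Rightarrow> nat \<Rightarrow> nat \<Rightarrow> (nat \<Rightarrow> real) \<Rightarrow> (int \<Rightarrow> 'a \<Rightarrow> real) \<Rightarrow> ereal" where
  "lyapunov_exponent M p q \<theta> \<epsilon> =
     (INF n::nat. ext_expectation M
        (\<lambda>\<omega>. ext_ln (mat_norm (garch_matrix_prod p q \<theta> (\<lambda>t. \<epsilon> t \<omega>) n))) / ereal (real (Suc n)))"

definition bougerol_picard ::
  "'a measure \<Rightarrow> nat \<Rightarrow> nat \<Rightarrow> (nat \<Rightarrow> real) \<Rightarrow> (int \<Rightarrow> 'a \<Rightarrow> real) \<Rightarrow> bool" where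
  "bougerol_picard M p q \<theta> \<epsilon> \<longleftrightarrow>
     (\<integral>\<^sup>+ \<omega>. e2ennreal (ext_ln (mat_norm (garch_matrix p q \<theta> (\<epsilon> 0 \<omega>)))) \<partial>M) < \<infinity> \<and>
     lyapunov_exponent M p q \<theta> \<epsilon> < 0"

definition residual ::
  "nat \<Rightarrow> nat \<Rightarrow> (nat \<Rightarrow> real) \<Rightarrow> (int \<Rightarrow> real) \<Rightarrow> int \<Rightarrow> real" where
  "residual p q u x t =
     x t / sqrt (garch_coeff p q u 0 + (\<Sum>i=1..nat t. garch_coeff p q u i * (x (t - int i))\<^sup>2))"

definition sample_mean :: "(int \<Rightarrow> real) \<Rightarrow> nat \<Rightarrow> real" where
  "sample_mean e n = (\<Sum>t=1..int n. e t) / real n"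

definition partial_sum :: "(int \<Rightarrow> real) \<Rightarrow> nat \<Rightarrow> nat \<Rightarrow> real \<Rightarrow> real" where
  "partial_sum e k n u = (\<Sum>t=1..\<lfloor>real n * u\<rfloor>. (e t - sample_mean e n) ^ k)"

definition sample_sd :: "(int \<Rightarrow> real) \<Rightarrow> nat \<Rightarrow> real" where
  "sample_sd e n = sqrt (partial_sum e 2 n 1 / real n)"

definition bounded_in_prob :: "'a measure \<Rightarrow> (nat \<Rightarrow> 'a \<Rightarrow> real) \<Rightarrow> bool" where
  "bounded_in_prob M Z \<longleftrightarrow> (\<forall>n. Z n \<in> borel_measurable M) \<and>
     (\<forall>\<delta>>0. \<exists>C. \<forall>\<^sub>F n in sequentially. measure M {\<omega> \<in> space M. \<bar>Z n \<omega>\<bar> > C} \<le> \<delta>)"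

definition null_in_prob :: "'a measure \<Rightarrow> (nat \<Rightarrow> 'a \<Rightarrow> real) \<Rightarrow> bool" where
  "null_in_prob M Z \<longleftrightarrow> (\<forall>n. Z n \<in> borel_measurable M) \<and>
     (\<forall>\<delta>>0. (\<lambda>n. measure M {\<omega> \<in> space M. \<bar>Z n \<omega>\<bar> > \<delta>}) \<longlonglongrightarrow> 0)"

end

theory Submission
  imports Defs "HOL-Real_Asymp.Real_Asymp"
begin

text \<open>
  Write \<open>h\<close> for the squared volatility \<open>\<sigma>\<^sup>2\<close> at time \<open>t\<close> and \<open>\<delta>\<close> for the estimation error. A residual is the
  innovation times \<open>y = sqrt (h / h_hat)\<close>, where \<open>h_hat\<close> is the series of \<open>h\<close> with estimated coefficients,
  cut off at the first observation. To first order \<open>y\<close> is \<open>1 - \<delta> D / 2\<close>, where the score \<open>D\<close> is the gradient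
  of \<open>ln h\<close> with respect to the parameter. The score is a stationary function of the strict past,
  hence independent of the present innovation. Its mean \<open>\<mu>\<close> multiplies all residuals of a sample by
  the same factor \<open>b = 1 - \<delta> \<mu> / 2\<close>, which does not change a statistic normalised by the sample standard
  deviation (\<open>self_normalised_scale\<close>). What remains of the first-order term in the \<open>m\<close>-th power sums
  is a multiple of \<open>\<delta>\<close> times the sum of \<open>\<epsilon> ^ m (D - \<mu>)\<close>. These summands have mean zero, so the maximum of
  their partial sums is \<open>o (n)\<close>, and \<open>\<delta> = O (n powr (- 1 / 2))\<close> makes the product \<open>o (sqrt n)\<close>. Thus all
  power sums of the rescaled residuals and of the innovations agree up to \<open>o (sqrt n)\<close>
  (\<open>perturbed_power_sums\<close>), and so do the centred and normalised sums (\<open>self_normalised_sums_close\<close>).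

  The remainder is controlled as follows. The coefficients of the volatility series are polynomials
  in the parameters whose degree is at most the index. A relative change \<open>\<kappa>\<close> of the parameters
  therefore changes the coefficient \<open>i\<close> by a factor of at most \<open>(1 + \<kappa>) ^ i\<close>, with a Taylor remainder of
  relative size \<open>i\<^sup>2 \<kappa>\<^sup>2 (1 + \<kappa>) ^ i\<close> (\<open>garch_coeff_taylor\<close>). After division by \<open>h\<close> each term of the series
  is replaced by a small power of itself (\<open>ratio_le_powr\<close>), so the relative errors have a majorant of
  which high powers are integrable as soon as \<open>\<sigma>\<close> has some fractional moment
  (\<open>sqrt_ratio_expansion\<close>). The part that is lost at the first observation decays geometrically in \<open>t\<close>
  (\<open>tail_bound\<close>), so its sum stays bounded along almost every path.

  A fractional moment of \<open>\<sigma>\<close> comes from the negative Lyapunov exponent. Some product of the random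
  matrices has a norm with negative mean logarithm, hence with a moment of small order \<open>s\<close> below one
  (\<open>log_moment_contraction\<close>). Iterating the state recursion over blocks of that length bounds the
  moment of order \<open>s\<close> by a geometric series (\<open>smax_fractional_moment\<close>).

  For the law of large numbers, an integrable function of the past is approximated in mean by a
  bounded function of finitely many innovations, for which the variance of a sum of \<open>n\<close> shifted copies is
  of order \<open>n\<close>; a grid of finitely many sample fractions gives the maximal form (\<open>max_dev_tendsto_0\<close>).
  This convergence in mean is almost sure along subsequences, so that the estimates above can be
  carried out on single paths (\<open>residual_sums_close_on_path\<close>); convergence in probability follows
  because every subsequence has a further subsequence along which it holds.
\<close>

section \<open>Perturbation of the ARCH coefficients\<close>

lemma garch_coeff_0: "garch_coeff p q u 0 = u 0 / (1 - (\<Sum>j=1..q. u (p + j)))"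
  by (subst garch_coeff.simps) simp

lemma garch_coeff_pos_index:
  assumes "i > 0"
  shows "garch_coeff p q u i = (if i \<le> p then u i else 0) +
    (\<Sum>j=1..min (i - 1) q. u (p + j) * garch_coeff p q u (i - j))"
  by (subst garch_coeff.simps) (use assms in simp)

lemma garch_coeff_nonneg:
  assumes "\<And>l. l < p + q + 1 \<Longrightarrow> 0 \<le> u l" and "i > 0"
  shows "0 \<le> garch_coeff p q u i"
  using assms(2)
proof (induction i rule: less_induct)
  case (less i)
  have "0 \<le> (\<Sum>j=1..min (i - 1) q. u (p + j) * garch_coeff p q u (i - j))"
    using less assms(1) by (intro sum_nonneg mult_nonneg_nonneg) auto
  moreover have "0 \<le> (if i \<le> p then u i else 0)"
    using assms(1) by auto
  ultimately show ?case
    using less.prems by (subst garch_coeff_pos_index) auto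
qed

text \<open>Unrolling the recursion writes the coefficient with index \<open>i > 0\<close> as a
  polynomial in the parameters with nonnegative coefficients whose monomials have degree at most
  \<open>i\<close>. Enlarging every parameter by a factor \<open>a \<ge> 1\<close> therefore costs
  at most \<open>a ^ i\<close>.\<close>

lemma garch_coeff_le_power_mult:
  assumes "\<And>l. l < p + q + 1 \<Longrightarrow> 0 \<le> u l" and "\<And>l. l < p + q + 1 \<Longrightarrow> 0 \<le> \<theta> l"
    and "\<And>l. l < p + q + 1 \<Longrightarrow> u l \<le> a * \<theta> l" and "a \<ge> 1" and "i > 0"
  shows "garch_coeff p q u i \<le> a ^ i * garch_coeff p q \<theta> i"
  using assms(5)
proof (induction i rule: less_induct)
  case (less i)
  have a0: "a \<ge> 0" using assms(4) by simp
  have aa: "a \<le> a ^ i" using assms(4) less.prems self_le_power by blast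
  have "(\<Sum>j=1..min (i - 1) q. u (p + j) * garch_coeff p q u (i - j))
     \<le> (\<Sum>j=1..min (i - 1) q. a ^ i * (\<theta> (p + j) * garch_coeff p q \<theta> (i - j)))"
  proof (rule sum_mono)
    fix j assume j: "j \<in> {1..min (i - 1) q}"
    have p1: "a * a ^ (i - j) \<le> a ^ i"
      using j assms(4) by (subst power_Suc[symmetric], intro power_increasing) auto
    have "u (p + j) * garch_coeff p q u (i - j) \<le> (a * \<theta> (p + j)) * (a ^ (i - j) * garch_coeff p q \<theta> (i - j))"
      using j assms a0 less.IH[of "i - j"]
      by (intro mult_mono garch_coeff_nonneg mult_nonneg_nonneg) auto
    also have "\<dots> = (a * a ^ (i - j)) * (\<theta> (p + j) * garch_coeff p q \<theta> (i - j))" by (simp add: ac_simps)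
    also have "\<dots> \<le> a ^ i * (\<theta> (p + j) * garch_coeff p q \<theta> (i - j))"
      using j assms by (intro mult_right_mono p1 mult_nonneg_nonneg garch_coeff_nonneg) auto
    finally show "u (p + j) * garch_coeff p q u (i - j) \<le> a ^ i * (\<theta> (p + j) * garch_coeff p q \<theta> (i - j))" .
  qed
  moreover have "(if i \<le> p then u i else 0) \<le> a ^ i * (if i \<le> p then \<theta> i else 0)"
  proof (cases "i \<le> p")
    case True
    have "a * \<theta> i \<le> a ^ i * \<theta> i" using True aa assms(2)[of i] by (intro mult_right_mono) auto
    then show ?thesis using True assms(3)[of i] by auto
  qed simp
  ultimately show ?case
    using less.prems by (simp add: garch_coeff_pos_index[of i] sum_distrib_left distrib_left)
qed

lemma garch_coeff_ge_power_mult: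
  assumes "\<And>l. l < p + q + 1 \<Longrightarrow> 0 \<le> u l" and "\<And>l. l < p + q + 1 \<Longrightarrow> 0 \<le> \<theta> l"
    and "\<And>l. l < p + q + 1 \<Longrightarrow> a * \<theta> l \<le> u l" and "0 < a" "a \<le> 1" and "i > 0"
  shows "a ^ i * garch_coeff p q \<theta> i \<le> garch_coeff p q u i"
proof -
  have "garch_coeff p q \<theta> i \<le> (1 / a) ^ i * garch_coeff p q u i"
    using assms by (intro garch_coeff_le_power_mult) (auto simp: field_simps)
  then show ?thesis using assms(4) by (simp add: field_simps power_divide)
qed

lemma power_diff_inverse: "0 < r \<Longrightarrow> j \<le> i \<Longrightarrow> r ^ (i - j) = r ^ i * (1 / r) ^ j" for r :: real
  by (simp add: power_diff power_divide)

text \<open>Measured in the scale \<open>r ^ i\<close> the recursion has total weight \<open>b <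
  1\<close>. The constant \<open>C\<close> solves \<open>C = m * (1 / r) ^ p + C * b\<close>, where
  the first summand pays for the inhomogeneous terms, which occur up to index
  \<open>p\<close>.\<close>

lemma garch_coeff_geometric_decay:
  assumes "\<And>l. l < p + q + 1 \<Longrightarrow> 0 \<le> \<theta> l" and "0 < r" "r \<le> 1"
    and B: "(\<Sum>j=1..q. \<theta> (p + j) * (1 / r) ^ j) < 1"
  shows "\<exists>C>0. \<forall>i>0. garch_coeff p q \<theta> i \<le> C * r ^ i"
proof -
  define b where "b = (\<Sum>j=1..q. \<theta> (p + j) * (1 / r) ^ j)"
  define m where "m = (\<Sum>l\<le>p. \<theta> l) + 1"
  define C where "C = m * (1 / r) ^ p / (1 - b)"
  have th0: "0 \<le> \<theta> l" if "l \<le> p" for l using assms(1)[of l] that by auto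
  have m: "\<theta> l \<le> m" if "l \<le> p" for l
    using member_le_sum[of l "{..p}" \<theta>] th0 that by (auto simp: m_def)
  have mp: "m > 0" using sum_nonneg[of "{..p}" \<theta>] th0 by (auto simp: m_def)
  have b1: "b < 1" using B by (simp add: b_def)
  have C0: "C > 0" using mp b1 assms by (auto simp: C_def)
  have "C * (1 - b) = m * (1 / r) ^ p" using b1 by (simp add: C_def)
  then have CC: "m * (1 / r) ^ p + C * b = C" by (simp add: algebra_simps)
  have "garch_coeff p q \<theta> i \<le> C * r ^ i" if "i > 0" for i
    using that
  proof (induction i rule: less_induct)
    case (less i)
    have "(\<Sum>j=1..min (i - 1) q. \<theta> (p + j) * garch_coeff p q \<theta> (i - j))
       \<le> (\<Sum>j=1..min (i - 1) q. C * r ^ i * (\<theta> (p + j) * (1 / r) ^ j))"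
    proof (rule sum_mono)
      fix j assume j: "j \<in> {1..min (i - 1) q}"
      have "\<theta> (p + j) * garch_coeff p q \<theta> (i - j) \<le> \<theta> (p + j) * (C * r ^ (i - j))"
        using j less.IH[of "i - j"] assms(1) by (intro mult_left_mono) auto
      also have "r ^ (i - j) = r ^ i * (1 / r) ^ j"
        using j assms(2) by (intro power_diff_inverse) auto
      finally show "\<theta> (p + j) * garch_coeff p q \<theta> (i - j) \<le> C * r ^ i * (\<theta> (p + j) * (1 / r) ^ j)"
        by (simp add: ac_simps)
    qed
    also have "\<dots> \<le> (\<Sum>j=1..q. C * r ^ i * (\<theta> (p + j) * (1 / r) ^ j))"
      using C0 assms by (intro sum_mono2) auto
    also have "\<dots> = C * r ^ i * b" by (simp add: b_def sum_distrib_left)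
    finally have 1: "(\<Sum>j=1..min (i - 1) q. \<theta> (p + j) * garch_coeff p q \<theta> (i - j)) \<le> C * r ^ i * b" .
    have 2: "(if i \<le> p then \<theta> i else 0) \<le> m * (1 / r) ^ p * r ^ i"
    proof (cases "i \<le> p")
      case True
      have "1 \<le> (1 / r) ^ (p - i)" using assms(2,3) by (intro one_le_power) auto
      also have "\<dots> = (1 / r) ^ p * r ^ i"
        using True assms(2) by (simp add: power_diff power_divide)
      finally have "m * 1 \<le> m * ((1 / r) ^ p * r ^ i)" using mp by (intro mult_left_mono) auto
      with m[OF True] True show ?thesis by (simp add: mult.assoc)
    qed (use mp assms in auto)
    have "garch_coeff p q \<theta> i \<le> m * (1 / r) ^ p * r ^ i + C * r ^ i * b"
      using 1 2 less.prems by (simp add: garch_coeff_pos_index[of i])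
    also have "\<dots> = (m * (1 / r) ^ p + C * b) * r ^ i" by (simp add: algebra_simps)
    finally show ?case by (simp add: CC)
  qed
  with C0 show ?thesis by blast
qed

lemma garch_decay_rate_exists:
  assumes "(\<Sum>j=1..q. \<theta> (p + j)) < (1::real)"
  shows "\<exists>r. 0 < r \<and> r < 1 \<and> (\<Sum>j=1..q. \<theta> (p + j) * (1 / r) ^ j) < 1"
proof -
  have "((\<lambda>r. \<Sum>j=1..q. \<theta> (p + j) * (1 / r) ^ j) \<longlongrightarrow> (\<Sum>j=1..q. \<theta> (p + j) * (1 / 1) ^ j)) (at_left 1)"
    by (intro tendsto_intros) auto
  then have "eventually (\<lambda>r. (\<Sum>j=1..q. \<theta> (p + j) * (1 / r) ^ j) < 1) (at_left 1)"
    using assms by (intro order_tendstoD(2)[of _ "\<Sum>j=1..q. \<theta> (p + j)"]) auto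
  moreover have "eventually (\<lambda>r::real. r \<in> {0<..<1}) (at_left 1)"
    by (rule eventually_at_left_real) simp
  ultimately have "eventually (\<lambda>r. r \<in> {0<..<1} \<and> (\<Sum>j=1..q. \<theta> (p + j) * (1 / r) ^ j) < 1) (at_left 1)"
    by eventually_elim auto
  then have "\<exists>r. r \<in> {0<..<1} \<and> (\<Sum>j=1..q. \<theta> (p + j) * (1 / r) ^ j) < 1"
    by (rule eventually_happens'[rotated]) simp
  then show ?thesis by auto
qed

text \<open>The derivative of the coefficients at \<open>\<theta>\<close> in direction
  \<open>\<delta>\<close>. Differentiating the defining recursion gives a recursion again, so that
  the first-order expansion can be established by induction on the index.\<close>

function garch_deriv ::
  "nat \<Rightarrow> nat \<Rightarrow> (nat \<Rightarrow> real) \<Rightarrow> (nat \<Rightarrow> real) \<Rightarrow> nat \<Rightarrow> real" where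
  "garch_deriv p q \<theta> \<delta> i =
     (if i = 0 then
        (\<delta> 0 + garch_coeff p q \<theta> 0 * (\<Sum>j=1..q. \<delta> (p + j))) / (1 - (\<Sum>j=1..q. \<theta> (p + j)))
      else (if i \<le> p then \<delta> i else 0) +
        (\<Sum>j=1..min (i - 1) q. \<delta> (p + j) * garch_coeff p q \<theta> (i - j) + \<theta> (p + j) * garch_deriv p q \<theta> \<delta> (i - j)))"
  by auto
termination by (relation "Wellfounded.measure (\<lambda>(p, q, \<theta>, \<delta>, i). i)") auto

declare garch_deriv.simps [simp del]

lemma garch_deriv_0: "garch_deriv p q \<theta> \<delta> 0 =
    (\<delta> 0 + garch_coeff p q \<theta> 0 * (\<Sum>j=1..q. \<delta> (p + j))) / (1 - (\<Sum>j=1..q. \<theta> (p + j)))"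
  by (subst garch_deriv.simps) simp

lemma garch_deriv_pos_index:
  assumes "i > 0"
  shows "garch_deriv p q \<theta> \<delta> i = (if i \<le> p then \<delta> i else 0) +
    (\<Sum>j=1..min (i - 1) q. \<delta> (p + j) * garch_coeff p q \<theta> (i - j) + \<theta> (p + j) * garch_deriv p q \<theta> \<delta> (i - j))"
  by (subst garch_deriv.simps) (use assms in simp)

definition unit_dir :: "nat \<Rightarrow> nat \<Rightarrow> real" where
  "unit_dir l = (\<lambda>i. if i = l then 1 else 0)"

lemma sum_unit_dir: "m < d \<Longrightarrow> (\<Sum>l<d. \<delta> l * unit_dir l m) = \<delta> m"
  by (simp add: unit_dir_def if_distrib[of "(*) _"] sum.delta cong: if_cong)

lemma garch_deriv_linear:
  "garch_deriv p q \<theta> \<delta> i = (\<Sum>l<p + q + 1. \<delta> l * garch_deriv p q \<theta> (unit_dir l) i)"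
proof (induction i rule: less_induct)
  case (less i)
  show ?case
  proof (cases "i = 0")
    case True
    have "(\<Sum>l<p + q + 1. \<delta> l * (unit_dir l 0 + garch_coeff p q \<theta> 0 * (\<Sum>j=1..q. unit_dir l (p + j))))
       = \<delta> 0 + garch_coeff p q \<theta> 0 * (\<Sum>j=1..q. \<Sum>l<p + q + 1. \<delta> l * unit_dir l (p + j))"
    proof -
      have "(\<Sum>l<p + q + 1. \<delta> l * (unit_dir l 0 + garch_coeff p q \<theta> 0 * (\<Sum>j=1..q. unit_dir l (p + j))))
        = (\<Sum>l<p + q + 1. \<delta> l * unit_dir l 0) +
          garch_coeff p q \<theta> 0 * (\<Sum>l<p + q + 1. \<Sum>j=1..q. \<delta> l * unit_dir l (p + j))"
        by (simp only: distrib_left sum.distrib sum_distrib_left mult.left_commute)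
      also have "(\<Sum>l<p + q + 1. \<delta> l * unit_dir l 0) = \<delta> 0" by (rule sum_unit_dir) simp
      finally show ?thesis by (simp only: sum.swap[of "\<lambda>l j. \<delta> l * unit_dir l (p + j)"])
    qed
    also have "(\<Sum>j=1..q. \<Sum>l<p + q + 1. \<delta> l * unit_dir l (p + j)) = (\<Sum>j=1..q. \<delta> (p + j))"
      by (intro sum.cong sum_unit_dir) auto
    finally show ?thesis
      by (simp only: True garch_deriv_0 times_divide_eq_right sum_divide_distrib[symmetric])
  next
    case False
    let ?J = "{1..min (i - 1) q}"
    let ?L = "{..<p + q + 1}"
    let ?g = "\<lambda>l j. \<delta> l * unit_dir l (p + j) * garch_coeff p q \<theta> (i - j)
      + \<theta> (p + j) * (\<delta> l * garch_deriv p q \<theta> (unit_dir l) (i - j))"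
    have "(\<Sum>l\<in>?L. \<delta> l * garch_deriv p q \<theta> (unit_dir l) i)
       = (\<Sum>l\<in>?L. \<delta> l * (if i \<le> p then unit_dir l i else 0) + (\<Sum>j\<in>?J. ?g l j))"
    proof (rule sum.cong[OF refl])
      fix l
      show "\<delta> l * garch_deriv p q \<theta> (unit_dir l) i
        = \<delta> l * (if i \<le> p then unit_dir l i else 0) + (\<Sum>j\<in>?J. ?g l j)"
        using False by (subst garch_deriv_pos_index) (simp_all add: distrib_left sum_distrib_left mult_ac)
    qed
    also have "\<dots> = (\<Sum>l\<in>?L. \<delta> l * (if i \<le> p then unit_dir l i else 0)) + (\<Sum>l\<in>?L. \<Sum>j\<in>?J. ?g l j)"
      by (rule sum.distrib)
    also have "(\<Sum>l\<in>?L. \<Sum>j\<in>?J. ?g l j) = (\<Sum>j\<in>?J. \<Sum>l\<in>?L. ?g l j)" by (rule sum.swap)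
    also have "\<dots> = (\<Sum>j\<in>?J. (\<Sum>l<p + q + 1. \<delta> l * unit_dir l (p + j)) * garch_coeff p q \<theta> (i - j)
            + \<theta> (p + j) * (\<Sum>l<p + q + 1. \<delta> l * garch_deriv p q \<theta> (unit_dir l) (i - j)))"
      by (intro sum.cong refl) (simp only: sum.distrib sum_distrib_left sum_distrib_right)
    also have "(\<Sum>l<p + q + 1. \<delta> l * (if i \<le> p then unit_dir l i else 0)) = (if i \<le> p then \<delta> i else 0)"
      by (auto simp: sum_unit_dir simp del: sum.lessThan_Suc)
    also have "(\<Sum>j\<in>?J. (\<Sum>l<p + q + 1. \<delta> l * unit_dir l (p + j)) * garch_coeff p q \<theta> (i - j)
            + \<theta> (p + j) * (\<Sum>l<p + q + 1. \<delta> l * garch_deriv p q \<theta> (unit_dir l) (i - j)))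
       = (\<Sum>j\<in>?J. \<delta> (p + j) * garch_coeff p q \<theta> (i - j) + \<theta> (p + j) * garch_deriv p q \<theta> \<delta> (i - j))"
      using less.IH by (intro sum.cong refl arg_cong2[of _ _ _ _ "(+)"] arg_cong2[of _ _ _ _ "(*)"] sum_unit_dir)
        (auto simp del: sum.lessThan_Suc)
    finally show ?thesis using False by (simp add: garch_deriv_pos_index[of i])
  qed
qed

text \<open>A monomial of degree at most \<open>i\<close> changes, to first order, by at most the
  relative amount \<open>i * \<kappa>\<close> when each parameter changes by the relative amount
  \<open>\<kappa>\<close>.\<close>

lemma garch_deriv_bound:
  assumes th: "\<And>l. l < p + q + 1 \<Longrightarrow> 0 \<le> \<theta> l" and d: "\<And>l. l < p + q + 1 \<Longrightarrow> \<bar>\<delta> l\<bar> \<le> \<kappa> * \<theta> l"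
    and "\<kappa> \<ge> 0" "i > 0"
  shows "\<bar>garch_deriv p q \<theta> \<delta> i\<bar> \<le> real i * \<kappa> * garch_coeff p q \<theta> i"
  using assms(4)
proof (induction i rule: less_induct)
  case (less i)
  let ?J = "{1..min (i - 1) q}" and ?c = "garch_coeff p q \<theta>" and ?G = "garch_deriv p q \<theta> \<delta>"
  have "\<bar>\<Sum>j\<in>?J. \<delta> (p + j) * ?c (i - j) + \<theta> (p + j) * ?G (i - j)\<bar>
      \<le> (\<Sum>j\<in>?J. real i * \<kappa> * (\<theta> (p + j) * ?c (i - j)))"
  proof (rule order_trans[OF sum_abs sum_mono])
    fix j assume j: "j \<in> ?J"
    have c0: "0 \<le> ?c (i - j)" using j th by (intro garch_coeff_nonneg) auto
    have t0: "0 \<le> \<theta> (p + j)" using j th by auto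
    have "\<bar>\<delta> (p + j)\<bar> * ?c (i - j) \<le> \<kappa> * \<theta> (p + j) * ?c (i - j)"
      using j d c0 by (intro mult_right_mono) auto
    moreover have "\<theta> (p + j) * \<bar>?G (i - j)\<bar> \<le> \<theta> (p + j) * (real (i - j) * \<kappa> * ?c (i - j))"
      using j less.IH[of "i - j"] t0 by (intro mult_left_mono) auto
    moreover have "\<bar>\<delta> (p + j) * ?c (i - j) + \<theta> (p + j) * ?G (i - j)\<bar> \<le> \<bar>\<delta> (p + j)\<bar> * ?c (i - j) + \<theta> (p + j) * \<bar>?G (i - j)\<bar>"
      using abs_triangle_ineq[of "\<delta> (p + j) * ?c (i - j)" "\<theta> (p + j) * ?G (i - j)"] c0 t0 by (simp add: abs_mult)
    ultimately have "\<bar>\<delta> (p + j) * ?c (i - j) + \<theta> (p + j) * ?G (i - j)\<bar> \<le> (1 + real (i - j)) * (\<kappa> * \<theta> (p + j) * ?c (i - j))"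
      by (simp add: algebra_simps)
    also have "\<dots> \<le> real i * (\<kappa> * \<theta> (p + j) * ?c (i - j))"
      using j c0 t0 assms(3) by (intro mult_right_mono) auto
    finally show "\<bar>\<delta> (p + j) * ?c (i - j) + \<theta> (p + j) * ?G (i - j)\<bar> \<le> real i * \<kappa> * (\<theta> (p + j) * ?c (i - j))"
      by (simp add: ac_simps)
  qed
  moreover have "\<bar>if i \<le> p then \<delta> i else 0\<bar> \<le> real i * \<kappa> * (if i \<le> p then \<theta> i else 0)"
  proof (cases "i \<le> p")
    case True
    have "1 * (\<kappa> * \<theta> i) \<le> real i * (\<kappa> * \<theta> i)"
      using True th[of i] less.prems assms(3) by (intro mult_right_mono) auto
    then show ?thesis using True d[of i] by (simp add: mult.assoc)
  qed simp
  ultimately have "\<bar>(if i \<le> p then \<delta> i else 0) + (\<Sum>j\<in>?J. \<delta> (p + j) * ?c (i - j) + \<theta> (p + j) * ?G (i - j))\<bar>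
     \<le> real i * \<kappa> * (if i \<le> p then \<theta> i else 0) + (\<Sum>j\<in>?J. real i * \<kappa> * (\<theta> (p + j) * ?c (i - j)))"
    by linarith
  then have "\<bar>?G i\<bar> \<le> real i * \<kappa> * (if i \<le> p then \<theta> i else 0) + (\<Sum>j\<in>?J. real i * \<kappa> * (\<theta> (p + j) * ?c (i - j)))"
    by (simp only: garch_deriv_pos_index[OF less.prems])
  also have "\<dots> = real i * \<kappa> * ?c i"
    unfolding garch_coeff_pos_index[OF less.prems] by (simp only: sum_distrib_left distrib_left)
  finally show ?case .
qed

lemma power_minus_one_le: "\<kappa> \<ge> (0::real) \<Longrightarrow> (1 + \<kappa>) ^ m - 1 \<le> real m * \<kappa> * (1 + \<kappa>) ^ m"
proof (induction m)
  case (Suc m)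
  have "(1 + \<kappa>) ^ m * \<kappa> \<le> (1 + \<kappa>) ^ m * \<kappa> * (1 + \<kappa>)"
    using mult_left_mono[of 1 "1 + \<kappa>" "(1 + \<kappa>) ^ m * \<kappa>"] Suc.prems by simp
  moreover have "((1 + \<kappa>) ^ m - 1) * 1 \<le> real m * \<kappa> * (1 + \<kappa>) ^ m * (1 + \<kappa>)"
    using Suc by (intro mult_mono) auto
  ultimately show ?case by (simp add: algebra_simps)
qed simp

lemma garch_coeff_increment_bound:
  assumes th: "\<And>l. l < p + q + 1 \<Longrightarrow> 0 \<le> \<theta> l" and d: "\<And>l. l < p + q + 1 \<Longrightarrow> \<bar>u l - \<theta> l\<bar> \<le> \<kappa> * \<theta> l"
    and "0 \<le> \<kappa>" "\<kappa> < 1" "i > 0"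
  shows "\<bar>garch_coeff p q u i - garch_coeff p q \<theta> i\<bar> \<le> real i * \<kappa> * (1 + \<kappa>) ^ i * garch_coeff p q \<theta> i"
proof -
  have le: "u l \<le> (1 + \<kappa>) * \<theta> l" and ge: "(1 - \<kappa>) * \<theta> l \<le> u l" if "l < p + q + 1" for l
    using d[OF that] by (auto simp: algebra_simps)
  have u0: "0 \<le> u l" if "l < p + q + 1" for l
    using order_trans[OF mult_nonneg_nonneg ge[OF that]] th[OF that] assms(4) by simp
  have c0: "0 \<le> garch_coeff p q \<theta> i" using th assms(5) by (rule garch_coeff_nonneg)
  have "garch_coeff p q u i \<le> (1 + \<kappa>) ^ i * garch_coeff p q \<theta> i"
    using u0 th le assms by (intro garch_coeff_le_power_mult) auto
  moreover have "((1 + \<kappa>) ^ i - 1) * garch_coeff p q \<theta> i \<le> real i * \<kappa> * (1 + \<kappa>) ^ i * garch_coeff p q \<theta> i"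
    using assms(3) c0 by (intro mult_right_mono power_minus_one_le) auto
  moreover have "(1 - \<kappa>) ^ i * garch_coeff p q \<theta> i \<le> garch_coeff p q u i"
    using u0 th ge assms by (intro garch_coeff_ge_power_mult) auto
  moreover have "(1 - (1 - \<kappa>) ^ i) * garch_coeff p q \<theta> i \<le> real i * \<kappa> * (1 + \<kappa>) ^ i * garch_coeff p q \<theta> i"
  proof (rule mult_right_mono[OF _ c0])
    have "1 + real i * (- \<kappa>) \<le> (1 + (- \<kappa>)) ^ i"
      using assms by (intro Bernoulli_inequality) auto
    then have "1 - (1 - \<kappa>) ^ i \<le> real i * \<kappa> * 1" by simp
    also have "\<dots> \<le> real i * \<kappa> * (1 + \<kappa>) ^ i"
      using assms(3) by (intro mult_left_mono) auto
    finally show "1 - (1 - \<kappa>) ^ i \<le> real i * \<kappa> * (1 + \<kappa>) ^ i" .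
  qed
  ultimately show ?thesis unfolding abs_le_iff left_diff_distrib mult_1_left by linarith
qed

text \<open>The remainder obeys the recursion of the coefficients themselves, driven by products of
  a parameter increment and a coefficient increment. Both factors are of order
  \<open>\<kappa>\<close>, and the induction closes because \<open>(i - j) + (i - j)\<^sup>2 \<le>
  i\<^sup>2\<close> for \<open>j \<ge> 1\<close>.\<close>

lemma garch_coeff_taylor:
  assumes th: "\<And>l. l < p + q + 1 \<Longrightarrow> 0 \<le> \<theta> l" and d: "\<And>l. l < p + q + 1 \<Longrightarrow> \<bar>u l - \<theta> l\<bar> \<le> \<kappa> * \<theta> l"
    and "0 \<le> \<kappa>" "\<kappa> < 1" "i > 0"
  shows "\<bar>garch_coeff p q u i - garch_coeff p q \<theta> i - garch_deriv p q \<theta> (\<lambda>l. u l - \<theta> l) i\<bar>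
    \<le> (real i)\<^sup>2 * \<kappa>\<^sup>2 * (1 + \<kappa>) ^ i * garch_coeff p q \<theta> i"
  using assms(5)
proof (induction i rule: less_induct)
  case (less i)
  let ?J = "{1..min (i - 1) q}" and ?c = "garch_coeff p q \<theta>" and ?G = "garch_deriv p q \<theta> (\<lambda>l. u l - \<theta> l)"
    and ?b = "garch_coeff p q u"
  let ?R = "\<lambda>i. ?b i - ?c i - ?G i"
  have Req: "?R i = (\<Sum>j\<in>?J. (u (p + j) - \<theta> (p + j)) * (?b (i - j) - ?c (i - j)) + \<theta> (p + j) * ?R (i - j))"
  proof -
    have "?R i = (\<Sum>j\<in>?J. u (p + j) * ?b (i - j) - \<theta> (p + j) * ?c (i - j)
        - ((u (p + j) - \<theta> (p + j)) * ?c (i - j) + \<theta> (p + j) * ?G (i - j)))"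
      unfolding sum_subtractf using less.prems
      by (simp add: garch_deriv_pos_index[of i] garch_coeff_pos_index[of i])
    also have "\<dots> = (\<Sum>j\<in>?J. (u (p + j) - \<theta> (p + j)) * (?b (i - j) - ?c (i - j)) + \<theta> (p + j) * ?R (i - j))"
      by (intro sum.cong refl) (simp add: algebra_simps)
    finally show ?thesis .
  qed
  have "\<bar>?R i\<bar> \<le> (\<Sum>j\<in>?J. (real i)\<^sup>2 * \<kappa>\<^sup>2 * (1 + \<kappa>) ^ i * (\<theta> (p + j) * ?c (i - j)))"
    unfolding Req
  proof (rule order_trans[OF sum_abs sum_mono])
    fix j assume j: "j \<in> ?J"
    have c0: "0 \<le> ?c (i - j)" using j th by (intro garch_coeff_nonneg) auto
    have t0: "0 \<le> \<theta> (p + j)" using j th by auto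
    let ?m = "real (i - j)" and ?P = "(1 + \<kappa>) ^ (i - j)"
    have "\<bar>(u (p + j) - \<theta> (p + j)) * (?b (i - j) - ?c (i - j))\<bar> \<le> (\<kappa> * \<theta> (p + j)) * (?m * \<kappa> * ?P * ?c (i - j))"
      unfolding abs_mult using j d t0 c0 assms(3)
      by (intro mult_mono garch_coeff_increment_bound[OF th d assms(3,4)] mult_nonneg_nonneg) auto
    moreover have "\<bar>\<theta> (p + j) * ?R (i - j)\<bar> \<le> \<theta> (p + j) * (?m\<^sup>2 * \<kappa>\<^sup>2 * ?P * ?c (i - j))"
      unfolding abs_mult using j less.IH[of "i - j"] t0 by (intro mult_mono) auto
    ultimately have "\<bar>(u (p + j) - \<theta> (p + j)) * (?b (i - j) - ?c (i - j)) + \<theta> (p + j) * ?R (i - j)\<bar>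
       \<le> (\<kappa> * \<theta> (p + j)) * (?m * \<kappa> * ?P * ?c (i - j)) + \<theta> (p + j) * (?m\<^sup>2 * \<kappa>\<^sup>2 * ?P * ?c (i - j))"
      by linarith
    also have "\<dots> = (?m + ?m\<^sup>2) * ?P * (\<kappa>\<^sup>2 * (\<theta> (p + j) * ?c (i - j)))"
      by (simp add: algebra_simps power2_eq_square)
    also have "\<dots> \<le> ((real i)\<^sup>2 * (1 + \<kappa>) ^ i) * (\<kappa>\<^sup>2 * (\<theta> (p + j) * ?c (i - j)))"
    proof (intro mult_right_mono mult_mono)
      have "?m \<le> real i - 1" using j by auto
      then have "?m * (1 + ?m) \<le> (real i) * real i" using j by (intro mult_mono) auto
      then show "?m + ?m\<^sup>2 \<le> (real i)\<^sup>2" by (simp add: algebra_simps power2_eq_square)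
      show "?P \<le> (1 + \<kappa>) ^ i" using assms(3) by (intro power_increasing) auto
    qed (use c0 t0 assms(3) in auto)
    finally show "\<bar>(u (p + j) - \<theta> (p + j)) * (?b (i - j) - ?c (i - j)) + \<theta> (p + j) * ?R (i - j)\<bar>
        \<le> (real i)\<^sup>2 * \<kappa>\<^sup>2 * (1 + \<kappa>) ^ i * (\<theta> (p + j) * ?c (i - j))"
      by (simp add: ac_simps)
  qed
  also have "\<dots> = (real i)\<^sup>2 * \<kappa>\<^sup>2 * (1 + \<kappa>) ^ i * (\<Sum>j\<in>?J. \<theta> (p + j) * ?c (i - j))"
    by (simp only: sum_distrib_left)
  also have "\<dots> \<le> (real i)\<^sup>2 * \<kappa>\<^sup>2 * (1 + \<kappa>) ^ i * ?c i"
    unfolding garch_coeff_pos_index[OF less.prems] using th[of i] assms(3)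
    by (intro mult_left_mono mult_nonneg_nonneg) (auto simp del: min_less_iff_conj)
  finally show ?case .
qed

text \<open>At index 0 the coefficient is a quotient instead of a value of the recursion; the
  second-order remainder of this quotient has a closed form.\<close>

lemma garch_coeff_taylor_0:
  fixes u \<theta> :: "nat \<Rightarrow> real"
  assumes T: "(\<Sum>j=1..q. \<theta> (p + j)) < 1" and T': "(\<Sum>j=1..q. u (p + j)) < 1"
  shows "garch_coeff p q u 0 - garch_coeff p q \<theta> 0 - garch_deriv p q \<theta> (\<lambda>l. u l - \<theta> l) 0
    = (u 0 - \<theta> 0 + garch_coeff p q \<theta> 0 * (\<Sum>j=1..q. u (p + j) - \<theta> (p + j))) * (\<Sum>j=1..q. u (p + j) - \<theta> (p + j))
        / ((1 - (\<Sum>j=1..q. \<theta> (p + j))) * (1 - (\<Sum>j=1..q. u (p + j))))"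
proof -
  define T where "T = (\<Sum>j=1..q. \<theta> (p + j))"
  define T' where "T' = (\<Sum>j=1..q. u (p + j))"
  have *: "T < 1" "T' < 1" "(\<Sum>j=1..q. u (p + j) - \<theta> (p + j)) = T' - T"
    using assms by (auto simp: T_def T'_def sum_subtractf)
  then have "1 - T \<noteq> 0" "1 - T' \<noteq> 0" by auto
  then show ?thesis
    unfolding garch_coeff_0 garch_deriv_0 *(3) T_def[symmetric] T'_def[symmetric]
    by (simp add: divide_simps) (simp add: algebra_simps)
qed

section \<open>The volatility as a series in the past observations\<close>

definition vol_series :: "nat \<Rightarrow> nat \<Rightarrow> (nat \<Rightarrow> real) \<Rightarrow> (int \<Rightarrow> real) \<Rightarrow> int \<Rightarrow> real" where
  "vol_series p q u x t = garch_coeff p q u 0 + (\<Sum>i. garch_coeff p q u (Suc i) * (x (t - 1 - int i))\<^sup>2)"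

lemma sums_delayed: "g sums s \<Longrightarrow> (\<lambda>i. if j \<le> i then g (i - j) else 0 :: real) sums s"
  by (subst sums_zero_iff_shift[of j, symmetric]) auto

text \<open>Shifting the series back by \<open>j\<close> units of time delays its terms by
  \<open>j\<close> places, so that the recursion for the coefficients, read in the lag, becomes the
  recursion for the volatility, read in time.\<close>

lemma vol_series_recursion:
  assumes T: "(\<Sum>j=1..q. \<theta> (p + j)) \<noteq> 1"
    and summ: "\<And>t. summable (\<lambda>i. garch_coeff p q \<theta> (Suc i) * (x (t - 1 - int i))\<^sup>2)"
  shows "vol_series p q \<theta> x t = \<theta> 0 + (\<Sum>i=1..p. \<theta> i * (x (t - int i))\<^sup>2)
    + (\<Sum>j=1..q. \<theta> (p + j) * vol_series p q \<theta> x (t - int j))"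
proof -
  define f where "f t i = garch_coeff p q \<theta> (Suc i) * (x (t - 1 - int i))\<^sup>2" for t i
  define a where "a i = (if i \<in> {..<p} then \<theta> (Suc i) * (x (t - 1 - int i))\<^sup>2 else 0)" for i
  have c0: "garch_coeff p q \<theta> 0 = \<theta> 0 + (\<Sum>j=1..q. \<theta> (p + j) * garch_coeff p q \<theta> 0)"
    unfolding sum_distrib_right[symmetric] using T by (simp add: garch_coeff_0 field_simps)
  have f: "f t i = a i + (\<Sum>j=1..q. \<theta> (p + j) * (if j \<le> i then f (t - int j) (i - j) else 0))" for i
  proof -
    have "(\<Sum>j=1..min i q. \<theta> (p + j) * garch_coeff p q \<theta> (Suc i - j)) * (x (t - 1 - int i))\<^sup>2
       = (\<Sum>j=1..min i q. \<theta> (p + j) * f (t - int j) (i - j))"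
      unfolding sum_distrib_right
    proof (intro sum.cong refl)
      fix j assume "j \<in> {1..min i q}"
      then have "Suc i - j = Suc (i - j)" "t - 1 - int i = t - int j - 1 - int (i - j)" by auto
      then show "\<theta> (p + j) * garch_coeff p q \<theta> (Suc i - j) * (x (t - 1 - int i))\<^sup>2 = \<theta> (p + j) * f (t - int j) (i - j)"
        by (simp only: f_def mult.assoc)
    qed
    also have "\<dots> = (\<Sum>j=1..q. \<theta> (p + j) * (if j \<le> i then f (t - int j) (i - j) else 0))"
      by (rule sum.mono_neutral_cong_left) auto
    finally show ?thesis
      by (auto simp: f_def[of t i] a_def garch_coeff_pos_index[of "Suc i"] distrib_right)
  qed
  have s: "f t sums (\<Sum>i. f t i)" for t
    using summ[of t] by (simp add: f_def[abs_def] summable_sums)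
  have "(\<lambda>i. a i + (\<Sum>j=1..q. \<theta> (p + j) * (if j \<le> i then f (t - int j) (i - j) else 0)))
     sums ((\<Sum>i<p. \<theta> (Suc i) * (x (t - 1 - int i))\<^sup>2) + (\<Sum>j=1..q. \<theta> (p + j) * (\<Sum>i. f (t - int j) i)))"
    unfolding a_def
    by (intro sums_add sums_sum sums_mult sums_delayed s sums_If_finite_set finite_lessThan)
  then have "(\<Sum>i. f t i) = (\<Sum>i<p. \<theta> (Suc i) * (x (t - 1 - int i))\<^sup>2) + (\<Sum>j=1..q. \<theta> (p + j) * (\<Sum>i. f (t - int j) i))"
    unfolding f[symmetric] by (simp add: sums_iff)
  also have "(\<Sum>i<p. \<theta> (Suc i) * (x (t - 1 - int i))\<^sup>2) = (\<Sum>i=1..p. \<theta> i * (x (t - int i))\<^sup>2)"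
    by (rule sum.reindex_bij_witness[of _ "\<lambda>i. i - 1" Suc]) (auto simp: of_nat_diff algebra_simps)
  finally show ?thesis
    unfolding vol_series_def f_def[symmetric] by (subst c0) (simp add: distrib_left sum.distrib)
qed

text \<open>A homogeneous recursion with small positive weights has no nonzero solution of moderate growth
  into the past: the best growth constant reproduces itself with a factor less than one.\<close>

lemma homogeneous_recursion_zero:
  fixes d :: "int \<Rightarrow> real"
  assumes b: "\<And>j. j \<in> {1..q} \<Longrightarrow> 0 \<le> b j" and rec: "\<And>t. d t = (\<Sum>j=1..q. b j * d (t - int j))"
    and L: "0 < L" and B: "(\<Sum>j=1..q. b j * L ^ j) < 1"
    and growth: "\<And>i. \<bar>d (t - int i)\<bar> \<le> M * L ^ i"
  shows "d t = 0"
proof -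
  define S where "S = (SUP i. \<bar>d (t - int i)\<bar> / L ^ i)"
  have bdd: "bdd_above (range (\<lambda>i. \<bar>d (t - int i)\<bar> / L ^ i))"
    using growth L by (intro bdd_aboveI[of _ M]) (auto simp: field_simps)
  have S: "\<bar>d (t - int i)\<bar> \<le> S * L ^ i" for i
    using cSUP_upper[OF UNIV_I bdd, of i] L by (simp add: S_def[symmetric] field_simps)
  have S0: "0 \<le> S" using S[of 0] abs_ge_zero[of "d t"] by simp
  have "S \<le> S * (\<Sum>j=1..q. b j * L ^ j)"
    unfolding S_def
  proof (rule cSUP_least, simp, fold S_def)
    fix i
    have "\<bar>d (t - int i)\<bar> \<le> (\<Sum>j=1..q. \<bar>b j * d (t - int i - int j)\<bar>)"
      by (subst rec) (rule sum_abs)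
    also have "\<dots> \<le> (\<Sum>j=1..q. b j * (S * L ^ (i + j)))"
    proof (rule sum_mono)
      fix j assume j: "j \<in> {1..q}"
      show "\<bar>b j * d (t - int i - int j)\<bar> \<le> b j * (S * L ^ (i + j))"
        using mult_left_mono[OF S[of "i + j"] b[OF j]] b[OF j] by (simp add: abs_mult algebra_simps)
    qed
    also have "\<dots> = S * (\<Sum>j=1..q. b j * L ^ j) * L ^ i"
      by (simp add: sum_distrib_left sum_distrib_right power_add mult_ac)
    finally show "\<bar>d (t - int i)\<bar> / L ^ i \<le> S * (\<Sum>j=1..q. b j * L ^ j)"
      using L by (simp add: field_simps)
  qed
  then have "S * (1 - (\<Sum>j=1..q. b j * L ^ j)) \<le> 0" by (simp add: algebra_simps)
  with B have "S \<le> 0" by (simp add: mult_le_0_iff)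
  with S[of 0] show ?thesis by simp
qed

text \<open>Both sides solve the volatility recursion for the same observations, so their difference
  solves the homogeneous recursion. The growth rate \<open>L\<close> into the past is slow enough
  for the series to converge against the decay rate \<open>r\<close> of the coefficients and for the
  difference to vanish.\<close>

lemma volatility_eq_series:
  fixes x s :: "int \<Rightarrow> real"
  assumes th: "\<And>l. l < p + q + 1 \<Longrightarrow> 0 \<le> \<theta> l"
    and rec: "\<And>t. (s t)\<^sup>2 = \<theta> 0 + (\<Sum>i=1..p. \<theta> i * (x (t - int i))\<^sup>2) + (\<Sum>j=1..q. \<theta> (p + j) * (s (t - int j))\<^sup>2)"
    and L: "1 \<le> L" and B: "(\<Sum>j=1..q. \<theta> (p + j) * L ^ j) < 1"
    and C: "\<And>i. i > 0 \<Longrightarrow> garch_coeff p q \<theta> i \<le> C * r ^ i" and r: "0 < r" "r * L < 1"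
    and gs: "\<And>t i. (s (t - int i))\<^sup>2 \<le> Ms t * L ^ i" and gx: "\<And>t i. (x (t - int i))\<^sup>2 \<le> Mx t * L ^ i"
  shows "(s t)\<^sup>2 = vol_series p q \<theta> x t"
proof -
  let ?c = "garch_coeff p q \<theta>"
  have c0: "0 \<le> ?c (Suc i)" for i using th by (rule garch_coeff_nonneg) auto
  have C0: "0 \<le> C" using order_trans[OF c0[of 0] C[of 1, simplified]] r(1) by (simp add: zero_le_mult_iff)
  have rL: "0 \<le> r * L" "r * L < 1" using r L by auto
  have term_le: "?c (Suc i) * (x (t - 1 - int i))\<^sup>2 \<le> C * r * Mx (t - 1) * (r * L) ^ i" for t i
  proof -
    have "?c (Suc i) * (x (t - 1 - int i))\<^sup>2 \<le> (C * r ^ Suc i) * (Mx (t - 1) * L ^ i)"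
      using C0 r by (intro mult_mono C gx) auto
    then show ?thesis by (simp add: power_mult_distrib mult_ac)
  qed
  have geo: "summable (\<lambda>i. K * (r * L) ^ i)" for K
    using rL by (intro summable_mult summable_geometric) auto
  have summ: "summable (\<lambda>i. ?c (Suc i) * (x (t - 1 - int i))\<^sup>2)" for t
    by (rule summable_comparison_test'[OF geo, of 0]) (use c0 term_le in \<open>auto simp: abs_mult\<close>)
  have T: "(\<Sum>j=1..q. \<theta> (p + j)) < 1"
  proof -
    have "(\<Sum>j=1..q. \<theta> (p + j)) \<le> (\<Sum>j=1..q. \<theta> (p + j) * L ^ j)"
    proof (rule sum_mono)
      fix j assume "j \<in> {1..q}"
      then show "\<theta> (p + j) \<le> \<theta> (p + j) * L ^ j"
        using mult_left_mono[of 1 "L ^ j" "\<theta> (p + j)"] th[of "p + j"] L by simp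
    qed
    with B show ?thesis by simp
  qed
  define d where "d t = (s t)\<^sup>2 - vol_series p q \<theta> x t" for t
  have vbound: "0 \<le> vol_series p q \<theta> x (t - int i) \<and> vol_series p q \<theta> x (t - int i)
      \<le> (?c 0 + C * r * Mx (t - 1) / (1 - r * L)) * L ^ i" for i
  proof -
    have c00: "0 \<le> ?c 0" using T th[of 0] by (simp add: garch_coeff_0)
    have tl: "?c (Suc m) * (x (t - int i - 1 - int m))\<^sup>2 \<le> C * r * Mx (t - 1) * L ^ i * (r * L) ^ m" for m
    proof -
      have "(x (t - int i - 1 - int m))\<^sup>2 \<le> Mx (t - 1) * L ^ (i + m)"
        using gx[of "t - 1" "i + m"] by (simp add: algebra_simps)
      then have "?c (Suc m) * (x (t - int i - 1 - int m))\<^sup>2 \<le> (C * r ^ Suc m) * (Mx (t - 1) * L ^ (i + m))"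
        using C0 r by (intro mult_mono C) auto
      then show ?thesis by (simp add: power_mult_distrib power_add mult_ac)
    qed
    have "(\<Sum>m. ?c (Suc m) * (x (t - int i - 1 - int m))\<^sup>2) \<le> (\<Sum>m. C * r * Mx (t - 1) * L ^ i * (r * L) ^ m)"
      using tl by (intro suminf_le summ geo)
    also have "\<dots> = C * r * Mx (t - 1) * L ^ i * (1 / (1 - r * L))"
      using rL by (subst suminf_mult) (auto simp: suminf_geometric)
    finally have "(\<Sum>m. ?c (Suc m) * (x (t - int i - 1 - int m))\<^sup>2) \<le> C * r * Mx (t - 1) / (1 - r * L) * L ^ i" by simp
    moreover have "?c 0 * 1 \<le> ?c 0 * L ^ i" using c00 L by (intro mult_left_mono) auto
    moreover have "0 \<le> (\<Sum>m. ?c (Suc m) * (x (t - int i - 1 - int m))\<^sup>2)"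
      using c0 by (intro suminf_nonneg summ) auto
    ultimately show ?thesis using c00 by (simp add: vol_series_def distrib_right)
  qed
  have "d t = 0"
  proof (rule homogeneous_recursion_zero[OF _ _ _ B])
    show "d t = (\<Sum>j = 1..q. \<theta> (p + j) * d (t - int j))" for t
      using rec[of t] vol_series_recursion[where q = q and p = p and \<theta> = \<theta> and x = x and t = t, OF _ summ] T
      by (simp add: d_def right_diff_distrib sum_subtractf)
    show "\<bar>d (t - int i)\<bar> \<le> (Ms t + (?c 0 + C * r * Mx (t - 1) / (1 - r * L))) * L ^ i" for i
    proof -
      have "\<bar>d (t - int i)\<bar> \<le> (s (t - int i))\<^sup>2 + vol_series p q \<theta> x (t - int i)"
        using vbound[of i] zero_le_power2[of "s (t - int i)"] unfolding d_def by linarith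
      also have "\<dots> \<le> Ms t * L ^ i + (?c 0 + C * r * Mx (t - 1) / (1 - r * L)) * L ^ i"
        using vbound[of i] gs[of t i] by (intro add_mono) auto
      finally show ?thesis by (simp add: distrib_right)
    qed
  qed (use th L in auto)
  then show ?thesis by (simp add: d_def)
qed

section \<open>First-order expansion of the residuals\<close>

text \<open>Dividing a term of the volatility series by the whole series, which contains this term
  and a positive constant, turns an unbounded quantity into a small power of it. For this reason a
  small fractional moment of the volatility suffices to control high powers of all relative
  errors.\<close>

lemma ratio_le_powr:
  fixes z c a :: real
  assumes "0 \<le> z" "0 < c" "0 < a" "a \<le> 1"
  shows "z / (c + z) \<le> (z / c) powr a"
proof (cases "z \<le> c")
  case True
  then have *: "0 \<le> z / c" "z / c \<le> 1" using assms by simp_all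
  have "z / (c + z) \<le> z / c" using assms by (intro divide_left_mono) auto
  also have "\<dots> = (z / c) powr 1" using *(1) by (simp only: powr_one)
  also have "\<dots> \<le> (z / c) powr a" using * assms by (intro powr_mono') auto
  finally show ?thesis .
next
  case False
  then have "z / (c + z) \<le> 1" "1 \<le> z / c" using assms by simp_all
  then show ?thesis using ge_one_powr_ge_zero[of "z / c" a] assms by linarith
qed

text \<open>Here \<open>y\<close> is the inverse square root of \<open>1 + x\<close>, and the
  remainder of its linear expansion is exactly \<open>(1 - y)\<^sup>2 * (2 * y + 1) / (2 *
  y\<^sup>2)\<close>.\<close>

lemma inverse_sqrt_expansion:
  fixes x y :: real
  assumes "0 < y" and "x = 1 / y\<^sup>2 - 1"
  shows "\<bar>y - 1 + x / 2\<bar> \<le> x\<^sup>2 * y"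
proof -
  have y0: "y \<noteq> 0" using assms by simp
  have 1: "y - 1 + x / 2 = (1 - y)\<^sup>2 * (2 * y + 1) / (2 * y\<^sup>2)"
    unfolding assms(2) using y0 by (simp add: field_simps power2_eq_square)
  have 2: "x\<^sup>2 * y = (1 - y)\<^sup>2 * ((1 + y)\<^sup>2 * y / y ^ 4)"
    unfolding assms(2) using y0 by (simp add: field_simps power2_eq_square) (simp add: algebra_simps eval_nat_numeral)
  have 3: "(2 * y + 1) / (2 * y\<^sup>2) \<le> (1 + y)\<^sup>2 * y / y ^ 4"
  proof -
    have "(2 * y + 1) * y \<le> 2 * (1 + y)\<^sup>2" using assms(1) by (simp add: power2_eq_square algebra_simps)
    then have "(2 * y + 1) * y / (2 * y ^ 3) \<le> 2 * (1 + y)\<^sup>2 / (2 * y ^ 3)"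
      using assms(1) by (intro divide_right_mono) auto
    moreover have "(2 * y + 1) * y / (2 * y ^ 3) = (2 * y + 1) / (2 * y\<^sup>2)"
      using y0 by (simp add: eval_nat_numeral)
    moreover have "2 * (1 + y)\<^sup>2 / (2 * y ^ 3) = (1 + y)\<^sup>2 * y / y ^ 4"
      using y0 by (simp add: eval_nat_numeral)
    ultimately show ?thesis by simp
  qed
  have "\<bar>y - 1 + x / 2\<bar> = (1 - y)\<^sup>2 * ((2 * y + 1) / (2 * y\<^sup>2))"
    unfolding 1 using assms(1) by simp
  also have "\<dots> \<le> x\<^sup>2 * y" unfolding 2 by (intro mult_left_mono 3) auto
  finally show ?thesis .
qed

text \<open>One path seen from a fixed time \<open>t\<close>: \<open>\<xi> i\<close> is the squared
  observation at lag \<open>i + 1\<close>. Parameters may be perturbed by a relative amount up to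
  \<open>\<kappa>\<^sub>0\<close>; the coefficients then change by at most the factor \<open>\<nu> ^
  i\<close> in either direction, and the sum of the perturbed \<open>\<beta>\<close>-parameters
  stays below one.\<close>

locale volatility_path =
  fixes p q :: nat and \<theta> :: "nat \<Rightarrow> real" and \<kappa>\<^sub>0 \<nu> a :: real and \<xi> :: "nat \<Rightarrow> real"
  assumes th: "\<And>l. l < p + q + 1 \<Longrightarrow> 0 < \<theta> l"
    and T: "(\<Sum>j=1..q. \<theta> (p + j)) < 1"
    and k0: "0 < \<kappa>\<^sub>0" "\<kappa>\<^sub>0 \<le> 1 / 2" "(1 + \<kappa>\<^sub>0) * (\<Sum>j=1..q. \<theta> (p + j)) \<le> (1 + (\<Sum>j=1..q. \<theta> (p + j))) / 2"
    and nu: "1 / (1 - \<kappa>\<^sub>0) \<le> \<nu>"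
    and a: "0 < a" "a \<le> 1"
    and xi: "\<And>i. 0 \<le> \<xi> i"
    and summable_lin: "summable (\<lambda>i. (real (Suc i))\<^sup>2 * \<nu> ^ Suc i * (garch_coeff p q \<theta> (Suc i) * \<xi> i))"
    and summable_pow: "summable (\<lambda>i. (real (Suc i))\<^sup>2 * \<nu> ^ Suc i * (2 * garch_coeff p q \<theta> (Suc i) * \<xi> i / \<theta> 0) powr a)"
begin

abbreviation "T \<equiv> \<Sum>j=1..q. \<theta> (p + j)"
abbreviation "c \<equiv> garch_coeff p q \<theta>"
abbreviation "cst \<equiv> \<theta> 0 / 2"

definition h where "h = c 0 + (\<Sum>i. c (Suc i) * \<xi> i)"
definition score where
  "score l = (garch_deriv p q \<theta> (unit_dir l) 0 + (\<Sum>i. garch_deriv p q \<theta> (unit_dir l) (Suc i) * \<xi> i)) / h"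

text \<open>The common majorant of all relative errors below. Its terms are small powers of the
  terms of the volatility series, which gives it moments of the required order.\<close>

definition Gam where
  "Gam = (\<Sum>i. (real (Suc i))\<^sup>2 * \<nu> ^ Suc i * (2 * c (Suc i) * \<xi> i / \<theta> 0) powr a)"

text \<open>Dominates the constants that arise at index 0: \<open>1 / (1 - T)\<close> from the
  derivative, \<open>2 / (1 - T)\<close> from bounding \<open>c 0\<close> relative to a perturbed
  volatility, and \<open>2 / (1 - T) ^ 3\<close> from the second-order remainder.\<close>

definition C1 where "C1 = 4 / (1 - T) ^ 3"

lemma T_nonneg: "0 \<le> T" using th by (intro sum_nonneg) (auto intro!: less_imp_le)
lemma th0: "0 < \<theta> 0" using th by simp
lemma nu1: "1 \<le> \<nu>" using order_trans[OF _ nu, of 1] k0 by simp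
lemma c_pos: "0 \<le> c (Suc i)" using th by (intro garch_coeff_nonneg) (auto intro!: less_imp_le)
lemma c0: "c 0 = \<theta> 0 / (1 - T)" by (simp add: garch_coeff_0)
lemma c0_ge: "\<theta> 0 \<le> c 0" using T T_nonneg th0 by (simp add: c0 field_simps)
lemma cxi: "0 \<le> c (Suc i) * \<xi> i" using c_pos xi by simp

lemma C1_ge: "1 \<le> C1"
proof -
  have "(1 - T) ^ 3 \<le> 1" using T T_nonneg by (intro power_le_one) auto
  then show ?thesis using T by (simp add: C1_def field_simps)
qed

lemma summable_weight:
  assumes "\<And>i. \<bar>w i\<bar> \<le> K * ((real (Suc i))\<^sup>2 * \<nu> ^ Suc i * c (Suc i))"
  shows "summable (\<lambda>i. w i * \<xi> i)"
proof (rule summable_comparison_test'[of _ 0])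
  show "summable (\<lambda>i. K * ((real (Suc i))\<^sup>2 * \<nu> ^ Suc i * (c (Suc i) * \<xi> i)))"
    by (intro summable_mult summable_lin)
  show "norm (w i * \<xi> i) \<le> K * ((real (Suc i))\<^sup>2 * \<nu> ^ Suc i * (c (Suc i) * \<xi> i))" for i
    using mult_right_mono[OF assms xi[of i], of i] xi[of i] by (simp add: abs_mult mult.assoc)
qed

lemma one_le_w: "1 \<le> (real (Suc i))\<^sup>2 * \<nu> ^ Suc i"
  using mult_mono[OF one_le_power[of "real (Suc i)" 2] one_le_power[OF nu1, of "Suc i"]] by simp

lemma summable_c: "summable (\<lambda>i. c (Suc i) * \<xi> i)"
  by (rule summable_weight[of _ 1])
     (use mult_right_mono[OF one_le_w c_pos] c_pos in \<open>simp add: mult.assoc\<close>)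

lemma h_ge: "\<theta> 0 + c (Suc i) * \<xi> i \<le> h"
  using sum_le_suminf[OF summable_c, of "{i}"] cxi c0_ge by (simp add: h_def)

lemma h_ge0: "\<theta> 0 \<le> h" and h_pos: "0 < h"
  using h_ge[of 0] cxi[of 0] th0 by linarith+

lemma ratio_h: "c (Suc i) * \<xi> i / h \<le> (2 * c (Suc i) * \<xi> i / \<theta> 0) powr a"
proof -
  have "c (Suc i) * \<xi> i / h \<le> c (Suc i) * \<xi> i / (cst + c (Suc i) * \<xi> i)"
    using h_ge[of i] th0 cxi[of i] h_pos by (intro divide_left_mono) (auto intro!: mult_pos_pos add_pos_nonneg)
  also have "\<dots> \<le> (c (Suc i) * \<xi> i / cst) powr a"
    using cxi a th0 by (intro ratio_le_powr) auto
  finally show ?thesis by (simp add: mult_ac)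
qed

lemma Gam_nonneg: "0 \<le> Gam" unfolding Gam_def
  using nu1 by (intro suminf_nonneg summable_pow) auto

text \<open>Termwise division by \<open>h\<close> replaces the terms by their small powers
  (\<open>ratio_h\<close>). Errors that are small relative to the coefficients therefore have a sum
  that is small relative to the volatility.\<close>

lemma series_div_h:
  assumes K: "0 \<le> K" and w: "\<And>i. \<bar>w i\<bar> \<le> K * ((real (Suc i))\<^sup>2 * \<nu> ^ Suc i * c (Suc i))"
  shows "\<bar>\<Sum>i. w i * \<xi> i\<bar> / h \<le> K * Gam"
proof -
  have le: "norm (w i * \<xi> i / h) \<le> K * ((real (Suc i))\<^sup>2 * \<nu> ^ Suc i * (2 * c (Suc i) * \<xi> i / \<theta> 0) powr a)" for i
  proof -
    have "norm (w i * \<xi> i / h) \<le> K * ((real (Suc i))\<^sup>2 * \<nu> ^ Suc i) * (c (Suc i) * \<xi> i / h)"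
      using divide_right_mono[OF mult_right_mono[OF w xi[of i], of i], of h] h_pos xi[of i]
      by (simp add: abs_mult mult.assoc)
    also have "\<dots> \<le> K * ((real (Suc i))\<^sup>2 * \<nu> ^ Suc i) * (2 * c (Suc i) * \<xi> i / \<theta> 0) powr a"
      using K nu1 by (intro mult_left_mono ratio_h) auto
    finally show ?thesis by (simp add: mult.assoc)
  qed
  have "\<bar>\<Sum>i. w i * \<xi> i\<bar> / h = norm (\<Sum>i. w i * \<xi> i / h)"
    using h_pos by (simp add: suminf_divide[OF summable_weight[OF w]])
  also have "\<dots> \<le> (\<Sum>i. K * ((real (Suc i))\<^sup>2 * \<nu> ^ Suc i * (2 * c (Suc i) * \<xi> i / \<theta> 0) powr a))"
    by (intro norm_suminf_le le summable_mult summable_pow)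
  also have "\<dots> = K * Gam" unfolding Gam_def by (intro suminf_mult summable_pow)
  finally show ?thesis .
qed

lemma deriv_weight:
  assumes "\<And>l. l < p + q + 1 \<Longrightarrow> \<bar>\<delta> l\<bar> \<le> \<kappa> * \<theta> l" and "0 \<le> \<kappa>"
  shows "\<bar>garch_deriv p q \<theta> \<delta> (Suc i)\<bar> \<le> \<kappa> * ((real (Suc i))\<^sup>2 * \<nu> ^ Suc i * c (Suc i))"
proof -
  have "\<bar>garch_deriv p q \<theta> \<delta> (Suc i)\<bar> \<le> real (Suc i) * \<kappa> * c (Suc i)"
    using th assms by (intro garch_deriv_bound) (auto intro!: less_imp_le)
  also have "real (Suc i) * 1 \<le> (real (Suc i))\<^sup>2 * \<nu> ^ Suc i"
    using nu1 by (intro mult_mono one_le_power self_le_power) auto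
  then have "real (Suc i) * (\<kappa> * c (Suc i)) \<le> ((real (Suc i))\<^sup>2 * \<nu> ^ Suc i) * (\<kappa> * c (Suc i))"
    using assms(2) c_pos by (intro mult_right_mono mult_nonneg_nonneg) auto
  then have "real (Suc i) * \<kappa> * c (Suc i) \<le> \<kappa> * ((real (Suc i))\<^sup>2 * \<nu> ^ Suc i * c (Suc i))"
    by (simp add: mult_ac)
  finally show ?thesis .
qed

lemma abs_sum_beta:
  assumes "\<And>l. l < p + q + 1 \<Longrightarrow> \<bar>\<delta> l\<bar> \<le> \<kappa> * \<theta> l"
  shows "\<bar>\<Sum>j=1..q. \<delta> (p + j)\<bar> \<le> \<kappa> * T"
proof -
  have "\<bar>\<Sum>j=1..q. \<delta> (p + j)\<bar> \<le> (\<Sum>j=1..q. \<kappa> * \<theta> (p + j))"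
    using assms by (intro order_trans[OF sum_abs sum_mono]) auto
  then show ?thesis by (simp add: sum_distrib_left)
qed

lemma numerator_0:
  assumes d: "\<And>l. l < p + q + 1 \<Longrightarrow> \<bar>\<delta> l\<bar> \<le> \<kappa> * \<theta> l"
  shows "\<bar>\<delta> 0 + c 0 * (\<Sum>j=1..q. \<delta> (p + j))\<bar> \<le> \<kappa> * c 0"
proof -
  have c00: "0 \<le> c 0" using c0_ge th0 by simp
  have "\<bar>\<delta> 0 + c 0 * (\<Sum>j=1..q. \<delta> (p + j))\<bar> \<le> \<bar>\<delta> 0\<bar> + c 0 * \<bar>\<Sum>j=1..q. \<delta> (p + j)\<bar>"
    using abs_triangle_ineq[of "\<delta> 0" "c 0 * (\<Sum>j=1..q. \<delta> (p + j))"] c00 by (simp add: abs_mult)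
  also have "\<dots> \<le> \<kappa> * \<theta> 0 + c 0 * (\<kappa> * T)"
    using d c00 by (intro add_mono mult_left_mono abs_sum_beta) auto
  also have "\<theta> 0 = c 0 * (1 - T)" using T by (simp add: c0)
  finally show ?thesis by (simp add: algebra_simps)
qed

lemma deriv_0_bound:
  assumes d: "\<And>l. l < p + q + 1 \<Longrightarrow> \<bar>\<delta> l\<bar> \<le> \<kappa> * \<theta> l" and "0 \<le> \<kappa>"
  shows "\<bar>garch_deriv p q \<theta> \<delta> 0\<bar> \<le> \<kappa> * C1 * \<theta> 0"
proof -
  have T1: "0 < 1 - T" "1 - T \<le> 1" using T T_nonneg by auto
  have "\<bar>garch_deriv p q \<theta> \<delta> 0\<bar> = \<bar>\<delta> 0 + c 0 * (\<Sum>j=1..q. \<delta> (p + j))\<bar> / (1 - T)"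
    using T by (simp add: garch_deriv_0)
  also have "\<dots> \<le> \<kappa> * c 0 / (1 - T)" using T1 d by (intro divide_right_mono numerator_0) auto
  also have "\<dots> = \<kappa> * \<theta> 0 * (1 / (1 - T)\<^sup>2)" by (simp add: c0 power2_eq_square)
  also have "\<dots> \<le> \<kappa> * \<theta> 0 * C1"
  proof (rule mult_left_mono)
    have "(1 - T) ^ 3 \<le> (1 - T) ^ 2" using T1 by (intro power_decreasing) auto
    then have "(1 - T) ^ 3 \<le> 4 * (1 - T)\<^sup>2" using zero_le_power2[of "1 - T"] by linarith
    then show "1 / (1 - T)\<^sup>2 \<le> C1" using T1 by (simp add: C1_def field_simps)
  qed (use assms th0 in auto)
  finally show ?thesis by (simp add: mult_ac)
qed

lemma score_series_bound:
  assumes d: "\<And>l. l < p + q + 1 \<Longrightarrow> \<bar>\<delta> l\<bar> \<le> \<kappa> * \<theta> l" and k: "0 \<le> \<kappa>"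
  shows "\<bar>garch_deriv p q \<theta> \<delta> 0 + (\<Sum>i. garch_deriv p q \<theta> \<delta> (Suc i) * \<xi> i)\<bar> / h \<le> \<kappa> * (C1 + Gam)"
proof -
  let ?S = "\<Sum>i. garch_deriv p q \<theta> \<delta> (Suc i) * \<xi> i"
  have "\<bar>garch_deriv p q \<theta> \<delta> 0\<bar> / h \<le> \<kappa> * C1 * \<theta> 0 / \<theta> 0"
    using deriv_0_bound[OF d k] h_ge0 th0 h_pos k C1_ge by (intro frac_le) auto
  then have "\<bar>garch_deriv p q \<theta> \<delta> 0\<bar> / h \<le> \<kappa> * C1" using th0 by simp
  moreover have "\<bar>?S\<bar> / h \<le> \<kappa> * Gam"
    by (rule series_div_h[OF k deriv_weight[OF d k]])
  moreover have "\<bar>garch_deriv p q \<theta> \<delta> 0 + ?S\<bar> / h \<le> \<bar>garch_deriv p q \<theta> \<delta> 0\<bar> / h + \<bar>?S\<bar> / h"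
    unfolding add_divide_distrib[symmetric] using h_pos by (intro divide_right_mono abs_triangle_ineq) auto
  ultimately show ?thesis by (simp add: distrib_left)
qed

lemma score_linear:
  "(\<Sum>l<p + q + 1. \<delta> l * score l)
   = (garch_deriv p q \<theta> \<delta> 0 + (\<Sum>i. garch_deriv p q \<theta> \<delta> (Suc i) * \<xi> i)) / h"
proof -
  let ?g = "\<lambda>l. garch_deriv p q \<theta> (unit_dir l)"
  have s: "summable (\<lambda>i. ?g l (Suc i) * \<xi> i)" if "l < p + q + 1" for l
    using that th[OF that]
    by (intro summable_weight[of _ "1 / \<theta> l"] deriv_weight) (auto simp: unit_dir_def intro!: divide_nonneg_pos less_imp_le[OF th])
  have "(\<Sum>i. garch_deriv p q \<theta> \<delta> (Suc i) * \<xi> i) = (\<Sum>i. \<Sum>l<p + q + 1. \<delta> l * (?g l (Suc i) * \<xi> i))"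
    by (subst garch_deriv_linear) (simp only: sum_distrib_right mult.assoc)
  also have "\<dots> = (\<Sum>l<p + q + 1. \<Sum>i. \<delta> l * (?g l (Suc i) * \<xi> i))"
    using s by (intro suminf_sum summable_mult) auto
  also have "\<dots> = (\<Sum>l<p + q + 1. \<delta> l * (\<Sum>i. ?g l (Suc i) * \<xi> i))"
    using s by (intro sum.cong refl suminf_mult) auto
  finally show ?thesis
    by (simp only: garch_deriv_linear[of p q \<theta> \<delta> 0] score_def sum_divide_distrib[symmetric]
        times_divide_eq_right distrib_left sum.distrib)
qed

lemma score_bound:
  assumes "l < p + q + 1" "\<And>l. l < p + q + 1 \<Longrightarrow> m \<le> \<theta> l" "0 < m"
  shows "\<bar>score l\<bar> \<le> (C1 + Gam) / m"
proof -
  have "\<bar>score l\<bar> \<le> 1 / m * (C1 + Gam)"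
    unfolding score_def abs_divide abs_of_pos[OF h_pos]
    using assms less_imp_le[OF th] by (intro score_series_bound) (auto simp: unit_dir_def)
  then show ?thesis by simp
qed

end

lemma two_div_le_four_div_cube: "0 < z \<Longrightarrow> z \<le> 1 \<Longrightarrow> 2 / z \<le> 4 / z ^ 3" for z :: real
proof -
  assume z: "0 < z" "z \<le> 1"
  then have "z\<^sup>2 \<le> 1" by (intro power_le_one) auto
  then have "z\<^sup>2 * 2 / z ^ 3 \<le> 4 / z ^ 3" using z by (intro divide_right_mono) auto
  moreover have "z\<^sup>2 * 2 / z ^ 3 = 2 / z" using z by (simp add: power2_eq_square power3_eq_cube)
  ultimately show ?thesis by simp
qed

lemma ratio_split: "0 < x \<Longrightarrow> 0 \<le> e \<Longrightarrow> h / x = h / (x + e) * (1 + e / x)" for x e h :: real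
proof -
  assume "0 < x" "0 \<le> e"
  then have "1 + e / x = (x + e) / x" "x + e \<noteq> 0" by (auto simp: add_divide_distrib)
  then show "h / x = h / (x + e) * (1 + e / x)" by simp
qed

context volatility_path
begin

text \<open>The estimated volatility at time \<open>n\<close>, whose series ends at the first
  observation.\<close>

definition h_hat where
  "h_hat u n = garch_coeff p q u 0 + (\<Sum>i<n. garch_coeff p q u (Suc i) * \<xi> i)"

context
  fixes u :: "nat \<Rightarrow> real" and \<kappa> E :: real and n :: nat
  assumes d: "\<And>l. l < p + q + 1 \<Longrightarrow> \<bar>u l - \<theta> l\<bar> \<le> \<kappa> * \<theta> l"
    and k: "0 \<le> \<kappa>" "\<kappa> \<le> \<kappa>\<^sub>0"
    and E: "(\<Sum>i. \<nu> ^ Suc (i + n) * (garch_coeff p q \<theta> (Suc (i + n)) * \<xi> (i + n))) \<le> E * cst"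
begin

abbreviation "b \<equiv> garch_coeff p q u"
abbreviation "T' \<equiv> \<Sum>j=1..q. u (p + j)"

lemma u_bounds:
  assumes "l < p + q + 1"
  shows "u l \<le> (1 + \<kappa>) * \<theta> l" "(1 - \<kappa>) * \<theta> l \<le> u l" "\<theta> l / 2 \<le> u l" "0 < u l"
proof -
  show 1: "u l \<le> (1 + \<kappa>) * \<theta> l" "(1 - \<kappa>) * \<theta> l \<le> u l"
    using d[OF assms] by (auto simp: abs_le_iff algebra_simps)
  have "(1 - \<kappa>) * \<theta> l \<ge> (1 / 2) * \<theta> l"
    using th[OF assms] k k0 by (intro mult_right_mono) auto
  with 1 th[OF assms] show "\<theta> l / 2 \<le> u l" "0 < u l" by linarith+
qed

lemma T'_bounds: "T' \<le> (1 + T) / 2" "0 \<le> T'" "(1 - T) / 2 \<le> 1 - T'"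
proof -
  have "T' \<le> (\<Sum>j=1..q. (1 + \<kappa>) * \<theta> (p + j))"
    by (intro sum_mono u_bounds) auto
  also have "\<dots> = (1 + \<kappa>) * T" by (simp add: sum_distrib_left)
  also have "\<dots> \<le> (1 + \<kappa>\<^sub>0) * T" using k T_nonneg by (intro mult_right_mono) auto
  finally show 1: "T' \<le> (1 + T) / 2" using k0(3) by linarith
  show "0 \<le> T'" by (intro sum_nonneg less_imp_le u_bounds) auto
  show "(1 - T) / 2 \<le> 1 - T'" using 1 by (simp add: field_simps)
qed

lemma b0_ge: "cst \<le> b 0"
proof -
  have T1: "0 < 1 - T'" "1 - T' \<le> 1" using T'_bounds T by auto
  have "u 0 / 1 \<le> u 0 / (1 - T')"
    using T1 u_bounds(4)[of 0] by (intro divide_left_mono) auto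
  then show ?thesis using u_bounds(3)[of 0] unfolding garch_coeff_0 by linarith
qed

lemma b_nonneg: "0 \<le> b (Suc i)"
  using u_bounds(4) by (intro garch_coeff_nonneg) (auto intro!: less_imp_le)

lemma bxi: "0 \<le> b (Suc i) * \<xi> i" using b_nonneg xi by simp

lemma nu_ge: "1 + \<kappa> \<le> \<nu>" "1 / (1 - \<kappa>) \<le> \<nu>"
proof -
  have 1: "1 / (1 - \<kappa>) \<le> 1 / (1 - \<kappa>\<^sub>0)" using k k0 by (intro divide_left_mono) auto
  then show "1 / (1 - \<kappa>) \<le> \<nu>" using nu by simp
  have "(1 + \<kappa>) * (1 - \<kappa>) \<le> 1" by (simp add: algebra_simps)
  then have "1 + \<kappa> \<le> 1 / (1 - \<kappa>)" using k k0 by (simp add: field_simps)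
  with \<open>1 / (1 - \<kappa>) \<le> \<nu>\<close> show "1 + \<kappa> \<le> \<nu>" by simp
qed

lemma b_le: "b (Suc i) \<le> \<nu> ^ Suc i * c (Suc i)"
proof -
  have "b (Suc i) \<le> (1 + \<kappa>) ^ Suc i * c (Suc i)"
    using u_bounds th k by (intro garch_coeff_le_power_mult) (auto intro!: less_imp_le)
  also have "\<dots> \<le> \<nu> ^ Suc i * c (Suc i)"
    using nu_ge k c_pos by (intro mult_right_mono power_mono) auto
  finally show ?thesis .
qed

lemma c_le: "c (Suc i) \<le> \<nu> ^ Suc i * b (Suc i)"
proof -
  have p: "0 < (1 - \<kappa>) ^ Suc i" using k k0 by simp
  have "(1 - \<kappa>) ^ Suc i * c (Suc i) \<le> b (Suc i)"
    using u_bounds th k k0 by (intro garch_coeff_ge_power_mult) (auto intro!: less_imp_le)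
  then have "c (Suc i) \<le> b (Suc i) / (1 - \<kappa>) ^ Suc i"
    using p by (simp only: pos_le_divide_eq mult.commute)
  then have "c (Suc i) \<le> (1 / (1 - \<kappa>)) ^ Suc i * b (Suc i)"
    by (simp only: power_one_over mult_1_left times_divide_eq_left)
  also have "\<dots> \<le> \<nu> ^ Suc i * b (Suc i)"
    using nu_ge k k0 b_nonneg by (intro mult_right_mono power_mono) auto
  finally show ?thesis .
qed

lemma w_ge: "\<nu> ^ Suc i * c (Suc i) \<le> (real (Suc i))\<^sup>2 * \<nu> ^ Suc i * c (Suc i)"
proof -
  have "1 * (\<nu> ^ Suc i * c (Suc i)) \<le> (real (Suc i))\<^sup>2 * (\<nu> ^ Suc i * c (Suc i))"
    using nu1 c_pos by (intro mult_right_mono one_le_power mult_nonneg_nonneg) auto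
  then show ?thesis by (simp add: mult.assoc)
qed

lemma summable_b: "summable (\<lambda>i. b (Suc i) * \<xi> i)"
proof (rule summable_weight[of _ 1])
  show "\<bar>b (Suc i)\<bar> \<le> 1 * ((real (Suc i))\<^sup>2 * \<nu> ^ Suc i * c (Suc i))" for i
    using order_trans[OF b_le w_ge] b_nonneg[of i] by simp
qed

lemma summable_nc: "summable (\<lambda>i. \<nu> ^ Suc i * (c (Suc i) * \<xi> i))"
proof -
  have "summable (\<lambda>i. (\<nu> ^ Suc i * c (Suc i)) * \<xi> i)"
  proof (rule summable_weight[of _ 1])
    show "\<bar>\<nu> ^ Suc i * c (Suc i)\<bar> \<le> 1 * ((real (Suc i))\<^sup>2 * \<nu> ^ Suc i * c (Suc i))" for i
      using w_ge[of i] c_pos[of i] nu1 by (simp add: abs_mult)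
  qed
  then show ?thesis by (simp add: mult.assoc)
qed

text \<open>The error of the estimated volatility has two sources: \<open>hu\<close> replaces the
  parameter but keeps the infinite past, and \<open>e\<close> is the part of \<open>hu\<close> that
  lies before the first observation.\<close>

abbreviation "hu \<equiv> b 0 + (\<Sum>i. b (Suc i) * \<xi> i)"
abbreviation "e \<equiv> \<Sum>i. b (Suc (i + n)) * \<xi> (i + n)"

lemma hu_ge: "cst + b (Suc i) * \<xi> i \<le> hu"
  using sum_le_suminf[OF summable_b, of "{i}"] bxi b0_ge by simp

lemma hu_split: "hu = h_hat u n + e"
  unfolding h_hat_def using suminf_split_initial_segment[OF summable_b, of n] by (simp add: add_ac)

lemma e_nonneg: "0 \<le> e"
proof -
  have "summable (\<lambda>i. b (Suc (i + n)) * \<xi> (i + n))" using summable_ignore_initial_segment[OF summable_b, of n] by simp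
  then show ?thesis by (intro suminf_nonneg bxi) 
qed

lemma e_le: "e \<le> E * cst"
proof -
  have "e \<le> (\<Sum>i. \<nu> ^ Suc (i + n) * (c (Suc (i + n)) * \<xi> (i + n)))"
  proof (rule suminf_le)
    show "b (Suc (i + n)) * \<xi> (i + n) \<le> \<nu> ^ Suc (i + n) * (c (Suc (i + n)) * \<xi> (i + n))" for i
      using mult_right_mono[OF b_le xi, of "i + n" "i + n"] by (simp only: mult.assoc)
    show "summable (\<lambda>i. b (Suc (i + n)) * \<xi> (i + n))"
      using summable_ignore_initial_segment[OF summable_b, of n] by simp
    show "summable (\<lambda>i. \<nu> ^ Suc (i + n) * (c (Suc (i + n)) * \<xi> (i + n)))"
      using summable_ignore_initial_segment[OF summable_nc, of n] by simp
  qed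
  with E show ?thesis by linarith
qed

lemma E_nonneg: "0 \<le> E"
  using order_trans[OF e_nonneg e_le] th0 by (simp add: zero_le_mult_iff)

lemma h_hat_ge: "cst \<le> h_hat u n"
proof -
  have "0 \<le> (\<Sum>i<n. b (Suc i) * \<xi> i)" by (intro sum_nonneg bxi)
  with b0_ge show ?thesis unfolding h_hat_def by linarith
qed

text \<open>A perturbed coefficient may be smaller than the true one by the factor \<open>\<nu> ^
  Suc i\<close>. Only the reduced term \<open>y\<close> is compared with the perturbed volatility;
  the lost factor reappears outside the power, among the weights of \<open>Gam\<close>.\<close>

lemma ratio_h_hu: "h / hu \<le> C1 + Gam"
proof -
  have hu0: "0 < hu" using hu_ge[of 0] bxi[of 0] th0 by linarith
  have le: "c (Suc i) * \<xi> i / hu \<le> (real (Suc i))\<^sup>2 * \<nu> ^ Suc i * (2 * c (Suc i) * \<xi> i / \<theta> 0) powr a" for i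
  proof -
    have N: "0 < \<nu> ^ Suc i" using nu1 by simp
    define y where "y = c (Suc i) * \<xi> i / \<nu> ^ Suc i"
    have y0: "0 \<le> y" using cxi[of i] N by (simp add: y_def)
    have ycx: "y \<le> c (Suc i) * \<xi> i"
      unfolding y_def using N cxi[of i] nu1 by (intro divide_le_eq[THEN iffD2]) (simp add: mult_le_cancel_left1 one_le_power del: power_Suc)
    have yb: "y \<le> b (Suc i) * \<xi> i"
      using mult_right_mono[OF c_le xi, of i i] N unfolding y_def by (simp add: field_simps del: power_Suc)
    have "c (Suc i) * \<xi> i / hu = \<nu> ^ Suc i * (y / hu)" using nu1 by (auto simp: y_def simp del: power_Suc)
    also have "\<dots> \<le> \<nu> ^ Suc i * (y / (cst + y))"
      using N y0 yb hu_ge[of i] hu0 th0 by (intro mult_left_mono divide_left_mono mult_pos_pos) auto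
    also have "\<dots> \<le> \<nu> ^ Suc i * (y / cst) powr a"
      using N y0 th0 a by (intro mult_left_mono ratio_le_powr) auto
    also have "\<dots> \<le> \<nu> ^ Suc i * (c (Suc i) * \<xi> i / cst) powr a"
      using N y0 ycx th0 a by (intro mult_left_mono powr_mono2 divide_right_mono) auto
    also have "\<dots> \<le> (real (Suc i))\<^sup>2 * (\<nu> ^ Suc i * (c (Suc i) * \<xi> i / cst) powr a)"
      using N mult_right_mono[OF one_le_power[of "real (Suc i)" 2], of "\<nu> ^ Suc i * (c (Suc i) * \<xi> i / cst) powr a"]
      by simp
    finally show ?thesis by (simp add: mult_ac)
  qed
  have "(\<Sum>i. c (Suc i) * \<xi> i) / hu = (\<Sum>i. c (Suc i) * \<xi> i / hu)"
    by (intro suminf_divide[symmetric] summable_c)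
  also have "\<dots> \<le> Gam"
    unfolding Gam_def by (intro suminf_le le summable_divide summable_c summable_pow)
  finally have 1: "(\<Sum>i. c (Suc i) * \<xi> i) / hu \<le> Gam" .
  have "c 0 / hu \<le> c 0 / cst"
    using hu_ge[of 0] bxi[of 0] th0 hu0 c0_ge by (intro divide_left_mono) auto
  also have "\<dots> = 2 / (1 - T)" using th0 by (simp add: c0)
  also have "\<dots> \<le> C1"
    unfolding C1_def using T T_nonneg by (intro two_div_le_four_div_cube) auto
  finally show ?thesis using 1 unfolding h_def add_divide_distrib by linarith
qed

definition G where "G = garch_deriv p q \<theta> (\<lambda>l. u l - \<theta> l) 0 + (\<Sum>i. garch_deriv p q \<theta> (\<lambda>l. u l - \<theta> l) (Suc i) * \<xi> i)"

lemma G_bound: "\<bar>G\<bar> / h \<le> \<kappa> * (C1 + Gam)"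
  unfolding G_def by (rule score_series_bound[OF d k(1)])

lemma remainder_0: "\<bar>b 0 - c 0 - garch_deriv p q \<theta> (\<lambda>l. u l - \<theta> l) 0\<bar> \<le> \<kappa>\<^sup>2 * C1 * \<theta> 0"
proof -
  have T1: "0 < 1 - T" "1 - T \<le> 1" using T T_nonneg by auto
  let ?\<tau> = "\<Sum>j=1..q. u (p + j) - \<theta> (p + j)"
  have tau: "\<bar>?\<tau>\<bar> \<le> \<kappa>"
    using order_trans[OF abs_sum_beta[OF d] mult_left_mono[of T 1 \<kappa>]] T k by simp
  have c00: "0 \<le> c 0" using c0_ge th0 by linarith
  have num: "\<bar>u 0 - \<theta> 0 + c 0 * ?\<tau>\<bar> * \<bar>?\<tau>\<bar> \<le> (\<kappa> * c 0) * \<kappa>"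
    by (rule mult_mono[OF numerator_0[OF d] tau]) (use c00 k in auto)
  have den: "(1 - T) * ((1 - T) / 2) \<le> (1 - T) * (1 - T')"
    using T1 T'_bounds by (intro mult_left_mono) auto
  have "\<bar>b 0 - c 0 - garch_deriv p q \<theta> (\<lambda>l. u l - \<theta> l) 0\<bar>
      = \<bar>u 0 - \<theta> 0 + c 0 * ?\<tau>\<bar> * \<bar>?\<tau>\<bar> / ((1 - T) * (1 - T'))"
    using T T'_bounds by (subst garch_coeff_taylor_0) (auto simp: abs_mult)
  also have "\<dots> \<le> (\<kappa> * c 0) * \<kappa> / ((1 - T) * ((1 - T) / 2))"
    by (rule frac_le[OF _ num _ den]) (use T1 k c00 in auto)
  also have "\<dots> = \<kappa>\<^sup>2 * \<theta> 0 * (2 / (1 - T) ^ 3)" by (simp add: c0 power2_eq_square eval_nat_numeral)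
  also have "\<dots> \<le> \<kappa>\<^sup>2 * \<theta> 0 * C1"
    using T1 th0 unfolding C1_def by (intro mult_left_mono divide_right_mono) auto
  finally show ?thesis by (simp add: mult_ac)
qed

lemma remainder_series: "\<bar>hu - h - G\<bar> / h \<le> \<kappa>\<^sup>2 * (C1 + Gam)"
proof -
  let ?g = "garch_deriv p q \<theta> (\<lambda>l. u l - \<theta> l)"
  have w: "\<bar>b (Suc i) - c (Suc i) - ?g (Suc i)\<bar> \<le> \<kappa>\<^sup>2 * ((real (Suc i))\<^sup>2 * \<nu> ^ Suc i * c (Suc i))" for i
  proof -
    have "\<bar>b (Suc i) - c (Suc i) - ?g (Suc i)\<bar> \<le> (real (Suc i))\<^sup>2 * \<kappa>\<^sup>2 * (1 + \<kappa>) ^ Suc i * c (Suc i)"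
      using k k0 d by (intro garch_coeff_taylor) (auto intro!: less_imp_le[OF th])
    also have "\<dots> \<le> (real (Suc i))\<^sup>2 * \<kappa>\<^sup>2 * \<nu> ^ Suc i * c (Suc i)"
      using c_pos nu_ge k by (intro mult_right_mono mult_left_mono power_mono) auto
    finally show ?thesis by (simp add: mult_ac)
  qed
  have sg: "summable (\<lambda>i. ?g (Suc i) * \<xi> i)"
    by (rule summable_weight[OF deriv_weight[OF d k(1)]])
  have "(\<Sum>i. b (Suc i) * \<xi> i) - (\<Sum>i. c (Suc i) * \<xi> i) - (\<Sum>i. ?g (Suc i) * \<xi> i)
     = (\<Sum>i. (b (Suc i) - c (Suc i) - ?g (Suc i)) * \<xi> i)"
    unfolding left_diff_distrib using summable_b summable_c sg by (simp add: suminf_diff summable_diff)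
  then have eq: "hu - h - G = (b 0 - c 0 - ?g 0) + (\<Sum>i. (b (Suc i) - c (Suc i) - ?g (Suc i)) * \<xi> i)"
    unfolding h_def G_def by linarith
  have "\<bar>hu - h - G\<bar> / h \<le> \<bar>b 0 - c 0 - ?g 0\<bar> / h + \<bar>\<Sum>i. (b (Suc i) - c (Suc i) - ?g (Suc i)) * \<xi> i\<bar> / h"
    unfolding eq add_divide_distrib[symmetric] using h_pos by (intro divide_right_mono abs_triangle_ineq) auto
  also have "\<dots> \<le> \<kappa>\<^sup>2 * C1 * \<theta> 0 / \<theta> 0 + \<kappa>\<^sup>2 * Gam"
    using remainder_0 h_ge0 th0 C1_ge w by (intro add_mono frac_le series_div_h) auto
  finally show ?thesis using th0 by (simp add: distrib_left)
qed

text \<open>The square root is the factor that turns an innovation into a residual. The relative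
  error \<open>x\<close> of the estimated volatility is linear in the parameter up to the Taylor
  remainder \<open>\<kappa>\<^sup>2 * Q\<close> and the truncation error \<open>E\<close>; the
  expansion of the inverse square root adds \<open>x\<^sup>2 * y\<close>. Two powers of
  \<open>Q\<close> come from \<open>x\<^sup>2\<close> and one from \<open>y\<close>.\<close>

lemma sqrt_ratio_expansion:
  fixes Q :: real
  assumes Q: "C1 + Gam \<le> Q"
  shows "\<bar>sqrt (h / h_hat u n) - 1 + (\<Sum>l<p + q + 1. (u l - \<theta> l) * score l) / 2\<bar>
    \<le> 9 * \<kappa>\<^sup>2 * Q ^ 3 + 9 * Q ^ 3 * E * (1 + E)\<^sup>2"
proof -
  have Q1: "1 \<le> Q" using Q C1_ge Gam_nonneg by linarith
  have k1: "\<kappa> \<le> 1" using k k0 by simp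
  have hh: "0 < h_hat u n" using h_hat_ge th0 by linarith
  define y where "y = sqrt (h / h_hat u n)"
  define x where "x = (h_hat u n - h) / h"
  have y0: "0 < y" using hh h_pos by (simp add: y_def)
  have y2: "y\<^sup>2 = h / h_hat u n" using hh h_pos by (simp add: y_def)
  have x: "x = 1 / y\<^sup>2 - 1" using hh h_pos by (simp add: x_def y2 field_simps)
  have eh: "e / h \<le> E"
  proof -
    have "e / h \<le> (E * cst) / cst"
      using e_le e_nonneg h_ge0 th0 E_nonneg by (intro frac_le) auto
    then show ?thesis using th0 by simp
  qed
  have kQ: "0 \<le> \<kappa>\<^sup>2 * Q" "0 \<le> \<kappa> * Q" using k Q1 by auto
  have xG: "\<bar>x - G / h\<bar> \<le> \<kappa>\<^sup>2 * Q + E"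
  proof -
    have "x - G / h = (hu - h - G) / h - e / h"
      unfolding x_def hu_split by (simp add: diff_divide_distrib add_divide_distrib)
    then have "\<bar>x - G / h\<bar> \<le> \<bar>(hu - h - G) / h\<bar> + \<bar>e / h\<bar>" by (simp only: abs_triangle_ineq4)
    also have "\<dots> = \<bar>hu - h - G\<bar> / h + e / h" using h_pos e_nonneg by (simp only: abs_divide abs_of_pos abs_of_nonneg)
    also have "\<dots> \<le> \<kappa>\<^sup>2 * Q + E"
      using remainder_series mult_left_mono[OF Q zero_le_power2[of \<kappa>]] eh by linarith
    finally show ?thesis .
  qed
  have Gh: "\<bar>G / h\<bar> \<le> \<kappa> * Q"
    using G_bound mult_left_mono[OF Q k(1)] h_pos by (simp add: abs_divide)
  have kk: "\<kappa>\<^sup>2 * Q \<le> \<kappa> * Q"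
    using k k1 Q1 by (intro mult_right_mono) (auto simp: power2_eq_square mult_left_le)
  have xb: "\<bar>x\<bar> \<le> 2 * (\<kappa> * Q) + E" using xG Gh kk by linarith
  have yb: "y \<le> Q * (1 + E)"
  proof -
    have "y\<^sup>2 = (h / hu) * (1 + e / h_hat u n)"
      unfolding y2 hu_split by (rule ratio_split[OF hh e_nonneg])
    also have "\<dots> \<le> Q * (1 + E)"
    proof (rule mult_mono)
      show "h / hu \<le> Q" using ratio_h_hu Q by linarith
      have "e / h_hat u n \<le> (E * cst) / cst"
        using e_le e_nonneg h_hat_ge th0 E_nonneg by (intro frac_le) auto
      then show "1 + e / h_hat u n \<le> 1 + E" using th0 by simp
    qed (use Q1 e_nonneg hh in auto)
    also have "\<dots> \<le> (Q * (1 + E))\<^sup>2"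
      using Q1 E_nonneg by (intro self_le_power) (auto intro!: mult_ge1_I)
    finally show ?thesis using Q1 E_nonneg by (rule_tac power2_le_imp_le) auto
  qed
  have exp: "\<bar>y - 1 + x / 2\<bar> \<le> (2 * (\<kappa> * Q) + E)\<^sup>2 * (Q * (1 + E))"
  proof -
    have "x\<^sup>2 \<le> (2 * (\<kappa> * Q) + E)\<^sup>2" using power_mono[OF xb abs_ge_zero, of 2] by simp
    then have "x\<^sup>2 * y \<le> (2 * (\<kappa> * Q) + E)\<^sup>2 * (Q * (1 + E))"
      using yb y0 by (intro mult_mono) auto
    with inverse_sqrt_expansion[OF y0 x] show ?thesis by linarith
  qed
  have sc: "(\<Sum>l<p + q + 1. (u l - \<theta> l) * score l) = G / h"
    unfolding score_linear G_def by simp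
  have split: "y - 1 + G / h / 2 = (y - 1 + x / 2) - (x - G / h) / 2" by (simp add: diff_divide_distrib)
  have "\<bar>y - 1 + G / h / 2\<bar> \<le> \<bar>y - 1 + x / 2\<bar> + \<bar>(x - G / h) / 2\<bar>"
    unfolding split by (rule abs_triangle_ineq4)
  also have "\<dots> = \<bar>y - 1 + x / 2\<bar> + \<bar>x - G / h\<bar> / 2" by simp
  also have "\<dots> \<le> (2 * (\<kappa> * Q) + E)\<^sup>2 * (Q * (1 + E)) + (\<kappa>\<^sup>2 * Q + E) / 2"
    by (rule add_mono[OF exp divide_right_mono[OF xG]]) simp
  also have "\<dots> \<le> (8 * (\<kappa>\<^sup>2 * Q\<^sup>2) + 2 * E\<^sup>2) * (Q * (1 + E)) + (\<kappa>\<^sup>2 * Q + E) / 2"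
  proof -
    have "0 \<le> (2 * (\<kappa> * Q) - E)\<^sup>2" by simp
    then have "(2 * (\<kappa> * Q) + E)\<^sup>2 \<le> 8 * (\<kappa>\<^sup>2 * Q\<^sup>2) + 2 * E\<^sup>2"
      by (simp add: power2_eq_square algebra_simps)
    then show ?thesis using Q1 E_nonneg by (intro add_right_mono mult_right_mono) auto
  qed
  also have "\<dots> = 8 * (\<kappa>\<^sup>2 * Q ^ 3) + 8 * (\<kappa>\<^sup>2 * (Q ^ 3 * E)) + 2 * (Q * (E\<^sup>2 * (1 + E))) + \<kappa>\<^sup>2 * Q / 2 + E / 2"
    by (simp add: power2_eq_square eval_nat_numeral algebra_simps)
  also have "\<dots> \<le> 8 * (\<kappa>\<^sup>2 * Q ^ 3) + 8 * (Q ^ 3 * E) + 2 * (Q ^ 3 * (E\<^sup>2 * (1 + E))) + \<kappa>\<^sup>2 * Q ^ 3 / 2 + Q ^ 3 * E / 2"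
  proof -
    have 1: "\<kappa>\<^sup>2 * (Q ^ 3 * E) \<le> 1 * (Q ^ 3 * E)"
      using k k1 Q1 E_nonneg by (intro mult_right_mono power_le_one) auto
    have Q3: "Q \<le> Q ^ 3" "1 \<le> Q ^ 3" using Q1 by (auto intro!: self_le_power one_le_power)
    have 2: "Q * (E\<^sup>2 * (1 + E)) \<le> Q ^ 3 * (E\<^sup>2 * (1 + E))"
      using Q3 E_nonneg by (intro mult_right_mono) auto
    have 3: "\<kappa>\<^sup>2 * Q \<le> \<kappa>\<^sup>2 * Q ^ 3" using Q3 by (intro mult_left_mono) auto
    have 4: "1 * E \<le> Q ^ 3 * E" using Q3 E_nonneg by (intro mult_right_mono) auto
    from 1 2 3 4 show ?thesis by linarith
  qed
  also have "\<dots> \<le> 9 * \<kappa>\<^sup>2 * Q ^ 3 + 9 * Q ^ 3 * E * (1 + E)\<^sup>2"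
  proof -
    have "9 * Q ^ 3 * E * (1 + E)\<^sup>2 = 9 * (Q ^ 3 * E) + 18 * (Q ^ 3 * E\<^sup>2) + 9 * (Q ^ 3 * E ^ 3)"
      by (simp add: power2_eq_square eval_nat_numeral algebra_simps)
    moreover have "Q ^ 3 * (E\<^sup>2 * (1 + E)) = Q ^ 3 * E\<^sup>2 + Q ^ 3 * E ^ 3"
      by (simp add: power2_eq_square eval_nat_numeral algebra_simps)
    moreover have "0 \<le> Q ^ 3 * E" "0 \<le> Q ^ 3 * E\<^sup>2" "0 \<le> Q ^ 3 * E ^ 3" "0 \<le> \<kappa>\<^sup>2 * Q ^ 3"
      using Q1 E_nonneg by auto
    ultimately show ?thesis by linarith
  qed
  finally show ?thesis unfolding sc y_def .
qed

end
end

section \<open>Self-normalised partial sums under small multiplicative perturbations\<close>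

lemma floor_atMost_subset: "u \<in> {0..1::real} \<Longrightarrow> {1..\<lfloor>real n * u\<rfloor>} \<subseteq> {1..int n}"
proof -
  assume "u \<in> {0..1}"
  then have "real n * u \<le> real n" by (intro mult_left_le) auto
  then have "\<lfloor>real n * u\<rfloor> \<le> int n" by linarith
  then show ?thesis by auto
qed

text \<open>Suprema over the time fraction \<open>u\<close> are expressed as uniform limits in
  \<open>u\<close>, along an arbitrary filter of sample sizes: this allows restricting the sample
  sizes first to a subsequence and then, pathwise, to an event.\<close>

lemma uniform_null_mult_bounded:
  fixes f :: "nat \<Rightarrow> real \<Rightarrow> real" and c :: "nat \<Rightarrow> real"
  assumes f: "uniform_limit S f (\<lambda>_. 0) F" and c: "eventually (\<lambda>n. \<bar>c n\<bar> \<le> C) F"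
  shows "uniform_limit S (\<lambda>n u. c n * f n u) (\<lambda>_. 0) F"
proof (rule uniform_limitI)
  fix e :: real assume e: "0 < e"
  then have "0 < e / (\<bar>C\<bar> + 1)" by simp
  from uniform_limitD[OF f this] c show "\<forall>\<^sub>F n in F. \<forall>x\<in>S. dist (c n * f n x) 0 < e"
  proof eventually_elim
    case (elim n)
    show ?case
    proof
      fix x assume x: "x \<in> S"
      have "\<bar>c n * f n x\<bar> \<le> (\<bar>C\<bar> + 1) * \<bar>f n x\<bar>"
        unfolding abs_mult using elim(2) by (intro mult_right_mono) auto
      also have "\<dots> < (\<bar>C\<bar> + 1) * (e / (\<bar>C\<bar> + 1))"
        using elim(1)[rule_format, OF x] by (intro mult_strict_left_mono) (auto simp: dist_real_def)
      also have "\<dots> = e" by simp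
      finally show "dist (c n * f n x) 0 < e" by (simp add: dist_real_def)
    qed
  qed
qed

lemma uniform_null_bound:
  fixes f :: "nat \<Rightarrow> real \<Rightarrow> real" and c :: "nat \<Rightarrow> real"
  assumes c: "(c \<longlongrightarrow> 0) F" and f: "eventually (\<lambda>n. \<forall>u\<in>S. \<bar>f n u\<bar> \<le> c n) F"
  shows "uniform_limit S f (\<lambda>_. 0) F"
proof (rule uniform_limitI)
  fix e :: real assume "0 < e"
  with c have "\<forall>\<^sub>F n in F. c n < e" by (rule order_tendstoD)
  with f show "\<forall>\<^sub>F n in F. \<forall>x\<in>S. dist (f n x) 0 < e"
    by eventually_elim (force simp: dist_real_def)
qed

lemma uniform_null_bounded_mult:
  fixes f :: "nat \<Rightarrow> real \<Rightarrow> real" and c :: "nat \<Rightarrow> real"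
  assumes c: "(c \<longlongrightarrow> 0) F" and f: "eventually (\<lambda>n. \<forall>u\<in>S. \<bar>f n u\<bar> \<le> C) F"
  shows "uniform_limit S (\<lambda>n u. c n * f n u) (\<lambda>_. 0) F"
proof (rule uniform_null_bound)
  show "((\<lambda>n. \<bar>c n\<bar> * \<bar>C\<bar>) \<longlongrightarrow> 0) F" using tendsto_mult_left[OF tendsto_rabs[OF c], of "\<bar>C\<bar>"] by (simp add: mult.commute)
  from f show "\<forall>\<^sub>F n in F. \<forall>u\<in>S. \<bar>c n * f n u\<bar> \<le> \<bar>c n\<bar> * \<bar>C\<bar>"
  proof eventually_elim
    case (elim n)
    show ?case
    proof
      fix u assume "u \<in> S"
      with elim have "\<bar>f n u\<bar> \<le> \<bar>C\<bar>" by force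
      then show "\<bar>c n * f n u\<bar> \<le> \<bar>c n\<bar> * \<bar>C\<bar>" unfolding abs_mult by (intro mult_left_mono) auto
    qed
  qed
qed

lemma uniform_null_sum:
  fixes f :: "'i \<Rightarrow> nat \<Rightarrow> real \<Rightarrow> real"
  assumes "\<And>i. i \<in> I \<Longrightarrow> uniform_limit S (f i) (\<lambda>_. 0) F"
  shows "uniform_limit S (\<lambda>n u. \<Sum>i\<in>I. f i n u) (\<lambda>_. 0) F"
proof (cases "finite I")
  case True
  then show ?thesis using assms
  proof (induction I rule: finite_induct)
    case empty
    show ?case by (simp add: uniform_limit_const)
  next
    case (insert i I)
    then have "uniform_limit S (\<lambda>n u. f i n u + (\<Sum>i\<in>I. f i n u)) (\<lambda>_. 0 + 0) F"
      by (intro uniform_limit_add) auto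
    then show ?case using insert by simp
  qed
qed (simp add: uniform_limit_const)

lemma sqrt_mult_divide: "0 < n \<Longrightarrow> sqrt n * (x / n) = x / sqrt n"
proof -
  assume n: "0 < n"
  then have "sqrt n * (x / n) = (n / sqrt n) * (x / n)" by (simp only: real_div_sqrt less_imp_le)
  also have "\<dots> = x / sqrt n" using n by simp
  finally show ?thesis .
qed

lemma sum_power_binomial:
  fixes e :: "int \<Rightarrow> real"
  shows "(\<Sum>t\<in>A. (e t - m) ^ j) = (\<Sum>i\<le>j. of_nat (j choose i) * ((- m) ^ (j - i) * (\<Sum>t\<in>A. e t ^ i)))"
proof -
  have "(\<Sum>t\<in>A. (e t - m) ^ j) = (\<Sum>t\<in>A. \<Sum>i\<le>j. of_nat (j choose i) * e t ^ i * (- m) ^ (j - i))"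
    by (intro sum.cong refl) (simp only: diff_conv_add_uminus binomial_ring)
  also have "\<dots> = (\<Sum>i\<le>j. \<Sum>t\<in>A. of_nat (j choose i) * e t ^ i * (- m) ^ (j - i))" by (rule sum.swap)
  also have "\<dots> = (\<Sum>i\<le>j. of_nat (j choose i) * ((- m) ^ (j - i) * (\<Sum>t\<in>A. e t ^ i)))"
    by (intro sum.cong refl) (simp add: sum_distrib_left mult_ac)
  finally show ?thesis .
qed

text \<open>Expanding around the sample mean reduces the centred sums to the raw power sums. The two
  sample means differ by \<open>o (n powr (- 1 / 2))\<close>, and so do the two standard deviations,
  by the case of squares. As the sums of powers are of order \<open>n\<close>, exchanging mean and
  scale costs \<open>o (sqrt n)\<close>.\<close>

lemma self_normalised_sums_close:
  fixes e :: "int \<Rightarrow> real" and eh :: "nat \<Rightarrow> int \<Rightarrow> real"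
  assumes F: "F \<le> sequentially" and k: "k \<ge> 1" and K: "K = max k 2"
    and a: "\<And>m. m \<in> {1..K} \<Longrightarrow> uniform_limit {0..1} (\<lambda>n u. (\<Sum>t=1..\<lfloor>real n * u\<rfloor>. eh n t ^ m - e t ^ m) / sqrt (real n)) (\<lambda>_. 0) F"
    and b1: "((\<lambda>n. (\<Sum>t=1..int n. (e t)\<^sup>2) / real n) \<longlongrightarrow> 1) F"
    and b2: "((\<lambda>n. (\<Sum>t=1..int n. e t) / real n) \<longlongrightarrow> 0) F"
    and b3: "eventually (\<lambda>n. \<forall>m\<le>K. (\<Sum>t=1..int n. \<bar>e t\<bar> ^ m) / real n \<le> C) F"
  shows "uniform_limit {0..1} (\<lambda>n u. 1 / sqrt (real n) *
       \<bar>partial_sum (eh n) k n u / sample_sd (eh n) n ^ k - partial_sum e k n u / sample_sd e n ^ k\<bar>) (\<lambda>_. 0) F"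
proof -
  have pos: "eventually (\<lambda>n. 0 < n) F" using F eventually_gt_at_top[of 0] by (rule filter_leD)
  define m where "m n = sample_mean e n" for n
  define mh where "mh n = sample_mean (eh n) n" for n
  have m0: "(m \<longlongrightarrow> 0) F" using b2 by (simp add: m_def[abs_def] sample_mean_def)
  have root: "real n / sqrt (real n) = sqrt (real n)" for n by (simp add: real_div_sqrt)
  have at1: "(\<lambda>n. (\<Sum>t=1..int n. eh n t ^ l - e t ^ l) / sqrt (real n)) = (\<lambda>n. (\<Sum>t=1..\<lfloor>real n * 1\<rfloor>. eh n t ^ l - e t ^ l) / sqrt (real n))" for l
    by simp
  have dm: "((\<lambda>n. sqrt (real n) * (mh n - m n)) \<longlongrightarrow> 0) F"
  proof -
    have "((\<lambda>n. (\<Sum>t=1..int n. eh n t ^ 1 - e t ^ 1) / sqrt (real n)) \<longlongrightarrow> 0) F"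
      unfolding at1 by (rule tendsto_uniform_limitI[OF a]) (use K in auto)
    moreover have "(\<Sum>t=1..int n. eh n t ^ 1 - e t ^ 1) / sqrt (real n) = sqrt (real n) * (mh n - m n)" for n
    proof (cases "n = 0")
      case False
      have "sqrt (real n) * (mh n - m n) = sqrt (real n) * (\<Sum>t=1..int n. eh n t - e t) / real n"
        by (simp add: mh_def m_def sample_mean_def sum_subtractf diff_divide_distrib right_diff_distrib)
      also have "\<dots> = (\<Sum>t=1..int n. eh n t - e t) / (real n / sqrt (real n))" using False by (simp add: mult.commute)
      finally show ?thesis unfolding root by simp
    qed simp
    ultimately show ?thesis by simp
  qed
  have dm0: "((\<lambda>n. mh n - m n) \<longlongrightarrow> 0) F"
  proof (rule tendsto_rabs_zero_cancel, rule tendsto_sandwich[OF _ _ tendsto_const tendsto_rabs_zero[OF dm]])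
    from pos show "\<forall>\<^sub>F n in F. \<bar>mh n - m n\<bar> \<le> \<bar>sqrt (real n) * (mh n - m n)\<bar>"
    proof eventually_elim
      case (elim n)
      then have "1 * \<bar>mh n - m n\<bar> \<le> sqrt (real n) * \<bar>mh n - m n\<bar>" by (intro mult_right_mono) auto
      then show ?case by (simp add: abs_mult)
    qed
  qed auto
  have mh0: "(mh \<longlongrightarrow> 0) F" using tendsto_add[OF dm0 m0] by simp
  have m1: "eventually (\<lambda>n. \<bar>m n\<bar> \<le> 1) F"
    using order_tendstoD(2)[OF tendsto_rabs_zero[OF m0], of 1] by (auto elim: eventually_mono)
  have mh1: "eventually (\<lambda>n. \<bar>mh n\<bar> \<le> 1) F"
    using order_tendstoD(2)[OF tendsto_rabs_zero[OF mh0], of 1] by (auto elim: eventually_mono)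
  have Pb: "eventually (\<lambda>n. \<forall>u\<in>{0..1}. \<bar>(\<Sum>t=1..\<lfloor>real n * u\<rfloor>. e t ^ i) / real n\<bar> \<le> C) F" if "i \<le> K" for i
    using b3
  proof eventually_elim
    case (elim n)
    show ?case
    proof
      fix u :: real assume u: "u \<in> {0..1}"
      have "\<bar>\<Sum>t=1..\<lfloor>real n * u\<rfloor>. e t ^ i\<bar> \<le> (\<Sum>t=1..\<lfloor>real n * u\<rfloor>. \<bar>e t\<bar> ^ i)"
        by (rule order_trans[OF sum_abs]) (simp add: power_abs)
      also have "\<dots> \<le> (\<Sum>t=1..int n. \<bar>e t\<bar> ^ i)"
        by (rule sum_mono2[OF _ floor_atMost_subset[OF u]]) auto
      finally have "\<bar>(\<Sum>t=1..\<lfloor>real n * u\<rfloor>. e t ^ i) / real n\<bar> \<le> (\<Sum>t=1..int n. \<bar>e t\<bar> ^ i) / real n"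
        by (simp add: divide_right_mono)
      with elim that show "\<bar>(\<Sum>t=1..\<lfloor>real n * u\<rfloor>. e t ^ i) / real n\<bar> \<le> C" by force
    qed
  qed
  have powdiff: "((\<lambda>n. sqrt (real n) * ((- mh n) ^ i - (- m n) ^ i)) \<longlongrightarrow> 0) F" for i
  proof (rule tendsto_rabs_zero_cancel, rule tendsto_sandwich[OF _ _ tendsto_const])
    show "((\<lambda>n. real i * \<bar>sqrt (real n) * (mh n - m n)\<bar>) \<longlongrightarrow> 0) F"
      using tendsto_mult_left[OF tendsto_rabs_zero[OF dm], of "real i"] by simp
    from m1 mh1 show "\<forall>\<^sub>F n in F. \<bar>sqrt (real n) * ((- mh n) ^ i - (- m n) ^ i)\<bar> \<le> real i * \<bar>sqrt (real n) * (mh n - m n)\<bar>"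
    proof eventually_elim
      case (elim n)
      have "\<bar>(- mh n) ^ i - (- m n) ^ i\<bar> \<le> real i * \<bar>- mh n - - m n\<bar>"
        using norm_power_diff[of "- mh n" "- m n" i] elim by simp
      then have "sqrt (real n) * \<bar>(- mh n) ^ i - (- m n) ^ i\<bar> \<le> sqrt (real n) * (real i * \<bar>mh n - m n\<bar>)"
        by (intro mult_left_mono) (auto simp: abs_minus_commute)
      then show ?case by (simp add: abs_mult mult_ac)
    qed
  qed auto
  (* Each term of the binomial expansion splits into the change of the i-th power sum and the change
     of a power of the mean; the latter is o(n^(-1/2)) and multiplies a sum of order n. *)
  have D: "uniform_limit {0..1} (\<lambda>n u. (partial_sum (eh n) j n u - partial_sum e j n u) / sqrt (real n)) (\<lambda>_. 0) F"
    if j: "j \<le> K" for j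
  proof -
    let ?P = "\<lambda>n u i. \<Sum>t=1..\<lfloor>real n * u\<rfloor>. e t ^ i" and ?Ph = "\<lambda>n u i. \<Sum>t=1..\<lfloor>real n * u\<rfloor>. eh n t ^ i"
    have eq: "(partial_sum (eh n) j n u - partial_sum e j n u) / sqrt (real n)
       = (\<Sum>i\<le>j. (of_nat (j choose i) * (- mh n) ^ (j - i)) * ((\<Sum>t=1..\<lfloor>real n * u\<rfloor>. eh n t ^ i - e t ^ i) / sqrt (real n))
           + of_nat (j choose i) * ((sqrt (real n) * ((- mh n) ^ (j - i) - (- m n) ^ (j - i))) * (?P n u i / real n)))" for n u
    proof (cases "n = 0")
      case False
      have sn: "sqrt (real n) * (x / real n) = x / sqrt (real n)" for x
        using False by (intro sqrt_mult_divide) simp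
      have "(partial_sum (eh n) j n u - partial_sum e j n u) / sqrt (real n)
        = (\<Sum>i\<le>j. (real (j choose i) * ((- mh n) ^ (j - i) * ?Ph n u i) - real (j choose i) * ((- m n) ^ (j - i) * ?P n u i)) / sqrt (real n))"
        by (simp only: partial_sum_def mh_def[symmetric] m_def[symmetric] sum_power_binomial sum_subtractf sum_divide_distrib diff_divide_distrib)
      then show ?thesis
      proof (rule trans, intro sum.cong refl)
        fix i
        have "of_nat (j choose i) * ((sqrt (real n) * ((- mh n) ^ (j - i) - (- m n) ^ (j - i))) * (?P n u i / real n))
           = of_nat (j choose i) * ((- mh n) ^ (j - i) - (- m n) ^ (j - i)) * (sqrt (real n) * (?P n u i / real n))" by simp
        also have "\<dots> = of_nat (j choose i) * ((- mh n) ^ (j - i) - (- m n) ^ (j - i)) * ?P n u i / sqrt (real n)" unfolding sn by simp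
        finally have R: "of_nat (j choose i) * ((sqrt (real n) * ((- mh n) ^ (j - i) - (- m n) ^ (j - i))) * (?P n u i / real n))
           = of_nat (j choose i) * ((- mh n) ^ (j - i) - (- m n) ^ (j - i)) * ?P n u i / sqrt (real n)" .
        show "(real (j choose i) * ((- mh n) ^ (j - i) * ?Ph n u i) - real (j choose i) * ((- m n) ^ (j - i) * ?P n u i)) / sqrt (real n)
          = (of_nat (j choose i) * (- mh n) ^ (j - i)) * ((\<Sum>t=1..\<lfloor>real n * u\<rfloor>. eh n t ^ i - e t ^ i) / sqrt (real n))
           + of_nat (j choose i) * ((sqrt (real n) * ((- mh n) ^ (j - i) - (- m n) ^ (j - i))) * (?P n u i / real n))"
          unfolding R sum_subtractf by (simp add: add_divide_distrib[symmetric] algebra_simps)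
      qed
    qed (simp add: partial_sum_def)
    have "uniform_limit {0..1} (\<lambda>n u. \<Sum>i\<le>j. (of_nat (j choose i) * (- mh n) ^ (j - i)) * ((\<Sum>t=1..\<lfloor>real n * u\<rfloor>. eh n t ^ i - e t ^ i) / sqrt (real n))
           + of_nat (j choose i) * ((sqrt (real n) * ((- mh n) ^ (j - i) - (- m n) ^ (j - i))) * (?P n u i / real n))) (\<lambda>_. 0) F"
    proof (rule uniform_null_sum)
      fix i assume i: "i \<in> {..j}"
      have "uniform_limit {0..1} (\<lambda>n u. (\<Sum>t=1..\<lfloor>real n * u\<rfloor>. eh n t ^ i - e t ^ i) / sqrt (real n)) (\<lambda>_. 0) F"
        using a[of i] i j by (cases "i = 0") (auto simp: uniform_limit_const)
      then have 1: "uniform_limit {0..1} (\<lambda>n u. (of_nat (j choose i) * (- mh n) ^ (j - i)) * ((\<Sum>t=1..\<lfloor>real n * u\<rfloor>. eh n t ^ i - e t ^ i) / sqrt (real n))) (\<lambda>_. 0) F"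
      proof (rule uniform_null_mult_bounded)
        from mh1 show "\<forall>\<^sub>F n in F. \<bar>of_nat (j choose i) * (- mh n) ^ (j - i)\<bar> \<le> of_nat (j choose i) * 1"
          by eventually_elim (auto simp: abs_mult power_abs intro!: mult_left_le power_le_one)
      qed
      have 2: "uniform_limit {0..1} (\<lambda>n u. of_nat (j choose i) * ((sqrt (real n) * ((- mh n) ^ (j - i) - (- m n) ^ (j - i))) * (?P n u i / real n))) (\<lambda>_. 0) F"
        using i j
        by (intro uniform_null_mult_bounded[where c = "\<lambda>_. of_nat (j choose i)" and C = "of_nat (j choose i)"]
            uniform_null_bounded_mult[OF powdiff Pb]) auto
      from uniform_limit_add[OF 1 2]
      show "uniform_limit {0..1} (\<lambda>n u. (of_nat (j choose i) * (- mh n) ^ (j - i)) * ((\<Sum>t=1..\<lfloor>real n * u\<rfloor>. eh n t ^ i - e t ^ i) / sqrt (real n))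
           + of_nat (j choose i) * ((sqrt (real n) * ((- mh n) ^ (j - i) - (- m n) ^ (j - i))) * (?P n u i / real n))) (\<lambda>_. 0) F"
        by simp
    qed
    then show ?thesis unfolding eq .
  qed
  define s where "s n = sample_sd e n" for n
  define sh where "sh n = sample_sd (eh n) n" for n
  have ps2: "0 \<le> partial_sum g 2 n 1" for g n unfolding partial_sum_def by (intro sum_nonneg) auto
  have s2: "(s n)\<^sup>2 = partial_sum e 2 n 1 / real n" and sh2: "(sh n)\<^sup>2 = partial_sum (eh n) 2 n 1 / real n" for n
    using ps2 by (auto simp: s_def sh_def sample_sd_def)
  have s0: "0 \<le> s n" and sh0: "0 \<le> sh n" for n using ps2 by (auto simp: s_def sh_def sample_sd_def)
  have "((\<lambda>n. (\<Sum>t=1..int n. (e t)\<^sup>2) / real n - (m n)\<^sup>2) \<longlongrightarrow> 1 - 0\<^sup>2) F"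
    by (intro tendsto_intros b1 m0)
  moreover have "eventually (\<lambda>n. (\<Sum>t=1..int n. (e t)\<^sup>2) / real n - (m n)\<^sup>2 = (s n)\<^sup>2) F"
    using pos
  proof eventually_elim
    case (elim n)
    have sm: "(\<Sum>t=1..int n. e t) = real n * m n" using elim by (simp add: m_def sample_mean_def)
    have "partial_sum e 2 n 1 = (\<Sum>t=1..int n. (e t)\<^sup>2 - 2 * m n * e t + (m n)\<^sup>2)"
      by (simp add: partial_sum_def m_def[symmetric] power2_diff algebra_simps)
    also have "\<dots> = (\<Sum>t=1..int n. (e t)\<^sup>2) - 2 * m n * (\<Sum>t=1..int n. e t) + real n * (m n)\<^sup>2"
      by (simp add: sum.distrib sum_subtractf sum_distrib_left)
    also have "\<dots> = (\<Sum>t=1..int n. (e t)\<^sup>2) - real n * (m n)\<^sup>2" unfolding sm by (simp add: power2_eq_square)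
    finally show ?case unfolding s2 using elim by (simp add: diff_divide_distrib)
  qed
  ultimately have s2lim: "((\<lambda>n. (s n)\<^sup>2) \<longlongrightarrow> 1) F" by (simp add: tendsto_cong)
  have slim: "(s \<longlongrightarrow> 1) F" using tendsto_real_sqrt[OF s2lim] s0 by simp
  have dsd: "((\<lambda>n. sqrt (real n) * ((sh n)\<^sup>2 - (s n)\<^sup>2)) \<longlongrightarrow> 0) F"
  proof -
    have "((\<lambda>n. (partial_sum (eh n) 2 n 1 - partial_sum e 2 n 1) / sqrt (real n)) \<longlongrightarrow> 0) F"
      using tendsto_uniform_limitI[OF D[of 2], of 1] K by simp
    moreover have "(partial_sum (eh n) 2 n 1 - partial_sum e 2 n 1) / sqrt (real n) = sqrt (real n) * ((sh n)\<^sup>2 - (s n)\<^sup>2)" for n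
    proof (cases "n = 0")
      case False
      have "sqrt (real n) * ((sh n)\<^sup>2 - (s n)\<^sup>2) = (partial_sum (eh n) 2 n 1 - partial_sum e 2 n 1) / (real n / sqrt (real n))"
        unfolding s2 sh2 using False by (simp add: diff_divide_distrib[symmetric] mult.commute)
      then show ?thesis unfolding root by simp
    qed simp
    ultimately show ?thesis by simp
  qed
  (* The difference of the squares is divided by sh + s, which is eventually at least 1/2. *)
  have ds: "((\<lambda>n. sqrt (real n) * (sh n - s n)) \<longlongrightarrow> 0) F"
  proof (rule tendsto_rabs_zero_cancel, rule tendsto_sandwich[OF _ _ tendsto_const])
    show "((\<lambda>n. 2 * \<bar>sqrt (real n) * ((sh n)\<^sup>2 - (s n)\<^sup>2)\<bar>) \<longlongrightarrow> 0) F"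
      using tendsto_mult_left[OF tendsto_rabs_zero[OF dsd], of 2] by simp
    have "eventually (\<lambda>n. 1 / 2 < s n) F" using slim by (rule order_tendstoD) simp
    then show "\<forall>\<^sub>F n in F. \<bar>sqrt (real n) * (sh n - s n)\<bar> \<le> 2 * \<bar>sqrt (real n) * ((sh n)\<^sup>2 - (s n)\<^sup>2)\<bar>"
    proof eventually_elim
      case (elim n)
      have "(sh n)\<^sup>2 - (s n)\<^sup>2 = (sh n - s n) * (sh n + s n)" by (simp add: power2_eq_square algebra_simps)
      then have "\<bar>(sh n)\<^sup>2 - (s n)\<^sup>2\<bar> = \<bar>sh n - s n\<bar> * (sh n + s n)" using s0[of n] sh0[of n] by (simp add: abs_mult)
      moreover have "\<bar>sh n - s n\<bar> * (1 / 2) \<le> \<bar>sh n - s n\<bar> * (sh n + s n)"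
        using elim sh0[of n] by (intro mult_left_mono) auto
      ultimately have "\<bar>sh n - s n\<bar> \<le> 2 * \<bar>(sh n)\<^sup>2 - (s n)\<^sup>2\<bar>" by simp
      then have "sqrt (real n) * \<bar>sh n - s n\<bar> \<le> sqrt (real n) * (2 * \<bar>(sh n)\<^sup>2 - (s n)\<^sup>2\<bar>)" by (intro mult_left_mono) auto
      then show ?case by (simp add: abs_mult mult_ac)
    qed
  qed auto
  have "((\<lambda>n. sh n - s n) \<longlongrightarrow> 0) F"
  proof (rule tendsto_rabs_zero_cancel, rule tendsto_sandwich[OF _ _ tendsto_const tendsto_rabs_zero[OF ds]])
    from pos show "\<forall>\<^sub>F n in F. \<bar>sh n - s n\<bar> \<le> \<bar>sqrt (real n) * (sh n - s n)\<bar>"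
    proof eventually_elim
      case (elim n)
      then have "1 * \<bar>sh n - s n\<bar> \<le> sqrt (real n) * \<bar>sh n - s n\<bar>" by (intro mult_right_mono) auto
      then show ?case by (simp add: abs_mult)
    qed
  qed auto
  from tendsto_add[OF this slim] have shlim: "(sh \<longlongrightarrow> 1) F" by simp
  define c where "c n = 1 / sh n ^ k" for n
  define d where "d n = 1 / s n ^ k" for n
  have clim: "(c \<longlongrightarrow> 1) F" unfolding c_def[abs_def] using tendsto_divide[OF tendsto_const tendsto_power[OF shlim, of k], of 1] by simp
  have cd: "((\<lambda>n. sqrt (real n) * (c n - d n)) \<longlongrightarrow> 0) F"
  proof -
    have "((\<lambda>n. \<bar>sqrt (real n) * (s n ^ k - sh n ^ k)\<bar>) \<longlongrightarrow> 0) F"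
    proof (rule tendsto_sandwich[OF _ _ tendsto_const])
      show "((\<lambda>n. 2 ^ k * real k * \<bar>sqrt (real n) * (sh n - s n)\<bar>) \<longlongrightarrow> 0) F"
        using tendsto_mult_left[OF tendsto_rabs_zero[OF ds], of "2 ^ k * real k"] by simp
      have "eventually (\<lambda>n. s n < 2) F" "eventually (\<lambda>n. sh n < 2) F"
        using slim shlim by (auto intro: order_tendstoD)
      then show "\<forall>\<^sub>F n in F. \<bar>sqrt (real n) * (s n ^ k - sh n ^ k)\<bar> \<le> 2 ^ k * real k * \<bar>sqrt (real n) * (sh n - s n)\<bar>"
      proof eventually_elim
        case (elim n)
        (* Halving brings both deviations below one, where powers are Lipschitz with constant k. *)
        have "\<bar>(s n / 2) ^ k - (sh n / 2) ^ k\<bar> \<le> real k * \<bar>s n / 2 - sh n / 2\<bar>"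
          using norm_power_diff[of "s n / 2" "sh n / 2" k] elim s0[of n] sh0[of n] by simp
        also have "\<dots> \<le> real k * \<bar>sh n - s n\<bar>" by (intro mult_left_mono) auto
        finally have "\<bar>s n ^ k - sh n ^ k\<bar> / 2 ^ k \<le> real k * \<bar>sh n - s n\<bar>"
          by (simp add: power_divide diff_divide_distrib[symmetric] abs_divide)
        then have "\<bar>s n ^ k - sh n ^ k\<bar> \<le> 2 ^ k * real k * \<bar>sh n - s n\<bar>" by (simp add: pos_divide_le_eq mult_ac)
        then have "sqrt (real n) * \<bar>s n ^ k - sh n ^ k\<bar> \<le> sqrt (real n) * (2 ^ k * real k * \<bar>sh n - s n\<bar>)"
          by (intro mult_left_mono) auto
        then show ?case by (simp add: abs_mult mult_ac)
      qed
    qed auto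
    then have 1: "((\<lambda>n. sqrt (real n) * (s n ^ k - sh n ^ k)) \<longlongrightarrow> 0) F" by (rule tendsto_rabs_zero_cancel)
    have "((\<lambda>n. sh n ^ k * s n ^ k) \<longlongrightarrow> 1 ^ k * 1 ^ k) F" by (intro tendsto_intros slim shlim)
    then have 2: "((\<lambda>n. sqrt (real n) * (s n ^ k - sh n ^ k) / (sh n ^ k * s n ^ k)) \<longlongrightarrow> 0) F"
      using tendsto_divide[OF 1, of "\<lambda>n. sh n ^ k * s n ^ k" 1] by simp
    have "eventually (\<lambda>n. 0 < s n) F" "eventually (\<lambda>n. 0 < sh n) F" using slim shlim by (auto intro: order_tendstoD)
    then have "eventually (\<lambda>n. sqrt (real n) * (s n ^ k - sh n ^ k) / (sh n ^ k * s n ^ k) = sqrt (real n) * (c n - d n)) F"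
      by eventually_elim (simp add: c_def d_def field_simps)
    with 2 show ?thesis by (simp add: tendsto_cong)
  qed
  have kK: "k \<le> K" using K by simp
  have c2: "eventually (\<lambda>n. \<bar>c n\<bar> \<le> 2) F"
  proof -
    have "((\<lambda>n. \<bar>c n\<bar>) \<longlongrightarrow> 1) F" using tendsto_rabs[OF clim] by simp
    then have "eventually (\<lambda>n. \<bar>c n\<bar> < 2) F" by (rule order_tendstoD) simp
    then show ?thesis by (rule eventually_mono) simp
  qed
  have t1: "uniform_limit {0..1} (\<lambda>n u. c n * ((partial_sum (eh n) k n u - partial_sum e k n u) / sqrt (real n))) (\<lambda>_. 0) F"
    by (rule uniform_null_mult_bounded[OF D[OF kK] c2])
  have Tb: "eventually (\<lambda>n. \<forall>u\<in>{0..1}. \<bar>partial_sum e k n u / real n\<bar> \<le> (\<Sum>i\<le>k. of_nat (k choose i) * C)) F"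
  proof -
    have "eventually (\<lambda>n. \<forall>i\<in>{..k}. \<forall>u\<in>{0..1}. \<bar>(\<Sum>t=1..\<lfloor>real n * u\<rfloor>. e t ^ i) / real n\<bar> \<le> C) F"
      by (rule eventually_ball_finite) (use Pb kK in auto)
    with m1 show ?thesis
    proof eventually_elim
      case (elim n)
      show ?case
      proof
        fix u :: real assume u: "u \<in> {0..1}"
        have eqT: "partial_sum e k n u / real n = (\<Sum>i\<le>k. of_nat (k choose i) * ((- m n) ^ (k - i) * ((\<Sum>t=1..\<lfloor>real n * u\<rfloor>. e t ^ i) / real n)))"
          unfolding partial_sum_def m_def[symmetric] sum_power_binomial
          by (simp only: sum_divide_distrib[of _ "{..k}"] times_divide_eq_right)
        show "\<bar>partial_sum e k n u / real n\<bar> \<le> (\<Sum>i\<le>k. of_nat (k choose i) * C)"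
          unfolding eqT
        proof (rule order_trans[OF sum_abs sum_mono])
          fix i assume i: "i \<in> {..k}"
          have "\<bar>(- m n) ^ (k - i)\<bar> \<le> 1" using elim(1) by (simp add: power_abs power_le_one)
          moreover have "\<bar>(\<Sum>t=1..\<lfloor>real n * u\<rfloor>. e t ^ i) / real n\<bar> \<le> C" using elim(2) i u by blast
          ultimately have "\<bar>(- m n) ^ (k - i)\<bar> * \<bar>(\<Sum>t=1..\<lfloor>real n * u\<rfloor>. e t ^ i) / real n\<bar> \<le> 1 * C"
            by (intro mult_mono) auto
          then show "\<bar>of_nat (k choose i) * ((- m n) ^ (k - i) * ((\<Sum>t=1..\<lfloor>real n * u\<rfloor>. e t ^ i) / real n))\<bar> \<le> of_nat (k choose i) * C"
            unfolding abs_mult by (intro mult_mono) auto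
        qed
      qed
    qed
  qed
  have t2: "uniform_limit {0..1} (\<lambda>n u. (sqrt (real n) * (c n - d n)) * (partial_sum e k n u / real n)) (\<lambda>_. 0) F"
    by (rule uniform_null_bounded_mult[OF cd Tb])
  have eq: "1 / sqrt (real n) * \<bar>partial_sum (eh n) k n u / sample_sd (eh n) n ^ k - partial_sum e k n u / sample_sd e n ^ k\<bar>
     = \<bar>c n * ((partial_sum (eh n) k n u - partial_sum e k n u) / sqrt (real n)) + (sqrt (real n) * (c n - d n)) * (partial_sum e k n u / real n)\<bar>" for n u
  proof (cases "n = 0")
    case False
    have sn: "sqrt (real n) * (x / real n) = x / sqrt (real n)" for x
      using False by (intro sqrt_mult_divide) simp
    have "(sqrt (real n) * (c n - d n)) * (partial_sum e k n u / real n) = (c n - d n) * (sqrt (real n) * (partial_sum e k n u / real n))" by simp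
    then have 1: "(sqrt (real n) * (c n - d n)) * (partial_sum e k n u / real n) = (c n - d n) * partial_sum e k n u / sqrt (real n)"
      unfolding sn by simp
    have 2: "c n * ((partial_sum (eh n) k n u - partial_sum e k n u) / sqrt (real n)) + (sqrt (real n) * (c n - d n)) * (partial_sum e k n u / real n)
       = (c n * partial_sum (eh n) k n u - d n * partial_sum e k n u) / sqrt (real n)"
      unfolding 1 by (simp add: add_divide_distrib[symmetric] algebra_simps)
    show ?thesis unfolding 2 by (simp add: abs_divide c_def d_def s_def sh_def)
  qed simp
  have "uniform_limit {0..1} (\<lambda>n u. norm (c n * ((partial_sum (eh n) k n u - partial_sum e k n u) / sqrt (real n)) + (sqrt (real n) * (c n - d n)) * (partial_sum e k n u / real n))) (\<lambda>u. norm (0 + 0 :: real)) F"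
    by (intro uniform_limit_norm uniform_limit_add t1 t2)
  then show ?thesis unfolding eq by simp
qed

lemma power_mult_le_one_plus: "i \<le> K \<Longrightarrow> 0 \<le> x \<Longrightarrow> x ^ i \<le> 1 + x ^ K" for x :: real
proof (cases "x \<le> 1")
  case True
  assume "i \<le> K" "0 \<le> x"
  then have "x ^ i \<le> 1" "0 \<le> x ^ K" using True by (auto intro: power_le_one)
  then show ?thesis by linarith
next
  case False
  assume "i \<le> K" "0 \<le> x"
  then have "x ^ i \<le> x ^ K" using False by (intro power_increasing) auto
  then show ?thesis by linarith
qed

text \<open>The hypothesis on \<open>R ^ l\<close> is imposed from \<open>l = 2\<close> on, since
  \<open>R\<close> will be a sum of terms of order \<open>n powr (- 1 / 2)\<close> and \<open>\<rho>
  ^ t\<close>, whose higher powers are of the order \<open>z = 1 / n + \<rho> ^ t\<close> but not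
  \<open>R\<close> itself.\<close>

lemma power_one_plus_remainder:
  fixes r :: real
  assumes "m \<le> K" "\<bar>r\<bar> \<le> R" "1 \<le> Q" "\<And>l. 2 \<le> l \<Longrightarrow> l \<le> m \<Longrightarrow> R ^ l \<le> A ^ l * z * Q ^ (3 * l)" "0 \<le> z" "1 \<le> A" 
  shows "\<bar>(1 + r) ^ m - 1 - real m * r\<bar> \<le> (2 * A) ^ K * z * Q ^ (3 * K)"
proof -
  have m0: ?thesis if "m = 0" using that assms by simp
  have "(1 + r) ^ m - 1 - real m * r = (\<Sum>l=2..m. of_nat (m choose l) * r ^ l)" if "m \<noteq> 0"
  proof -
    have "(1 + r) ^ m = (\<Sum>l\<le>m. of_nat (m choose l) * r ^ l)"
      by (subst add.commute) (simp add: binomial_ring)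
    also have "{..m} = {0} \<union> {1} \<union> {2..m}" using that by auto
    finally show ?thesis using that by (subst (asm) sum.union_disjoint; auto)+
  qed
  moreover have "\<bar>\<Sum>l=2..m. of_nat (m choose l) * r ^ l\<bar> \<le> (\<Sum>l=2..m. of_nat (m choose l) * (A ^ K * z * Q ^ (3 * K)))"
  proof (rule order_trans[OF sum_abs sum_mono])
    fix l assume l: "l \<in> {2..m}"
    have "\<bar>r\<bar> ^ l \<le> R ^ l" using assms(2) by (intro power_mono) auto
    also have "\<dots> \<le> A ^ l * z * Q ^ (3 * l)" using l assms(4) by auto
    also have "\<dots> \<le> A ^ K * z * Q ^ (3 * K)"
      using l assms by (intro mult_mono power_increasing mult_nonneg_nonneg) auto
    finally show "\<bar>of_nat (m choose l) * r ^ l\<bar> \<le> of_nat (m choose l) * (A ^ K * z * Q ^ (3 * K))"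
      by (simp add: abs_mult power_abs mult_left_mono)
  qed
  moreover have "(\<Sum>l=2..m. of_nat (m choose l) * (A ^ K * z * Q ^ (3 * K))) \<le> (2 * A) ^ K * z * Q ^ (3 * K)"
  proof -
    have nn: "0 \<le> A ^ K * z * Q ^ (3 * K)" using assms by auto
    have "(\<Sum>l=2..m. of_nat (m choose l) * (A ^ K * z * Q ^ (3 * K))) \<le> (\<Sum>l\<le>m. of_nat (m choose l) * (A ^ K * z * Q ^ (3 * K)))"
      using nn by (intro sum_mono2) auto
    also have "\<dots> = of_nat (\<Sum>l\<le>m. m choose l) * (A ^ K * z * Q ^ (3 * K))" by (simp only: sum_distrib_right of_nat_sum)
    also have "\<dots> = 2 ^ m * (A ^ K * z * Q ^ (3 * K))" by (simp add: choose_row_sum)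
    also have "\<dots> \<le> 2 ^ K * (A ^ K * z * Q ^ (3 * K))" using assms(1) nn by (intro mult_right_mono power_increasing) auto
    also have "\<dots> = (2 * A) ^ K * z * Q ^ (3 * K)" by (simp add: power_mult_distrib)
    finally show ?thesis .
  qed
  ultimately show ?thesis using m0 by (cases "m = 0") auto
qed

text \<open>To first order, \<open>y / b - 1\<close> is \<open>- \<delta> (D - \<mu>) / (2
  b)\<close>: dividing by \<open>b\<close> has centred the score, and the law of large numbers
  \<open>L\<close> makes the sums of the centred score negligible against the factor \<open>\<delta>
  = O (n powr (- 1 / 2))\<close>. Everything else is of the size \<open>1 / n + \<rho> ^ t\<close>
  times an envelope, and the sum of these terms over \<open>t\<close> stays bounded.\<close>

lemma perturbed_power_sums:
  fixes e :: "int \<Rightarrow> real" and D :: "nat \<Rightarrow> int \<Rightarrow> real" and y :: "nat \<Rightarrow> int \<Rightarrow> real"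
  assumes F: "F \<le> sequentially" and rho: "0 \<le> \<rho>" "\<rho> \<le> 1"
    and Q: "\<And>t. 1 \<le> Q t" and Cd: "0 \<le> Cd" and C2: "0 \<le> C2" and C3: "0 \<le> C3"
    and del: "eventually (\<lambda>n. \<forall>l<d. \<bar>\<delta> n l\<bar> \<le> Cd / sqrt (real n)) F"
    and exp: "eventually (\<lambda>n. \<forall>t\<in>{1..int n}. \<bar>y n t - 1 + (\<Sum>l<d. \<delta> n l * D l t) / 2\<bar> \<le> C2 * ((1 / real n + \<rho> ^ nat t) * Q t ^ 3)) F"
    and Db: "\<And>l t. l < d \<Longrightarrow> 1 \<le> t \<Longrightarrow> \<bar>D l t\<bar> \<le> C3 * Q t"
    and L: "\<And>m l. m \<in> {1..K} \<Longrightarrow> l < d \<Longrightarrow> uniform_limit {0..1} (\<lambda>n u. (\<Sum>t=1..\<lfloor>real n * u\<rfloor>. e t ^ m * (D l t - \<mu> l)) / real n) (\<lambda>_. 0) F"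
    and S1: "eventually (\<lambda>n. (\<Sum>t=1..int n. (1 + \<bar>e t\<bar> ^ K) * Q t ^ (3 * K)) / real n \<le> C4) F"
    and S2: "\<And>n. (\<Sum>t=1..int n. \<rho> ^ nat t * ((1 + \<bar>e t\<bar> ^ K) * Q t ^ (3 * K))) \<le> C5"
  shows "eventually (\<lambda>n. 1 / 2 \<le> 1 - (\<Sum>l<d. \<delta> n l * \<mu> l) / 2) F"
    and "m \<in> {1..K} \<Longrightarrow> uniform_limit {0..1} (\<lambda>n u. (\<Sum>t=1..\<lfloor>real n * u\<rfloor>.
            (e t * (y n t / (1 - (\<Sum>l<d. \<delta> n l * \<mu> l) / 2))) ^ m - e t ^ m) / sqrt (real n)) (\<lambda>_. 0) F"
proof -
  have pos: "eventually (\<lambda>n. 0 < n) F" using F eventually_gt_at_top[of 0] by (rule filter_leD)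
  have "((\<lambda>n. 1 / sqrt (real n)) \<longlongrightarrow> 0) sequentially" by real_asymp
  then have isq: "((\<lambda>n. 1 / sqrt (real n)) \<longlongrightarrow> 0) F" using F by (rule tendsto_mono[rotated])
  define b where "b n = 1 - (\<Sum>l<d. \<delta> n l * \<mu> l) / 2" for n
  define M where "M = (\<Sum>l<d. \<bar>\<mu> l\<bar>)"
  have M0: "0 \<le> M" by (simp add: M_def sum_nonneg)
  have small: "eventually (\<lambda>n. Cd * M * (1 / sqrt (real n)) < 1) F"
    using tendsto_mult_left[OF isq, of "Cd * M"] by (intro order_tendstoD(2)) auto
  have bdev: "\<bar>\<Sum>l<d. \<delta> n l * \<mu> l\<bar> \<le> Cd * M * (1 / sqrt (real n))" if "\<forall>l<d. \<bar>\<delta> n l\<bar> \<le> Cd / sqrt (real n)" for n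
  proof -
    have "\<bar>\<Sum>l<d. \<delta> n l * \<mu> l\<bar> \<le> (\<Sum>l<d. Cd / sqrt (real n) * \<bar>\<mu> l\<bar>)"
    proof (rule order_trans[OF sum_abs sum_mono])
      fix l assume "l \<in> {..<d}"
      then show "\<bar>\<delta> n l * \<mu> l\<bar> \<le> Cd / sqrt (real n) * \<bar>\<mu> l\<bar>"
        unfolding abs_mult using that by (intro mult_right_mono) auto
    qed
    then show ?thesis by (simp add: M_def sum_distrib_left mult_ac)
  qed
  show bn: "eventually (\<lambda>n. 1 / 2 \<le> 1 - (\<Sum>l<d. \<delta> n l * \<mu> l) / 2) F"
    using del small
  proof eventually_elim
    case (elim n)
    have "\<bar>\<Sum>l<d. \<delta> n l * \<mu> l\<bar> \<le> 1" using bdev[OF elim(1)] elim(2) by linarith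
    then show ?case by (simp add: abs_le_iff)
  qed
  assume m: "m \<in> {1..K}"
  define G where "G t = (1 + \<bar>e t\<bar> ^ K) * Q t ^ (3 * K)" for t
  have G0: "0 \<le> G t" for t using Q[of t] by (simp add: G_def)
  define C6 where "C6 = Cd * (real d * C3 + M) + 2 * C2 + 1"
  have C6: "1 \<le> C6" using Cd C2 C3 M0 by (simp add: C6_def)
  define C7 where "C7 = 2 * real m * C2 + (2 * (2 * C6)) ^ K"
  have C7: "0 \<le> C7" using C2 C6 by (simp add: C7_def)
  let ?z = "\<lambda>n t. - (\<Sum>l<d. \<delta> n l * (D l t - \<mu> l)) / 2"
  have pointwise: "eventually (\<lambda>n. \<forall>t\<in>{1..int n}. \<bar>(e t * (y n t / b n)) ^ m - e t ^ m - real m / b n * (e t ^ m * ?z n t)\<bar>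
      \<le> C7 * ((1 / real n + \<rho> ^ nat t) * G t)) F"
    using bn del exp small pos
  proof eventually_elim
    case (elim n)
    have bh: "1 / 2 \<le> b n" using elim(1) by (simp add: b_def)
    then have b0: "0 < b n" "1 / b n \<le> 2" by (auto simp: field_simps)
    show ?case
    proof
      fix t assume t: "t \<in> {1..int n}"
      let ?sn = "1 / sqrt (real n)" and ?rt = "\<rho> ^ nat t"
      have sn: "0 \<le> ?sn" "?sn \<le> 1" "?sn * ?sn = 1 / real n" using elim(5) by auto
      have sn2: "1 / real n \<le> ?sn" using mult_left_mono[OF sn(2) sn(1)] sn(3) by simp
      have rt: "0 \<le> ?rt" "?rt \<le> 1" using rho by (auto intro: power_le_one)
      define rem where "rem = y n t - 1 + (\<Sum>l<d. \<delta> n l * D l t) / 2"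
      have rem: "\<bar>rem\<bar> \<le> C2 * ((1 / real n + ?rt) * Q t ^ 3)" using elim(3) t by (simp add: rem_def)
      define r where "r = (?z n t + rem) / b n"
      have yb: "y n t / b n = 1 + r"
        using b0 unfolding r_def rem_def b_def[of n] by (simp add: field_simps sum_subtractf)
      have zb: "\<bar>?z n t\<bar> \<le> Cd * (real d * C3 + M) * (?sn * Q t) / 2"
      proof -
        have "\<bar>\<Sum>l<d. \<delta> n l * (D l t - \<mu> l)\<bar> \<le> (\<Sum>l<d. (Cd * ?sn) * ((C3 + \<bar>\<mu> l\<bar>) * Q t))"
        proof (rule order_trans[OF sum_abs sum_mono])
          fix l assume l: "l \<in> {..<d}"
          have "\<bar>D l t - \<mu> l\<bar> \<le> C3 * Q t + \<bar>\<mu> l\<bar> * 1" using Db[of l t] l t abs_triangle_ineq4[of "D l t" "\<mu> l"] by simp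
          also have "\<dots> \<le> C3 * Q t + \<bar>\<mu> l\<bar> * Q t" using Q by (intro add_left_mono mult_left_mono) auto
          finally have "\<bar>D l t - \<mu> l\<bar> \<le> (C3 + \<bar>\<mu> l\<bar>) * Q t" by (simp add: distrib_right)
          then show "\<bar>\<delta> n l * (D l t - \<mu> l)\<bar> \<le> (Cd * ?sn) * ((C3 + \<bar>\<mu> l\<bar>) * Q t)"
            unfolding abs_mult using elim(2) l Cd by (intro mult_mono) auto
        qed
        also have "\<dots> = (Cd * ?sn) * (\<Sum>l<d. C3 + \<bar>\<mu> l\<bar>) * Q t" by (simp only: sum_distrib_left sum_distrib_right mult.assoc)
        also have "\<dots> = Cd * (real d * C3 + M) * (?sn * Q t)" by (simp add: sum.distrib M_def)
        finally show ?thesis by simp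
      qed
      have Q3: "Q t \<le> Q t ^ 3" "1 \<le> Q t ^ 3" using Q[of t] by (auto intro: self_le_power one_le_power)
      have rb: "\<bar>r\<bar> \<le> C6 * (?sn + ?rt) * Q t ^ 3"
      proof -
        have "\<bar>r\<bar> = \<bar>?z n t + rem\<bar> * (1 / b n)" using b0 by (simp add: r_def abs_divide)
        also have "\<dots> \<le> (\<bar>?z n t\<bar> + \<bar>rem\<bar>) * 2" using b0 by (intro mult_mono abs_triangle_ineq) auto
        also have "\<dots> \<le> (Cd * (real d * C3 + M) * (?sn * Q t) / 2 + C2 * ((1 / real n + ?rt) * Q t ^ 3)) * 2"
          using zb rem by (intro mult_right_mono add_mono) auto
        also have "\<dots> = Cd * (real d * C3 + M) * (?sn * Q t) + 2 * C2 * ((1 / real n + ?rt) * Q t ^ 3)" by simp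
        also have "\<dots> \<le> Cd * (real d * C3 + M) * ((?sn + ?rt) * Q t ^ 3) + 2 * C2 * ((?sn + ?rt) * Q t ^ 3)"
          using Cd C2 C3 M0 sn sn2 rt Q3 Q[of t] by (intro add_mono mult_left_mono mult_mono add_right_mono) auto
        also have "\<dots> \<le> C6 * ((?sn + ?rt) * Q t ^ 3)"
        proof -
          have X: "0 \<le> (?sn + ?rt) * Q t ^ 3" using sn rt Q[of t] by (intro mult_nonneg_nonneg) auto
          have "a * x + 2 * c * x \<le> (a + 2 * c + 1) * x" if "0 \<le> x" for a c x :: real
            using that by (simp add: distrib_right)
          from this[OF X] show ?thesis unfolding C6_def .
        qed
        finally show ?thesis by simp
      qed
      have pr: "\<bar>(1 + r) ^ m - 1 - real m * r\<bar> \<le> (2 * (2 * C6)) ^ K * (1 / real n + ?rt) * Q t ^ (3 * K)"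
      proof (rule power_one_plus_remainder[OF _ rb Q])
        (* From the second power on, n^(-1/2) has turned into 1/n, while the powers of \<rho>^t only
           decrease. *)
        fix l :: nat assume l: "2 \<le> l" "l \<le> m"
        have "(?sn + ?rt) ^ l \<le> (2 * max ?sn ?rt) ^ l" using sn rt by (intro power_mono) auto
        also have "\<dots> = 2 ^ l * max ?sn ?rt ^ l" by (rule power_mult_distrib)
        also have "max ?sn ?rt ^ l \<le> 1 / real n + ?rt"
        proof (cases "?sn \<le> ?rt")
          case True
          have "?rt ^ l \<le> ?rt ^ 1" using l rt by (intro power_decreasing) auto
          then show ?thesis using True by (simp add: max_def add_increasing)
        next
          case False
          have "?sn ^ l \<le> ?sn ^ 2" using l sn by (intro power_decreasing) auto
          also have "\<dots> = 1 / real n" using sn(3) by (simp only: power2_eq_square)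
          finally show ?thesis using False rt by (simp add: max_def)
        qed
        finally have 1: "(?sn + ?rt) ^ l \<le> 2 ^ l * (1 / real n + ?rt)" by simp
        have "(C6 * (?sn + ?rt) * Q t ^ 3) ^ l = (C6 ^ l * Q t ^ (3 * l)) * (?sn + ?rt) ^ l"
          by (simp only: power_mult_distrib power_mult[of _ 3 l]) (simp only: mult_ac)
        also have "\<dots> \<le> (C6 ^ l * Q t ^ (3 * l)) * (2 ^ l * (1 / real n + ?rt))"
          using 1 C6 Q[of t] by (intro mult_left_mono) auto
        also have "\<dots> = (2 * C6) ^ l * (1 / real n + ?rt) * Q t ^ (3 * l)" by (simp only: power_mult_distrib mult_ac)
        finally show "(C6 * (?sn + ?rt) * Q t ^ 3) ^ l \<le> (2 * C6) ^ l * (1 / real n + ?rt) * Q t ^ (3 * l)" .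
      qed (use m rt C6 in auto)
      have em: "\<bar>e t\<bar> ^ m \<le> 1 + \<bar>e t\<bar> ^ K" using m by (intro power_mult_le_one_plus) auto
      have Q3K: "Q t ^ 3 \<le> Q t ^ (3 * K)" using Q[of t] m by (intro power_increasing) auto
      have "(e t * (y n t / b n)) ^ m - e t ^ m - real m / b n * (e t ^ m * ?z n t)
         = e t ^ m * ((1 + r) ^ m - 1 - real m * r) + real m / b n * (e t ^ m * rem)"
      proof -
        have mr: "real m * r = real m / b n * (?z n t + rem)" by (simp add: r_def)
        have "E * P - E - mb * (E * z) = E * (P - 1 - mb * (z + rm)) + mb * (E * rm)" for E P z rm mb :: real
          by (simp add: algebra_simps)
        then show ?thesis unfolding yb power_mult_distrib mr .
      qed
      then have "\<bar>(e t * (y n t / b n)) ^ m - e t ^ m - real m / b n * (e t ^ m * ?z n t)\<bar>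
         \<le> \<bar>e t ^ m * ((1 + r) ^ m - 1 - real m * r)\<bar> + \<bar>real m / b n * (e t ^ m * rem)\<bar>"
        by (simp only: abs_triangle_ineq)
      also have "\<dots> = \<bar>e t\<bar> ^ m * \<bar>(1 + r) ^ m - 1 - real m * r\<bar> + (1 / b n) * (real m * (\<bar>e t\<bar> ^ m * \<bar>rem\<bar>))"
        using b0 by (simp add: abs_mult abs_divide power_abs)
      also have "\<dots> \<le> (1 + \<bar>e t\<bar> ^ K) * ((2 * (2 * C6)) ^ K * (1 / real n + ?rt) * Q t ^ (3 * K))
          + 2 * (real m * ((1 + \<bar>e t\<bar> ^ K) * (C2 * ((1 / real n + ?rt) * Q t ^ (3 * K)))))"
      proof (intro add_mono mult_mono em pr b0(2) order_refl)
        have "C2 * ((1 / real n + ?rt) * Q t ^ 3) \<le> C2 * ((1 / real n + ?rt) * Q t ^ (3 * K))"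
          using C2 rt Q3K by (intro mult_left_mono) auto
        with rem show "\<bar>rem\<bar> \<le> C2 * ((1 / real n + ?rt) * Q t ^ (3 * K))" by linarith
      qed (use b0 C2 rt Q[of t] in auto)
      also have "\<dots> = C7 * ((1 / real n + ?rt) * G t)"
      proof -
        have "H * (c * S * G3) + 2 * (mm * (H * (C * (S * G3)))) = (2 * mm * C + c) * (S * (H * G3))" for H c S G3 mm C :: real
          by (simp add: algebra_simps)
        then show ?thesis unfolding C7_def G_def .
      qed
      finally show "\<bar>(e t * (y n t / b n)) ^ m - e t ^ m - real m / b n * (e t ^ m * ?z n t)\<bar> \<le> C7 * ((1 / real n + ?rt) * G t)" .
    qed
  qed
  let ?A = "\<lambda>n u. \<lfloor>real n * u\<rfloor>"
  have rest: "uniform_limit {0..1} (\<lambda>n u. (\<Sum>t=1..?A n u. (e t * (y n t / b n)) ^ m - e t ^ m - real m / b n * (e t ^ m * ?z n t)) / sqrt (real n)) (\<lambda>_. 0) F"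
  proof (rule uniform_null_bound)
    show "((\<lambda>n. C7 * (C4 + C5) * (1 / sqrt (real n))) \<longlongrightarrow> 0) F"
      using tendsto_mult_left[OF isq, of "C7 * (C4 + C5)"] by simp
    from pointwise S1 pos
    show "\<forall>\<^sub>F n in F. \<forall>u\<in>{0..1}. \<bar>(\<Sum>t=1..?A n u. (e t * (y n t / b n)) ^ m - e t ^ m - real m / b n * (e t ^ m * ?z n t)) / sqrt (real n)\<bar>
        \<le> C7 * (C4 + C5) * (1 / sqrt (real n))"
    proof eventually_elim
      case (elim n)
      show ?case
      proof
        fix u :: real assume u: "u \<in> {0..1}"
        have "\<bar>\<Sum>t=1..?A n u. (e t * (y n t / b n)) ^ m - e t ^ m - real m / b n * (e t ^ m * ?z n t)\<bar>
           \<le> (\<Sum>t=1..?A n u. C7 * ((1 / real n + \<rho> ^ nat t) * G t))"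
          using elim(1) floor_atMost_subset[OF u, of n] by (intro order_trans[OF sum_abs sum_mono]) blast
        also have "\<dots> \<le> (\<Sum>t=1..int n. C7 * ((1 / real n + \<rho> ^ nat t) * G t))"
          using C7 G0 rho by (intro sum_mono2 floor_atMost_subset[OF u]) auto
        also have "\<dots> = C7 * ((\<Sum>t=1..int n. G t) / real n + (\<Sum>t=1..int n. \<rho> ^ nat t * G t))"
          by (simp add: sum_distrib_left sum.distrib sum_divide_distrib algebra_simps)
        also have "\<dots> \<le> C7 * (C4 + C5)"
          using elim(2) S2[of n] C7 unfolding G_def by (intro mult_left_mono add_mono) auto
        finally show "\<bar>(\<Sum>t=1..?A n u. (e t * (y n t / b n)) ^ m - e t ^ m - real m / b n * (e t ^ m * ?z n t)) / sqrt (real n)\<bar>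
            \<le> C7 * (C4 + C5) * (1 / sqrt (real n))"
          by (simp add: divide_right_mono)
      qed
    qed
  qed
  have lin: "uniform_limit {0..1} (\<lambda>n u. \<Sum>l<d. (- (real m / b n) * (sqrt (real n) * \<delta> n l) / 2) * ((\<Sum>t=1..?A n u. e t ^ m * (D l t - \<mu> l)) / real n)) (\<lambda>_. 0) F"
  proof (intro uniform_null_sum)
    fix l assume l: "l \<in> {..<d}"
    have ev: "\<forall>\<^sub>F n in F. \<bar>- (real m / b n) * (sqrt (real n) * \<delta> n l) / 2\<bar> \<le> real m * 2 * Cd / 2"
      using bn del pos
    proof eventually_elim
      case (elim n)
      have bh: "1 / 2 \<le> b n" using elim(1) by (simp add: b_def)
      then have b0: "0 < b n" "1 / b n \<le> 2" by (auto simp: field_simps)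
      have "sqrt (real n) * \<bar>\<delta> n l\<bar> \<le> sqrt (real n) * (Cd / sqrt (real n))" using elim(2) l by (intro mult_left_mono) auto
      then have s: "sqrt (real n) * \<bar>\<delta> n l\<bar> \<le> Cd" using elim(3) by simp
      have "\<bar>- (real m / b n) * (sqrt (real n) * \<delta> n l) / 2\<bar> = real m * (1 / b n) * (sqrt (real n) * \<bar>\<delta> n l\<bar>) / 2"
        using b0 by (simp add: abs_mult abs_divide)
      also have "\<dots> \<le> real m * 2 * Cd / 2" using b0 s by (intro divide_right_mono mult_mono mult_left_mono) auto
      finally show ?case .
    qed
    show "uniform_limit {0..1} (\<lambda>n u. (- (real m / b n) * (sqrt (real n) * \<delta> n l) / 2) * ((\<Sum>t=1..?A n u. e t ^ m * (D l t - \<mu> l)) / real n)) (\<lambda>_. 0) F"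
      using l m by (intro uniform_null_mult_bounded[OF L ev]) auto
  qed
  have eq: "(\<Sum>t=1..?A n u. (e t * (y n t / b n)) ^ m - e t ^ m) / sqrt (real n)
     = (\<Sum>t=1..?A n u. (e t * (y n t / b n)) ^ m - e t ^ m - real m / b n * (e t ^ m * ?z n t)) / sqrt (real n)
     + (\<Sum>l<d. (- (real m / b n) * (sqrt (real n) * \<delta> n l) / 2) * ((\<Sum>t=1..?A n u. e t ^ m * (D l t - \<mu> l)) / real n))" for n u
  proof (cases "n = 0")
    case False
    have "(\<Sum>t=1..?A n u. real m / b n * (e t ^ m * ?z n t)) = (\<Sum>t=1..?A n u. \<Sum>l<d. - (real m / b n) * \<delta> n l / 2 * (e t ^ m * (D l t - \<mu> l)))"
      by (intro sum.cong refl) (simp add: sum_distrib_left sum_divide_distrib sum_negf[symmetric] mult_ac)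
    also have "\<dots> = (\<Sum>l<d. \<Sum>t=1..?A n u. - (real m / b n) * \<delta> n l / 2 * (e t ^ m * (D l t - \<mu> l)))" by (rule sum.swap)
    finally have "(\<Sum>t=1..?A n u. real m / b n * (e t ^ m * ?z n t)) / sqrt (real n)
       = (\<Sum>l<d. - (real m / b n) * \<delta> n l / 2 * ((\<Sum>t=1..?A n u. e t ^ m * (D l t - \<mu> l)) / sqrt (real n)))"
      by (simp add: sum_distrib_left sum_divide_distrib)
    also have "\<dots> = (\<Sum>l<d. (- (real m / b n) * (sqrt (real n) * \<delta> n l) / 2) * ((\<Sum>t=1..?A n u. e t ^ m * (D l t - \<mu> l)) / real n))"
      using False by (intro sum.cong refl) (simp add: sqrt_mult_divide[symmetric])
    finally have E: "(\<Sum>t=1..?A n u. real m / b n * (e t ^ m * ?z n t)) / sqrt (real n)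
       = (\<Sum>l<d. (- (real m / b n) * (sqrt (real n) * \<delta> n l) / 2) * ((\<Sum>t=1..?A n u. e t ^ m * (D l t - \<mu> l)) / real n))" .
    show ?thesis unfolding E[symmetric] add_divide_distrib[symmetric] sum.distrib[symmetric] by simp
  qed simp
  show "uniform_limit {0..1} (\<lambda>n u. (\<Sum>t=1..\<lfloor>real n * u\<rfloor>.
            (e t * (y n t / (1 - (\<Sum>l<d. \<delta> n l * \<mu> l) / 2))) ^ m - e t ^ m) / sqrt (real n)) (\<lambda>_. 0) F"
    unfolding b_def[symmetric] eq using uniform_limit_add[OF rest lin] by (simp only: add_0_left)
qed

section \<open>A maximal law of large numbers for functions of the past of an i.i.d. sequence\<close>

abbreviation seqM :: "(nat \<Rightarrow> real) measure" where
  "seqM \<equiv> PiM UNIV (\<lambda>_. borel)"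

lemma space_seqM [simp]: "space seqM = UNIV"
  by (simp add: space_PiM)

lemma measurable_into_seqM:
  assumes "\<And>i. (\<lambda>\<omega>. f \<omega> i) \<in> borel_measurable M"
  shows "f \<in> measurable M seqM"
  using assms by (intro measurable_PiM_single') auto

lemma measurable_seqM_component [measurable]: "(\<lambda>x. x i) \<in> borel_measurable seqM"
  by (rule measurable_component_singleton) simp

definition depends_on :: "nat \<Rightarrow> ((nat \<Rightarrow> real) \<Rightarrow> 'b) \<Rightarrow> bool" where
  "depends_on m h \<longleftrightarrow> (\<forall>x y. (\<forall>i<m. x i = y i) \<longrightarrow> h x = h y)"

lemma depends_on_mono: "depends_on m h \<Longrightarrow> m \<le> m' \<Longrightarrow> depends_on m' h"
  unfolding depends_on_def by (meson less_le_trans)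

lemma depends_on_comp2:
  "depends_on m h1 \<Longrightarrow> depends_on m h2 \<Longrightarrow> depends_on m (\<lambda>x. f (h1 x) (h2 x))"
  unfolding depends_on_def by (intro allI impI arg_cong2[of _ _ _ _ f]) blast+

text \<open>Sets that coincide, up to an arbitrarily small measure, with a set determined by
  finitely many coordinates. They contain the sets determined by one coordinate and form a
  sigma-algebra, hence comprise all measurable sets.\<close>

definition approx_set :: "(nat \<Rightarrow> real) measure \<Rightarrow> (nat \<Rightarrow> real) set \<Rightarrow> bool" where
  "approx_set P A \<longleftrightarrow> (\<forall>e>0. \<exists>m. \<exists>B\<in>sets P. depends_on m (\<lambda>x. x \<in> B) \<and> measure P ((A - B) \<union> (B - A)) < e)"

lemma approx_setD:
  assumes "approx_set P A" "0 < e"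
  obtains m B where "B \<in> sets P" "depends_on m (\<lambda>x. x \<in> B)" "measure P ((A - B) \<union> (B - A)) < e"
  using assms unfolding approx_set_def by blast

lemma approx_set_Un_finite:
  fixes M :: "(nat \<Rightarrow> real) measure" and A :: "nat \<Rightarrow> (nat \<Rightarrow> real) set"
  assumes fin: "finite_measure M" and M: "sets M = sets seqM" and A: "\<And>i. A i \<in> sets M" and ap: "\<And>i. approx_set M (A i)"
  shows "approx_set M (\<Union>i<n. A i)"
proof -
  interpret finite_measure M by fact
  show ?thesis
  proof (induction n)
    case 0
    show ?case unfolding approx_set_def depends_on_def by (auto intro!: bexI[of _ "{}"])
  next
    case (Suc n)
    show ?case unfolding approx_set_def
    proof safe
      fix e :: real assume e: "0 < e"
      obtain m1 B1 where 1: "B1 \<in> sets M" "depends_on m1 (\<lambda>x. x \<in> B1)"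
        "measure M (((\<Union>i<n. A i) - B1) \<union> (B1 - (\<Union>i<n. A i))) < e / 2"
        using Suc[unfolded approx_set_def, rule_format, of "e / 2"] e by auto
      obtain m2 B2 where 2: "B2 \<in> sets M" "depends_on m2 (\<lambda>x. x \<in> B2)"
        "measure M ((A n - B2) \<union> (B2 - A n)) < e / 2"
        using ap[of n, unfolded approx_set_def, rule_format, of "e / 2"] e by auto
      let ?U = "\<Union>i<n. A i"
      have U: "?U \<in> sets M" using A by auto
      have "measure M (((\<Union>i<Suc n. A i) - (B1 \<union> B2)) \<union> ((B1 \<union> B2) - (\<Union>i<Suc n. A i)))
         \<le> measure M (((?U - B1) \<union> (B1 - ?U)) \<union> ((A n - B2) \<union> (B2 - A n)))"
        using 1 2 U A by (intro finite_measure_mono) (auto simp: lessThan_Suc)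
      also have "\<dots> \<le> measure M ((?U - B1) \<union> (B1 - ?U)) + measure M ((A n - B2) \<union> (B2 - A n))"
        using 1 2 U A by (intro measure_Un_le) auto
      also have "\<dots> < e" using 1 2 by linarith
      finally have lt: "measure M (((\<Union>i<Suc n. A i) - (B1 \<union> B2)) \<union> ((B1 \<union> B2) - (\<Union>i<Suc n. A i))) < e" .
      have "depends_on (max m1 m2) (\<lambda>x. x \<in> B1)" "depends_on (max m1 m2) (\<lambda>x. x \<in> B2)"
        using 1(2) 2(2) by (auto elim: depends_on_mono)
      then have "depends_on (max m1 m2) (\<lambda>x. x \<in> B1 \<union> B2)"
        unfolding Un_iff by (rule depends_on_comp2)
      with lt 1(1) 2(1) show "\<exists>m. \<exists>B\<in>sets M. depends_on m (\<lambda>x. x \<in> B) \<and>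
          measure M ((\<Union> (A ` {..<Suc n}) - B) \<union> (B - \<Union> (A ` {..<Suc n}))) < e"
        by blast
    qed
  qed
qed

lemma approx_set_all:
  fixes M :: "(nat \<Rightarrow> real) measure"
  assumes fin: "finite_measure M" and M: "sets M = sets seqM" and "A \<in> sets M"
  shows "approx_set M A"
proof -
  interpret finite_measure M by fact
  have "A \<in> sigma_sets (\<Pi>\<^sub>E i\<in>UNIV. space (borel::real measure))
      {{f\<in>\<Pi>\<^sub>E i\<in>UNIV. space (borel::real measure). f i \<in> B} |i B. i \<in> (UNIV::nat set) \<and> B \<in> sets borel}"
    using assms by (simp add: sets_PiM_single)
  then show ?thesis
  proof (induction rule: sigma_sets.induct)
    case (Basic A)
    then obtain i B where A: "A = {f. f i \<in> B}" "B \<in> sets borel" by auto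
    have "A = (\<lambda>x. x i) -` B \<inter> space seqM" using A by auto
    moreover have "(\<lambda>x. x i) -` B \<inter> space seqM \<in> sets seqM"
      using A(2) by (rule measurable_sets[OF measurable_seqM_component])
    ultimately have "A \<in> sets M" using M by metis
    moreover have "depends_on (Suc i) (\<lambda>x. x \<in> A)" unfolding A depends_on_def by auto
    ultimately show ?case unfolding approx_set_def by (auto intro!: exI[of _ "Suc i"] bexI[of _ A])
  next
    case Empty
    show ?case unfolding approx_set_def depends_on_def by (auto intro!: bexI[of _ "{}"])
  next
    case (Compl A)
    have sp: "space M = UNIV" using sets_eq_imp_space_eq[OF M] by simp
    show ?case unfolding approx_set_def
    proof safe
      fix e :: real assume "0 < e"
      then obtain m B where B: "B \<in> sets M" "depends_on m (\<lambda>x. x \<in> B)" "measure M ((A - B) \<union> (B - A)) < e"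
        using Compl(2) unfolding approx_set_def by blast
      have "- B \<in> sets M" using B(1) sets.compl_sets[of B M] sp by (simp add: Compl_eq_Diff_UNIV)
      moreover have "depends_on m (\<lambda>x. x \<in> - B)" using B(2) unfolding depends_on_def by simp
      moreover have "((\<Pi>\<^sub>E i\<in>UNIV. space (borel::real measure)) - A - - B) \<union> (- B - ((\<Pi>\<^sub>E i\<in>UNIV. space (borel::real measure)) - A)) = (A - B) \<union> (B - A)"
        by auto
      ultimately show "\<exists>m. \<exists>B\<in>sets M. depends_on m (\<lambda>x. x \<in> B) \<and>
         measure M (((\<Pi>\<^sub>E i\<in>UNIV. space (borel::real measure)) - A - B) \<union> (B - ((\<Pi>\<^sub>E i\<in>UNIV. space (borel::real measure)) - A))) < e"
        using B(3) by metis
    qed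
  next
    case (Union A)
    have A: "A i \<in> sets M" for i using Union(1) M by (simp add: sets_PiM_single)
    show ?case unfolding approx_set_def
    proof safe
      fix e :: real assume e: "0 < e"
      have "(\<lambda>n. measure M (\<Union>i<n. A i)) \<longlonglongrightarrow> measure M (\<Union>n. \<Union>i<n. A i)"
        using A by (intro finite_Lim_measure_incseq) (auto simp: incseq_def, meson lessThan_iff less_le_trans)
      moreover have "(\<Union>n. \<Union>i<n. A i) = (\<Union>i. A i)" by auto
      ultimately have "(\<lambda>n. measure M (\<Union>i<n. A i)) \<longlonglongrightarrow> measure M (\<Union>i. A i)" by simp
      then have "eventually (\<lambda>n. measure M (\<Union>i. A i) - e / 2 < measure M (\<Union>i<n. A i)) sequentially"
        using e by (intro order_tendstoD(1)) auto
      then obtain n where n: "measure M (\<Union>i. A i) - e / 2 < measure M (\<Union>i<n. A i)"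
        by (auto simp: eventually_sequentially)
      let ?U = "\<Union>i<n. A i" and ?V = "\<Union>i. A i"
      have UV: "?U \<in> sets M" "?V \<in> sets M" using A by auto
      have VU: "measure M (?V - ?U) < e / 2"
        using n UV by (subst finite_measure_Diff) auto
      obtain m B where B: "B \<in> sets M" "depends_on m (\<lambda>x. x \<in> B)" "measure M ((?U - B) \<union> (B - ?U)) < e / 2"
        by (rule approx_setD[OF approx_set_Un_finite[OF fin M A Union(2)] half_gt_zero[OF e]])
      have "measure M ((?V - B) \<union> (B - ?V)) \<le> measure M ((?V - ?U) \<union> ((?U - B) \<union> (B - ?U)))"
        using UV B(1) by (intro finite_measure_mono) auto
      also have "\<dots> \<le> measure M (?V - ?U) + measure M ((?U - B) \<union> (B - ?U))"
        using UV B(1) by (intro measure_Un_le) auto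
      also have "\<dots> < e" using VU B(3) by linarith
      finally show "\<exists>m. \<exists>B\<in>sets M. depends_on m (\<lambda>x. x \<in> B) \<and> measure M ((?V - B) \<union> (B - ?V)) < e"
        using B by blast
    qed
  qed
qed

definition finitely_approximable :: "(nat \<Rightarrow> real) measure \<Rightarrow> ((nat \<Rightarrow> real) \<Rightarrow> real) \<Rightarrow> bool" where
  "finitely_approximable P g \<longleftrightarrow> (\<forall>e>0. \<exists>m h C. depends_on m h \<and> h \<in> borel_measurable P \<and> (\<forall>x. \<bar>h x\<bar> \<le> C) \<and>
      (\<integral>x. \<bar>g x - h x\<bar> \<partial>P) < e)"

lemma integrable_finitely_approximable:
  fixes M :: "(nat \<Rightarrow> real) measure"
  assumes fin: "finite_measure M" and M: "sets M = sets seqM" and "integrable M (g :: (nat \<Rightarrow> real) \<Rightarrow> real)"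
  shows "finitely_approximable M g"
proof -
  interpret finite_measure M by fact
  show ?thesis using assms(3)
  proof (induction rule: integrable_induct)
    case (base A c)
    show ?case unfolding finitely_approximable_def
    proof safe
      fix e :: real assume e: "0 < e"
      obtain m B where B: "B \<in> sets M" "depends_on m (\<lambda>x. x \<in> B)" "measure M ((A - B) \<union> (B - A)) < e / (\<bar>c\<bar> + 1)"
        using approx_set_all[OF fin M base(1), unfolded approx_set_def, rule_format, of "e / (\<bar>c\<bar> + 1)"] e by auto
      let ?D = "(A - B) \<union> (B - A)"
      have D: "?D \<in> sets M" using B(1) base(1) by auto
      have "(\<integral>x. \<bar>indicator A x *\<^sub>R c - indicator B x * c\<bar> \<partial>M) = (\<integral>x. indicator ?D x * \<bar>c\<bar> \<partial>M)"
        by (intro Bochner_Integration.integral_cong) (auto simp: indicator_def)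
      also have "\<dots> = measure M ?D * \<bar>c\<bar>" using D by (simp add: measure_def[symmetric] emeasure_eq_measure)
      also have "\<dots> \<le> measure M ?D * (\<bar>c\<bar> + 1)" by (intro mult_left_mono) auto
      also have "\<dots> < e" using B(3) by (simp add: field_simps)
      finally have lt: "(\<integral>x. \<bar>indicator A x *\<^sub>R c - indicator B x * c\<bar> \<partial>M) < e" .
      have "depends_on m (\<lambda>x. indicator B x * c)"
        using depends_on_comp2[OF B(2) B(2), of "\<lambda>a b. of_bool a * c"] by (simp add: indicator_def of_bool_def)
      moreover have "(\<lambda>x. indicator B x * c) \<in> borel_measurable M" using B(1) by simp
      moreover have "\<bar>indicator B x * c\<bar> \<le> \<bar>c\<bar>" for x by (auto simp: indicator_def)
      ultimately show "\<exists>m h C. depends_on m h \<and> h \<in> borel_measurable M \<and> (\<forall>x. \<bar>h x\<bar> \<le> C) \<and>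
        (\<integral>x. \<bar>indicator A x *\<^sub>R c - h x\<bar> \<partial>M) < e" using lt by blast
    qed
  next
    case (add f g)
    show ?case unfolding finitely_approximable_def
    proof safe
      fix e :: real assume e: "0 < e"
      obtain m1 h1 C1 where 1: "depends_on m1 h1" "h1 \<in> borel_measurable M" "\<forall>x. \<bar>h1 x\<bar> \<le> C1" "(\<integral>x. \<bar>f x - h1 x\<bar> \<partial>M) < e / 2"
        using add(3)[unfolded finitely_approximable_def, rule_format, of "e / 2"] e by auto
      obtain m2 h2 C2 where 2: "depends_on m2 h2" "h2 \<in> borel_measurable M" "\<forall>x. \<bar>h2 x\<bar> \<le> C2" "(\<integral>x. \<bar>g x - h2 x\<bar> \<partial>M) < e / 2"
        using add(4)[unfolded finitely_approximable_def, rule_format, of "e / 2"] e by auto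
      have i1: "integrable M h1" using 1 by (intro integrable_const_bound[of _ C1]) auto
      have i2: "integrable M h2" using 2 by (intro integrable_const_bound[of _ C2]) auto
      have "(\<integral>x. \<bar>(f x + g x) - (h1 x + h2 x)\<bar> \<partial>M) \<le> (\<integral>x. \<bar>f x - h1 x\<bar> + \<bar>g x - h2 x\<bar> \<partial>M)"
        using add(1,2) i1 i2 by (intro integral_mono) auto
      also have "\<dots> < e" using add(1,2) i1 i2 1(4) 2(4) by (subst Bochner_Integration.integral_add) auto
      finally have lt: "(\<integral>x. \<bar>(f x + g x) - (h1 x + h2 x)\<bar> \<partial>M) < e" .
      have "depends_on (max m1 m2) h1" "depends_on (max m1 m2) h2"
        using 1(1) 2(1) by (auto elim: depends_on_mono)
      then have "depends_on (max m1 m2) (\<lambda>x. h1 x + h2 x)" by (rule depends_on_comp2)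
      moreover have "(\<lambda>x. h1 x + h2 x) \<in> borel_measurable M" using 1 2 by simp
      moreover have "\<bar>h1 x + h2 x\<bar> \<le> C1 + C2" for x
        using 1(3)[rule_format, of x] 2(3)[rule_format, of x] by linarith
      ultimately show "\<exists>m h C. depends_on m h \<and> h \<in> borel_measurable M \<and> (\<forall>x. \<bar>h x\<bar> \<le> C) \<and>
        (\<integral>x. \<bar>f x + g x - h x\<bar> \<partial>M) < e" using lt by blast
    qed
  next
    case (lim f s)
    show ?case unfolding finitely_approximable_def
    proof safe
      fix e :: real assume e: "0 < e"
      have meas: "f \<in> borel_measurable M" "\<And>i. s i \<in> borel_measurable M" using lim(1,4) by auto
      have "(\<lambda>i. \<integral>x. \<bar>f x - s i x\<bar> \<partial>M) \<longlonglongrightarrow> (\<integral>x. 0 \<partial>M)"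
      proof (rule integral_dominated_convergence[where w = "\<lambda>x. 3 * \<bar>f x\<bar>"])
        show "AE x in M. (\<lambda>i. \<bar>f x - s i x\<bar>) \<longlonglongrightarrow> 0"
        proof (intro AE_I2)
          fix x assume "x \<in> space M"
          then have "(\<lambda>i. \<bar>f x - s i x\<bar>) \<longlonglongrightarrow> \<bar>f x - f x\<bar>" by (intro tendsto_intros lim(2))
          then show "(\<lambda>i. \<bar>f x - s i x\<bar>) \<longlonglongrightarrow> 0" by simp
        qed
        show "AE x in M. norm \<bar>f x - s i x\<bar> \<le> 3 * \<bar>f x\<bar>" for i
        proof (intro AE_I2)
          fix x assume "x \<in> space M"
          from lim(3)[OF this, of i] show "norm \<bar>f x - s i x\<bar> \<le> 3 * \<bar>f x\<bar>" by simp
        qed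
      qed (use lim(4) meas in auto)
      then have "eventually (\<lambda>i. (\<integral>x. \<bar>f x - s i x\<bar> \<partial>M) < e / 2) sequentially"
        using e by (intro order_tendstoD(2)) auto
      then obtain i where i: "(\<integral>x. \<bar>f x - s i x\<bar> \<partial>M) < e / 2" by (auto simp: eventually_sequentially)
      obtain m h C where h: "depends_on m h" "h \<in> borel_measurable M" "\<forall>x. \<bar>h x\<bar> \<le> C" "(\<integral>x. \<bar>s i x - h x\<bar> \<partial>M) < e / 2"
        using lim(5)[of i, unfolded finitely_approximable_def, rule_format, of "e / 2"] e by auto
      have ih: "integrable M h" using h by (intro integrable_const_bound[of _ C]) auto
      have "(\<integral>x. \<bar>f x - h x\<bar> \<partial>M) \<le> (\<integral>x. \<bar>f x - s i x\<bar> + \<bar>s i x - h x\<bar> \<partial>M)"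
        using lim(1,4) ih by (intro integral_mono) auto
      also have "\<dots> < e" using lim(1,4) ih h(4) i by (subst Bochner_Integration.integral_add) auto
      finally show "\<exists>m h C. depends_on m h \<and> h \<in> borel_measurable M \<and> (\<forall>x. \<bar>h x\<bar> \<le> C) \<and> (\<integral>x. \<bar>f x - h x\<bar> \<partial>M) < e"
        using h by blast
    qed
  qed
qed

locale iid_seq = prob_space M for M :: "'a measure" +
  fixes \<epsilon> :: "int \<Rightarrow> 'a \<Rightarrow> real"
  assumes iid: "iid_process M \<epsilon>"
begin

definition past :: "int \<Rightarrow> 'a \<Rightarrow> nat \<Rightarrow> real" where
  "past t \<omega> = (\<lambda>i. \<epsilon> (t - int i) \<omega>)"

definition law :: "(nat \<Rightarrow> real) measure" where
  "law = distr M seqM (past 0)"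

lemma indep_eps: "indep_vars (\<lambda>_. borel) \<epsilon> UNIV"
  using iid by (simp add: iid_process_def)

lemma eps_measurable [measurable]: "\<epsilon> t \<in> borel_measurable M"
  using indep_eps by (simp add: indep_vars_def)

lemma eps_distr: "distr M borel (\<epsilon> t) = distr M borel (\<epsilon> s)"
  using iid unfolding iid_process_def by metis

lemma past_measurable [measurable]: "past t \<in> measurable M seqM"
  unfolding past_def by (rule measurable_into_seqM) simp

lemma distr_past: "distr M seqM (past t) = law"
proof -
  have *: "distr M seqM (past t) = PiM UNIV (\<lambda>i::nat. distr M borel (\<epsilon> 0))" for t
  proof -
    have "indep_vars (\<lambda>i. PiM {t - int i} (\<lambda>_. borel)) (\<lambda>i \<omega>. restrict (\<lambda>j. \<epsilon> j \<omega>) {t - int i}) (UNIV :: nat set)"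
      by (rule indep_vars_restrict[OF indep_eps]) (auto simp: disjoint_family_on_def)
    then have "indep_vars (\<lambda>_. borel) (\<lambda>i \<omega>. restrict (\<lambda>j. \<epsilon> j \<omega>) {t - int i} (t - int i)) (UNIV :: nat set)"
      by (rule indep_vars_compose2[where Y = "\<lambda>i x. x (t - int i)"]) (rule measurable_component_singleton, simp)
    then have "indep_vars (\<lambda>_. borel) (\<lambda>i. \<epsilon> (t - int i)) (UNIV :: nat set)" by simp
    then have "distr M seqM (\<lambda>\<omega>. \<lambda>i\<in>UNIV. \<epsilon> (t - int i) \<omega>) = PiM UNIV (\<lambda>i. distr M borel (\<epsilon> (t - int i)))"
      by (subst (asm) indep_vars_iff_distr_eq_PiM') auto
    moreover have "(\<lambda>i::nat. distr M borel (\<epsilon> (t - int i))) = (\<lambda>i. distr M borel (\<epsilon> 0))"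
      by (rule ext) (rule eps_distr)
    ultimately show ?thesis by (simp add: past_def[abs_def] restrict_UNIV)
  qed
  show ?thesis unfolding law_def * by simp
qed

lemma law_prob: "prob_space law"
  unfolding law_def by (rule prob_space_distr) simp

lemma sets_law [simp, measurable_cong]: "sets law = sets seqM"
  by (simp add: law_def)

lemma integral_past:
  assumes [measurable]: "g \<in> borel_measurable seqM"
  shows "(\<integral>\<omega>. g (past t \<omega>) \<partial>M) = (\<integral>x. (g x :: real) \<partial>law)"
  unfolding distr_past[symmetric, of t] by (subst integral_distr) auto

lemma integrable_past:
  assumes [measurable]: "(g :: (nat \<Rightarrow> real) \<Rightarrow> real) \<in> borel_measurable seqM" and "integrable law g"
  shows "integrable M (\<lambda>\<omega>. g (past t \<omega>))"
  using assms(2) unfolding distr_past[symmetric, of t] by (subst (asm) integrable_distr_eq) auto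

lemma nn_integral_past:
  assumes [measurable]: "g \<in> borel_measurable seqM"
  shows "(\<integral>\<^sup>+\<omega>. g (past t \<omega>) \<partial>M) = (\<integral>\<^sup>+x. g x \<partial>law)"
  unfolding distr_past[symmetric, of t] by (subst nn_integral_distr) auto

text \<open>The last \<open>m\<close> innovations up to time \<open>t\<close> as a function of a
  family \<open>y\<close> that may be known only on a finite set of times, which is the form needed
  to use the independence of the restrictions of a process to disjoint sets. Entries from
  \<open>m\<close> on are set to 0.\<close>

definition window :: "nat \<Rightarrow> int \<Rightarrow> (int \<Rightarrow> real) \<Rightarrow> nat \<Rightarrow> real" where
  "window m t y = (\<lambda>i. if i < m then y (t - int i) else 0)"

lemma window_measurable:
  assumes "{t - int m<..t} \<subseteq> A"
  shows "window m t \<in> measurable (PiM A (\<lambda>_. borel)) seqM"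
  unfolding window_def
proof (rule measurable_into_seqM)
  fix i
  show "(\<lambda>y. if i < m then y (t - int i) else 0) \<in> borel_measurable (PiM A (\<lambda>_. borel))"
    using assms by (cases "i < m") (auto intro!: measurable_component_singleton)
qed

lemma depends_on_window:
  assumes "depends_on m h" "{t - int m<..t} \<subseteq> A"
  shows "h (past t \<omega>) = h (window m t (restrict (\<lambda>i. \<epsilon> i \<omega>) A))"
  using assms(1)[unfolded depends_on_def, rule_format, of "past t \<omega>" "window m t (restrict (\<lambda>i. \<epsilon> i \<omega>) A)"] assms(2)
  by (auto simp: past_def window_def subset_iff)

lemma indep_windows:
  assumes h: "depends_on m (h :: (nat \<Rightarrow> real) \<Rightarrow> real)" and [measurable]: "h \<in> borel_measurable seqM" and "s \<le> t - int m"
  shows "indep_var borel (\<lambda>\<omega>. h (past t \<omega>)) borel (\<lambda>\<omega>. h (past s \<omega>))"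
proof -
  let ?A = "{t - int m<..t}" and ?B = "{s - int m<..s}"
  have "indep_var (PiM ?A (\<lambda>_. borel)) (\<lambda>\<omega>. restrict (\<lambda>i. \<epsilon> i \<omega>) ?A) (PiM ?B (\<lambda>_. borel)) (\<lambda>\<omega>. restrict (\<lambda>i. \<epsilon> i \<omega>) ?B)"
    using assms(3) by (intro indep_var_restrict[OF indep_eps]) auto
  then have "indep_var borel ((h \<circ> window m t) \<circ> (\<lambda>\<omega>. restrict (\<lambda>i. \<epsilon> i \<omega>) ?A)) borel ((h \<circ> window m s) \<circ> (\<lambda>\<omega>. restrict (\<lambda>i. \<epsilon> i \<omega>) ?B))"
    by (rule indep_var_compose) (auto intro!: measurable_comp[OF window_measurable])
  then show ?thesis
    by (simp add: comp_def depends_on_window[OF h order_refl, symmetric])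
qed

text \<open>Windows that do not overlap are independent, so each \<open>t\<close> has a nonzero
  covariance with at most \<open>2 * m + 1\<close> of the other times.\<close>

lemma bounded_window_variance:
  assumes h: "depends_on m h" and m[measurable]: "h \<in> borel_measurable seqM" and C: "\<And>x. \<bar>h x\<bar> \<le> C"
  shows "(\<integral>\<omega>. (\<Sum>t=1..int n. h (past t \<omega>) - (\<integral>x. h x \<partial>law))\<^sup>2 \<partial>M) \<le> real n * (2 * real m + 1) * (2 * C)\<^sup>2"
proof -
  define \<mu> where "\<mu> = (\<integral>x. h x \<partial>law)"
  define Z where "Z t \<omega> = h (past t \<omega>) - \<mu>" for t \<omega>
  have Zm[measurable]: "Z t \<in> borel_measurable M" for t unfolding Z_def by measurable
  have C0: "0 \<le> C" by (rule order_trans[OF abs_ge_zero[of "h undefined"]]) (rule C)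
  interpret L: prob_space law by (rule law_prob)
  have mu: "\<bar>\<mu>\<bar> \<le> C"
  proof -
    have "\<bar>\<mu>\<bar> \<le> (\<integral>x. \<bar>h x\<bar> \<partial>law)" unfolding \<mu>_def by (rule integral_abs_bound)
    also have "\<dots> \<le> (\<integral>x. C \<partial>law)"
      using C C0 by (intro integral_mono L.integrable_const_bound[of _ C]) (auto simp: measurable_def[of law])
    finally show ?thesis by (simp add: L.prob_space)
  qed
  have Zb: "\<bar>Z t \<omega>\<bar> \<le> 2 * C" for t \<omega>
    using abs_triangle_ineq4[of "h (past t \<omega>)" \<mu>] C[of "past t \<omega>"] mu unfolding Z_def by linarith
  have ZZb: "\<bar>Z t \<omega> * Z s \<omega>\<bar> \<le> (2 * C)\<^sup>2" for t s \<omega>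
    using mult_mono[OF Zb[of t \<omega>] Zb[of s \<omega>]] C0 by (simp add: abs_mult power2_eq_square)
  have iZ: "integrable M (Z t)" for t using Zb by (intro integrable_const_bound[of _ "2 * C"]) auto
  have iZZ: "integrable M (\<lambda>\<omega>. Z t \<omega> * Z s \<omega>)" for t s
    using ZZb by (intro integrable_const_bound[of _ "(2 * C)\<^sup>2"]) auto
  have EZ: "(\<integral>\<omega>. Z t \<omega> \<partial>M) = 0" for t
  proof -
    have "integrable M (\<lambda>\<omega>. h (past t \<omega>))" using C by (intro integrable_const_bound[of _ C]) auto
    then show ?thesis unfolding Z_def by (simp add: integral_past prob_space \<mu>_def)
  qed
  have cov: "(\<integral>\<omega>. Z t \<omega> * Z s \<omega> \<partial>M) = 0" if "s \<le> t - int m" for t s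
  proof -
    have "indep_var borel (\<lambda>\<omega>. h (past t \<omega>) - \<mu>) borel (\<lambda>\<omega>. h (past s \<omega>) - \<mu>)"
      using indep_var_compose[OF indep_windows[OF h m that], of "\<lambda>x. x - \<mu>" borel "\<lambda>x. x - \<mu>" borel]
      by (simp add: comp_def)
    then have "indep_var borel (Z t) borel (Z s)" unfolding Z_def[abs_def] .
    then show ?thesis using indep_var_lebesgue_integral[OF _ iZ[of t] iZ[of s]] EZ by simp
  qed
  have cov': "(\<integral>\<omega>. Z t \<omega> * Z s \<omega> \<partial>M) \<le> (if s \<in> {t - int m..t + int m} then (2 * C)\<^sup>2 else 0)" for t s
  proof (cases "s \<in> {t - int m..t + int m}")
    case True
    have "(\<integral>\<omega>. Z t \<omega> * Z s \<omega> \<partial>M) \<le> (\<integral>\<omega>. (2 * C)\<^sup>2 \<partial>M)"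
      using iZZ abs_le_D1[OF ZZb] by (intro integral_mono) auto
    then show ?thesis using True by (simp add: prob_space)
  next
    case False
    then have "s \<le> t - int m \<or> t \<le> s - int m" by auto
    then show ?thesis using False cov[of s t] cov[of t s] by (auto simp: mult.commute)
  qed
  have "(\<integral>\<omega>. (\<Sum>t=1..int n. Z t \<omega>)\<^sup>2 \<partial>M) = (\<integral>\<omega>. (\<Sum>t=1..int n. \<Sum>s=1..int n. Z t \<omega> * Z s \<omega>) \<partial>M)"
    by (simp add: power2_eq_square sum_product)
  also have "\<dots> = (\<Sum>t=1..int n. \<Sum>s=1..int n. \<integral>\<omega>. Z t \<omega> * Z s \<omega> \<partial>M)"
    using iZZ by (simp add: Bochner_Integration.integral_sum)
  also have "\<dots> \<le> (\<Sum>t=1..int n. \<Sum>s=1..int n. if s \<in> {t - int m..t + int m} then (2 * C)\<^sup>2 else 0)"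
    by (intro sum_mono cov')
  also have "\<dots> \<le> (\<Sum>t=1..int n. (2 * real m + 1) * (2 * C)\<^sup>2)"
  proof (rule sum_mono)
    fix t
    have "(\<Sum>s=1..int n. if s \<in> {t - int m..t + int m} then (2 * C)\<^sup>2 else 0)
       \<le> (\<Sum>s\<in>{1..int n} \<union> {t - int m..t + int m}. if s \<in> {t - int m..t + int m} then (2 * C)\<^sup>2 else 0)"
      by (intro sum_mono2) auto
    also have "\<dots> = (\<Sum>s\<in>{t - int m..t + int m}. (2 * C)\<^sup>2)"
      by (rule sum.mono_neutral_cong_right) auto
    also have "\<dots> = (2 * real m + 1) * (2 * C)\<^sup>2" by simp
    finally show "(\<Sum>s=1..int n. if s \<in> {t - int m..t + int m} then (2 * C)\<^sup>2 else 0) \<le> (2 * real m + 1) * (2 * C)\<^sup>2" .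
  qed
  also have "\<dots> = real n * (2 * real m + 1) * (2 * C)\<^sup>2" by simp
  finally show ?thesis by (simp add: Z_def \<mu>_def)
qed

definition dev_sum :: "((nat \<Rightarrow> real) \<Rightarrow> real) \<Rightarrow> nat \<Rightarrow> 'a \<Rightarrow> real" where
  "dev_sum g n \<omega> = (\<Sum>t=1..int n. g (past t \<omega>) - (\<integral>x. g x \<partial>law))"

lemma dev_sum_measurable [measurable]: "g \<in> borel_measurable seqM \<Longrightarrow> dev_sum g n \<in> borel_measurable M"
  unfolding dev_sum_def[abs_def]
  by (intro borel_measurable_sum borel_measurable_diff measurable_compose[OF past_measurable] borel_measurable_const)

lemma dev_sum_integrable:
  "g \<in> borel_measurable seqM \<Longrightarrow> integrable law g \<Longrightarrow> integrable M (dev_sum g n)"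
  unfolding dev_sum_def[abs_def] using integrable_past[of g] by simp

text \<open>Up to an error of \<open>e / 4\<close> in mean, \<open>g\<close> is a bounded function
  of finitely many coordinates. For such functions the variance of the sum is of order
  \<open>n\<close>, and \<open>\<bar>w\<bar> \<le> e * n / 4 + w\<^sup>2 / (e * n)\<close> turns
  this into a bound on the mean absolute deviation.\<close>

lemma L1_law_of_large_numbers:
  assumes m[measurable]: "g \<in> borel_measurable seqM" and int: "integrable law g" and e: "0 < e"
  shows "eventually (\<lambda>n. (\<integral>\<omega>. \<bar>dev_sum g n \<omega>\<bar> \<partial>M) \<le> e * real n) sequentially"
proof -
  interpret L: prob_space law by (rule law_prob)
  obtain k h C where h: "depends_on k h" "h \<in> borel_measurable law" "\<forall>x. \<bar>h x\<bar> \<le> C" "(\<integral>x. \<bar>g x - h x\<bar> \<partial>law) < e / 4"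
    using integrable_finitely_approximable[OF L.finite_measure_axioms sets_law int, unfolded finitely_approximable_def, rule_format, of "e / 4"] e by auto
  have hm[measurable]: "h \<in> borel_measurable seqM" using h(2) by (simp cong: measurable_cong_sets)
  have ih: "integrable law h" using h by (intro L.integrable_const_bound[of _ C]) auto
  define V where "V = (2 * real k + 1) * (2 * C)\<^sup>2"
  have V0: "0 \<le> V" by (simp add: V_def)
  have main: "(\<integral>\<omega>. \<bar>dev_sum g n \<omega>\<bar> \<partial>M) \<le> 3 * e / 4 * real n + V / e" for n
  proof -
    have i1: "integrable M (\<lambda>\<omega>. \<bar>g (past t \<omega>) - h (past t \<omega>)\<bar>)" for t
      using integrable_past[of "\<lambda>x. \<bar>g x - h x\<bar>" t] int ih by auto
    have b1: "(\<integral>\<omega>. \<bar>g (past t \<omega>) - h (past t \<omega>)\<bar> \<partial>M) \<le> e / 4" for t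
      using integral_past[of "\<lambda>x. \<bar>g x - h x\<bar>" t] h(4) by simp
    have b2: "\<bar>(\<integral>x. h x \<partial>law) - (\<integral>x. g x \<partial>law)\<bar> \<le> e / 4"
    proof -
      have "\<bar>(\<integral>x. h x \<partial>law) - (\<integral>x. g x \<partial>law)\<bar> = \<bar>\<integral>x. g x - h x \<partial>law\<bar>" using int ih by (simp add: abs_minus_commute)
      also have "\<dots> \<le> (\<integral>x. \<bar>g x - h x\<bar> \<partial>law)" by (rule integral_abs_bound)
      finally show ?thesis using h(4) by simp
    qed
    have i2: "integrable M (\<lambda>\<omega>. (dev_sum h n \<omega>)\<^sup>2)"
    proof (rule integrable_const_bound)
      show "AE \<omega> in M. norm ((dev_sum h n \<omega>)\<^sup>2) \<le> (real n * (C + \<bar>\<integral>x. h x \<partial>law\<bar>))\<^sup>2"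
      proof (intro AE_I2)
        fix \<omega>
        have "\<bar>dev_sum h n \<omega>\<bar> \<le> (\<Sum>t=1..int n. C + \<bar>\<integral>x. h x \<partial>law\<bar>)"
          unfolding dev_sum_def
        proof (rule order_trans[OF sum_abs sum_mono])
          fix t show "\<bar>h (past t \<omega>) - (\<integral>x. h x \<partial>law)\<bar> \<le> C + \<bar>\<integral>x. h x \<partial>law\<bar>"
            using abs_triangle_ineq4[of "h (past t \<omega>)" "\<integral>x. h x \<partial>law"] h(3)[rule_format, of "past t \<omega>"] by linarith
        qed
        also have "\<dots> = real n * (C + \<bar>\<integral>x. h x \<partial>law\<bar>)" by simp
        finally have "\<bar>dev_sum h n \<omega>\<bar>\<^sup>2 \<le> (real n * (C + \<bar>\<integral>x. h x \<partial>law\<bar>))\<^sup>2" by (intro power_mono) auto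
        then show "norm ((dev_sum h n \<omega>)\<^sup>2) \<le> (real n * (C + \<bar>\<integral>x. h x \<partial>law\<bar>))\<^sup>2" by simp
      qed
    qed simp
    show ?thesis
    proof (cases "n = 0")
      case True
      then show ?thesis using V0 e by (simp add: dev_sum_def)
    next
      case False
      then have n: "0 < real n" by simp
      have pw: "\<bar>dev_sum g n \<omega>\<bar> \<le> (\<Sum>t=1..int n. \<bar>g (past t \<omega>) - h (past t \<omega>)\<bar>) + real n * (e / 4)
          + (e / 4 * real n + (dev_sum h n \<omega>)\<^sup>2 / (e * real n))" for \<omega>
      proof -
        have "dev_sum g n \<omega> = (\<Sum>t=1..int n. g (past t \<omega>) - h (past t \<omega>)) + dev_sum h n \<omega>
            + real n * ((\<integral>x. h x \<partial>law) - (\<integral>x. g x \<partial>law))"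
          by (simp add: dev_sum_def sum_subtractf algebra_simps)
        moreover have "\<bar>\<Sum>t=1..int n. g (past t \<omega>) - h (past t \<omega>)\<bar> \<le> (\<Sum>t=1..int n. \<bar>g (past t \<omega>) - h (past t \<omega>)\<bar>)"
          by (rule sum_abs)
        moreover have "\<bar>real n * ((\<integral>x. h x \<partial>law) - (\<integral>x. g x \<partial>law))\<bar> \<le> real n * (e / 4)"
          using mult_left_mono[OF b2, of "real n"] by (simp add: abs_mult)
        moreover have "\<bar>dev_sum h n \<omega>\<bar> \<le> e / 4 * real n + (dev_sum h n \<omega>)\<^sup>2 / (e * real n)"
        proof -
          have "0 \<le> (e * real n / 2 - \<bar>dev_sum h n \<omega>\<bar>)\<^sup>2" by simp
          then have "\<bar>dev_sum h n \<omega>\<bar> * (e * real n) \<le> (e / 4 * real n) * (e * real n) + (dev_sum h n \<omega>)\<^sup>2"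
            by (simp add: power2_diff power2_eq_square algebra_simps)
          then have "\<bar>dev_sum h n \<omega>\<bar> \<le> ((e / 4 * real n) * (e * real n) + (dev_sum h n \<omega>)\<^sup>2) / (e * real n)"
            using n e by (simp only: pos_le_divide_eq mult_pos_pos)
          also have "\<dots> = e / 4 * real n + (dev_sum h n \<omega>)\<^sup>2 / (e * real n)" using n e by (simp add: add_divide_distrib)
          finally show ?thesis .
        qed
        ultimately show ?thesis by linarith
      qed
      have "(\<integral>\<omega>. \<bar>dev_sum g n \<omega>\<bar> \<partial>M) \<le> (\<integral>\<omega>. (\<Sum>t=1..int n. \<bar>g (past t \<omega>) - h (past t \<omega>)\<bar>) + real n * (e / 4)
          + (e / 4 * real n + (dev_sum h n \<omega>)\<^sup>2 / (e * real n)) \<partial>M)"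
        using dev_sum_integrable[OF m int, of n] i1 i2 by (intro integral_mono pw) auto
      also have "\<dots> = (\<Sum>t=1..int n. \<integral>\<omega>. \<bar>g (past t \<omega>) - h (past t \<omega>)\<bar> \<partial>M) + real n * (e / 4)
          + (e / 4 * real n + (\<integral>\<omega>. (dev_sum h n \<omega>)\<^sup>2 \<partial>M) / (e * real n))"
        using i1 i2 by (simp add: Bochner_Integration.integral_sum Bochner_Integration.integral_add prob_space)
      also have "\<dots> \<le> (\<Sum>t=1..int n. e / 4) + real n * (e / 4) + (e / 4 * real n + (real n * V) / (e * real n))"
        using b1 n e bounded_window_variance[OF h(1) hm h(3)[rule_format], of n]
        by (intro add_mono sum_mono divide_right_mono order_refl) (auto simp: dev_sum_def V_def mult.assoc)
      also have "\<dots> = 3 * e / 4 * real n + V / e" using n e by (simp add: field_simps)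
      finally show ?thesis .
    qed
  qed
  obtain N where N: "4 * V / e\<^sup>2 \<le> real N" using real_arch_simple by blast
  show ?thesis unfolding eventually_sequentially
  proof (intro exI allI impI)
    fix n assume "N \<le> n"
    then have "4 * V / e\<^sup>2 \<le> real n" using N by linarith
    then have "4 * V \<le> real n * e\<^sup>2" using e by (simp add: pos_divide_le_eq)
    then have "V / e \<le> e / 4 * real n" using e by (simp add: pos_divide_le_eq power2_eq_square algebra_simps)
    with main[of n] show "(\<integral>\<omega>. \<bar>dev_sum g n \<omega>\<bar> \<partial>M) \<le> e * real n" by linarith
  qed
qed

text \<open>The finitely many indices below the threshold of the law contribute a constant, which
  \<open>n\<close> absorbs. The range extends to \<open>2 * n\<close> because the last point of the
  grid used below may exceed \<open>n\<close>.\<close>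

lemma L1_law_uniform:
  assumes m[measurable]: "g \<in> borel_measurable seqM" and int: "integrable law g" and e: "0 < e"
  shows "eventually (\<lambda>n. \<forall>j\<le>2 * n. (\<integral>\<omega>. \<bar>dev_sum g j \<omega>\<bar> \<partial>M) \<le> e * real n) sequentially"
proof -
  let ?a = "\<lambda>j. \<integral>\<omega>. \<bar>dev_sum g j \<omega>\<bar> \<partial>M"
  obtain N where N: "\<And>j. N \<le> j \<Longrightarrow> ?a j \<le> e / 2 * real j"
    using L1_law_of_large_numbers[OF m int, of "e / 2"] e by (auto simp: eventually_sequentially)
  have a0: "0 \<le> ?a j" for j by simp
  obtain N' where N': "(\<Sum>j<N. ?a j) / e \<le> real N'" using real_arch_simple by blast
  show ?thesis unfolding eventually_sequentially
  proof (intro exI allI impI)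
    fix n j assume n: "N' \<le> n" and j: "j \<le> 2 * n"
    show "?a j \<le> e * real n"
    proof (cases "N \<le> j")
      case True
      have "?a j \<le> e / 2 * real j" by (rule N[OF True])
      also have "\<dots> \<le> e / 2 * (2 * real n)" using e j by (intro mult_left_mono) auto
      finally show ?thesis by simp
    next
      case False
      then have "?a j \<le> (\<Sum>j<N. ?a j)" by (intro member_le_sum a0) auto
      also have "\<dots> \<le> e * real N'" using N' e by (simp add: pos_divide_le_eq mult.commute)
      also have "\<dots> \<le> e * real n" using n e by simp
      finally show ?thesis .
    qed
  qed
qed

definition max_dev :: "((nat \<Rightarrow> real) \<Rightarrow> real) \<Rightarrow> nat \<Rightarrow> 'a \<Rightarrow> real" where
  "max_dev g n \<omega> = Max ((\<lambda>j. \<bar>dev_sum g j \<omega>\<bar>) ` {..n}) / real n"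

lemma max_dev_measurable [measurable]: "g \<in> borel_measurable seqM \<Longrightarrow> max_dev g n \<in> borel_measurable M"
  unfolding max_dev_def[abs_def] by (intro borel_measurable_divide borel_measurable_Max borel_measurable_abs dev_sum_measurable) auto

lemma max_dev_ge: "j \<le> n \<Longrightarrow> \<bar>dev_sum g j \<omega>\<bar> / real n \<le> max_dev g n \<omega>"
  unfolding max_dev_def by (intro divide_right_mono Max_ge) auto

lemma max_dev_nonneg: "0 \<le> max_dev g n \<omega>"
  by (rule order_trans[OF _ max_dev_ge[of 0]]) (auto simp: dev_sum_def)

lemma max_dev_integrable:
  assumes m[measurable]: "g \<in> borel_measurable seqM" and int: "integrable law g"
  shows "integrable M (max_dev g n)"
proof (rule Bochner_Integration.integrable_bound)
  show "integrable M (\<lambda>\<omega>. (\<Sum>j\<le>n. \<bar>dev_sum g j \<omega>\<bar>) / real n)"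
    using dev_sum_integrable[OF m int] by auto
  show "AE \<omega> in M. norm (max_dev g n \<omega>) \<le> norm ((\<Sum>j\<le>n. \<bar>dev_sum g j \<omega>\<bar>) / real n)"
  proof (intro AE_I2)
    fix \<omega>
    have "Max ((\<lambda>j. \<bar>dev_sum g j \<omega>\<bar>) ` {..n}) \<le> (\<Sum>j\<le>n. \<bar>dev_sum g j \<omega>\<bar>)"
      by (intro Max.boundedI) (auto intro!: member_le_sum)
    then have "max_dev g n \<omega> \<le> (\<Sum>j\<le>n. \<bar>dev_sum g j \<omega>\<bar>) / real n"
      unfolding max_dev_def by (intro divide_right_mono) auto
    then show "norm (max_dev g n \<omega>) \<le> norm ((\<Sum>j\<le>n. \<bar>dev_sum g j \<omega>\<bar>) / real n)"
      using max_dev_nonneg[of g n \<omega>] by (simp add: sum_nonneg)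
  qed
qed simp

text \<open>Partial sums are compared with those at \<open>K\<close> grid points; between grid points the sum of the
  absolute values is at most its mean plus a deviation that obeys the same law.\<close>

lemma max_dev_tendsto_0:
  assumes m[measurable]: "g \<in> borel_measurable seqM" and int: "integrable law g"
  shows "(\<lambda>n. \<integral>\<omega>. max_dev g n \<omega> \<partial>M) \<longlonglongrightarrow> 0"
proof (rule tendstoI)
  fix \<delta> :: real assume del: "0 < \<delta>"
  define \<mu> where "\<mu> = (\<integral>x. g x \<partial>law)"
  define g' where "g' x = \<bar>g x - \<mu>\<bar>" for x
  define \<nu> where "\<nu> = (\<integral>x. g' x \<partial>law)"
  interpret L: prob_space law by (rule law_prob)
  have m'[measurable]: "g' \<in> borel_measurable seqM" unfolding g'_def by measurable
  have int': "integrable law g'" using int unfolding g'_def by auto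
  have nu0: "0 \<le> \<nu>" unfolding \<nu>_def g'_def by simp
  (* The mean of g' over one grid cell, about n * \<nu> / K, uses up a quarter of \<delta> * n. *)
  obtain K :: nat where K: "4 * \<nu> / \<delta> < real K" using reals_Archimedean2 by blast
  have nd: "0 \<le> 4 * \<nu> / \<delta>" using nu0 del by simp
  have "0 < real K" using K nd by linarith
  then have K0: "0 < K" by simp
  (* Each of the K + 2 grid points contributes three deviations of size e * n; together they use up
     another quarter. *)
  define e where "e = \<delta> / (12 * (real K + 2))"
  have e: "0 < e" using del by (simp add: e_def)
  define gr where "gr n i = i * n div K" for n i :: nat
  have ev1: "eventually (\<lambda>n. real n \<ge> 1 + 4 * \<nu> / \<delta>) sequentially"
    by (rule eventually_sequentiallyI[of "nat \<lceil>1 + 4 * \<nu> / \<delta>\<rceil>"]) linarith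
  from ev1 L1_law_uniform[OF m int e] L1_law_uniform[OF m' int' e]
  show "eventually (\<lambda>n. dist (\<integral>\<omega>. max_dev g n \<omega> \<partial>M) 0 < \<delta>) sequentially"
  proof eventually_elim
    case (elim n)
    have n: "0 < real n" using elim(1) nd by linarith
    have pw: "Max ((\<lambda>j. \<bar>dev_sum g j \<omega>\<bar>) ` {..n})
        \<le> (\<Sum>i\<le>Suc K. \<bar>dev_sum g (gr n i) \<omega>\<bar> + 2 * \<bar>dev_sum g' (gr n i) \<omega>\<bar>) + (real n / real K + 1) * \<nu>" for \<omega>
    proof (rule Max.boundedI; clarsimp)
      fix j assume j: "j \<le> n"
      define i where "i = j * K div n"
      have nn: "0 < n" using n by simp
      have iK: "i \<le> K" using j nn unfolding i_def by (metis div_le_mono mult.commute mult_le_mono2 nonzero_mult_div_cancel_right less_not_refl2)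
      have "i * n \<le> j * K" unfolding i_def by (rule div_times_less_eq_dividend)
      then have g1: "gr n i \<le> j" unfolding gr_def using K0 by (metis div_le_mono nonzero_mult_div_cancel_right less_not_refl2)
      have "j * K \<le> Suc i * n" unfolding i_def using dividend_less_div_times[OF nn, of "j * K"] by simp
      then have g2: "j \<le> gr n (Suc i)" unfolding gr_def using K0 by (metis div_le_mono nonzero_mult_div_cancel_right less_not_refl2)
      have gap: "real (gr n (Suc i)) - real (gr n i) \<le> real n / real K + 1"
      proof -
        have "real (gr n (Suc i)) \<le> real (Suc i * n) / real K" unfolding gr_def by (rule of_nat_div_le_of_nat)
        moreover have "real (i * n) / real K \<le> 1 + real (gr n i)"
        proof -
          have "i * n < K + K * gr n i" unfolding gr_def using K0 by (rule dividend_less_times_div)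
          then have "real (i * n) \<le> real (K + K * gr n i)" by (intro of_nat_mono) simp
          then show ?thesis using K0 by (simp add: pos_divide_le_eq algebra_simps)
        qed
        moreover have "real (Suc i * n) / real K = real (i * n) / real K + real n / real K"
          by (simp add: add_divide_distrib algebra_simps)
        ultimately show ?thesis by linarith
      qed
      let ?Y = "\<lambda>t. g (past t \<omega>) - \<mu>"
      have S: "dev_sum g k \<omega> = (\<Sum>t=1..int k. ?Y t)" for k by (simp add: dev_sum_def \<mu>_def)
      have S': "(\<Sum>t=1..int k. \<bar>?Y t\<bar>) = dev_sum g' k \<omega> + real k * \<nu>" for k
        by (simp add: dev_sum_def g'_def \<nu>_def sum_subtractf)
      have sp: "sum f {1..int b} = sum f {1..int a} + sum f {int a + 1..int b}" if "a \<le> b" for a b and f :: "int \<Rightarrow> real"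
        using that by (subst sum.union_disjoint[symmetric]) (auto intro!: sum.cong)
      have "\<bar>dev_sum g j \<omega>\<bar> \<le> \<bar>dev_sum g (gr n i) \<omega>\<bar> + (\<Sum>t=int (gr n i) + 1..int j. \<bar>?Y t\<bar>)"
        unfolding S sp[OF g1, of ?Y] by (intro order_trans[OF abs_triangle_ineq] add_mono order_refl sum_abs)
      also have "(\<Sum>t=int (gr n i) + 1..int j. \<bar>?Y t\<bar>) \<le> (\<Sum>t=int (gr n i) + 1..int (gr n (Suc i)). \<bar>?Y t\<bar>)"
        using g2 by (intro sum_mono2) auto
      also have "\<dots> = dev_sum g' (gr n (Suc i)) \<omega> + real (gr n (Suc i)) * \<nu> - (dev_sum g' (gr n i) \<omega> + real (gr n i) * \<nu>)"
        unfolding S'[symmetric] sp[OF order_trans[OF g1 g2], of "\<lambda>t. \<bar>?Y t\<bar>"] by simp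
      also have "\<dots> = dev_sum g' (gr n (Suc i)) \<omega> - dev_sum g' (gr n i) \<omega> + (real (gr n (Suc i)) - real (gr n i)) * \<nu>"
        by (simp add: algebra_simps)
      also have "\<dots> \<le> \<bar>dev_sum g' (gr n (Suc i)) \<omega>\<bar> + \<bar>dev_sum g' (gr n i) \<omega>\<bar> + (real n / real K + 1) * \<nu>"
        using mult_right_mono[OF gap nu0] by linarith
      finally have 1: "\<bar>dev_sum g j \<omega>\<bar> \<le> \<bar>dev_sum g (gr n i) \<omega>\<bar> + (\<bar>dev_sum g' (gr n (Suc i)) \<omega>\<bar> + \<bar>dev_sum g' (gr n i) \<omega>\<bar> + (real n / real K + 1) * \<nu>)"
        by simp
      let ?f = "\<lambda>i. \<bar>dev_sum g (gr n i) \<omega>\<bar> + 2 * \<bar>dev_sum g' (gr n i) \<omega>\<bar>"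
      have "?f i + ?f (Suc i) = (\<Sum>l\<in>{i, Suc i}. ?f l)" by simp
      also have "\<dots> \<le> (\<Sum>l\<le>Suc K. ?f l)" using iK by (intro sum_mono2) auto
      finally have "?f i + ?f (Suc i) \<le> (\<Sum>l\<le>Suc K. ?f l)" .
      with 1 show "\<bar>dev_sum g j \<omega>\<bar> \<le> (\<Sum>i\<le>K. ?f i) + ?f (Suc K) + (real n / real K + 1) * \<nu>"
        by (simp only: sum.atMost_Suc) linarith
    qed
    have gr2: "gr n i \<le> 2 * n" if "i \<le> Suc K" for i
    proof -
      have "i * n \<le> (2 * n) * K" using that K0 mult_le_mono1[of i "2 * K" n] by (simp add: mult_ac)
      then show ?thesis unfolding gr_def using K0 by (metis div_le_mono nonzero_mult_div_cancel_right less_not_refl2)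
    qed
    have "(\<integral>\<omega>. max_dev g n \<omega> \<partial>M) * real n = (\<integral>\<omega>. Max ((\<lambda>j. \<bar>dev_sum g j \<omega>\<bar>) ` {..n}) \<partial>M)"
      using n by (simp add: max_dev_def)
    also have "\<dots> \<le> (\<integral>\<omega>. (\<Sum>i\<le>Suc K. \<bar>dev_sum g (gr n i) \<omega>\<bar> + 2 * \<bar>dev_sum g' (gr n i) \<omega>\<bar>) + (real n / real K + 1) * \<nu> \<partial>M)"
    proof (rule integral_mono)
      show "integrable M (\<lambda>\<omega>. Max ((\<lambda>j. \<bar>dev_sum g j \<omega>\<bar>) ` {..n}))"
        using integrable_mult_left[OF max_dev_integrable[OF m int, of n], of "real n"] n by (simp add: max_dev_def)
      show "integrable M (\<lambda>\<omega>. (\<Sum>i\<le>Suc K. \<bar>dev_sum g (gr n i) \<omega>\<bar> + 2 * \<bar>dev_sum g' (gr n i) \<omega>\<bar>) + (real n / real K + 1) * \<nu>)"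
        using dev_sum_integrable[OF m int] dev_sum_integrable[OF m' int'] by (simp del: sum.atMost_Suc)
    qed (rule pw)
    also have "\<dots> = (\<Sum>i\<le>Suc K. (\<integral>\<omega>. \<bar>dev_sum g (gr n i) \<omega>\<bar> \<partial>M) + 2 * (\<integral>\<omega>. \<bar>dev_sum g' (gr n i) \<omega>\<bar> \<partial>M)) + (real n / real K + 1) * \<nu>"
      using dev_sum_integrable[OF m int] dev_sum_integrable[OF m' int']
      by (simp add: Bochner_Integration.integral_sum Bochner_Integration.integral_add prob_space del: sum.atMost_Suc)
    also have "\<dots> \<le> (\<Sum>i\<le>Suc K. e * real n + 2 * (e * real n)) + (real n / real K + 1) * \<nu>"
      using elim(2,3) gr2 by (intro add_right_mono sum_mono add_mono mult_left_mono) auto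
    also have "\<dots> = 3 * (real K + 2) * e * real n + (real n / real K + 1) * \<nu>" by (simp add: algebra_simps)
    also have "\<dots> = (\<delta> / 4 + \<nu> / real K) * real n + \<nu>" 
    proof -
      have e3: "3 * (real K + 2) * e = \<delta> / 4" by (simp add: e_def field_simps)
      show ?thesis unfolding e3 by (simp add: algebra_simps)
    qed
    also have "\<dots> < (\<delta> / 4 + \<delta> / 4) * real n + \<delta> / 4 * real n"
    proof (rule add_less_le_mono)
      have "\<nu> / real K < \<delta> / 4" using K K0 del by (simp add: field_simps)
      then show "(\<delta> / 4 + \<nu> / real K) * real n < (\<delta> / 4 + \<delta> / 4) * real n" by (intro mult_strict_right_mono n add_strict_left_mono)
      have "4 * \<nu> / \<delta> \<le> real n" using elim(1) by simp
      then show "\<nu> \<le> \<delta> / 4 * real n" using del by (simp add: field_simps)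
    qed
    finally have "(\<integral>\<omega>. max_dev g n \<omega> \<partial>M) * real n < (\<delta> * (3 / 4)) * real n" by (simp add: algebra_simps)
    then have "(\<integral>\<omega>. max_dev g n \<omega> \<partial>M) < \<delta>" using n del by (simp add: mult_less_cancel_right)
    moreover have "0 \<le> (\<integral>\<omega>. max_dev g n \<omega> \<partial>M)" by (intro integral_nonneg_AE AE_I2 max_dev_nonneg)
    ultimately show ?case by simp
  qed
qed

text \<open>Convergence in mean gives almost sure convergence along a further subsequence; applied
  to the sum over \<open>I\<close>, it provides one subsequence for all the functions.\<close>

lemma max_dev_AE_subseq:
  assumes fin: "finite I" and m: "\<And>i. i \<in> I \<Longrightarrow> g i \<in> borel_measurable seqM" and int: "\<And>i. i \<in> I \<Longrightarrow> integrable law (g i)"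
    and s: "strict_mono (s :: nat \<Rightarrow> nat)"
  shows "\<exists>r. strict_mono r \<and> (AE \<omega> in M. \<forall>i\<in>I. (\<lambda>n. max_dev (g i) (s (r n)) \<omega>) \<longlonglongrightarrow> 0)"
proof -
  define U where "U n \<omega> = (\<Sum>i\<in>I. max_dev (g i) (s n) \<omega>)" for n \<omega>
  have U0: "0 \<le> U n \<omega>" for n \<omega> unfolding U_def by (intro sum_nonneg max_dev_nonneg)
  have iU: "integrable M (U n)" for n
    unfolding U_def using m int by (intro Bochner_Integration.integrable_sum max_dev_integrable) auto
  have "(\<lambda>n. \<Sum>i\<in>I. \<integral>\<omega>. max_dev (g i) (s n) \<omega> \<partial>M) \<longlonglongrightarrow> (\<Sum>i\<in>I. 0)"
  proof (rule tendsto_sum)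
    fix i assume "i \<in> I"
    then have "(\<lambda>n. \<integral>\<omega>. max_dev (g i) n \<omega> \<partial>M) \<longlonglongrightarrow> 0" using m int by (intro max_dev_tendsto_0)
    from LIMSEQ_subseq_LIMSEQ[OF this s] show "(\<lambda>n. \<integral>\<omega>. max_dev (g i) (s n) \<omega> \<partial>M) \<longlonglongrightarrow> 0" by (simp add: comp_def)
  qed
  moreover have "(\<Sum>i\<in>I. \<integral>\<omega>. max_dev (g i) (s n) \<omega> \<partial>M) = (\<integral>\<omega>. norm (U n \<omega>) \<partial>M)" for n
    using U0 m int by (simp add: U_def Bochner_Integration.integral_sum max_dev_integrable abs_of_nonneg sum_nonneg max_dev_nonneg)
  ultimately have "(\<lambda>n. \<integral>\<omega>. norm (U n \<omega>) \<partial>M) \<longlonglongrightarrow> 0" by simp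
  from tendsto_L1_AE_subseq[OF iU this] obtain r where r: "strict_mono r" "AE \<omega> in M. (\<lambda>n. U (r n) \<omega>) \<longlonglongrightarrow> 0" by blast
  from r(2) have "AE \<omega> in M. \<forall>i\<in>I. (\<lambda>n. max_dev (g i) (s (r n)) \<omega>) \<longlonglongrightarrow> 0"
  proof eventually_elim
    case (elim \<omega>)
    show ?case
    proof
      fix i assume i: "i \<in> I"
      show "(\<lambda>n. max_dev (g i) (s (r n)) \<omega>) \<longlonglongrightarrow> 0"
      proof (rule tendsto_sandwich[OF _ _ tendsto_const elim])
        show "\<forall>\<^sub>F n in sequentially. max_dev (g i) (s (r n)) \<omega> \<le> U (r n) \<omega>"
          unfolding U_def using i fin max_dev_nonneg by (intro always_eventually allI member_le_sum) auto
      qed (use max_dev_nonneg in auto)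
    qed
  qed
  with r(1) show ?thesis by blast
qed

end

section \<open>The Bougerol-Picard state recursion\<close>

(* The dollar sign denotes entries of the vectors that the matrices of the model act on. *)
no_notation Finite_Cartesian_Product.vec.vec_nth (infixl "$" 90)

lemma row_sum_le_mat_norm:
  assumes "A \<in> carrier_mat d d" "i < d"
  shows "(\<Sum>j<d. \<bar>A $$ (i, j)\<bar>) \<le> mat_norm A"
  unfolding mat_norm_def using assms by (intro Max_ge) auto

lemma mat_norm_leI:
  assumes "A \<in> carrier_mat d d" "0 < d" "\<And>i. i < d \<Longrightarrow> (\<Sum>j<d. \<bar>A $$ (i, j)\<bar>) \<le> C"
  shows "mat_norm A \<le> C"
  unfolding mat_norm_def using assms by (intro Max.boundedI) auto

lemma mat_norm_nonneg:
  assumes "A \<in> carrier_mat d d" "0 < d"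
  shows "0 \<le> mat_norm A"
  by (rule order_trans[OF _ row_sum_le_mat_norm[OF assms]]) (simp add: sum_nonneg)

lemma mat_mult_index_sum:
  assumes "A \<in> carrier_mat d d" "B \<in> carrier_mat d d" "i < d" "j < d"
  shows "(A * B) $$ (i, j) = (\<Sum>k<d. A $$ (i, k) * B $$ (k, j))"
  using assms by (auto simp: scalar_prod_def atLeast0LessThan intro!: sum.cong)

lemma mat_vec_index_sum:
  assumes "A \<in> carrier_mat d d" "v \<in> carrier_vec d" "i < d"
  shows "(A *\<^sub>v v) $ i = (\<Sum>k<d. A $$ (i, k) * v $ k)"
  using assms by (auto simp: scalar_prod_def atLeast0LessThan intro!: sum.cong)

lemma mat_norm_mult_le:
  assumes A: "A \<in> carrier_mat d d" and B: "B \<in> carrier_mat d d" and d: "0 < d"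
  shows "mat_norm (A * B) \<le> mat_norm A * mat_norm B"
proof (rule mat_norm_leI[OF mult_carrier_mat[OF A B] d])
  fix i assume i: "i < d"
  have "(\<Sum>j<d. \<bar>(A * B) $$ (i, j)\<bar>) \<le> (\<Sum>j<d. \<Sum>k<d. \<bar>A $$ (i, k)\<bar> * \<bar>B $$ (k, j)\<bar>)"
    using mat_mult_index_sum[OF A B i] by (intro sum_mono) (auto simp: abs_mult[symmetric] intro!: sum_abs)
  also have "\<dots> = (\<Sum>k<d. \<bar>A $$ (i, k)\<bar> * (\<Sum>j<d. \<bar>B $$ (k, j)\<bar>))"
    by (subst sum.swap) (simp only: sum_distrib_left)
  also have "\<dots> \<le> (\<Sum>k<d. \<bar>A $$ (i, k)\<bar> * mat_norm B)"
    by (intro sum_mono mult_left_mono row_sum_le_mat_norm[OF B]) auto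
  also have "\<dots> = (\<Sum>k<d. \<bar>A $$ (i, k)\<bar>) * mat_norm B" by (simp only: sum_distrib_right)
  also have "\<dots> \<le> mat_norm A * mat_norm B"
    by (intro mult_right_mono row_sum_le_mat_norm[OF A i] mat_norm_nonneg[OF B d])
  finally show "(\<Sum>j<d. \<bar>(A * B) $$ (i, j)\<bar>) \<le> mat_norm A * mat_norm B" .
qed

lemma mat_vec_le_mat_norm:
  assumes A: "A \<in> carrier_mat d d" and v: "v \<in> carrier_vec d" and i: "i < d" and R: "\<And>k. k < d \<Longrightarrow> \<bar>v $ k\<bar> \<le> R"
  shows "\<bar>(A *\<^sub>v v) $ i\<bar> \<le> mat_norm A * R"
proof -
  have R0: "0 \<le> R" using R[OF i] by linarith
  have "\<bar>(A *\<^sub>v v) $ i\<bar> \<le> (\<Sum>k<d. \<bar>A $$ (i, k)\<bar> * R)"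
    unfolding mat_vec_index_sum[OF A v i] using R
    by (intro order_trans[OF sum_abs sum_mono]) (auto simp: abs_mult intro!: mult_left_mono)
  also have "\<dots> = (\<Sum>k<d. \<bar>A $$ (i, k)\<bar>) * R" by (simp only: sum_distrib_right)
  also have "\<dots> \<le> mat_norm A * R" by (intro mult_right_mono row_sum_le_mat_norm[OF A i] R0)
  finally show ?thesis .
qed

text \<open>With \<open>x\<close> listing the innovations backwards from the present, this is
  \<open>A\<^sub>0 A\<^sub>-\<^sub>1 ... A\<^sub>1\<^sub>-\<^sub>m\<close>.\<close>

definition gprod :: "nat \<Rightarrow> nat \<Rightarrow> (nat \<Rightarrow> real) \<Rightarrow> (nat \<Rightarrow> real) \<Rightarrow> nat \<Rightarrow> real mat" where
  "gprod p q \<theta> x m = foldr (\<lambda>k B. garch_matrix p q \<theta> (x k) * B) [0..<m] (1\<^sub>m (p + q - 1))"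

lemma garch_matrix_carrier [simp]: "garch_matrix p q \<theta> e \<in> carrier_mat (p + q - 1) (p + q - 1)"
  by (simp add: garch_matrix_def)

lemma foldr_mat_mult:
  fixes A :: "nat \<Rightarrow> real mat"
  assumes "\<And>k. A k \<in> carrier_mat d d" "C \<in> carrier_mat d d"
  shows "foldr (\<lambda>k B. A k * B) ks C = foldr (\<lambda>k B. A k * B) ks (1\<^sub>m d) * C \<and> foldr (\<lambda>k B. A k * B) ks (1\<^sub>m d) \<in> carrier_mat d d"
proof (induction ks)
  case (Cons k ks)
  then show ?case using assms by (auto simp: assoc_mult_mat[of _ d d _ d _ d] intro!: mult_carrier_mat)
qed (use left_mult_one_mat[OF assms(2)] in auto)

lemma gprod_carrier [simp]: "gprod p q \<theta> x m \<in> carrier_mat (p + q - 1) (p + q - 1)"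
  unfolding gprod_def
  by (rule conjunct2[OF foldr_mat_mult[where C = "1\<^sub>m (p + q - 1)", OF garch_matrix_carrier one_carrier_mat]])

lemmas carriers_Suc [simp] = garch_matrix_carrier[unfolded One_nat_def] gprod_carrier[unfolded One_nat_def]

lemma gprod_0: "gprod p q \<theta> x 0 = 1\<^sub>m (p + q - 1)"
  by (simp add: gprod_def)

lemma gprod_Suc: "gprod p q \<theta> x (Suc m) = gprod p q \<theta> x m * garch_matrix p q \<theta> (x m)"
proof -
  have "gprod p q \<theta> x (Suc m) = foldr (\<lambda>k B. garch_matrix p q \<theta> (x k) * B) [0..<m] (garch_matrix p q \<theta> (x m))"
    by (simp add: gprod_def right_mult_one_mat[OF garch_matrix_carrier, unfolded One_nat_def])
  then show ?thesis
    unfolding gprod_def[of p q \<theta> x m]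
    by (simp only: conjunct1[OF foldr_mat_mult[where C = "garch_matrix p q \<theta> (x m)", OF garch_matrix_carrier garch_matrix_carrier]])
qed

text \<open>The vector of the squared volatilities at times \<open>t + 1, ..., t - q + 2\<close>
  followed by the squared observations at times \<open>t, ..., t - p + 2\<close>, for which the
  model equations become an affine recursion of order one.\<close>

definition state_vec :: "nat \<Rightarrow> nat \<Rightarrow> (int \<Rightarrow> real) \<Rightarrow> (int \<Rightarrow> real) \<Rightarrow> int \<Rightarrow> real vec" where
  "state_vec p q s x t = vec (p + q - 1) (\<lambda>i. if i < q then (s (t + 1 - int i))\<^sup>2 else (x (t - int (i - q)))\<^sup>2)"

definition drift_vec :: "nat \<Rightarrow> nat \<Rightarrow> (nat \<Rightarrow> real) \<Rightarrow> real vec" where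
  "drift_vec p q \<theta> = vec (p + q - 1) (\<lambda>i. if i = 0 then \<theta> 0 else 0)"

lemma state_step:
  assumes pq: "p \<ge> 1" "q \<ge> 1" and x: "x t = s t * e"
    and rec: "(s (t + 1))\<^sup>2 = \<theta> 0 + (\<Sum>i=1..p. \<theta> i * (x (t + 1 - int i))\<^sup>2) + (\<Sum>j=1..q. \<theta> (p + j) * (s (t + 1 - int j))\<^sup>2)"
  shows "state_vec p q s x t = garch_matrix p q \<theta> e *\<^sub>v state_vec p q s x (t - 1) + drift_vec p q \<theta>"
proof (rule eq_vecI)
  let ?d = "p + q - 1" and ?G = "garch_matrix p q \<theta> e" and ?v = "state_vec p q s x (t - 1)"
  have vc: "?v \<in> carrier_vec ?d" by (simp add: state_vec_def)
  fix i assume "i < dim_vec (?G *\<^sub>v ?v + drift_vec p q \<theta>)"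
  then have i: "i < ?d" by (simp add: drift_vec_def)
  have rhs: "(?G *\<^sub>v ?v + drift_vec p q \<theta>) $ i = (\<Sum>k<?d. ?G $$ (i, k) * ?v $ k) + (if i = 0 then \<theta> 0 else 0)"
    using i by (subst index_add_vec(1)) (simp_all add: drift_vec_def mat_vec_index_sum[OF garch_matrix_carrier vc i])
  have vk: "?v $ k = (if k < q then (s (t - int k))\<^sup>2 else (x (t - 1 - int (k - q)))\<^sup>2)" if "k < ?d" for k
    using that by (simp add: state_vec_def)
  show "state_vec p q s x t $ i = (?G *\<^sub>v ?v + drift_vec p q \<theta>) $ i"
  proof (cases "i = 0")
    case True
    have split: "{..<?d} = {0} \<union> {1..<q} \<union> {q..<?d}" using pq by auto
    have "(\<Sum>k<?d. ?G $$ (0, k) * ?v $ k) = (\<Sum>k\<in>{0}. ?G $$ (0, k) * ?v $ k) + (\<Sum>k=1..<q. ?G $$ (0, k) * ?v $ k) + (\<Sum>k=q..<?d. ?G $$ (0, k) * ?v $ k)"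
      unfolding split using pq by (subst sum.union_disjoint; (subst sum.union_disjoint)?) auto
    also have "(\<Sum>k\<in>{0}. ?G $$ (0, k) * ?v $ k) = \<theta> (p + 1) * (s t)\<^sup>2 + \<theta> 1 * (x t)\<^sup>2"
      using pq i True vk[of 0] by (simp add: garch_matrix_def x power_mult_distrib algebra_simps)
    also have "(\<Sum>k=1..<q. ?G $$ (0, k) * ?v $ k) = (\<Sum>j=2..q. \<theta> (p + j) * (s (t + 1 - int j))\<^sup>2)"
      by (rule sum.reindex_bij_witness[of _ "\<lambda>j. j - 1" Suc])
         (use pq vk in \<open>auto simp: garch_matrix_def of_nat_diff algebra_simps\<close>)
    also have "(\<Sum>k=q..<?d. ?G $$ (0, k) * ?v $ k) = (\<Sum>i=2..p. \<theta> i * (x (t + 1 - int i))\<^sup>2)"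
      by (rule sum.reindex_bij_witness[of _ "\<lambda>i. i + q - 2" "\<lambda>k. k - q + 2"])
         (use pq vk in \<open>auto simp: garch_matrix_def of_nat_diff algebra_simps\<close>)
    finally have 1: "(\<Sum>k<?d. ?G $$ (0, k) * ?v $ k) = \<theta> (p + 1) * (s t)\<^sup>2 + \<theta> 1 * (x t)\<^sup>2
      + (\<Sum>j=2..q. \<theta> (p + j) * (s (t + 1 - int j))\<^sup>2) + (\<Sum>i=2..p. \<theta> i * (x (t + 1 - int i))\<^sup>2)" .
    have 2: "(\<Sum>i=1..p. \<theta> i * (x (t + 1 - int i))\<^sup>2) = \<theta> 1 * (x t)\<^sup>2 + (\<Sum>i=2..p. \<theta> i * (x (t + 1 - int i))\<^sup>2)"
      using pq by (subst sum.atLeast_Suc_atMost) (auto simp: numeral_2_eq_2)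
    have 3: "(\<Sum>j=1..q. \<theta> (p + j) * (s (t + 1 - int j))\<^sup>2) = \<theta> (p + 1) * (s t)\<^sup>2 + (\<Sum>j=2..q. \<theta> (p + j) * (s (t + 1 - int j))\<^sup>2)"
      using pq by (subst sum.atLeast_Suc_atMost) (auto simp: numeral_2_eq_2)
    have "state_vec p q s x t $ i = (s (t + 1))\<^sup>2" using True i pq by (simp add: state_vec_def)
    then show ?thesis unfolding rhs using rec 1 2 3 True by simp
  next
    case False
    have G: "?G $$ (i, k) = (if i = q then (if k = 0 then e\<^sup>2 else 0) else (if i = k + 1 then 1 else 0))" if "k < ?d" for k
      using that False i by (simp add: garch_matrix_def)
    show ?thesis
    proof (cases "i = q")
      case True
      have "(\<Sum>k<?d. ?G $$ (i, k) * ?v $ k) = (\<Sum>k<?d. if k = 0 then e\<^sup>2 * ?v $ 0 else 0)"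
        using True G by (intro sum.cong) auto
      also have "\<dots> = e\<^sup>2 * (s t)\<^sup>2" using i pq vk[of 0] by (simp add: sum.delta)
      finally show ?thesis unfolding rhs using True False i pq x by (simp add: state_vec_def power_mult_distrib)
    next
      case nq: False
      have "(\<Sum>k<?d. ?G $$ (i, k) * ?v $ k) = (\<Sum>k<?d. if k = i - 1 then ?v $ (i - 1) else 0)"
        using nq False G by (intro sum.cong) auto
      also have "\<dots> = ?v $ (i - 1)" using i by (simp add: sum.delta)
      also have "\<dots> = state_vec p q s x t $ i"
        using i False nq vk[of "i - 1"] by (auto simp: state_vec_def of_nat_diff algebra_simps)
      finally show ?thesis unfolding rhs using False by simp
    qed
  qed
qed (simp add: state_vec_def drift_vec_def)

lemma state_iterate:
  assumes step: "\<And>k. Y k = garch_matrix p q \<theta> (x k) *\<^sub>v Y (Suc k) + drift_vec p q \<theta>"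
    and Y: "\<And>k. Y k \<in> carrier_vec (p + q - 1)" and i: "i < p + q - 1"
  shows "Y 0 $ i = (gprod p q \<theta> x m *\<^sub>v Y m) $ i + (\<Sum>k<m. (gprod p q \<theta> x k *\<^sub>v drift_vec p q \<theta>) $ i)"
proof (induction m)
  case 0
  show ?case using Y[of 0] by (simp add: gprod_0)
next
  case (Suc m)
  let ?d = "p + q - 1" and ?P = "gprod p q \<theta> x m" and ?G = "garch_matrix p q \<theta> (x m)"
  have dc: "drift_vec p q \<theta> \<in> carrier_vec ?d" by (simp add: drift_vec_def)
  have "?P *\<^sub>v Y m = ?P *\<^sub>v (?G *\<^sub>v Y (Suc m) + drift_vec p q \<theta>)" using step[of m] by simp
  also have "\<dots> = ?P *\<^sub>v (?G *\<^sub>v Y (Suc m)) + ?P *\<^sub>v drift_vec p q \<theta>"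
    by (rule mult_add_distrib_mat_vec[OF gprod_carrier mult_mat_vec_carrier[OF garch_matrix_carrier Y] dc])
  also have "?P *\<^sub>v (?G *\<^sub>v Y (Suc m)) = gprod p q \<theta> x (Suc m) *\<^sub>v Y (Suc m)"
    unfolding gprod_Suc by (rule assoc_mult_mat_vec[symmetric, OF gprod_carrier garch_matrix_carrier Y])
  finally have eq: "?P *\<^sub>v Y m = gprod p q \<theta> x (Suc m) *\<^sub>v Y (Suc m) + ?P *\<^sub>v drift_vec p q \<theta>" .
  have "i < dim_vec (?P *\<^sub>v drift_vec p q \<theta>)" using i carrier_matD(1)[OF gprod_carrier, of p q \<theta> x m] by simp
  then have "(?P *\<^sub>v Y m) $ i = (gprod p q \<theta> x (Suc m) *\<^sub>v Y (Suc m)) $ i + (?P *\<^sub>v drift_vec p q \<theta>) $ i"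
    unfolding eq by (rule index_add_vec(1))
  then show ?case using Suc by simp
qed

text \<open>Taking the largest entry turns the affine vector recursion over \<open>m\<close> steps
  into a scalar inequality (\<open>state_max_recursion\<close>). Its coefficients are the norms of
  the matrix products whose logarithmic growth the Lyapunov exponent describes.\<close>

definition state_max :: "nat \<Rightarrow> nat \<Rightarrow> (int \<Rightarrow> real) \<Rightarrow> (int \<Rightarrow> real) \<Rightarrow> int \<Rightarrow> real" where
  "state_max p q s x t = Max ((\<lambda>i. state_vec p q s x t $ i) ` {..<p + q - 1})"

lemma state_vec_nonneg: "i < p + q - 1 \<Longrightarrow> 0 \<le> state_vec p q s x t $ i"
  by (simp add: state_vec_def)

lemma state_vec_le_max: "i < p + q - 1 \<Longrightarrow> state_vec p q s x t $ i \<le> state_max p q s x t"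
  unfolding state_max_def by (intro Max_ge) auto

lemma sigma_le_state_max:
  assumes "p \<ge> 1" "q \<ge> 1"
  shows "(s (t + 1))\<^sup>2 \<le> state_max p q s x t"
  using state_vec_le_max[of 0 p q s x t] assms by (simp add: state_vec_def)

lemma state_max_nonneg: "p \<ge> 1 \<Longrightarrow> q \<ge> 1 \<Longrightarrow> 0 \<le> state_max p q s x t"
  using order_trans[OF zero_le_power2 sigma_le_state_max] .

definition prod_norm :: "nat \<Rightarrow> nat \<Rightarrow> (nat \<Rightarrow> real) \<Rightarrow> nat \<Rightarrow> (nat \<Rightarrow> real) \<Rightarrow> real" where
  "prod_norm p q \<theta> m x = mat_norm (gprod p q \<theta> x m)"

lemma prod_norm_nonneg: "p \<ge> 1 \<Longrightarrow> q \<ge> 1 \<Longrightarrow> 0 \<le> prod_norm p q \<theta> m x"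
  unfolding prod_norm_def by (intro mat_norm_nonneg[OF gprod_carrier]) simp

lemma state_max_recursion:
  assumes pq: "p \<ge> 1" "q \<ge> 1" and th0: "0 \<le> \<theta> 0" and x: "\<And>t. x t = s t * e t"
    and rec: "\<And>t. (s t)\<^sup>2 = \<theta> 0 + (\<Sum>i=1..p. \<theta> i * (x (t - int i))\<^sup>2) + (\<Sum>j=1..q. \<theta> (p + j) * (s (t - int j))\<^sup>2)"
  shows "state_max p q s x t \<le> prod_norm p q \<theta> m (\<lambda>k. e (t - int k)) * state_max p q s x (t - int m)
     + \<theta> 0 * (\<Sum>k<m. prod_norm p q \<theta> k (\<lambda>k. e (t - int k)))"
proof -
  let ?d = "p + q - 1" and ?y = "\<lambda>k. e (t - int k)"
  have d: "0 < ?d" using pq by simp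
  define Y where "Y k = state_vec p q s x (t - int k)" for k
  have Yc: "Y k \<in> carrier_vec ?d" for k by (simp add: Y_def state_vec_def)
  have dc: "drift_vec p q \<theta> \<in> carrier_vec ?d" by (simp add: drift_vec_def)
  have step: "Y k = garch_matrix p q \<theta> (?y k) *\<^sub>v Y (Suc k) + drift_vec p q \<theta>" for k
    using state_step[OF pq x rec, of "t - int k"] by (simp add: Y_def algebra_simps)
  show ?thesis
    unfolding state_max_def[of p q s x t]
  proof (rule Max.boundedI)
    show "finite ((\<lambda>i. state_vec p q s x t $ i) ` {..<?d})" by simp
    show "(\<lambda>i. state_vec p q s x t $ i) ` {..<?d} \<noteq> {}" using d by (simp add: lessThan_empty_iff)
    fix a assume "a \<in> (\<lambda>i. state_vec p q s x t $ i) ` {..<?d}"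
    then obtain i where i: "i < ?d" and ai: "a = state_vec p q s x t $ i" by auto
    have "a = (gprod p q \<theta> ?y m *\<^sub>v Y m) $ i + (\<Sum>k<m. (gprod p q \<theta> ?y k *\<^sub>v drift_vec p q \<theta>) $ i)"
      unfolding ai using state_iterate[where Y = Y and x = ?y and m = m, OF step Yc i] by (simp add: Y_def)
    also have "\<dots> \<le> prod_norm p q \<theta> m ?y * state_max p q s x (t - int m) + (\<Sum>k<m. prod_norm p q \<theta> k ?y * \<theta> 0)"
    proof (intro add_mono sum_mono)
      show "(gprod p q \<theta> ?y m *\<^sub>v Y m) $ i \<le> prod_norm p q \<theta> m ?y * state_max p q s x (t - int m)"
        unfolding prod_norm_def
        using state_vec_le_max[of _ p q s x "t - int m"] state_vec_nonneg[of _ p q s x "t - int m"]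
        by (intro order_trans[OF abs_ge_self mat_vec_le_mat_norm[OF gprod_carrier Yc i]]) (simp add: Y_def)
      show "(gprod p q \<theta> ?y k *\<^sub>v drift_vec p q \<theta>) $ i \<le> prod_norm p q \<theta> k ?y * \<theta> 0" for k
        unfolding prod_norm_def
        by (intro order_trans[OF abs_ge_self mat_vec_le_mat_norm[OF gprod_carrier dc i]]) (use th0 in \<open>auto simp: drift_vec_def\<close>)
    qed
    also have "(\<Sum>k<m. prod_norm p q \<theta> k ?y * \<theta> 0) = \<theta> 0 * (\<Sum>k<m. prod_norm p q \<theta> k ?y)"
      by (simp add: sum_distrib_left mult.commute)
    finally show "a \<le> prod_norm p q \<theta> m ?y * state_max p q s x (t - int m) + \<theta> 0 * (\<Sum>k<m. prod_norm p q \<theta> k ?y)" .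
  qed
qed

lemma garch_matrix_norm_bound:
  assumes pq: "p \<ge> 1" "q \<ge> 1"
  shows "\<exists>C\<ge>0. \<forall>e. mat_norm (garch_matrix p q \<theta> e) \<le> C * (1 + e\<^sup>2)"
proof -
  let ?d = "p + q - 1"
  define B where "B = (\<Sum>l\<le>p + q. \<bar>\<theta> l\<bar>) + 1"
  have B: "\<bar>\<theta> l\<bar> \<le> B" if "l \<le> p + q" for l
    using member_le_sum[of l "{..p + q}" "\<lambda>l. \<bar>\<theta> l\<bar>"] that by (simp add: B_def)
  have B1: "1 \<le> B" by (simp add: B_def sum_nonneg)
  have ent: "\<bar>garch_matrix p q \<theta> e $$ (i, j)\<bar> \<le> B * (1 + e\<^sup>2)" if ij: "i < ?d" "j < ?d" for i j e
  proof -
    have e1: "B * 1 \<le> B * (1 + e\<^sup>2)" "B * e\<^sup>2 \<le> B * (1 + e\<^sup>2)" using B1 by (auto intro!: mult_left_mono)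
    have e2: "e\<^sup>2 \<le> B * e\<^sup>2" using mult_right_mono[OF B1, of "e\<^sup>2"] by simp
    have "\<bar>\<theta> (p + 1) + \<theta> 1 * e\<^sup>2\<bar> \<le> B * (1 + e\<^sup>2)"
    proof -
      have "\<bar>\<theta> (p + 1) + \<theta> 1 * e\<^sup>2\<bar> \<le> \<bar>\<theta> (p + 1)\<bar> + \<bar>\<theta> 1\<bar> * e\<^sup>2"
        using abs_triangle_ineq[of "\<theta> (p + 1)" "\<theta> 1 * e\<^sup>2"] by (simp add: abs_mult)
      also have "\<dots> \<le> B + B * e\<^sup>2" using pq by (intro add_mono mult_right_mono B) auto
      finally show ?thesis by (simp add: distrib_left)
    qed
    moreover have "\<bar>\<theta> (p + j + 1)\<bar> \<le> B * (1 + e\<^sup>2)" if "j < q" using B[of "p + j + 1"] e1 that by simp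
    moreover have "\<bar>\<theta> (j - q + 2)\<bar> \<le> B * (1 + e\<^sup>2)" 
    proof -
      have "j - q + 2 \<le> p + q" using ij pq by linarith
      from B[OF this] e1 show ?thesis by linarith
    qed
    moreover have "e\<^sup>2 \<le> B * (1 + e\<^sup>2)" "1 \<le> B * (1 + e\<^sup>2)" "0 \<le> B * (1 + e\<^sup>2)" using e1 e2 B1 by linarith+
    ultimately show ?thesis using ij by (auto simp: garch_matrix_def)
  qed
  have "mat_norm (garch_matrix p q \<theta> e) \<le> (real ?d * B) * (1 + e\<^sup>2)" for e
  proof (rule mat_norm_leI[OF garch_matrix_carrier])
    fix i assume i: "i < ?d"
    have "(\<Sum>j<?d. \<bar>garch_matrix p q \<theta> e $$ (i, j)\<bar>) \<le> (\<Sum>j<?d. B * (1 + e\<^sup>2))"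
      by (intro sum_mono ent i) auto
    then show "(\<Sum>j<?d. \<bar>garch_matrix p q \<theta> e $$ (i, j)\<bar>) \<le> (real ?d * B) * (1 + e\<^sup>2)" by (simp add: mult_ac)
  qed (use pq in simp)
  moreover have "0 \<le> real ?d * B" using B1 by simp
  ultimately show ?thesis by blast
qed

lemma prod_norm_bound:
  assumes pq: "p \<ge> 1" "q \<ge> 1" and C: "C \<ge> 0" "\<And>e. mat_norm (garch_matrix p q \<theta> e) \<le> C * (1 + e\<^sup>2)"
  shows "prod_norm p q \<theta> m x \<le> (\<Prod>k<m. C * (1 + (x k)\<^sup>2))"
proof (induction m)
  case 0
  have "mat_norm (1\<^sub>m (p + q - 1)) \<le> 1"
    by (rule mat_norm_leI[of _ "p + q - 1"]) (use pq in \<open>auto simp: if_distrib[of abs] sum.delta cong: if_cong\<close>)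
  then show ?case by (simp add: prod_norm_def gprod_0)
next
  case (Suc m)
  have "prod_norm p q \<theta> (Suc m) x \<le> prod_norm p q \<theta> m x * mat_norm (garch_matrix p q \<theta> (x m))"
    unfolding prod_norm_def gprod_Suc using pq by (intro mat_norm_mult_le[OF gprod_carrier garch_matrix_carrier]) auto
  also have "\<dots> \<le> (\<Prod>k<m. C * (1 + (x k)\<^sup>2)) * (C * (1 + (x m)\<^sup>2))"
    using Suc C pq by (intro mult_mono mat_norm_nonneg[OF garch_matrix_carrier] prod_nonneg) auto
  finally show ?case by simp
qed

lemma prod_norm_measurable:
  assumes pq: "p \<ge> 1" "q \<ge> 1"
  shows "prod_norm p q \<theta> m \<in> borel_measurable (PiM UNIV (\<lambda>_::nat. borel))"
proof -
  let ?d = "p + q - 1" and ?N = "PiM UNIV (\<lambda>_::nat. borel) :: (nat \<Rightarrow> real) measure"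
  have comp: "(\<lambda>x. x k) \<in> borel_measurable ?N" for k by (rule measurable_component_singleton) simp
  have G: "(\<lambda>x. garch_matrix p q \<theta> (x k) $$ (i, j)) \<in> borel_measurable ?N" if "i < ?d" "j < ?d" for i j k
    using that by (simp add: garch_matrix_def)
  have P: "(\<lambda>x. gprod p q \<theta> x m $$ (i, j)) \<in> borel_measurable ?N" if "i < ?d" "j < ?d" for i j
    using that
  proof (induction m arbitrary: i j)
    case 0
    then show ?case by (simp add: gprod_0)
  next
    case (Suc m)
    have "(\<lambda>x. gprod p q \<theta> x (Suc m) $$ (i, j)) = (\<lambda>x. \<Sum>k<?d. gprod p q \<theta> x m $$ (i, k) * garch_matrix p q \<theta> (x m) $$ (k, j))"
      using Suc.prems by (intro ext) (simp only: gprod_Suc mat_mult_index_sum[OF gprod_carrier garch_matrix_carrier])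
    also have "\<dots> \<in> borel_measurable ?N"
      using Suc G by (intro borel_measurable_sum borel_measurable_times) auto
    finally show ?case .
  qed
  have "prod_norm p q \<theta> m = (\<lambda>x. Max ((\<lambda>i. \<Sum>j<?d. \<bar>gprod p q \<theta> x m $$ (i, j)\<bar>) ` {..<?d}))"
    using carrier_matD[OF gprod_carrier] by (intro ext) (simp add: prod_norm_def mat_norm_def)
  also have "\<dots> \<in> borel_measurable ?N"
    by (intro borel_measurable_Max borel_measurable_sum borel_measurable_abs P) auto
  finally show ?thesis .
qed

lemma prod_norm_cong:
  assumes "\<And>k. k < m \<Longrightarrow> x k = y k"
  shows "prod_norm p q \<theta> m x = prod_norm p q \<theta> m y"
  unfolding prod_norm_def gprod_def using assms by (intro arg_cong[of _ _ mat_norm] foldr_cong) auto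

section \<open>A fractional moment of the volatility\<close>

lemma powr_add_le:
  fixes a b s :: real
  assumes "0 \<le> a" "0 \<le> b" "0 < s" "s \<le> 1"
  shows "(a + b) powr s \<le> a powr s + b powr s"
proof (cases "a + b = 0")
  case False
  then have ab: "0 < a + b" using assms by auto
  have *: "x / (a + b) \<le> (x / (a + b)) powr s" if "0 \<le> x" "x \<le> a + b" for x
  proof -
    have "x / (a + b) = (x / (a + b)) powr 1" using that ab by simp
    also have "\<dots> \<le> (x / (a + b)) powr s" using that ab assms by (intro powr_mono') auto
    finally show ?thesis .
  qed
  have "1 = a / (a + b) + b / (a + b)" using ab by (simp add: add_divide_distrib[symmetric])
  also have "\<dots> \<le> (a / (a + b)) powr s + (b / (a + b)) powr s" using assms by (intro add_mono *) auto
  also have "\<dots> = (a powr s + b powr s) / (a + b) powr s" using assms ab by (simp add: powr_divide add_divide_distrib)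
  finally show ?thesis using ab by (simp add: field_simps)
qed (use assms in auto)

text \<open>The derivative of \<open>s \<mapsto> E (l powr s)\<close> at 0 is \<open>E (ln l) <
  0\<close>. As \<open>E (ln l)\<close> may be \<open>- \<infinity>\<close>, the logarithm is first
  truncated from below at a level \<open>- K\<close> that keeps the mean negative; the difference
  quotients of the truncated variable \<open>Z\<close> lie between \<open>Z\<close> and \<open>exp Z
  - 1\<close>, so the limit may be taken inside the integral.\<close>

lemma (in prob_space) log_moment_contraction:
  fixes l :: "'a \<Rightarrow> real"
  assumes l: "integrable M l" "\<And>x. 0 \<le> l x" and neg: "ext_expectation M (\<lambda>x. ext_ln (l x)) < 0"
  shows "\<exists>s. 0 < s \<and> s \<le> 1 \<and> (\<integral>\<^sup>+x. ennreal (l x powr s) \<partial>M) < 1"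
proof -
  have lm[measurable]: "l \<in> borel_measurable M" using l(1) by simp
  define fp where "fp x = (if l x \<le> 0 then 0 else max 0 (ln (l x)))" for x
  define fm where "fm K x = (if l x \<le> 0 then real K else min (real K) (max 0 (- ln (l x))))" for K x
  have [measurable]: "fp \<in> borel_measurable M" "\<And>K. fm K \<in> borel_measurable M"
    unfolding fp_def fm_def by measurable
  have fp0: "0 \<le> fp x" and fm0: "0 \<le> fm K x" for x K by (auto simp: fp_def fm_def)
  have e1: "e2ennreal (ext_ln (l x)) = ennreal (fp x)" for x
    unfolding ext_ln_def fp_def by (auto simp: e2ennreal_ereal e2ennreal_neg max_def ennreal_neg)
  have e2: "e2ennreal (- ext_ln (l x)) = (SUP K. ennreal (fm K x))" for x
  proof (cases "l x \<le> 0")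
    case True
    have S: "(SUP K. ennreal (real K)) = \<top>"
      unfolding ennreal_of_nat_eq_real_of_nat[symmetric] by (rule ennreal_SUP_of_nat_eq_top)
    have "(SUP K. ennreal (fm K x)) = \<top>" using S by (simp only: fm_def True if_True)
    then show ?thesis by (simp only:) (simp add: ext_ln_def True)
  next
    case False
    obtain N :: nat where N: "max 0 (- ln (l x)) \<le> real N" using real_arch_simple by blast
    have "(SUP K. ennreal (fm K x)) = ennreal (max 0 (- ln (l x)))"
    proof (rule antisym)
      show "(SUP K. ennreal (fm K x)) \<le> ennreal (max 0 (- ln (l x)))"
        using False by (intro SUP_least ennreal_leI) (auto simp: fm_def)
      have "fm N x = max 0 (- ln (l x))" using False N by (auto simp: fm_def min_def)
      then show "ennreal (max 0 (- ln (l x))) \<le> (SUP K. ennreal (fm K x))" by (metis SUP_upper UNIV_I)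
    qed
    then show ?thesis using False by (auto simp: ext_ln_def e2ennreal_ereal max_def ennreal_neg)
  qed
  have fple: "fp x \<le> l x" for x
    using ln_le_minus_one[of "l x"] l(2)[of x] by (auto simp: fp_def max_def)
  have ifp: "integrable M fp" by (rule Bochner_Integration.integrable_bound[OF l(1)]) (use fple fp0 l(2) in auto)
  have fmK: "fm K x \<le> real K" for K x by (auto simp: fm_def)
  have ifm: "integrable M (fm K)" for K by (rule integrable_const_bound[of _ "real K"]) (use fm0 fmK in auto)
  have I1: "(\<integral>\<^sup>+x. e2ennreal (ext_ln (l x)) \<partial>M) = ennreal (expectation fp)"
    unfolding e1 by (rule nn_integral_eq_integral[OF ifp]) (use fp0 in auto)
  have I2: "(\<integral>\<^sup>+x. e2ennreal (- ext_ln (l x)) \<partial>M) = (SUP K. ennreal (expectation (fm K)))"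
  proof -
    have e3: "(\<integral>\<^sup>+x. ennreal (fm K x) \<partial>M) = ennreal (expectation (fm K))" for K
      by (rule nn_integral_eq_integral[OF ifm]) (use fm0 in auto)
    have "(\<integral>\<^sup>+x. e2ennreal (- ext_ln (l x)) \<partial>M) = (SUP K. \<integral>\<^sup>+x. ennreal (fm K x) \<partial>M)"
      unfolding e2
      by (rule nn_integral_monotone_convergence_SUP) (auto simp: incseq_def le_fun_def fm_def intro!: ennreal_leI)
    then show ?thesis unfolding e3 .
  qed
  have "ennreal (expectation fp) < (SUP K. ennreal (expectation (fm K)))"
  proof (rule ccontr)
    assume "\<not> ?thesis"
    then have le: "enn2ereal (SUP K. ennreal (expectation (fm K))) \<le> enn2ereal (ennreal (expectation fp))"
      by (simp add: less_eq_ennreal.rep_eq[symmetric])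
    have fin: "\<bar>enn2ereal (ennreal (expectation fp))\<bar> \<noteq> \<infinity>" by simp
    have "0 \<le> enn2ereal (ennreal (expectation fp)) - enn2ereal (SUP K. ennreal (expectation (fm K)))"
      using le fin by (cases "enn2ereal (SUP K. ennreal (expectation (fm K)))"; cases "enn2ereal (ennreal (expectation fp))") auto
    then show False using neg unfolding ext_expectation_def I1 I2 by simp
  qed
  then obtain K where "ennreal (expectation fp) < ennreal (expectation (fm K))" by (auto simp: less_SUP_iff)
  then have K: "expectation fp < expectation (fm K)" by (simp add: ennreal_less_iff integral_nonneg_AE fp0)
  define Z where "Z x = fp x - fm K x" for x
  have Zm[measurable]: "Z \<in> borel_measurable M" unfolding Z_def by measurable
  have iZ: "integrable M Z" unfolding Z_def using ifp ifm by auto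
  have EZ: "expectation Z < 0" unfolding Z_def using K ifp ifm by simp
  have Zexp: "exp (Z x) \<le> l x + 1" for x
  proof (cases "l x \<le> 1")
    case True
    then have "fp x = 0" by (auto simp: fp_def max_def ln_le_zero_iff)
    then have "exp (Z x) \<le> 1" using fm0 by (simp add: Z_def)
    then show ?thesis using l(2)[of x] by linarith
  next
    case False
    then have "fm K x = 0" "fp x = ln (l x)" by (auto simp: fp_def fm_def max_def)
    then have "exp (Z x) = l x" using False by (simp add: Z_def)
    then show ?thesis by simp
  qed
  define g where "g n x = real (Suc n) * (exp (Z x / real (Suc n)) - 1)" for n x
  have gm[measurable]: "g n \<in> borel_measurable M" for n unfolding g_def by measurable
  have glow: "Z x \<le> g n x" for n x
  proof -
    have "1 + Z x / real (Suc n) \<le> exp (Z x / real (Suc n))" by (rule exp_ge_add_one_self)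
    then have "Z x / real (Suc n) \<le> exp (Z x / real (Suc n)) - 1" by linarith
    then have "real (Suc n) * (Z x / real (Suc n)) \<le> g n x" unfolding g_def by (rule mult_left_mono) simp
    then show ?thesis by simp
  qed
  have gup: "g n x \<le> exp (Z x) - 1" for n x
  proof -
    have "1 + real (Suc n) * (exp (Z x / real (Suc n)) - 1) \<le> (1 + (exp (Z x / real (Suc n)) - 1)) ^ Suc n"
      by (rule Bernoulli_inequality) (simp add: less_imp_le)
    also have "\<dots> = exp (real (Suc n) * (Z x / real (Suc n)))" by (simp only: add_diff_cancel_left' exp_of_nat_mult add_diff_eq)
    also have "\<dots> = exp (Z x)" by simp
    finally show ?thesis by (simp add: g_def)
  qed
  have gabs: "\<bar>g n x\<bar> \<le> \<bar>Z x\<bar> + l x + 1" for n x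
    using glow[of x n] gup[of n x] Zexp[of x] l(2)[of x] by linarith
  have lim: "(\<lambda>n. g n x) \<longlonglongrightarrow> Z x" for x
  proof -
    have "((\<lambda>h. (exp (0 + h) - exp 0) / h) \<longlongrightarrow> exp 0) (at (0::real))" using DERIV_exp[of 0] by (simp only: DERIV_def)
    then have d: "((\<lambda>h. (exp h - 1) / h) \<longlongrightarrow> 1) (at (0::real))" by simp
    show ?thesis
    proof (cases "Z x = 0")
      case False
      have s: "(\<lambda>n. Z x / real (Suc n)) \<longlonglongrightarrow> 0" by (rule LIMSEQ_Suc) (rule lim_const_over_n)
      have "filterlim (\<lambda>n. Z x / real (Suc n)) (at 0) sequentially"
        using s False by (auto simp: filterlim_at intro!: always_eventually)
      from filterlim_compose[OF d this] have "(\<lambda>n. (exp (Z x / real (Suc n)) - 1) / (Z x / real (Suc n))) \<longlonglongrightarrow> 1" .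
      from tendsto_mult_left[OF this, of "Z x"] show ?thesis using False by (simp add: g_def mult.commute)
    qed (simp add: g_def)
  qed
  have "(\<lambda>n. expectation (g n)) \<longlonglongrightarrow> expectation Z"
    by (rule integral_dominated_convergence[where w = "\<lambda>x. \<bar>Z x\<bar> + l x + 1"]) (use iZ l(1) lim gabs in auto)
  then have "eventually (\<lambda>n. expectation (g n) < 0) sequentially" using EZ by (rule order_tendstoD(2))
  then obtain n where n: "expectation (g n) < 0" by (auto simp: eventually_sequentially)
  define s where "s = 1 / real (Suc n)"
  have s: "0 < s" "s \<le> 1" by (auto simp: s_def)
  have ig: "integrable M (g n)"
    by (rule Bochner_Integration.integrable_bound[of _ "\<lambda>x. \<bar>Z x\<bar> + l x + 1"]) (use iZ l gabs in auto)
  have ex: "exp (Z x * s) = 1 + g n x * s" for x by (simp add: g_def s_def)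
  have iex: "integrable M (\<lambda>x. exp (Z x * s))" unfolding ex using ig by simp
  have "expectation (\<lambda>x. exp (Z x * s)) = 1 + expectation (g n) * s" unfolding ex using ig by (simp add: prob_space)
  then have lt: "expectation (\<lambda>x. exp (Z x * s)) < 1" using n s by (simp add: mult_neg_pos)
  have pw: "l x powr s \<le> exp (Z x * s)" for x
  proof (cases "l x = 0")
    case False
    then have lx: "0 < l x" using l(2)[of x] by simp
    have "ln (l x) \<le> Z x" using lx by (auto simp: Z_def fp_def fm_def max_def min_def)
    then have "ln (l x) * s \<le> Z x * s" using s by (intro mult_right_mono) auto
    then show ?thesis using lx by (simp add: powr_def mult.commute)
  qed simp
  have "(\<integral>\<^sup>+x. ennreal (l x powr s) \<partial>M) \<le> (\<integral>\<^sup>+x. ennreal (exp (Z x * s)) \<partial>M)"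
    by (intro nn_integral_mono ennreal_leI pw)
  also have "\<dots> = ennreal (expectation (\<lambda>x. exp (Z x * s)))" by (rule nn_integral_eq_integral[OF iex]) simp
  also have "\<dots> < 1" using lt by (simp add: ennreal_less_one_iff)
  finally show ?thesis using s by blast
qed

text \<open>The windows of length \<open>m\<close> that end at \<open>t, t - m, t - 2 * m,
  ...\<close> are disjoint.\<close>

lemma (in iid_seq) indep_block_functions:
  fixes h :: "nat \<Rightarrow> (nat \<Rightarrow> real) \<Rightarrow> real"
  assumes dep: "\<And>j. depends_on m (h j)" and m: "\<And>j. h j \<in> borel_measurable seqM"
  shows "indep_vars (\<lambda>_. borel) (\<lambda>j \<omega>. h j (past (t - int (j * m)) \<omega>)) (UNIV :: nat set)"
proof -
  let ?A = "\<lambda>j::nat. {t - int (j * m) - int m<..t - int (j * m)}"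
  have "indep_vars (\<lambda>j. PiM (?A j) (\<lambda>_. borel)) (\<lambda>j \<omega>. restrict (\<lambda>i. \<epsilon> i \<omega>) (?A j)) (UNIV :: nat set)"
  proof (rule indep_vars_restrict[OF indep_eps])
    show "disjoint_family_on ?A (UNIV :: nat set)"
    proof -
      have "?A i \<inter> ?A j = {}" if "i < j" for i j
      proof -
        have "Suc i * m \<le> j * m" using that by (intro mult_le_mono1) auto
        from of_nat_mono[OF this, where ?'a = int] have "int (i * m) + int m \<le> int (j * m)"
          by (simp only: mult_Suc of_nat_add add.commute)
        then show ?thesis by auto
      qed
      then show ?thesis unfolding disjoint_family_on_def by (metis Int_commute linorder_neqE_nat)
    qed
  qed auto
  then have "indep_vars (\<lambda>_. borel) (\<lambda>j \<omega>. (h j \<circ> window m (t - int (j * m))) (restrict (\<lambda>i. \<epsilon> i \<omega>) (?A j))) (UNIV :: nat set)"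
    by (rule indep_vars_compose2) (intro measurable_comp[OF window_measurable m] order_refl)
  then show ?thesis by (simp add: depends_on_window[OF dep order_refl, symmetric])
qed

text \<open>The solution enters only through the function \<open>f\<close> that expresses the
  volatility by the innovations strictly before it. All further quantities thereby become functions
  of the past, for which stationarity and the laws of large numbers are available.\<close>

locale causal_garch = iid_seq M \<epsilon> for M :: "'a measure" and \<epsilon> +
  fixes p q :: nat and \<theta> :: "nat \<Rightarrow> real" and f :: "(nat \<Rightarrow> real) \<Rightarrow> real"
  assumes pq: "p \<ge> 1" "q \<ge> 1"
    and th: "\<And>l. l < p + q + 1 \<Longrightarrow> 0 < \<theta> l"
    and f_meas [measurable]: "f \<in> borel_measurable seqM"
    and sq_int: "integrable M (\<lambda>\<omega>. (\<epsilon> 0 \<omega>)\<^sup>2)"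
    and lyap: "lyapunov_exponent M p q \<theta> \<epsilon> < 0"
    and eqs: "AE \<omega> in M. \<forall>t. 0 \<le> f (past (t - 1) \<omega>) \<and> (f (past (t - 1) \<omega>))\<^sup>2 = \<theta> 0
       + (\<Sum>i=1..p. \<theta> i * (f (past (t - int i - 1) \<omega>) * \<epsilon> (t - int i) \<omega>)\<^sup>2)
       + (\<Sum>j=1..q. \<theta> (p + j) * (f (past (t - int j - 1) \<omega>))\<^sup>2)"
begin

definition sig :: "'a \<Rightarrow> int \<Rightarrow> real" where "sig \<omega> t = f (past (t - 1) \<omega>)"
definition obs :: "'a \<Rightarrow> int \<Rightarrow> real" where "obs \<omega> t = sig \<omega> t * \<epsilon> t \<omega>"

definition solution :: "'a \<Rightarrow> bool" where
  "solution \<omega> \<longleftrightarrow> (\<forall>t. 0 \<le> sig \<omega> t \<and> (sig \<omega> t)\<^sup>2 = \<theta> 0 + (\<Sum>i=1..p. \<theta> i * (obs \<omega> (t - int i))\<^sup>2)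
     + (\<Sum>j=1..q. \<theta> (p + j) * (sig \<omega> (t - int j))\<^sup>2))"

lemma AE_solution: "AE \<omega> in M. solution \<omega>"
  using eqs by (simp add: solution_def sig_def obs_def)

abbreviation "nrm \<equiv> prod_norm p q \<theta>"

lemma th0: "0 < \<theta> 0" using th by simp

lemma nrm_measurable [measurable]: "nrm m \<in> borel_measurable seqM"
  by (rule prod_norm_measurable[OF pq])

lemma nrm_nonneg: "0 \<le> nrm m x" by (rule prod_norm_nonneg[OF pq])

lemma integrable_nrm: "integrable law (nrm m)"
proof -
  obtain C where C: "0 \<le> C" "\<And>e. mat_norm (garch_matrix p q \<theta> e) \<le> C * (1 + e\<^sup>2)"
    using garch_matrix_norm_bound[OF pq, of \<theta>] by blast
  have sq: "integrable M (\<lambda>\<omega>. (\<epsilon> t \<omega>)\<^sup>2)" for t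
  proof -
    have "integrable (distr M borel (\<epsilon> 0)) (\<lambda>x. x\<^sup>2)" using sq_int by (subst integrable_distr_eq) auto
    then have "integrable (distr M borel (\<epsilon> t)) (\<lambda>x. x\<^sup>2)" by (simp only: eps_distr[of t 0])
    then show ?thesis by (subst (asm) integrable_distr_eq) auto
  qed
  let ?I = "(\<lambda>k. - int k) ` {..<m}"
  have "indep_vars (\<lambda>_. borel) (\<lambda>t \<omega>. C * (1 + (\<epsilon> t \<omega>)\<^sup>2)) ?I"
    by (rule indep_vars_compose2[OF indep_vars_subset[OF indep_eps]]) auto
  then have "integrable M (\<lambda>\<omega>. \<Prod>t\<in>?I. C * (1 + (\<epsilon> t \<omega>)\<^sup>2))"
    using sq by (intro indep_vars_integrable) auto
  then have int: "integrable M (\<lambda>\<omega>. \<Prod>k<m. C * (1 + (past 0 \<omega> k)\<^sup>2))"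
    by (subst (asm) prod.reindex) (auto simp: inj_on_def past_def)
  have "integrable M (\<lambda>\<omega>. nrm m (past 0 \<omega>))"
  proof (rule Bochner_Integration.integrable_bound[OF int])
    show "AE \<omega> in M. norm (nrm m (past 0 \<omega>)) \<le> norm (\<Prod>k<m. C * (1 + (past 0 \<omega> k)\<^sup>2))"
      using prod_norm_bound[OF pq C] nrm_nonneg by (auto intro!: AE_I2 order_trans[OF _ abs_ge_self])
  qed simp
  then show ?thesis unfolding law_def by (subst integrable_distr_eq) auto
qed

definition drift :: "nat \<Rightarrow> (nat \<Rightarrow> real) \<Rightarrow> real" where
  "drift m x = \<theta> 0 * (\<Sum>k<m. nrm k x)"

lemma drift_measurable [measurable]: "drift m \<in> borel_measurable seqM"
  unfolding drift_def[abs_def] by measurable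

lemma drift_nonneg: "0 \<le> drift m x"
  unfolding drift_def using th0 nrm_nonneg by (intro mult_nonneg_nonneg sum_nonneg) auto

lemma depends_nrm: "k \<le> m \<Longrightarrow> depends_on m (nrm k)"
  unfolding depends_on_def by (auto intro!: prod_norm_cong)

lemma depends_drift: "depends_on m (drift m)"
proof -
  have "nrm k x = nrm k y" if "\<forall>i<m. x i = y i" "k < m" for k x y
    using depends_nrm[of k m] that unfolding depends_on_def by auto
  then show ?thesis unfolding depends_on_def drift_def by (auto intro!: arg_cong[of _ _ "\<lambda>x. \<theta> 0 * x"] sum.cong)
qed

text \<open>A negative infimum has a negative member, which fixes the number \<open>m\<close> of
  steps, and \<open>log_moment_contraction\<close> fixes the power \<open>s\<close>. The drift is
  integrable, hence has a moment of order \<open>s \<le> 1\<close>.\<close>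

lemma contraction_exists:
  obtains m s where "0 < m" "0 < s" "s \<le> 1" "(\<integral>\<^sup>+x. ennreal (nrm m x powr s) \<partial>law) < 1"
    "(\<integral>\<^sup>+x. ennreal (drift m x powr s) \<partial>law) < \<infinity>"
proof -
  obtain n where n: "ext_expectation M (\<lambda>\<omega>. ext_ln (mat_norm (garch_matrix_prod p q \<theta> (\<lambda>t. \<epsilon> t \<omega>) n))) / ereal (real (Suc n)) < 0"
    using lyap unfolding lyapunov_exponent_def by (auto simp: INF_less_iff)
  define m where "m = Suc n"
  have eq: "mat_norm (garch_matrix_prod p q \<theta> (\<lambda>t. \<epsilon> t \<omega>) n) = nrm m (past 0 \<omega>)" for \<omega>
    by (simp add: garch_matrix_prod_def prod_norm_def gprod_def m_def past_def)
  have neg: "ext_expectation M (\<lambda>\<omega>. ext_ln (nrm m (past 0 \<omega>))) < 0"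
  proof (rule ccontr)
    assume "\<not> ?thesis"
    then have "0 \<le> ext_expectation M (\<lambda>\<omega>. ext_ln (nrm m (past 0 \<omega>))) / ereal (real (Suc n))"
      by (intro zero_le_divide_ereal) auto
    with n show False unfolding eq by simp
  qed
  have "integrable M (\<lambda>\<omega>. nrm m (past 0 \<omega>))" by (rule integrable_past[OF nrm_measurable integrable_nrm])
  from log_moment_contraction[OF this nrm_nonneg neg]
  obtain s where s: "0 < s" "s \<le> 1" "(\<integral>\<^sup>+\<omega>. ennreal (nrm m (past 0 \<omega>) powr s) \<partial>M) < 1" by blast
  have 1: "(\<integral>\<^sup>+x. ennreal (nrm m x powr s) \<partial>law) < 1"
    using s(3) nn_integral_past[of "\<lambda>x. ennreal (nrm m x powr s)" 0] by simp
  have idr: "integrable law (drift m)" unfolding drift_def[abs_def] using integrable_nrm by auto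
  interpret L: prob_space law by (rule law_prob)
  have id: "integrable law (\<lambda>x. 1 + drift m x)" using idr by auto
  have "(\<integral>\<^sup>+x. ennreal (drift m x powr s) \<partial>law) \<le> (\<integral>\<^sup>+x. ennreal (1 + drift m x) \<partial>law)"
  proof (intro nn_integral_mono ennreal_leI)
    fix x
    have "drift m x powr s \<le> (1 + drift m x) powr s" using s drift_nonneg by (intro powr_mono2) auto
    also have "\<dots> \<le> (1 + drift m x) powr 1" using s drift_nonneg by (intro powr_mono) auto
    finally show "drift m x powr s \<le> 1 + drift m x" using drift_nonneg[of m x] by simp
  qed
  also have "\<dots> = ennreal (\<integral>x. 1 + drift m x \<partial>law)"
    using drift_nonneg by (intro nn_integral_eq_integral[OF id]) (auto intro!: AE_I2 add_nonneg_nonneg)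
  also have "\<dots> < \<infinity>" by simp
  finally have 2: "(\<integral>\<^sup>+x. ennreal (drift m x powr s) \<partial>law) < \<infinity>" .
  show ?thesis by (rule that[of m s]) (use s 1 2 in \<open>auto simp: m_def\<close>)
qed

text \<open>The maximum of the state vector of the solution, with its entries expressed through
  \<open>f\<close>: squared volatilities for \<open>i < q\<close>, squared observations at lag
  \<open>i - q\<close> otherwise.\<close>

definition smax :: "(nat \<Rightarrow> real) \<Rightarrow> real" where
  "smax x = Max ((\<lambda>i. if i < q then (f (\<lambda>k. x (k + i)))\<^sup>2
      else (f (\<lambda>k. x (k + (i - q) + 1)) * x (i - q))\<^sup>2) ` {..<p + q - 1})"

lemma smax_measurable [measurable]: "smax \<in> borel_measurable seqM"
proof -
  have sh: "(\<lambda>x k. x (k + i)) \<in> measurable seqM seqM" for i :: nat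
    by (rule measurable_into_seqM) simp
  have [measurable]: "(\<lambda>x. f (\<lambda>k. x (k + i))) \<in> borel_measurable seqM" for i :: nat
    using measurable_compose[OF sh f_meas] by simp
  have [measurable]: "(\<lambda>x. f (\<lambda>k. x (k + i + 1))) \<in> borel_measurable seqM" for i :: nat
    using measurable_compose[OF sh[of "i + 1"] f_meas] by (simp add: add.assoc)
  show ?thesis unfolding smax_def[abs_def] by (intro borel_measurable_Max) auto
qed

lemma smax_past: "state_max p q (sig \<omega>) (obs \<omega>) t = smax (past t \<omega>)"
proof -
  have "state_vec p q (sig \<omega>) (obs \<omega>) t $ i = (if i < q then (f (\<lambda>k. past t \<omega> (k + i)))\<^sup>2
      else (f (\<lambda>k. past t \<omega> (k + (i - q) + 1)) * past t \<omega> (i - q))\<^sup>2)" if "i < p + q - 1" for i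
  proof -
    have 1: "past (t + 1 - int i - 1) \<omega> = (\<lambda>k. past t \<omega> (k + i))" for i by (auto simp: past_def algebra_simps)
    have 2: "past (t - int i - 1) \<omega> = (\<lambda>k. past t \<omega> (k + i + 1))" for i by (auto simp: past_def algebra_simps)
    show ?thesis unfolding state_vec_def sig_def obs_def 1 2 using that by (simp add: past_def)
  qed
  then show ?thesis unfolding state_max_def smax_def by (intro arg_cong[of _ _ Max] image_cong) auto
qed

lemma smax_nonneg: "0 \<le> smax (past t \<omega>)"
  using state_max_nonneg[OF pq] by (simp add: smax_past[symmetric])

lemma smax_recursion:
  assumes "solution \<omega>"
  shows "smax (past t \<omega>) \<le> nrm m (past t \<omega>) * smax (past (t - int m) \<omega>) + drift m (past t \<omega>)"
proof -
  have "state_max p q (sig \<omega>) (obs \<omega>) t \<le> nrm m (\<lambda>k. \<epsilon> (t - int k) \<omega>) * state_max p q (sig \<omega>) (obs \<omega>) (t - int m)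
     + \<theta> 0 * (\<Sum>k<m. nrm k (\<lambda>k. \<epsilon> (t - int k) \<omega>))"
  proof (rule state_max_recursion[where e = "\<lambda>t. \<epsilon> t \<omega>" and \<theta> = \<theta> and x = "obs \<omega>" and s = "sig \<omega>", OF pq less_imp_le[OF th0]])
    show "obs \<omega> t = sig \<omega> t * \<epsilon> t \<omega>" for t by (rule obs_def)
    show "(sig \<omega> t)\<^sup>2 = \<theta> 0 + (\<Sum>i=1..p. \<theta> i * (obs \<omega> (t - int i))\<^sup>2) + (\<Sum>j=1..q. \<theta> (p + j) * (sig \<omega> (t - int j))\<^sup>2)" for t
      using assms unfolding solution_def by blast
  qed
  then show ?thesis by (simp add: smax_past drift_def past_def[abs_def])
qed

text \<open>The \<open>s\<close>-th power is subadditive for \<open>s \<le> 1\<close>, so the affine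
  inequality keeps its form under iteration.\<close>

lemma smax_powr_unrolled:
  assumes sol: "solution \<omega>" and s: "0 < s" "s \<le> 1"
  shows "smax (past t \<omega>) powr s \<le> (\<Sum>j<K. (\<Prod>i<j. nrm m (past (t - int (i * m)) \<omega>) powr s) * drift m (past (t - int (j * m)) \<omega>) powr s)
     + (\<Prod>i<K. nrm m (past (t - int (i * m)) \<omega>) powr s) * smax (past (t - int (K * m)) \<omega>) powr s"
proof (induction K)
  case (Suc K)
  let ?t = "t - int (K * m)" and ?P = "\<Prod>i<K. nrm m (past (t - int (i * m)) \<omega>) powr s"
  have P0: "0 \<le> ?P" by (intro prod_nonneg) auto
  have "smax (past ?t \<omega>) powr s \<le> (nrm m (past ?t \<omega>) * smax (past (?t - int m) \<omega>) + drift m (past ?t \<omega>)) powr s"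
    using smax_recursion[OF sol] s smax_nonneg by (intro powr_mono2) auto
  also have "\<dots> \<le> (nrm m (past ?t \<omega>) * smax (past (?t - int m) \<omega>)) powr s + drift m (past ?t \<omega>) powr s"
    using s nrm_nonneg smax_nonneg drift_nonneg by (intro powr_add_le) auto
  also have "\<dots> = nrm m (past ?t \<omega>) powr s * smax (past (?t - int m) \<omega>) powr s + drift m (past ?t \<omega>) powr s"
    using nrm_nonneg smax_nonneg by (simp add: powr_mult)
  finally have "?P * smax (past ?t \<omega>) powr s \<le> ?P * (nrm m (past ?t \<omega>) powr s * smax (past (?t - int m) \<omega>) powr s + drift m (past ?t \<omega>) powr s)"
    using P0 by (intro mult_left_mono)
  moreover have "?t - int m = t - int (Suc K * m)" by (simp add: algebra_simps)
  ultimately show ?case using Suc by (simp add: algebra_simps)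
qed simp

lemma nn_integral_block_prod:
  assumes s: "0 < s"
  shows "(\<integral>\<^sup>+\<omega>. ennreal (\<Prod>i<K. nrm m (past (t - int (i * m)) \<omega>) powr s) \<partial>M) = (\<integral>\<^sup>+x. ennreal (nrm m x powr s) \<partial>law) ^ K"
    and "(\<integral>\<^sup>+\<omega>. ennreal ((\<Prod>i<K. nrm m (past (t - int (i * m)) \<omega>) powr s) * drift m (past (t - int (K * m)) \<omega>) powr s) \<partial>M)
       = (\<integral>\<^sup>+x. ennreal (nrm m x powr s) \<partial>law) ^ K * (\<integral>\<^sup>+x. ennreal (drift m x powr s) \<partial>law)"
proof -
  define h where "h j x = (if j < K then nrm m x powr s else drift m x powr s)" for j :: nat and x
  have h0: "0 \<le> h j x" for j x by (simp add: h_def)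
  have hm[measurable]: "h j \<in> borel_measurable seqM" for j unfolding h_def[abs_def] by measurable
  have hd: "depends_on m (h j)" for j
    unfolding h_def[abs_def] using depends_on_comp2[OF depends_nrm[OF order_refl] depends_drift, of m "\<lambda>a b. if j < K then a powr s else b powr s"] .
  have ind: "indep_vars (\<lambda>_. borel) (\<lambda>j \<omega>. ennreal (h j (past (t - int (j * m)) \<omega>))) (UNIV :: nat set)"
    by (rule indep_vars_compose2[OF indep_block_functions[where h = h, OF hd hm]]) simp
  have prod: "(\<integral>\<^sup>+\<omega>. ennreal (\<Prod>j\<in>J. h j (past (t - int (j * m)) \<omega>)) \<partial>M) = (\<Prod>j\<in>J. \<integral>\<^sup>+x. ennreal (h j x) \<partial>law)" if "finite J" for J
  proof -
    have "(\<integral>\<^sup>+\<omega>. (\<Prod>j\<in>J. ennreal (h j (past (t - int (j * m)) \<omega>))) \<partial>M) = (\<Prod>j\<in>J. \<integral>\<^sup>+\<omega>. ennreal (h j (past (t - int (j * m)) \<omega>)) \<partial>M)"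
      by (intro indep_vars_nn_integral that indep_vars_subset[OF ind]) auto
    moreover have "(\<integral>\<^sup>+\<omega>. ennreal (h j (past (t - int (j * m)) \<omega>)) \<partial>M) = (\<integral>\<^sup>+x. ennreal (h j x) \<partial>law)" for j
      by (rule nn_integral_past) simp
    ultimately show ?thesis using h0 by (simp add: prod_ennreal)
  qed
  show "(\<integral>\<^sup>+\<omega>. ennreal (\<Prod>i<K. nrm m (past (t - int (i * m)) \<omega>) powr s) \<partial>M) = (\<integral>\<^sup>+x. ennreal (nrm m x powr s) \<partial>law) ^ K"
    using prod[of "{..<K}"] by (simp add: h_def)
  show "(\<integral>\<^sup>+\<omega>. ennreal ((\<Prod>i<K. nrm m (past (t - int (i * m)) \<omega>) powr s) * drift m (past (t - int (K * m)) \<omega>) powr s) \<partial>M)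
       = (\<integral>\<^sup>+x. ennreal (nrm m x powr s) \<partial>law) ^ K * (\<integral>\<^sup>+x. ennreal (drift m x powr s) \<partial>law)"
    using prod[of "{..<Suc K}"] by (simp add: h_def)
qed

text \<open>The remainder after \<open>K\<close> blocks is a product of \<open>K\<close> contracting factors with a copy of a fixed
  random variable, so it vanishes in probability although nothing is known about moments yet.\<close>

lemma smax_fractional_moment:
  obtains s where "0 < s" "s \<le> 1" "(\<integral>\<^sup>+x. ennreal (smax x powr s) \<partial>law) < \<infinity>"
proof -
  obtain m s where m: "0 < m" and s: "0 < s" "s \<le> 1" and l1: "(\<integral>\<^sup>+x. ennreal (nrm m x powr s) \<partial>law) < 1"
    and g1: "(\<integral>\<^sup>+x. ennreal (drift m x powr s) \<partial>law) < \<infinity>" by (rule contraction_exists)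
  define \<gamma> where "\<gamma> = enn2real (\<integral>\<^sup>+x. ennreal (nrm m x powr s) \<partial>law)"
  have lam: "(\<integral>\<^sup>+x. ennreal (nrm m x powr s) \<partial>law) = ennreal \<gamma>" "0 \<le> \<gamma>" "\<gamma> < 1"
  proof -
    show 1: "(\<integral>\<^sup>+x. ennreal (nrm m x powr s) \<partial>law) = ennreal \<gamma>" unfolding \<gamma>_def using l1 by (subst ennreal_enn2real) (auto intro: less_trans)
    show "0 \<le> \<gamma>" by (simp add: \<gamma>_def)
    then show "\<gamma> < 1" using l1 unfolding 1 by (simp add: ennreal_less_one_iff)
  qed
  define P where "P K \<omega> = (\<Prod>i<K. nrm m (past (0 - int (i * m)) \<omega>) powr s)" for K \<omega>
  define R where "R K \<omega> = P K \<omega> * smax (past (0 - int (K * m)) \<omega>) powr s" for K \<omega>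
  define W where "W \<omega> = (\<Sum>j. ennreal (P j \<omega> * drift m (past (0 - int (j * m)) \<omega>) powr s))" for \<omega>
  have Pm[measurable]: "P K \<in> borel_measurable M" for K unfolding P_def by measurable
  have Rm[measurable]: "R K \<in> borel_measurable M" for K unfolding R_def by measurable
  have Wm[measurable]: "W \<in> borel_measurable M" unfolding W_def by measurable
  have P0: "0 \<le> P K \<omega>" for K \<omega> unfolding P_def by (intro prod_nonneg) auto
  have EP: "(\<integral>\<^sup>+\<omega>. ennreal (P K \<omega>) \<partial>M) = ennreal (\<gamma> ^ K)" for K
    unfolding P_def nn_integral_block_prod(1)[OF s(1)] lam(1) using lam(2) by (simp add: ennreal_power)
  have EW: "(\<integral>\<^sup>+\<omega>. W \<omega> \<partial>M) < \<infinity>"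
  proof -
    have "(\<integral>\<^sup>+\<omega>. W \<omega> \<partial>M) = (\<Sum>j. \<integral>\<^sup>+\<omega>. ennreal (P j \<omega> * drift m (past (0 - int (j * m)) \<omega>) powr s) \<partial>M)"
      unfolding W_def by (rule nn_integral_suminf) measurable
    also have "\<dots> = (\<Sum>j. ennreal (\<gamma> ^ j) * (\<integral>\<^sup>+x. ennreal (drift m x powr s) \<partial>law))"
      unfolding P_def nn_integral_block_prod(2)[OF s(1)] lam(1) using lam(2) by (simp add: ennreal_power)
    also have "\<dots> = (\<Sum>j. ennreal (\<gamma> ^ j)) * (\<integral>\<^sup>+x. ennreal (drift m x powr s) \<partial>law)" by (rule ennreal_suminf_multc)
    also have "(\<Sum>j. ennreal (\<gamma> ^ j)) = ennreal (\<Sum>j. \<gamma> ^ j)" using lam by (intro suminf_ennreal2 summable_geometric) auto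
    finally show ?thesis using g1 by (simp add: ennreal_mult_eq_top_iff less_top[symmetric])
  qed
  have le: "AE \<omega> in M. ennreal (smax (past 0 \<omega>) powr s) \<le> W \<omega> + ennreal (R K \<omega>)" for K
    using AE_solution
  proof eventually_elim
    case (elim \<omega>)
    let ?w = "\<lambda>j. P j \<omega> * drift m (past (0 - int (j * m)) \<omega>) powr s"
    have "ennreal (smax (past 0 \<omega>) powr s) \<le> ennreal ((\<Sum>j<K. ?w j) + R K \<omega>)"
      using smax_powr_unrolled[OF elim s, where t = 0 and K = K and m = m] by (intro ennreal_leI) (simp add: P_def R_def)
    also have "\<dots> = (\<Sum>j<K. ennreal (?w j)) + ennreal (R K \<omega>)"
      using P0 by (simp add: ennreal_plus sum_nonneg R_def)
    also have "\<dots> \<le> W \<omega> + ennreal (R K \<omega>)"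
      unfolding W_def by (intro add_right_mono sum_le_suminf) auto
    finally show ?case .
  qed
  (* R K exceeds \<delta> only if the state at lag K * m exceeds H, which has the same small
     probability for all K, or the product P K, whose mean is \<gamma> ^ K, exceeds \<delta> / H. *)
  have Rsmall: "(\<lambda>K. measure M {\<omega> \<in> space M. \<delta> < R K \<omega>}) \<longlonglongrightarrow> 0" if del: "0 < \<delta>" for \<delta>
  proof (rule LIMSEQ_I)
    fix \<eta> :: real assume eta: "0 < \<eta>"
    define A where "A H = {x \<in> space law. real H < smax x powr s}" for H :: nat
    interpret L: prob_space law by (rule law_prob)
    have Am: "A H \<in> sets law" for H unfolding A_def by measurable
    have "(\<lambda>H. measure law (A H)) \<longlonglongrightarrow> measure law (\<Inter>H. A H)"
      using Am by (intro L.finite_Lim_measure_decseq) (auto simp: decseq_def A_def)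
    moreover have "(\<Inter>H. A H) = {}"
    proof -
      have "x \<notin> (\<Inter>H. A H)" for x
      proof -
        obtain H :: nat where "smax x powr s < real H" using reals_Archimedean2 by blast
        then have "x \<notin> A H" by (simp add: A_def)
        then show ?thesis by blast
      qed
      then show ?thesis by blast
    qed
    ultimately have "(\<lambda>H. measure law (A H)) \<longlonglongrightarrow> 0" by simp
    then have "eventually (\<lambda>H. measure law (A H) < \<eta> / 2) sequentially" using eta by (intro order_tendstoD(2)) auto
    then obtain H0 where H0: "\<forall>H\<ge>H0. measure law (A H) < \<eta> / 2" by (auto simp: eventually_sequentially)
    define H where "H = Suc H0"
    have H: "measure law (A H) < \<eta> / 2" "0 < real H" using H0 by (auto simp: H_def)
    have "(\<lambda>K. \<gamma> ^ K) \<longlonglongrightarrow> 0" using lam by (intro LIMSEQ_realpow_zero) auto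
    then have "eventually (\<lambda>K. \<gamma> ^ K < \<eta> / 2 * (\<delta> / real H)) sequentially" using eta del H by (intro order_tendstoD(2)) auto
    then obtain K0 where K0: "\<forall>K\<ge>K0. \<gamma> ^ K < \<eta> / 2 * (\<delta> / real H)" by (auto simp: eventually_sequentially)
    show "\<exists>K0. \<forall>K\<ge>K0. norm (measure M {\<omega> \<in> space M. \<delta> < R K \<omega>} - 0) < \<eta>"
    proof (intro exI allI impI)
      fix K assume K: "K0 \<le> K"
      let ?t = "0 - int (K * m)"
      let ?B = "{\<omega> \<in> space M. real H < smax (past ?t \<omega>) powr s}" and ?C = "{\<omega> \<in> space M. \<delta> / real H \<le> P K \<omega>}"
      have "{\<omega> \<in> space M. \<delta> < R K \<omega>} \<subseteq> ?B \<union> ?C"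
      proof (rule subsetI, rule ccontr)
        fix \<omega> assume w: "\<omega> \<in> {\<omega> \<in> space M. \<delta> < R K \<omega>}" "\<omega> \<notin> ?B \<union> ?C"
        then have "P K \<omega> \<le> \<delta> / real H" "smax (past ?t \<omega>) powr s \<le> real H" by auto
        then have "R K \<omega> \<le> (\<delta> / real H) * real H" unfolding R_def using P0 del H by (intro mult_mono) auto
        also have "\<dots> = \<delta>" using H by simp
        finally show False using w by simp
      qed
      then have "measure M {\<omega> \<in> space M. \<delta> < R K \<omega>} \<le> measure M (?B \<union> ?C)" by (intro finite_measure_mono) auto
      also have "\<dots> \<le> measure M ?B + measure M ?C" by (intro measure_Un_le) auto
      also have "measure M ?B = measure law (A H)"
      proof -
        have "measure law (A H) = measure M (past ?t -` A H \<inter> space M)"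
          unfolding distr_past[symmetric, of ?t] by (rule measure_distr) (use Am in simp_all)
        also have "past ?t -` A H \<inter> space M = ?B" by (auto simp: A_def law_def)
        finally show ?thesis by simp
      qed
      also have "measure M ?C \<le> \<gamma> ^ K / (\<delta> / real H)"
      proof -
        have "integrable M (P K)" using EP[of K] P0 by (intro integrableI_nonneg) auto
        moreover have "expectation (P K) = \<gamma> ^ K"
          using EP[of K] P0 lam(2) nn_integral_eq_integral[OF calculation] by (simp add: integral_nonneg_AE)
        ultimately show ?thesis using P0 del H integral_Markov_inequality_measure[of M "P K" "{}" "\<delta> / real H"] by simp
      qed
      also have "\<gamma> ^ K / (\<delta> / real H) < \<eta> / 2" using K0 K del H by (subst pos_divide_less_eq) auto
      finally show "norm (measure M {\<omega> \<in> space M. \<delta> < R K \<omega>} - 0) < \<eta>" using H by simp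
    qed
  qed
  have "AE \<omega> in M. ennreal (smax (past 0 \<omega>) powr s) \<le> W \<omega> + ennreal \<delta>" if del: "0 < \<delta>" for \<delta>
  proof -
    let ?N = "{\<omega> \<in> space M. W \<omega> + ennreal \<delta> < ennreal (smax (past 0 \<omega>) powr s)}"
    have "measure M ?N \<le> measure M {\<omega> \<in> space M. \<delta> < R K \<omega>}" for K
    proof (rule finite_measure_mono_AE)
      show "AE \<omega> in M. \<omega> \<in> ?N \<longrightarrow> \<omega> \<in> {\<omega> \<in> space M. \<delta> < R K \<omega>}"
        using le[of K]
      proof eventually_elim
        case (elim \<omega>)
        show ?case
        proof clarify
          assume w: "\<omega> \<in> space M" "W \<omega> + ennreal \<delta> < ennreal (smax (past 0 \<omega>) powr s)"
          have "\<not> R K \<omega> \<le> \<delta>"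
          proof
            assume "R K \<omega> \<le> \<delta>"
            then have "W \<omega> + ennreal (R K \<omega>) \<le> W \<omega> + ennreal \<delta>" by (intro add_left_mono ennreal_leI)
            from order_trans[OF elim this] w(2) show False by (meson leD)
          qed
          then show "\<delta> < R K \<omega>" by simp
        qed
      qed
    qed measurable
    then have "measure M ?N \<le> 0" by (intro LIMSEQ_le_const[OF Rsmall[OF del]]) auto
    then have "emeasure M ?N = 0" by (simp add: emeasure_eq_measure measure_le_0_iff)
    then have "AE \<omega> in M. \<omega> \<notin> ?N" by (intro AE_not_in) (auto simp: null_sets_def)
    then show ?thesis by (auto elim!: eventually_mono simp: not_less AE_conj_iff) 
  qed
  then have "AE \<omega> in M. \<forall>n::nat. ennreal (smax (past 0 \<omega>) powr s) \<le> W \<omega> + ennreal (1 / real (Suc n))"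
    by (subst AE_all_countable) auto
  then have "AE \<omega> in M. ennreal (smax (past 0 \<omega>) powr s) \<le> W \<omega> + ennreal 1"
    by eventually_elim (metis One_nat_def div_by_1 of_nat_1)
  then have "(\<integral>\<^sup>+\<omega>. ennreal (smax (past 0 \<omega>) powr s) \<partial>M) \<le> (\<integral>\<^sup>+\<omega>. W \<omega> + 1 \<partial>M)" by (intro nn_integral_mono_AE) auto
  also have "\<dots> = (\<integral>\<^sup>+\<omega>. W \<omega> \<partial>M) + 1" by (subst nn_integral_add) (auto simp: emeasure_space_1)
  also have "\<dots> < \<infinity>" using EW by (simp add: less_top[symmetric])
  finally have "(\<integral>\<^sup>+x. ennreal (smax x powr s) \<partial>law) < \<infinity>"
    using nn_integral_past[of "\<lambda>x. ennreal (smax x powr s)" 0] by simp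
  with s show ?thesis by (rule that)
qed

end

section \<open>Envelopes for the volatility and the score\<close>

lemma summable_square_geometric:
  assumes "0 \<le> z" "z < (1::real)"
  shows "summable (\<lambda>i. (real (Suc i))\<^sup>2 * z ^ i)"
proof (cases "z = 0")
  case True
  have "summable (\<lambda>i. if i = 0 then 1 else 0 :: real)" by (rule summable_single)
  moreover have "(\<lambda>i. (real (Suc i))\<^sup>2 * z ^ i) = (\<lambda>i. if i = 0 then 1 else 0)"
    using True by (intro ext) (simp add: power_0_left)
  ultimately show ?thesis by simp
next
  case False
  with assms have z: "0 < z" by simp
  have "(\<lambda>n. (real (Suc (Suc n)) / real (Suc n))\<^sup>2 * z) \<longlonglongrightarrow> 1\<^sup>2 * z"
    by (intro tendsto_intros) real_asymp
  then have "eventually (\<lambda>n. (real (Suc (Suc n)) / real (Suc n))\<^sup>2 * z < (1 + z) / 2) sequentially"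
    using assms(2) by (intro order_tendstoD(2)) auto
  then obtain n0 where n0: "\<And>n. n \<ge> n0 \<Longrightarrow> (real (Suc (Suc n)) / real (Suc n))\<^sup>2 * z < (1 + z) / 2"
    by (auto simp: eventually_sequentially)
  show ?thesis
  proof (rule summable_ratio_test[of "(1 + z) / 2" n0])
    fix n assume n: "n0 \<le> n"
    have "norm ((real (Suc (Suc n)))\<^sup>2 * z ^ Suc n) = ((real (Suc (Suc n)) / real (Suc n))\<^sup>2 * z) * ((real (Suc n))\<^sup>2 * z ^ n)"
      using z by (simp add: power_divide abs_mult)
    also have "\<dots> \<le> (1 + z) / 2 * ((real (Suc n))\<^sup>2 * z ^ n)"
      using n0[OF n] z by (intro mult_right_mono) auto
    finally show "norm ((real (Suc (Suc n)))\<^sup>2 * z ^ Suc n) \<le> (1 + z) / 2 * norm ((real (Suc n))\<^sup>2 * z ^ n)"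
      using z by (simp add: abs_mult)
  qed (use assms in simp)
qed

lemma powr_base_less_one: "0 < x \<Longrightarrow> x < 1 \<Longrightarrow> 0 < b \<Longrightarrow> x powr b < 1" for x b :: real
  using powr_less_mono2[of b x 1] by simp

locale garch_moments = causal_garch +
  fixes K :: nat
  assumes T1: "(\<Sum>j=1..q. \<theta> (p + j)) < 1"
    and K2: "2 \<le> K" and momK: "integrable M (\<lambda>\<omega>. \<bar>\<epsilon> 0 \<omega>\<bar> ^ K)"

text \<open>All rates that depend on the law and the true parameter: \<open>s\<close> is the order
  of a finite moment of the state, and \<open>r\<close>, \<open>C\<close> describe the geometric
  decay of the coefficients.\<close>

locale garch_constants = garch_moments +
  fixes s r C :: real
  assumes s: "0 < s" "s \<le> 1" and smom: "(\<integral>\<^sup>+x. ennreal (smax x powr s) \<partial>law) < \<infinity>"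
    and r: "0 < r" "r < 1" and rB: "(\<Sum>j=1..q. \<theta> (p + j) * (1 / r) ^ j) < 1"
    and C: "0 < C" "\<And>i. i > 0 \<Longrightarrow> garch_coeff p q \<theta> i \<le> C * r ^ i"

lemma (in garch_moments) constants_exist: "\<exists>s r C. garch_constants M \<epsilon> p q \<theta> f K s r C"
proof -
  obtain s where s: "0 < s" "s \<le> 1" "(\<integral>\<^sup>+x. ennreal (smax x powr s) \<partial>law) < \<infinity>" by (rule smax_fractional_moment)
  obtain r where r: "0 < r" "r < 1" "(\<Sum>j=1..q. \<theta> (p + j) * (1 / r) ^ j) < 1"
    using garch_decay_rate_exists[OF T1] by blast
  obtain C where C: "0 < C" "\<forall>i>0. garch_coeff p q \<theta> i \<le> C * r ^ i"
    using garch_coeff_geometric_decay[of p q \<theta> r] r less_imp_le[OF th] by auto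
  have "garch_constants M \<epsilon> p q \<theta> f K s r C"
    by (rule garch_constants.intro[OF garch_moments_axioms garch_constants_axioms.intro[OF s r C(1)]]) (use C(2) in blast)
  then show ?thesis by blast
qed

context garch_constants
begin

text \<open>The observations grow into the past at most like \<open>L ^ i\<close>, and the
  coefficients decay like \<open>r ^ i\<close>, so the terms of the volatility series decay like
  \<open>\<rho>\<^sub>2 ^ i\<close> with \<open>\<rho>\<^sub>2 = r * L\<close>. The factor
  \<open>\<nu>\<close> per lag that is granted to perturbed coefficients is so close to one that it
  is absorbed even after taking small powers: \<open>\<nu> * \<rho>\<^sub>2 powr a < 1\<close>.
  Errors enter the statistic through powers up to \<open>N = 3 * K\<close> (third powers from the
  expansion of one residual, powers up to \<open>K\<close> from the sums), and \<open>a = s /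
  N\<close> makes the \<open>N\<close>-th power of the majorant of order \<open>s\<close> in the
  state. The effect of cutting off the series at the first observation decays like \<open>\<rho> ^
  t\<close>.\<close>

definition "L = 1 / sqrt r"
definition "lam = L powr (- s)"
definition "N = 3 * K"
definition "a = s / real N"
definition "\<rho>\<^sub>2 = sqrt r"
definition "\<nu> = \<rho>\<^sub>2 powr (- (a / 2))"
definition "\<rho> = \<nu> * r"

lemma N: "0 < N" "1 \<le> real N" using K2 by (auto simp: N_def)
lemma a: "0 < a" "a \<le> 1"
  using s N by (auto simp: a_def divide_simps)
lemma L: "1 < L" using r by (simp add: L_def)
lemma lam: "0 < lam" "lam < 1" using L s by (auto simp: lam_def intro: powr_less_one)
lemma rL: "r * L = \<rho>\<^sub>2" unfolding L_def \<rho>\<^sub>2_def using r by (simp add: real_div_sqrt)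
lemma rho2: "0 < \<rho>\<^sub>2" "\<rho>\<^sub>2 < 1" using r by (auto simp: \<rho>\<^sub>2_def)
lemma nu: "1 < \<nu>"
proof -
  have "1 / \<nu> = \<rho>\<^sub>2 powr (a / 2)" using rho2 by (simp add: \<nu>_def powr_minus_divide)
  also have "\<dots> < 1" using rho2 a by (intro powr_base_less_one) auto
  finally show ?thesis using rho2 by (simp add: \<nu>_def)
qed
lemma nu_rho2: "\<nu> * \<rho>\<^sub>2 < 1"
proof -
  have "\<nu> * \<rho>\<^sub>2 = \<rho>\<^sub>2 powr (- (a / 2)) * \<rho>\<^sub>2 powr 1" using rho2 by (simp add: \<nu>_def)
  also have "\<dots> = \<rho>\<^sub>2 powr (1 - a / 2)" by (simp only: powr_add[symmetric]) simp
  also have "\<dots> < 1" using rho2 a by (intro powr_base_less_one) auto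
  finally show ?thesis .
qed
lemma nu_rho2_a: "\<nu> * \<rho>\<^sub>2 powr a < 1"
proof -
  have "\<nu> * \<rho>\<^sub>2 powr a = \<rho>\<^sub>2 powr (- (a / 2) + a)" unfolding \<nu>_def by (rule powr_add[symmetric])
  also have "\<rho>\<^sub>2 powr (- (a / 2) + a) = \<rho>\<^sub>2 powr (a / 2)" by simp
  also have "\<dots> < 1" using rho2 a by (intro powr_base_less_one) auto
  finally show ?thesis .
qed
lemma rho: "0 < \<rho>" "\<rho> < 1"
proof -
  have "r \<le> \<rho>\<^sub>2" using r real_sqrt_le_mono[of "r\<^sup>2" r] by (simp add: \<rho>\<^sub>2_def power2_eq_square mult_left_le)
  then have "\<rho> \<le> \<nu> * \<rho>\<^sub>2" using nu unfolding \<rho>_def by (intro mult_left_mono) auto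
  then show "\<rho> < 1" using nu_rho2 by simp
  show "0 < \<rho>" using nu r by (simp add: \<rho>_def)
qed

definition shift :: "nat \<Rightarrow> (nat \<Rightarrow> real) \<Rightarrow> nat \<Rightarrow> real" where "shift i x = (\<lambda>k. x (k + i))"

lemma shift_measurable [measurable]: "shift i \<in> measurable seqM seqM"
  unfolding shift_def[abs_def] by (rule measurable_into_seqM) simp

lemma shift_past: "shift i (past t \<omega>) = past (t - int i) \<omega>"
  by (auto simp: shift_def past_def algebra_simps)

text \<open>An integrable envelope for all past states at once: the discount factor \<open>lam = L
  powr (- s)\<close> makes the sum of the fractional moments finite and bounds the state at lag
  \<open>i\<close> by a multiple of \<open>L ^ i\<close>. In the extended reals the sum may be
  integrated term by term.\<close>

definition VE :: "(nat \<Rightarrow> real) \<Rightarrow> ennreal" where "VE x = (\<Sum>i. ennreal (lam ^ i * smax (shift i x) powr s))"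
definition V :: "(nat \<Rightarrow> real) \<Rightarrow> real" where "V x = enn2real (VE x)"

lemma VE_measurable [measurable]: "VE \<in> borel_measurable seqM"
  unfolding VE_def[abs_def] by measurable

lemma V_measurable [measurable]: "V \<in> borel_measurable seqM"
  unfolding V_def[abs_def] by measurable

lemma V_nonneg: "0 \<le> V x" by (simp add: V_def)

lemma VE_integral: "(\<integral>\<^sup>+x. VE x \<partial>law) < \<infinity>"
proof -
  have "(\<integral>\<^sup>+x. VE x \<partial>law) = (\<integral>\<^sup>+\<omega>. VE (past 0 \<omega>) \<partial>M)" by (rule nn_integral_past[symmetric]) simp
  also have "\<dots> = (\<Sum>i. \<integral>\<^sup>+\<omega>. ennreal (lam ^ i * smax (past (0 - int i) \<omega>) powr s) \<partial>M)"
    unfolding VE_def shift_past by (rule nn_integral_suminf) measurable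
  also have "(\<lambda>i. \<integral>\<^sup>+\<omega>. ennreal (lam ^ i * smax (past (0 - int i) \<omega>) powr s) \<partial>M) = (\<lambda>i. ennreal (lam ^ i) * (\<integral>\<^sup>+x. ennreal (smax x powr s) \<partial>law))"
  proof
    fix i
    have "(\<integral>\<^sup>+\<omega>. ennreal (lam ^ i * smax (past (0 - int i) \<omega>) powr s) \<partial>M) = (\<integral>\<^sup>+x. ennreal (lam ^ i * smax x powr s) \<partial>law)"
      by (rule nn_integral_past[of "\<lambda>x. ennreal (lam ^ i * smax x powr s)"]) simp
    also have "\<dots> = ennreal (lam ^ i) * (\<integral>\<^sup>+x. ennreal (smax x powr s) \<partial>law)"
      using lam(1) by (subst nn_integral_cmult[symmetric]) (auto simp: ennreal_mult')
    finally show "(\<integral>\<^sup>+\<omega>. ennreal (lam ^ i * smax (past (0 - int i) \<omega>) powr s) \<partial>M) = ennreal (lam ^ i) * (\<integral>\<^sup>+x. ennreal (smax x powr s) \<partial>law)" .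
  qed
  also have "(\<Sum>i. ennreal (lam ^ i) * (\<integral>\<^sup>+x. ennreal (smax x powr s) \<partial>law)) = (\<Sum>i. ennreal (lam ^ i)) * (\<integral>\<^sup>+x. ennreal (smax x powr s) \<partial>law)"
    by (rule ennreal_suminf_multc)
  also have "(\<Sum>i. ennreal (lam ^ i)) = ennreal (\<Sum>i. lam ^ i)" using lam by (intro suminf_ennreal2 summable_geometric) auto
  finally show ?thesis using smom by (simp add: ennreal_mult_eq_top_iff less_top[symmetric])
qed

lemma AE_VE_finite: "AE \<omega> in M. \<forall>t. VE (past t \<omega>) < \<infinity>"
proof (subst AE_all_countable, rule allI)
  fix t
  have "(\<integral>\<^sup>+\<omega>. VE (past t \<omega>) \<partial>M) \<noteq> \<infinity>" using VE_integral nn_integral_past[of VE t] by simp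
  then have "AE \<omega> in M. VE (past t \<omega>) \<noteq> \<infinity>" by (intro nn_integral_PInf_AE) auto
  then show "AE \<omega> in M. VE (past t \<omega>) < \<infinity>" by eventually_elim (simp add: less_top)
qed

lemma V_integrable: "integrable law V"
proof (rule integrableI_nonneg)
  have "(\<integral>\<^sup>+x. ennreal (V x) \<partial>law) \<le> (\<integral>\<^sup>+x. VE x \<partial>law)"
    by (intro nn_integral_mono) (simp add: V_def ennreal_enn2real_if)
  then show "(\<integral>\<^sup>+x. ennreal (V x) \<partial>law) < \<infinity>" using VE_integral by (rule le_less_trans)
qed (use V_nonneg in auto)

definition regular :: "'a \<Rightarrow> bool" where "regular \<omega> \<longleftrightarrow> solution \<omega> \<and> (\<forall>t. VE (past t \<omega>) < \<infinity>)"

lemma AE_regular: "AE \<omega> in M. regular \<omega>"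
  using AE_solution AE_VE_finite by eventually_elim (simp add: regular_def)

text \<open>The envelope of the states before time \<open>t\<close>, and its \<open>N\<close>-th
  root made at least one, so that products of error terms are bounded by powers of \<open>Qv\<close>
  and all powers up to \<open>N\<close> are integrable.\<close>

definition U :: "'a \<Rightarrow> int \<Rightarrow> real" where "U \<omega> t = V (past (t - 1) \<omega>)"
definition Qv :: "'a \<Rightarrow> int \<Rightarrow> real" where "Qv \<omega> t = (1 + U \<omega> t) powr (1 / real N)"

lemma U_nonneg: "0 \<le> U \<omega> t" by (simp add: U_def V_nonneg)

lemma Qv_ge1: "1 \<le> Qv \<omega> t" unfolding Qv_def using U_nonneg by (intro ge_one_powr_ge_zero) auto

lemma Qv_power: "Qv \<omega> t ^ N = 1 + U \<omega> t"
  unfolding Qv_def using U_nonneg[of \<omega> t] N by (subst powr_realpow[symmetric]) (auto simp: powr_powr intro: add_pos_nonneg)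

lemma U_powr: "U \<omega> t powr (1 / real N) \<le> Qv \<omega> t"
  unfolding Qv_def using U_nonneg by (intro powr_mono2) auto

context
  fixes \<omega> assumes reg: "regular \<omega>"
begin

lemma sol: "(sig \<omega> t)\<^sup>2 = \<theta> 0 + (\<Sum>i=1..p. \<theta> i * (obs \<omega> (t - int i))\<^sup>2) + (\<Sum>j=1..q. \<theta> (p + j) * (sig \<omega> (t - int j))\<^sup>2)"
  "0 \<le> sig \<omega> t"
  using reg unfolding regular_def solution_def by blast+

lemma smax_growth: "smax (past (t - int i) \<omega>) \<le> V (past t \<omega>) powr (1 / s) * L ^ i"
proof -
  let ?g = "\<lambda>i. ennreal (lam ^ i * smax (past (t - int i) \<omega>) powr s)"
  have fin: "VE (past t \<omega>) < \<infinity>" using reg by (simp add: regular_def)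
  have "?g i \<le> VE (past t \<omega>)"
    unfolding VE_def shift_past using sum_le_suminf[of ?g "{i}"] by simp
  also have "\<dots> = ennreal (V (past t \<omega>))" unfolding V_def using fin by (simp add: less_top)
  finally have "lam ^ i * smax (past (t - int i) \<omega>) powr s \<le> V (past t \<omega>)" by (simp add: ennreal_le_iff V_nonneg)
  then have "(lam ^ i * smax (past (t - int i) \<omega>) powr s) powr (1 / s) \<le> V (past t \<omega>) powr (1 / s)"
    using s lam by (intro powr_mono2) auto
  moreover have "(lam ^ i * smax (past (t - int i) \<omega>) powr s) powr (1 / s) = smax (past (t - int i) \<omega>) / L ^ i"
  proof -
    have "(lam ^ i) powr (1 / s) = (1 / L) ^ i"
    proof -
      have "(lam ^ i) powr (1 / s) = (lam powr (1 / s)) ^ i"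
        using lam by (simp add: powr_realpow[symmetric] powr_powr mult.commute)
      also have "lam powr (1 / s) = 1 / L" 
      proof -
        have "lam powr (1 / s) = L powr (- s * (1 / s))" unfolding lam_def by (rule powr_powr)
        also have "- s * (1 / s) = - 1" using s by simp
        finally show ?thesis using L by (simp add: powr_minus_divide)
      qed
      finally show ?thesis .
    qed
    then show ?thesis using s lam smax_nonneg[of "t - int i" \<omega>]
      by (simp add: powr_mult powr_powr power_divide)
  qed
  ultimately show ?thesis using L by (simp add: pos_divide_le_eq)
qed

lemma sig_growth: "(sig \<omega> (t - int i))\<^sup>2 \<le> U \<omega> t powr (1 / s) * L ^ i"
proof -
  have "(sig \<omega> (t - int i))\<^sup>2 \<le> smax (past (t - 1 - int i) \<omega>)"
    using sigma_le_state_max[OF pq, of "sig \<omega>" "t - 1 - int i" "obs \<omega>"] by (simp add: smax_past algebra_simps)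
  also have "\<dots> \<le> U \<omega> t powr (1 / s) * L ^ i" unfolding U_def by (rule smax_growth)
  finally show ?thesis .
qed

text \<open>The squared observation, multiplied by its positive coefficient, is one of the summands
  of the next squared volatility.\<close>

lemma obs_le_sig: "(obs \<omega> t)\<^sup>2 \<le> (sig \<omega> (t + 1))\<^sup>2 / \<theta> 1"
proof -
  have th1: "0 < \<theta> 1" using th[of 1] pq by simp
  have "\<theta> 1 * (obs \<omega> (t + 1 - int 1))\<^sup>2 \<le> (\<Sum>i=1..p. \<theta> i * (obs \<omega> (t + 1 - int i))\<^sup>2)"
    by (rule member_le_sum[of 1]) (use pq less_imp_le[OF th] in \<open>auto intro!: mult_nonneg_nonneg\<close>)
  moreover have "0 \<le> (\<Sum>j=1..q. \<theta> (p + j) * (sig \<omega> (t + 1 - int j))\<^sup>2)"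
    using less_imp_le[OF th] by (intro sum_nonneg mult_nonneg_nonneg) auto
  ultimately have "\<theta> 1 * (obs \<omega> t)\<^sup>2 \<le> (sig \<omega> (t + 1))\<^sup>2" using sol(1)[of "t + 1"] th0 by (simp only: of_nat_1 add_diff_cancel_right')
  then show ?thesis using th1 by (simp add: pos_le_divide_eq mult.commute)
qed

lemma obs_growth: "(obs \<omega> (t - 1 - int i))\<^sup>2 \<le> U \<omega> t powr (1 / s) / \<theta> 1 * L ^ i"
proof -
  have th1: "0 < \<theta> 1" using th[of 1] pq by simp
  have "(obs \<omega> (t - 1 - int i))\<^sup>2 \<le> (sig \<omega> (t - int i))\<^sup>2 / \<theta> 1" using obs_le_sig[of "t - 1 - int i"] by simp
  also have "\<dots> \<le> (U \<omega> t powr (1 / s) * L ^ i) / \<theta> 1" using th1 sig_growth by (intro divide_right_mono) auto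
  finally show ?thesis by simp
qed

lemma sig_series: "(sig \<omega> t)\<^sup>2 = vol_series p q \<theta> (obs \<omega>) t"
proof (rule volatility_eq_series[where L = L and C = C and r = r and Ms = "\<lambda>t. U \<omega> t powr (1 / s)" and Mx = "\<lambda>t. U \<omega> (t + 1) powr (1 / s) / \<theta> 1"])
  show "(\<Sum>j = 1..q. \<theta> (p + j) * L ^ j) < 1"
  proof -
    have "L \<le> 1 / r" using rL rho2 r by (simp add: field_simps)
    then have "(\<Sum>j = 1..q. \<theta> (p + j) * L ^ j) \<le> (\<Sum>j=1..q. \<theta> (p + j) * (1 / r) ^ j)"
      using L less_imp_le[OF th] by (intro sum_mono mult_left_mono power_mono) auto
    then show ?thesis using rB by simp
  qed
  show "(obs \<omega> (t - int i))\<^sup>2 \<le> U \<omega> (t + 1) powr (1 / s) / \<theta> 1 * L ^ i" for t i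
    using obs_growth[of "t + 1" i] by simp
  show "(sig \<omega> t)\<^sup>2 = \<theta> 0 + (\<Sum>i=1..p. \<theta> i * (obs \<omega> (t - int i))\<^sup>2) + (\<Sum>j=1..q. \<theta> (p + j) * (sig \<omega> (t - int j))\<^sup>2)" for t
    by (rule sol(1))
qed (use sig_growth less_imp_le[OF th] L C r rL rho2 in auto)

end

definition "T = (\<Sum>j=1..q. \<theta> (p + j))"

text \<open>The largest relative perturbation of the parameter for which the coefficients change by
  at most \<open>\<nu> ^ i\<close> in either direction and the sum of the
  \<open>\<beta>\<close>-parameters stays below \<open>(1 + T) / 2\<close>.\<close>

definition "\<kappa>\<^sub>0 = min (1 / 2) (min (1 - 1 / \<nu>) ((1 - T) / 2))"
definition "A0 = (\<Sum>i. (real (Suc i))\<^sup>2 * (\<nu> * \<rho>\<^sub>2 powr a) ^ i) * (\<nu> * (2 * C * r / (\<theta> 0 * \<theta> 1)) powr a)"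
definition "A1 = 4 / (1 - T) ^ 3 + A0"

lemma T_bounds: "0 \<le> T" "T < 1"
  using T1 less_imp_le[OF th] by (auto simp: T_def intro!: sum_nonneg)

lemma kappa0: "0 < \<kappa>\<^sub>0" "\<kappa>\<^sub>0 \<le> 1 / 2" "(1 + \<kappa>\<^sub>0) * T \<le> (1 + T) / 2" "1 / (1 - \<kappa>\<^sub>0) \<le> \<nu>"
proof -
  show "0 < \<kappa>\<^sub>0" using nu T_bounds by (simp add: \<kappa>\<^sub>0_def)
  show "\<kappa>\<^sub>0 \<le> 1 / 2" unfolding \<kappa>\<^sub>0_def by linarith
  have k2: "\<kappa>\<^sub>0 \<le> (1 - T) / 2" unfolding \<kappa>\<^sub>0_def by linarith
  have "\<kappa>\<^sub>0 * T \<le> ((1 - T) / 2) * 1" using T_bounds \<open>0 < \<kappa>\<^sub>0\<close> k2 by (intro mult_mono) auto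
  then show "(1 + \<kappa>\<^sub>0) * T \<le> (1 + T) / 2" by (simp add: field_simps)
  have k: "1 / \<nu> \<le> 1 - \<kappa>\<^sub>0" unfolding \<kappa>\<^sub>0_def by linarith
  have "0 < 1 - \<kappa>\<^sub>0" using \<open>\<kappa>\<^sub>0 \<le> 1 / 2\<close> by simp
  with k nu show "1 / (1 - \<kappa>\<^sub>0) \<le> \<nu>" by (simp add: field_simps)
qed

lemma A0: "0 \<le> A0"
proof -
  have "0 \<le> (\<Sum>i. (real (Suc i))\<^sup>2 * (\<nu> * \<rho>\<^sub>2 powr a) ^ i)"
    using nu nu_rho2_a by (intro suminf_nonneg summable_square_geometric) auto
  then show ?thesis using nu by (simp add: A0_def)
qed

lemma summable_z: "summable (\<lambda>i. (real (Suc i))\<^sup>2 * (\<nu> * \<rho>\<^sub>2 powr a) ^ i)"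
  using nu nu_rho2_a by (intro summable_square_geometric) auto

lemma coeff_nonneg: "0 \<le> garch_coeff p q \<theta> (Suc i)"
  using less_imp_le[OF th] by (intro garch_coeff_nonneg) auto

lemma theta1: "0 < \<theta> 1" using th[of 1] pq by simp

context
  fixes \<omega> assumes reg: "regular \<omega>"
begin

lemma lin_term: "garch_coeff p q \<theta> (Suc i) * (obs \<omega> (t - 1 - int i))\<^sup>2 \<le> C * r * (U \<omega> t powr (1 / s) / \<theta> 1) * \<rho>\<^sub>2 ^ i"
proof -
  have "garch_coeff p q \<theta> (Suc i) * (obs \<omega> (t - 1 - int i))\<^sup>2 \<le> (C * r ^ Suc i) * (U \<omega> t powr (1 / s) / \<theta> 1 * L ^ i)"
    using C r by (intro mult_mono C obs_growth[OF reg]) auto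
  also have "\<dots> = C * r * (U \<omega> t powr (1 / s) / \<theta> 1) * (r * L) ^ i" by (simp add: power_mult_distrib)
  finally show ?thesis unfolding rL .
qed

lemma pow_term: "(2 * garch_coeff p q \<theta> (Suc i) * (obs \<omega> (t - 1 - int i))\<^sup>2 / \<theta> 0) powr a
    \<le> (2 * C * r / (\<theta> 0 * \<theta> 1)) powr a * (\<rho>\<^sub>2 powr a) ^ i * U \<omega> t powr (1 / real N)"
proof -
  have nn: "0 \<le> 2 * garch_coeff p q \<theta> (Suc i) * (obs \<omega> (t - 1 - int i))\<^sup>2 / \<theta> 0"
    using coeff_nonneg th0 by simp
  have "2 * garch_coeff p q \<theta> (Suc i) * (obs \<omega> (t - 1 - int i))\<^sup>2 / \<theta> 0
     \<le> (2 / \<theta> 0) * (C * r * (U \<omega> t powr (1 / s) / \<theta> 1) * \<rho>\<^sub>2 ^ i)"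
    using mult_left_mono[OF lin_term[of i t], of "2 / \<theta> 0"] th0 by (simp add: mult_ac)
  also have "\<dots> = (2 * C * r / (\<theta> 0 * \<theta> 1)) * \<rho>\<^sub>2 ^ i * U \<omega> t powr (1 / s)" by simp
  finally have "(2 * garch_coeff p q \<theta> (Suc i) * (obs \<omega> (t - 1 - int i))\<^sup>2 / \<theta> 0) powr a
     \<le> ((2 * C * r / (\<theta> 0 * \<theta> 1)) * \<rho>\<^sub>2 ^ i * U \<omega> t powr (1 / s)) powr a"
    using nn a by (intro powr_mono2) auto
  also have "\<dots> = (2 * C * r / (\<theta> 0 * \<theta> 1)) powr a * (\<rho>\<^sub>2 ^ i) powr a * (U \<omega> t powr (1 / s)) powr a"
  proof -
    have "(x * y * z) powr a = x powr a * y powr a * z powr a" if "0 \<le> x" "0 \<le> y" "0 \<le> z" for x y z :: real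
      using that by (simp add: powr_mult)
    from this[of "2 * C * r / (\<theta> 0 * \<theta> 1)" "\<rho>\<^sub>2 ^ i" "U \<omega> t powr (1 / s)"] show ?thesis
      using C(1) r th0 theta1 rho2 by simp
  qed
  also have "(\<rho>\<^sub>2 ^ i) powr a = (\<rho>\<^sub>2 powr a) ^ i" using rho2 by (simp add: powr_realpow[symmetric] powr_powr mult.commute)
  also have "(U \<omega> t powr (1 / s)) powr a = U \<omega> t powr (1 / real N)" using s by (simp add: powr_powr a_def)
  finally show ?thesis .
qed

text \<open>The two summability conditions hold because \<open>\<nu> * \<rho>\<^sub>2 < 1\<close>
  and \<open>\<nu> * \<rho>\<^sub>2 powr a < 1\<close>, respectively.\<close>

lemma path: "volatility_path p q \<theta> \<kappa>\<^sub>0 \<nu> a (\<lambda>i. (obs \<omega> (t - 1 - int i))\<^sup>2)"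
proof unfold_locales
  have z: "0 \<le> \<nu> * \<rho>\<^sub>2" using nu rho2 by simp
  show "summable (\<lambda>i. (real (Suc i))\<^sup>2 * \<nu> ^ Suc i * (garch_coeff p q \<theta> (Suc i) * (obs \<omega> (t - 1 - int i))\<^sup>2))"
  proof (rule summable_comparison_test'[of _ 0])
    show "summable (\<lambda>i. (\<nu> * (C * r * (U \<omega> t powr (1 / s) / \<theta> 1))) * ((real (Suc i))\<^sup>2 * (\<nu> * \<rho>\<^sub>2) ^ i))"
      by (intro summable_mult summable_square_geometric z nu_rho2)
    fix i
    have "norm ((real (Suc i))\<^sup>2 * \<nu> ^ Suc i * (garch_coeff p q \<theta> (Suc i) * (obs \<omega> (t - 1 - int i))\<^sup>2))
       = (real (Suc i))\<^sup>2 * \<nu> ^ Suc i * (garch_coeff p q \<theta> (Suc i) * (obs \<omega> (t - 1 - int i))\<^sup>2)"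
      using nu coeff_nonneg[of i] by (simp add: abs_mult)
    also have "\<dots> \<le> (real (Suc i))\<^sup>2 * \<nu> ^ Suc i * (C * r * (U \<omega> t powr (1 / s) / \<theta> 1) * \<rho>\<^sub>2 ^ i)"
      using nu by (intro mult_left_mono lin_term) auto
    also have "\<dots> = (\<nu> * (C * r * (U \<omega> t powr (1 / s) / \<theta> 1))) * ((real (Suc i))\<^sup>2 * (\<nu> * \<rho>\<^sub>2) ^ i)"
      by (simp add: power_mult_distrib)
    finally show "norm ((real (Suc i))\<^sup>2 * \<nu> ^ Suc i * (garch_coeff p q \<theta> (Suc i) * (obs \<omega> (t - 1 - int i))\<^sup>2))
      \<le> (\<nu> * (C * r * (U \<omega> t powr (1 / s) / \<theta> 1))) * ((real (Suc i))\<^sup>2 * (\<nu> * \<rho>\<^sub>2) ^ i)" .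
  qed
  show "summable (\<lambda>i. (real (Suc i))\<^sup>2 * \<nu> ^ Suc i * (2 * garch_coeff p q \<theta> (Suc i) * (obs \<omega> (t - 1 - int i))\<^sup>2 / \<theta> 0) powr a)"
  proof (rule summable_comparison_test'[of _ 0])
    show "summable (\<lambda>i. (real (Suc i))\<^sup>2 * (\<nu> * \<rho>\<^sub>2 powr a) ^ i * (\<nu> * (2 * C * r / (\<theta> 0 * \<theta> 1)) powr a * U \<omega> t powr (1 / real N)))"
      by (intro summable_mult2 summable_z)
    fix i
    have "(real (Suc i))\<^sup>2 * \<nu> ^ Suc i * (2 * garch_coeff p q \<theta> (Suc i) * (obs \<omega> (t - 1 - int i))\<^sup>2 / \<theta> 0) powr a
       \<le> (real (Suc i))\<^sup>2 * \<nu> ^ Suc i * ((2 * C * r / (\<theta> 0 * \<theta> 1)) powr a * (\<rho>\<^sub>2 powr a) ^ i * U \<omega> t powr (1 / real N))"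
      using nu by (intro mult_left_mono pow_term) auto
    then show "norm ((real (Suc i))\<^sup>2 * \<nu> ^ Suc i * (2 * garch_coeff p q \<theta> (Suc i) * (obs \<omega> (t - 1 - int i))\<^sup>2 / \<theta> 0) powr a)
      \<le> (real (Suc i))\<^sup>2 * (\<nu> * \<rho>\<^sub>2 powr a) ^ i * (\<nu> * (2 * C * r / (\<theta> 0 * \<theta> 1)) powr a * U \<omega> t powr (1 / real N))"
      using nu by (simp add: abs_mult power_mult_distrib mult_ac)
  qed
qed (use th T1 kappa0 a in \<open>auto simp: T_def\<close>)

lemma Gam_bound: "volatility_path.C1 p q \<theta> + volatility_path.Gam p q \<theta> \<nu> a (\<lambda>i. (obs \<omega> (t - 1 - int i))\<^sup>2) \<le> A1 * Qv \<omega> t"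
proof -
  interpret P: volatility_path p q \<theta> \<kappa>\<^sub>0 \<nu> a "\<lambda>i. (obs \<omega> (t - 1 - int i))\<^sup>2" by (rule path)
  have "P.Gam \<le> (\<Sum>i. (real (Suc i))\<^sup>2 * (\<nu> * \<rho>\<^sub>2 powr a) ^ i * (\<nu> * (2 * C * r / (\<theta> 0 * \<theta> 1)) powr a * U \<omega> t powr (1 / real N)))"
    unfolding P.Gam_def
  proof (rule suminf_le[OF _ P.summable_pow summable_mult2[OF summable_z]])
    fix i
    have "(real (Suc i))\<^sup>2 * \<nu> ^ Suc i * (2 * garch_coeff p q \<theta> (Suc i) * (obs \<omega> (t - 1 - int i))\<^sup>2 / \<theta> 0) powr a
       \<le> (real (Suc i))\<^sup>2 * \<nu> ^ Suc i * ((2 * C * r / (\<theta> 0 * \<theta> 1)) powr a * (\<rho>\<^sub>2 powr a) ^ i * U \<omega> t powr (1 / real N))"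
      using nu by (intro mult_left_mono pow_term) auto
    then show "(real (Suc i))\<^sup>2 * \<nu> ^ Suc i * (2 * garch_coeff p q \<theta> (Suc i) * (obs \<omega> (t - 1 - int i))\<^sup>2 / \<theta> 0) powr a
      \<le> (real (Suc i))\<^sup>2 * (\<nu> * \<rho>\<^sub>2 powr a) ^ i * (\<nu> * (2 * C * r / (\<theta> 0 * \<theta> 1)) powr a * U \<omega> t powr (1 / real N))"
      by (simp add: power_mult_distrib mult_ac)
  qed
  also have "\<dots> = A0 * U \<omega> t powr (1 / real N)"
    unfolding suminf_mult2[OF summable_z, symmetric] A0_def by simp
  also have "\<dots> \<le> A0 * Qv \<omega> t" using A0 by (intro mult_left_mono U_powr)
  finally have 1: "P.Gam \<le> A0 * Qv \<omega> t" .
  have "P.C1 * 1 \<le> P.C1 * Qv \<omega> t" using P.C1_ge Qv_ge1 by (intro mult_left_mono) auto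
  moreover have "A1 = P.C1 + A0" by (simp add: A1_def P.C1_def T_def)
  ultimately show ?thesis using 1 by (simp add: distrib_right)
qed

end

end

section \<open>The laws of large numbers for the score\<close>

context garch_constants
begin

text \<open>Observation, squared volatility and score as functions of the past, which makes each of
  them a stationary sequence.\<close>

definition obsf :: "(nat \<Rightarrow> real) \<Rightarrow> real" where "obsf x = f (shift 1 x) * x 0"

lemma obsf_past: "obs \<omega> t = obsf (past t \<omega>)"
  unfolding obsf_def shift_past obs_def sig_def by (simp add: past_def)

lemma obsf_measurable [measurable]: "obsf \<in> borel_measurable seqM"
  unfolding obsf_def[abs_def] by measurable

definition volf :: "(nat \<Rightarrow> real) \<Rightarrow> real" where
  "volf x = garch_coeff p q \<theta> 0 + (\<Sum>i. garch_coeff p q \<theta> (Suc i) * (obsf (shift i x))\<^sup>2)"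

definition scoref :: "nat \<Rightarrow> (nat \<Rightarrow> real) \<Rightarrow> real" where
  "scoref l x = (garch_deriv p q \<theta> (unit_dir l) 0
      + (\<Sum>i. garch_deriv p q \<theta> (unit_dir l) (Suc i) * (obsf (shift i x))\<^sup>2)) / volf x"

lemma scoref_measurable [measurable]: "scoref l \<in> borel_measurable seqM"
  unfolding scoref_def[abs_def] volf_def[abs_def] by measurable

definition D :: "nat \<Rightarrow> 'a \<Rightarrow> int \<Rightarrow> real" where "D l \<omega> t = scoref l (past (t - 1) \<omega>)"
definition \<mu> :: "nat \<Rightarrow> real" where "\<mu> l = (\<integral>x. scoref l x \<partial>law)"
definition th_min :: real where "th_min = Min (\<theta> ` {..<p + q + 1})"

lemma th_min: "0 < th_min" "l < p + q + 1 \<Longrightarrow> th_min \<le> \<theta> l"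
proof -
  show "0 < th_min" unfolding th_min_def using th by (subst Min_gr_iff) auto
  show "l < p + q + 1 \<Longrightarrow> th_min \<le> \<theta> l" unfolding th_min_def by (rule Min_le) auto
qed

lemma A1: "1 \<le> A1"
proof -
  have "(1 - T) ^ 3 \<le> 1" using T_bounds by (intro power_le_one) auto
  then have "1 \<le> 4 / (1 - T) ^ 3" using T_bounds by (simp add: field_simps)
  then show ?thesis using A0 by (simp add: A1_def)
qed

lemma D_bound:
  assumes reg: "regular \<omega>" and l: "l < p + q + 1"
  shows "\<bar>D l \<omega> t\<bar> \<le> A1 / th_min * Qv \<omega> t"
proof -
  interpret P: volatility_path p q \<theta> \<kappa>\<^sub>0 \<nu> a "\<lambda>i. (obs \<omega> (t - 1 - int i))\<^sup>2" by (rule path[OF reg])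
  have eq: "D l \<omega> t = P.score l"
    unfolding P.score_def P.h_def unfolding D_def scoref_def volf_def shift_past obsf_past by (rule refl)
  have "\<bar>P.score l\<bar> \<le> (P.C1 + P.Gam) / th_min" using th_min l by (intro P.score_bound) auto
  also have "\<dots> \<le> A1 * Qv \<omega> t / th_min" using Gam_bound[OF reg, of t] th_min by (intro divide_right_mono) auto
  finally show ?thesis unfolding eq by simp
qed

lemma integrable_law_iff_past:
  assumes [measurable]: "g \<in> borel_measurable seqM"
  shows "integrable law (g :: _ \<Rightarrow> real) \<longleftrightarrow> integrable M (\<lambda>\<omega>. g (past t \<omega>))"
  unfolding distr_past[symmetric, of t] by (rule integrable_distr_eq) auto

lemma scoref_integrable:
  assumes "l < p + q + 1"
  shows "integrable law (scoref l)"
proof -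
  have iv: "integrable M (\<lambda>\<omega>. A1 / th_min * (1 + V (past 0 \<omega>)))"
    using integrable_past[OF V_measurable V_integrable, of 0] by simp
  have "integrable M (\<lambda>\<omega>. scoref l (past 0 \<omega>))"
  proof (rule Bochner_Integration.integrable_bound[OF iv])
    show "AE \<omega> in M. norm (scoref l (past 0 \<omega>)) \<le> norm (A1 / th_min * (1 + V (past 0 \<omega>)))"
      using AE_regular
    proof eventually_elim
      case (elim \<omega>)
      have "\<bar>scoref l (past 0 \<omega>)\<bar> \<le> A1 / th_min * Qv \<omega> 1" using D_bound[OF elim assms, of 1] by (simp add: D_def)
      also have "\<dots> \<le> A1 / th_min * (1 + V (past 0 \<omega>))"
      proof (rule mult_left_mono)
        have "Qv \<omega> 1 \<le> Qv \<omega> 1 ^ N" using Qv_ge1 N by (intro self_le_power) auto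
        then show "Qv \<omega> 1 \<le> 1 + V (past 0 \<omega>)" unfolding Qv_power by (simp add: U_def)
      qed (use A1 th_min(1) in simp)
      finally show ?case unfolding real_norm_def by (rule order_trans[OF _ abs_ge_self])
    qed
  qed simp
  then show ?thesis using integrable_law_iff_past[of "scoref l" 0] by simp
qed

lemma indep_now_past:
  assumes [measurable]: "\<phi> \<in> borel_measurable borel" "\<psi> \<in> borel_measurable seqM"
  shows "indep_var borel (\<lambda>\<omega>. \<phi> (\<epsilon> 0 \<omega>)) borel (\<lambda>\<omega>. \<psi> (past (- 1) \<omega>))"
proof -
  let ?A = "{0 :: int}" and ?B = "{..< 0 :: int}"
  have "indep_var (PiM ?A (\<lambda>_. borel)) (\<lambda>\<omega>. restrict (\<lambda>i. \<epsilon> i \<omega>) ?A) (PiM ?B (\<lambda>_. borel)) (\<lambda>\<omega>. restrict (\<lambda>i. \<epsilon> i \<omega>) ?B)"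
    by (intro indep_var_restrict[OF indep_eps]) auto
  moreover have "(\<lambda>y. \<phi> (y 0)) \<in> borel_measurable (PiM ?A (\<lambda>_. borel))"
    by (rule measurable_compose[OF measurable_component_singleton]) auto
  moreover have "(\<lambda>y. \<psi> (\<lambda>i. y (- 1 - int i))) \<in> borel_measurable (PiM ?B (\<lambda>_. borel))"
  proof (rule measurable_compose[of _ _ seqM])
    show "(\<lambda>y i. y (- 1 - int i)) \<in> measurable (PiM ?B (\<lambda>_. borel)) seqM"
      by (rule measurable_into_seqM, rule measurable_component_singleton) auto
  qed simp
  ultimately have "indep_var borel ((\<lambda>y. \<phi> (y 0)) \<circ> (\<lambda>\<omega>. restrict (\<lambda>i. \<epsilon> i \<omega>) ?A)) borel ((\<lambda>y. \<psi> (\<lambda>i. y (- 1 - int i))) \<circ> (\<lambda>\<omega>. restrict (\<lambda>i. \<epsilon> i \<omega>) ?B))"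
    by (rule indep_var_compose)
  then show ?thesis by (simp add: comp_def past_def)
qed

text \<open>Coordinate 0 of the past is the present innovation, and the shifted sequence is the
  strict past, which is independent of it.\<close>

lemma now_times_past:
  fixes \<phi> :: "real \<Rightarrow> real" and \<psi> :: "(nat \<Rightarrow> real) \<Rightarrow> real"
  assumes m[measurable]: "\<phi> \<in> borel_measurable borel" "\<psi> \<in> borel_measurable seqM"
    and i1: "integrable M (\<lambda>\<omega>. \<phi> (\<epsilon> 0 \<omega>))" and i2: "integrable law \<psi>"
  shows "integrable law (\<lambda>x. \<phi> (x 0) * \<psi> (shift 1 x))"
    and "(\<integral>x. \<phi> (x 0) * \<psi> (shift 1 x) \<partial>law) = expectation (\<lambda>\<omega>. \<phi> (\<epsilon> 0 \<omega>)) * (\<integral>x. \<psi> x \<partial>law)"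
proof -
  have i2': "integrable M (\<lambda>\<omega>. \<psi> (past (- 1) \<omega>))" by (rule integrable_past[OF m(2) i2])
  have eq: "\<phi> (past 0 \<omega> 0) * \<psi> (shift 1 (past 0 \<omega>)) = \<phi> (\<epsilon> 0 \<omega>) * \<psi> (past (- 1) \<omega>)" for \<omega>
    unfolding shift_past by (simp add: past_def)
  have gm[measurable]: "(\<lambda>x. \<phi> (x 0) * \<psi> (shift 1 x)) \<in> borel_measurable seqM" by measurable
  have "integrable M (\<lambda>\<omega>. \<phi> (past 0 \<omega> 0) * \<psi> (shift 1 (past 0 \<omega>)))"
    unfolding eq using indep_var_integrable[OF indep_now_past[OF m] i1 i2'] .
  then show "integrable law (\<lambda>x. \<phi> (x 0) * \<psi> (shift 1 x))"
    using integrable_law_iff_past[OF gm, of 0] by simp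
  have "(\<integral>x. \<phi> (x 0) * \<psi> (shift 1 x) \<partial>law) = (\<integral>\<omega>. \<phi> (past 0 \<omega> 0) * \<psi> (shift 1 (past 0 \<omega>)) \<partial>M)"
    using integral_past[OF gm, of 0] by simp
  also have "\<dots> = expectation (\<lambda>\<omega>. \<phi> (\<epsilon> 0 \<omega>)) * (\<integral>\<omega>. \<psi> (past (- 1) \<omega>) \<partial>M)"
    unfolding eq by (rule indep_var_lebesgue_integral[OF indep_now_past[OF m] i1 i2'])
  also have "(\<integral>\<omega>. \<psi> (past (- 1) \<omega>) \<partial>M) = (\<integral>x. \<psi> x \<partial>law)" by (rule integral_past[OF m(2)])
  finally show "(\<integral>x. \<phi> (x 0) * \<psi> (shift 1 x) \<partial>law) = expectation (\<lambda>\<omega>. \<phi> (\<epsilon> 0 \<omega>)) * (\<integral>x. \<psi> x \<partial>law)" .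
qed

lemma moment_le:
  assumes "m \<le> K"
  shows "integrable M (\<lambda>\<omega>. \<bar>\<epsilon> 0 \<omega>\<bar> ^ m)" "integrable M (\<lambda>\<omega>. \<epsilon> 0 \<omega> ^ m)"
proof -
  have i: "integrable M (\<lambda>\<omega>. 1 + \<bar>\<epsilon> 0 \<omega>\<bar> ^ K)" using momK by simp
  show "integrable M (\<lambda>\<omega>. \<bar>\<epsilon> 0 \<omega>\<bar> ^ m)"
    by (rule Bochner_Integration.integrable_bound[OF i]) (use power_mult_le_one_plus[OF assms] in \<open>auto intro!: AE_I2 order_trans[OF _ abs_ge_self]\<close>)
  then show "integrable M (\<lambda>\<omega>. \<epsilon> 0 \<omega> ^ m)"
    by (rule Bochner_Integration.integrable_bound) (auto simp: power_abs)
qed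

text \<open>Dominates the error terms of all power sums. Its factors belong to the present and to
  the strict past, so that their separate integrability suffices.\<close>

definition Hf :: "(nat \<Rightarrow> real) \<Rightarrow> real" where "Hf x = (1 + \<bar>x 0\<bar> ^ K) * (1 + V (shift 1 x))"

lemma Hf_measurable [measurable]: "Hf \<in> borel_measurable seqM"
  unfolding Hf_def[abs_def] by measurable

lemma Hf_nonneg: "0 \<le> Hf x" unfolding Hf_def using V_nonneg by (intro mult_nonneg_nonneg add_nonneg_nonneg) auto

lemma Hf_integrable: "integrable law Hf"
proof -
  interpret Lw: prob_space law by (rule law_prob)
  have "integrable law (\<lambda>x. (1 + \<bar>x 0\<bar> ^ K) * (1 + V (shift 1 x)))"
    by (rule now_times_past(1)[where \<phi> = "\<lambda>x. 1 + \<bar>x\<bar> ^ K" and \<psi> = "\<lambda>x. 1 + V x"]) (use momK V_integrable in auto)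
  then show ?thesis by (simp add: Hf_def[abs_def])
qed

lemma Hf_past: "Hf (past t \<omega>) = (1 + \<bar>\<epsilon> t \<omega>\<bar> ^ K) * Qv \<omega> t ^ (3 * K)"
proof -
  have "Hf (past t \<omega>) = (1 + \<bar>\<epsilon> t \<omega>\<bar> ^ K) * (1 + V (past (t - 1) \<omega>))"
    unfolding Hf_def shift_past by (simp add: past_def)
  then show ?thesis using Qv_power[of \<omega> t] by (simp add: N_def U_def)
qed

text \<open>Cutting off the volatility series at the first observation causes errors of this form.
  Their total has finite mean, so it is finite almost surely and negligible against \<open>sqrt
  n\<close>.\<close>

lemma AE_weighted_sum_bounded: "AE \<omega> in M. \<exists>c. \<forall>n. (\<Sum>t=1..int n. \<rho> ^ nat t * Hf (past t \<omega>)) \<le> c"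
proof -
  let ?g = "\<lambda>i \<omega>. ennreal (\<rho> ^ Suc i * Hf (past (int (Suc i)) \<omega>))"
  have "(\<integral>\<^sup>+\<omega>. (\<Sum>i. ?g i \<omega>) \<partial>M) = (\<Sum>i. \<integral>\<^sup>+\<omega>. ?g i \<omega> \<partial>M)" by (rule nn_integral_suminf) measurable
  also have "(\<lambda>i. \<integral>\<^sup>+\<omega>. ?g i \<omega> \<partial>M) = (\<lambda>i. ennreal (\<rho> ^ Suc i * (\<integral>x. Hf x \<partial>law)))"
  proof
    fix i
    have "(\<integral>\<^sup>+\<omega>. ?g i \<omega> \<partial>M) = (\<integral>\<^sup>+x. ennreal (\<rho> ^ Suc i * Hf x) \<partial>law)"
      by (rule nn_integral_past[of "\<lambda>x. ennreal (\<rho> ^ Suc i * Hf x)"]) measurable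
    also have "\<dots> = ennreal (\<integral>x. \<rho> ^ Suc i * Hf x \<partial>law)"
      using Hf_nonneg rho Hf_integrable by (intro nn_integral_eq_integral) (auto intro!: AE_I2 mult_nonneg_nonneg)
    finally show "(\<integral>\<^sup>+\<omega>. ?g i \<omega> \<partial>M) = ennreal (\<rho> ^ Suc i * (\<integral>x. Hf x \<partial>law))" by simp
  qed
  also have "(\<Sum>i. ennreal (\<rho> ^ Suc i * (\<integral>x. Hf x \<partial>law))) = ennreal (\<Sum>i. \<rho> ^ Suc i * (\<integral>x. Hf x \<partial>law))"
    using rho Hf_nonneg
    by (intro suminf_ennreal2 summable_mult2 mult_nonneg_nonneg integral_nonneg_AE AE_I2) (auto simp: summable_Suc_iff intro!: summable_geometric)
  also have "\<dots> < \<infinity>" by simp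
  finally have "AE \<omega> in M. (\<Sum>i. ?g i \<omega>) \<noteq> \<infinity>" by (intro nn_integral_PInf_AE) auto
  then show ?thesis
  proof eventually_elim
    case (elim \<omega>)
    define c where "c = enn2real (\<Sum>i. ?g i \<omega>)"
    have c: "(\<Sum>i. ?g i \<omega>) = ennreal c" unfolding c_def using elim by (simp add: less_top)
    have "(\<Sum>t=1..int n. \<rho> ^ nat t * Hf (past t \<omega>)) \<le> c" for n
    proof -
      have "(\<Sum>t=1..int n. \<rho> ^ nat t * Hf (past t \<omega>)) = (\<Sum>i<n. \<rho> ^ Suc i * Hf (past (int (Suc i)) \<omega>))"
        by (rule sum.reindex_bij_witness[of _ "\<lambda>i. int (Suc i)" "\<lambda>t. nat t - 1"]) (auto simp: Suc_diff_le nat_eq_iff simp del: power_Suc)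
      also have "ennreal \<dots> = (\<Sum>i<n. ?g i \<omega>)" using rho Hf_nonneg by (intro sum_ennreal[symmetric]) (auto intro!: mult_nonneg_nonneg)
      also have "\<dots> \<le> ennreal c" unfolding c[symmetric] by (rule sum_le_suminf) auto
      finally show ?thesis by (simp add: ennreal_le_iff c_def)
    qed
    then show ?case by blast
  qed
qed

text \<open>The functions to which the law of large numbers is applied, collected in one finite
  family so that a single subsequence and a single null set serve them all.\<close>

definition lln :: "(nat \<times> nat) + nat \<Rightarrow> (nat \<Rightarrow> real) \<Rightarrow> real" where
  "lln i x = (case i of Inl (m, l) \<Rightarrow> x 0 ^ m * (scoref l (shift 1 x) - \<mu> l)
     | Inr m \<Rightarrow> if m = 0 then Hf x else if m = 1 then x 0 else if m = 2 then (x 0)\<^sup>2 else \<bar>x 0\<bar> ^ K)"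

definition lln_index :: "((nat \<times> nat) + nat) set" where
  "lln_index = Inl ` ({..K} \<times> {..<p + q + 1}) \<union> Inr ` {..3}"

lemma lln_measurable: "lln i \<in> borel_measurable seqM"
proof (cases i)
  case (Inl a)
  then show ?thesis unfolding lln_def[abs_def] by (cases a) simp
next
  case (Inr m)
  then show ?thesis unfolding lln_def[abs_def] by simp
qed

lemma integrable_now:
  assumes [measurable]: "\<phi> \<in> borel_measurable borel" and "integrable M (\<lambda>\<omega>. \<phi> (\<epsilon> 0 \<omega>))"
  shows "integrable law (\<lambda>x. \<phi> (x 0) :: real)" "(\<integral>x. \<phi> (x 0) \<partial>law) = expectation (\<lambda>\<omega>. \<phi> (\<epsilon> 0 \<omega>))"
proof -
  have e: "past 0 \<omega> 0 = \<epsilon> 0 \<omega>" for \<omega> by (simp add: past_def)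
  show "integrable law (\<lambda>x. \<phi> (x 0))" using assms(2) integrable_law_iff_past[of "\<lambda>x. \<phi> (x 0)" 0] by (simp add: e)
  show "(\<integral>x. \<phi> (x 0) \<partial>law) = expectation (\<lambda>\<omega>. \<phi> (\<epsilon> 0 \<omega>))"
    using integral_past[of "\<lambda>x. \<phi> (x 0)" 0] by (simp add: e)
qed

lemma lln_integrable:
  assumes "i \<in> lln_index"
  shows "integrable law (lln i)"
proof -
  interpret Lw: prob_space law by (rule law_prob)
  from assms consider (l) m l where "i = Inl (m, l)" "m \<le> K" "l < p + q + 1" | (r) m where "i = Inr m" "m \<le> 3"
    by (auto simp: lln_index_def)
  then show ?thesis
  proof cases
    case l
    have "integrable law (\<lambda>x. x 0 ^ m * (scoref l (shift 1 x) - \<mu> l))"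
      by (rule now_times_past(1)[where \<phi> = "\<lambda>x. x ^ m" and \<psi> = "\<lambda>x. scoref l x - \<mu> l"]) (use moment_le[OF l(2)] scoref_integrable[OF l(3)] in auto)
    then show ?thesis using l by (simp add: lln_def[abs_def])
  next
    case r
    have "integrable law (\<lambda>x. x 0)" using integrable_now(1)[of "\<lambda>x. x"] moment_le(2)[of 1] K2 by simp
    moreover have "integrable law (\<lambda>x. (x 0)\<^sup>2)" using integrable_now(1)[of "\<lambda>x. x\<^sup>2"] moment_le(2)[OF K2] by simp
    moreover have "integrable law (\<lambda>x. \<bar>x 0\<bar> ^ K)" using integrable_now(1)[of "\<lambda>x. \<bar>x\<bar> ^ K"] momK by simp
    ultimately show ?thesis using r Hf_integrable
      by (cases "m = 0"; cases "m = 1"; cases "m = 2") (simp_all add: lln_def[abs_def])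
  qed
qed

text \<open>Given the past, the centred score is a constant factor; its mean is zero by independence
  of the present innovation, whatever the moment of the latter.\<close>

lemma lln_score_mean:
  assumes "m \<le> K" "l < p + q + 1"
  shows "(\<integral>x. lln (Inl (m, l)) x \<partial>law) = 0"
proof -
  interpret Lw: prob_space law by (rule law_prob)
  have "(\<integral>x. x 0 ^ m * (scoref l (shift 1 x) - \<mu> l) \<partial>law) = expectation (\<lambda>\<omega>. \<epsilon> 0 \<omega> ^ m) * (\<integral>x. scoref l x - \<mu> l \<partial>law)"
    by (rule now_times_past(2)[where \<phi> = "\<lambda>x. x ^ m" and \<psi> = "\<lambda>x. scoref l x - \<mu> l"]) (use moment_le[OF assms(1)] scoref_integrable[OF assms(2)] in auto)
  also have "(\<integral>x. scoref l x - \<mu> l \<partial>law) = 0"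
    using scoref_integrable[OF assms(2)] by (simp add: \<mu>_def Lw.prob_space)
  finally show ?thesis by (simp add: lln_def)
qed

lemma max_dev_uniform:
  assumes F: "F \<le> sequentially" and lim: "((\<lambda>n. max_dev g n \<omega>) \<longlongrightarrow> 0) F"
  shows "uniform_limit {0..1} (\<lambda>n u. (\<Sum>t=1..\<lfloor>real n * u\<rfloor>. g (past t \<omega>) - (\<integral>x. g x \<partial>law)) / real n) (\<lambda>_. 0) F"
proof (rule uniform_null_bound[OF lim], rule always_eventually, intro allI ballI)
  fix n and u :: real assume u: "u \<in> {0..1}"
  have j: "nat \<lfloor>real n * u\<rfloor> \<le> n" "{1..\<lfloor>real n * u\<rfloor>} = {1..int (nat \<lfloor>real n * u\<rfloor>)}"
  proof -
    have "0 \<le> \<lfloor>real n * u\<rfloor>" using u by simp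
    moreover have "\<lfloor>real n * u\<rfloor> \<le> int n"
      using u mult_left_le[of u "real n"] by (simp add: floor_le_iff)
    ultimately show "nat \<lfloor>real n * u\<rfloor> \<le> n" "{1..\<lfloor>real n * u\<rfloor>} = {1..int (nat \<lfloor>real n * u\<rfloor>)}" by auto
  qed
  show "\<bar>(\<Sum>t=1..\<lfloor>real n * u\<rfloor>. g (past t \<omega>) - (\<integral>x. g x \<partial>law)) / real n\<bar> \<le> max_dev g n \<omega>"
    using max_dev_ge[OF j(1), of g \<omega>] unfolding j(2) dev_sum_def[symmetric] by simp
qed

end

section \<open>The residuals along a typical path\<close>

text \<open>The mean of the score acts as such a common factor on the residuals, which the
  normalisation removes.\<close>

lemma self_normalised_scale:
  fixes g1 g2 :: "int \<Rightarrow> real"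
  assumes g: "\<And>t. t \<in> {1..int n} \<Longrightarrow> g1 t = b * g2 t" and b: "0 < b" and u: "u \<in> {0..1}"
  shows "partial_sum g1 k n u / sample_sd g1 n ^ k = partial_sum g2 k n u / sample_sd g2 n ^ k"
proof -
  have mean: "sample_mean g1 n = b * sample_mean g2 n"
    unfolding sample_mean_def using g by (simp add: sum_distrib_left)
  have ps: "partial_sum g1 k n u = b ^ k * partial_sum g2 k n u" if "u \<in> {0..1}" for k u
    unfolding partial_sum_def mean sum_distrib_left
  proof (rule sum.cong[OF refl])
    fix t assume "t \<in> {1..\<lfloor>real n * u\<rfloor>}"
    then have "t \<in> {1..int n}" using floor_atMost_subset[OF that, of n] by blast
    then have "g1 t - b * sample_mean g2 n = b * (g2 t - sample_mean g2 n)" using g by (simp add: right_diff_distrib)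
    then show "(g1 t - b * sample_mean g2 n) ^ k = b ^ k * (g2 t - sample_mean g2 n) ^ k" by (simp only: power_mult_distrib)
  qed
  have sd: "sample_sd g1 n = b * sample_sd g2 n"
    unfolding sample_sd_def using b by (subst ps) (auto simp: real_sqrt_mult real_sqrt_divide)
  show ?thesis unfolding ps[OF u] sd power_mult_distrib using b by simp
qed

context garch_constants
begin

definition "W1 \<omega> = 2 / \<theta> 0 * (C * (U \<omega> 0 powr (1 / s) / \<theta> 1) / (1 - \<nu> * \<rho>\<^sub>2))"

lemma W1_nonneg: "0 \<le> W1 \<omega>"
  unfolding W1_def using th0 theta1 C(1) nu_rho2 by (intro mult_nonneg_nonneg divide_nonneg_nonneg) auto

text \<open>At time \<open>n\<close> the terms before the first observation carry coefficients with
  index above \<open>n\<close>, which yields the factor \<open>\<rho> ^ n\<close>; the growth of the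
  observations themselves is measured from time 0 and does not depend on \<open>n\<close>.\<close>

lemma tail_bound:
  assumes reg: "regular \<omega>"
  shows "(\<Sum>i. \<nu> ^ Suc (i + n) * (garch_coeff p q \<theta> (Suc (i + n)) * (obs \<omega> (int n - 1 - int (i + n)))\<^sup>2))
     \<le> (\<rho> ^ n * W1 \<omega>) * (\<theta> 0 / 2)"
proof -
  define M0 where "M0 = U \<omega> 0 powr (1 / s) / \<theta> 1"
  have M0: "0 \<le> M0" using theta1 by (simp add: M0_def)
  have z: "0 \<le> \<nu> * \<rho>\<^sub>2" "norm (\<nu> * \<rho>\<^sub>2) < 1" using nu rho2 nu_rho2 by (auto simp: abs_mult)
  let ?f = "\<lambda>i. \<nu> ^ Suc (i + n) * (garch_coeff p q \<theta> (Suc (i + n)) * (obs \<omega> (int n - 1 - int (i + n)))\<^sup>2)"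
  have f0: "0 \<le> ?f i" for i using nu coeff_nonneg by (intro mult_nonneg_nonneg) auto
  have le: "?f i \<le> C * M0 * \<rho> ^ n * (\<nu> * \<rho>\<^sub>2) ^ i" for i
  proof -
    have o: "int n - 1 - int (i + n) = 0 - 1 - int i" by simp
    have "?f i \<le> \<nu> ^ Suc (i + n) * ((C * r ^ Suc (i + n)) * (M0 * L ^ i))"
      unfolding o M0_def using nu C r by (intro mult_left_mono mult_mono C obs_growth[OF reg]) auto
    also have "\<dots> = (C * M0) * \<rho> ^ Suc n * ((\<nu> * r) * L) ^ i"
      by (simp add: \<rho>_def power_mult_distrib power_add mult_ac)
    also have "(\<nu> * r) * L = \<nu> * \<rho>\<^sub>2" using rL by simp
    also have "(C * M0) * \<rho> ^ Suc n * (\<nu> * \<rho>\<^sub>2) ^ i \<le> (C * M0) * \<rho> ^ n * (\<nu> * \<rho>\<^sub>2) ^ i"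
      using C(1) M0 rho z by (intro mult_right_mono mult_left_mono) (auto simp: mult_left_le_one_le)
    finally show ?thesis by (simp add: mult_ac)
  qed
  have sg: "summable (\<lambda>i. C * M0 * \<rho> ^ n * (\<nu> * \<rho>\<^sub>2) ^ i)" using z by (intro summable_mult summable_geometric)
  have sf: "summable ?f" by (rule summable_comparison_test'[OF sg, of 0]) (use le f0 in \<open>simp only: real_norm_def abs_of_nonneg\<close>)
  have "(\<Sum>i. ?f i) \<le> (\<Sum>i. C * M0 * \<rho> ^ n * (\<nu> * \<rho>\<^sub>2) ^ i)" by (intro suminf_le le sf sg)
  also have "\<dots> = C * M0 * \<rho> ^ n * (1 / (1 - \<nu> * \<rho>\<^sub>2))"
    using z by (subst suminf_mult) (auto intro: summable_geometric simp: suminf_geometric)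
  also have "\<dots> = (\<rho> ^ n * W1 \<omega>) * (\<theta> 0 / 2)" using th0 by (simp add: W1_def M0_def)
  finally show ?thesis .
qed

lemma residual_expansion:
  fixes u :: "nat \<Rightarrow> real"
  assumes reg: "regular \<omega>" and d: "\<And>l. l < p + q + 1 \<Longrightarrow> \<bar>u l - \<theta> l\<bar> \<le> \<kappa> * \<theta> l"
    and k: "0 \<le> \<kappa>" "\<kappa> \<le> \<kappa>\<^sub>0" and t: "1 \<le> t"
  shows "\<exists>y. residual p q u (obs \<omega>) t = \<epsilon> t \<omega> * y \<and> \<bar>y - 1 + (\<Sum>l<p + q + 1. (u l - \<theta> l) * D l \<omega> t) / 2\<bar>
     \<le> 9 * A1 ^ 3 * (\<kappa>\<^sup>2 + \<rho> ^ nat t * (W1 \<omega> * (1 + W1 \<omega>)\<^sup>2)) * Qv \<omega> t ^ 3"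
proof -
  interpret P: volatility_path p q \<theta> \<kappa>\<^sub>0 \<nu> a "\<lambda>i. (obs \<omega> (t - 1 - int i))\<^sup>2" by (rule path[OF reg])
  define n where "n = nat t"
  have tn: "t = int n" using t by (simp add: n_def)
  have score: "D l \<omega> t = P.score l" for l
    unfolding P.score_def P.h_def unfolding D_def scoref_def volf_def shift_past obsf_past by (rule refl)
  have tail: "(\<Sum>i. \<nu> ^ Suc (i + n) * (garch_coeff p q \<theta> (Suc (i + n)) * (obs \<omega> (t - 1 - int (i + n)))\<^sup>2)) \<le> (\<rho> ^ n * W1 \<omega>) * (\<theta> 0 / 2)"
    unfolding tn by (rule tail_bound[OF reg])
  define y where "y = sqrt (P.h / P.h_hat u n)"
  have exp: "\<bar>y - 1 + (\<Sum>l<p + q + 1. (u l - \<theta> l) * D l \<omega> t) / 2\<bar>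
    \<le> 9 * \<kappa>\<^sup>2 * (A1 * Qv \<omega> t) ^ 3 + 9 * (A1 * Qv \<omega> t) ^ 3 * (\<rho> ^ n * W1 \<omega>) * (1 + \<rho> ^ n * W1 \<omega>)\<^sup>2"
    unfolding y_def score by (rule P.sqrt_ratio_expansion[OF d k tail Gam_bound[OF reg]])
  have "(A1 * Qv \<omega> t) ^ 3 * ((\<rho> ^ n * W1 \<omega>) * (1 + \<rho> ^ n * W1 \<omega>)\<^sup>2) \<le> (A1 * Qv \<omega> t) ^ 3 * (\<rho> ^ n * (W1 \<omega> * (1 + W1 \<omega>)\<^sup>2))"
  proof (rule mult_left_mono)
    have r1: "\<rho> ^ n \<le> 1" "0 \<le> \<rho> ^ n" using rho by (auto intro: power_le_one)
    have "(1 + \<rho> ^ n * W1 \<omega>)\<^sup>2 \<le> (1 + W1 \<omega>)\<^sup>2"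
      using r1 W1_nonneg mult_right_mono[OF r1(1) W1_nonneg, of \<omega>] by (intro power_mono) auto
    then have "(\<rho> ^ n * W1 \<omega>) * (1 + \<rho> ^ n * W1 \<omega>)\<^sup>2 \<le> (\<rho> ^ n * W1 \<omega>) * (1 + W1 \<omega>)\<^sup>2"
      using r1 W1_nonneg by (intro mult_left_mono) auto
    then show "(\<rho> ^ n * W1 \<omega>) * (1 + \<rho> ^ n * W1 \<omega>)\<^sup>2 \<le> \<rho> ^ n * (W1 \<omega> * (1 + W1 \<omega>)\<^sup>2)" by (simp only: mult.assoc)
  qed (use A1 Qv_ge1[of \<omega> t] in auto)
  with exp have bound: "\<bar>y - 1 + (\<Sum>l<p + q + 1. (u l - \<theta> l) * D l \<omega> t) / 2\<bar>
    \<le> 9 * A1 ^ 3 * (\<kappa>\<^sup>2 + \<rho> ^ nat t * (W1 \<omega> * (1 + W1 \<omega>)\<^sup>2)) * Qv \<omega> t ^ 3"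
    by (simp add: n_def power_mult_distrib algebra_simps)
  have h: "P.h = (sig \<omega> t)\<^sup>2" unfolding sig_series[OF reg] vol_series_def P.h_def by (rule refl)
  have hh: "P.h_hat u n = garch_coeff p q u 0 + (\<Sum>i=1..nat t. garch_coeff p q u i * (obs \<omega> (t - int i))\<^sup>2)"
  proof -
    have "(\<Sum>i<n. garch_coeff p q u (Suc i) * (obs \<omega> (t - 1 - int i))\<^sup>2) = (\<Sum>i=1..n. garch_coeff p q u i * (obs \<omega> (t - int i))\<^sup>2)"
      by (rule sum.reindex_bij_witness[of _ "\<lambda>i. i - 1" Suc]) (auto simp: of_nat_diff algebra_simps)
    then show ?thesis unfolding P.h_hat_def n_def by simp
  qed
  have sg0: "0 \<le> sig \<omega> t" by (rule sol(2)[OF reg])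
  have "residual p q u (obs \<omega>) t = obs \<omega> t / sqrt (P.h_hat u n)" unfolding residual_def hh by (rule refl)
  also have "\<dots> = \<epsilon> t \<omega> * y" unfolding y_def real_sqrt_divide h using sg0 by (simp add: obs_def)
  finally show ?thesis using bound by blast
qed

lemma lln_average:
  assumes F: "F \<le> sequentially" and lim: "((\<lambda>n. max_dev (lln i) n \<omega>) \<longlongrightarrow> 0) F"
  shows "((\<lambda>n. (\<Sum>t=1..int n. lln i (past t \<omega>)) / real n) \<longlongrightarrow> (\<integral>x. lln i x \<partial>law)) F"
proof -
  let ?m = "\<integral>x. lln i x \<partial>law"
  have pos: "eventually (\<lambda>n. 0 < n) F" using F eventually_gt_at_top[of 0] by (rule filter_leD)
  have "((\<lambda>n. (\<Sum>t=1..\<lfloor>real n * 1\<rfloor>. lln i (past t \<omega>) - ?m) / real n) \<longlongrightarrow> 0) F"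
    by (rule tendsto_uniform_limitI[OF max_dev_uniform[OF F lim]]) simp
  from tendsto_add[OF this tendsto_const[of ?m]]
  have "((\<lambda>n. (\<Sum>t=1..int n. lln i (past t \<omega>) - ?m) / real n + ?m) \<longlongrightarrow> ?m) F" by simp
  moreover have "eventually (\<lambda>n. (\<Sum>t=1..int n. lln i (past t \<omega>) - ?m) / real n + ?m = (\<Sum>t=1..int n. lln i (past t \<omega>)) / real n) F"
    using pos by eventually_elim (simp add: sum_subtractf diff_divide_distrib)
  ultimately show ?thesis by (simp add: tendsto_cong)
qed

lemma past_at_0: "past t \<omega> 0 = \<epsilon> t \<omega>" by (simp add: past_def)

text \<open>A deterministic statement about one path. Once the averages of the family
  \<open>lln\<close> converge along \<open>F\<close> and the estimation error is at most \<open>c /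
  sqrt n\<close>, no probability is left in the argument. For \<open>F\<close> one takes a
  subsequence of sample sizes, restricted to those at which the estimator is this close.\<close>

lemma residual_sums_close_on_path:
  fixes th_hat :: "nat \<Rightarrow> nat \<Rightarrow> real"
  assumes reg: "regular \<omega>" and F: "F \<le> sequentially"
    and lim: "\<And>i. i \<in> lln_index \<Longrightarrow> ((\<lambda>n. max_dev (lln i) n \<omega>) \<longlongrightarrow> 0) F"
    and wsum: "\<And>n. (\<Sum>t=1..int n. \<rho> ^ nat t * Hf (past t \<omega>)) \<le> c5"
    and mean: "expectation (\<epsilon> 0) = 0" and var: "expectation (\<lambda>\<omega>. (\<epsilon> 0 \<omega>)\<^sup>2) = 1"
    and k: "1 \<le> k" "K = max k 2"
    and est: "eventually (\<lambda>n. sqrt (real n) * max_norm (p + q + 1) (\<lambda>l. th_hat n l - \<theta> l) \<le> c) F"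
  shows "uniform_limit {0..1} (\<lambda>n u. 1 / sqrt (real n) *
       \<bar>partial_sum (residual p q (th_hat n) (obs \<omega>)) k n u / sample_sd (residual p q (th_hat n) (obs \<omega>)) n ^ k
         - partial_sum (\<lambda>t. \<epsilon> t \<omega>) k n u / sample_sd (\<lambda>t. \<epsilon> t \<omega>) n ^ k\<bar>) (\<lambda>_. 0) F"
proof -
  let ?d = "p + q + 1" and ?e = "\<lambda>t. \<epsilon> t \<omega>"
  define cd where "cd = max c 0"
  define \<delta> where "\<delta> n l = th_hat n l - \<theta> l" for n l
  define \<kappa> where "\<kappa> n = cd / sqrt (real n) / th_min" for n
  have cd: "0 \<le> cd" by (simp add: cd_def)
  have pos: "eventually (\<lambda>n. 0 < n) F" using F eventually_gt_at_top[of 0] by (rule filter_leD)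
  have del: "eventually (\<lambda>n. \<forall>l<?d. \<bar>\<delta> n l\<bar> \<le> cd / sqrt (real n)) F"
    using est pos
  proof eventually_elim
    case (elim n)
    have "\<bar>\<delta> n l\<bar> \<le> cd / sqrt (real n)" if "l < ?d" for l
    proof -
      have "\<bar>\<delta> n l\<bar> \<le> max_norm ?d (\<lambda>l. th_hat n l - \<theta> l)"
        unfolding max_norm_def \<delta>_def using that by (intro Max_ge) auto
      also have "\<dots> \<le> c / sqrt (real n)" using elim by (simp add: pos_le_divide_eq mult.commute)
      also have "\<dots> \<le> cd / sqrt (real n)" by (intro divide_right_mono) (auto simp: cd_def)
      finally show ?thesis .
    qed
    then show ?case by blast
  qed
  have kap0: "0 \<le> \<kappa> n" for n using cd th_min(1) by (simp add: \<kappa>_def)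
  have "((\<lambda>n. 1 / sqrt (real n)) \<longlongrightarrow> 0) sequentially" by real_asymp
  then have isq: "((\<lambda>n. 1 / sqrt (real n)) \<longlongrightarrow> 0) F" using F by (rule tendsto_mono[rotated])
  have "(\<kappa> \<longlongrightarrow> 0) F" using tendsto_mult_left[OF isq, of "cd / th_min"] by (simp add: \<kappa>_def[abs_def] mult.commute)
  then have kap: "eventually (\<lambda>n. \<kappa> n < \<kappa>\<^sub>0) F" using kappa0(1) by (rule order_tendstoD(2))
  have kd: "\<bar>th_hat n l - \<theta> l\<bar> \<le> \<kappa> n * \<theta> l" if "\<forall>l<?d. \<bar>\<delta> n l\<bar> \<le> cd / sqrt (real n)" "l < ?d" for n l
  proof -
    have "\<bar>th_hat n l - \<theta> l\<bar> \<le> cd / sqrt (real n)" using that by (simp add: \<delta>_def)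
    also have "\<dots> = \<kappa> n * th_min" using th_min(1) by (simp add: \<kappa>_def)
    also have "\<dots> \<le> \<kappa> n * \<theta> l" by (rule mult_left_mono[OF th_min(2)[OF that(2)] kap0])
    finally show ?thesis .
  qed
  define ok where "ok n t y \<longleftrightarrow> residual p q (th_hat n) (obs \<omega>) t = \<epsilon> t \<omega> * y \<and> \<bar>y - 1 + (\<Sum>l<?d. (th_hat n l - \<theta> l) * D l \<omega> t) / 2\<bar>
     \<le> 9 * A1 ^ 3 * ((\<kappa> n)\<^sup>2 + \<rho> ^ nat t * (W1 \<omega> * (1 + W1 \<omega>)\<^sup>2)) * Qv \<omega> t ^ 3" for n t y
  (* For the sample sizes at which the expansion is not yet valid this value is arbitrary. *)
  define y where "y n t = (SOME y. ok n t y)" for n t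
  have yok: "eventually (\<lambda>n. \<forall>t\<in>{1..int n}. ok n t (y n t)) F"
    using del kap
  proof eventually_elim
    case (elim n)
    have "\<exists>y. ok n t y" if "t \<in> {1..int n}" for t
      unfolding ok_def using that elim kap0
      by (intro residual_expansion[OF reg]) (auto intro: kd[OF elim(1)])
    then show ?case unfolding y_def by (blast intro: someI_ex)
  qed
  define C2 where "C2 = 9 * A1 ^ 3 * ((cd / th_min)\<^sup>2 + W1 \<omega> * (1 + W1 \<omega>)\<^sup>2)"
  have C2: "0 \<le> C2" unfolding C2_def using A1 W1_nonneg by (intro mult_nonneg_nonneg add_nonneg_nonneg) auto
  have exp: "eventually (\<lambda>n. \<forall>t\<in>{1..int n}. \<bar>y n t - 1 + (\<Sum>l<?d. \<delta> n l * D l \<omega> t) / 2\<bar> \<le> C2 * ((1 / real n + \<rho> ^ nat t) * Qv \<omega> t ^ 3)) F"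
    using yok pos
  proof eventually_elim
    case (elim n)
    show ?case
    proof
      fix t assume t: "t \<in> {1..int n}"
      let ?w = "W1 \<omega> * (1 + W1 \<omega>)\<^sup>2" and ?k = "(cd / th_min)\<^sup>2"
      have w: "0 \<le> ?w" using W1_nonneg by simp
      have r0: "0 \<le> \<rho> ^ nat t" using rho by simp
      have k2: "(\<kappa> n)\<^sup>2 = ?k * (1 / real n)" by (simp add: \<kappa>_def power_divide power_mult_distrib)
      have "\<bar>y n t - 1 + (\<Sum>l<?d. \<delta> n l * D l \<omega> t) / 2\<bar> \<le> 9 * A1 ^ 3 * ((\<kappa> n)\<^sup>2 + \<rho> ^ nat t * ?w) * Qv \<omega> t ^ 3"
        using elim(1) t unfolding ok_def \<delta>_def by blast
      also have "\<dots> \<le> 9 * A1 ^ 3 * ((?k + ?w) * (1 / real n + \<rho> ^ nat t)) * Qv \<omega> t ^ 3"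
      proof (intro mult_right_mono mult_left_mono)
        have "0 \<le> ?w * (1 / real n)" "0 \<le> ?k * \<rho> ^ nat t" using w r0 by auto
        then show "(\<kappa> n)\<^sup>2 + \<rho> ^ nat t * ?w \<le> (?k + ?w) * (1 / real n + \<rho> ^ nat t)"
          unfolding k2 by (simp add: distrib_left distrib_right mult.commute)
      qed (use A1 Qv_ge1[of \<omega> t] in auto)
      also have "\<dots> = C2 * ((1 / real n + \<rho> ^ nat t) * Qv \<omega> t ^ 3)" unfolding C2_def by (simp only: mult.assoc)
      finally show "\<bar>y n t - 1 + (\<Sum>l<?d. \<delta> n l * D l \<omega> t) / 2\<bar> \<le> C2 * ((1 / real n + \<rho> ^ nat t) * Qv \<omega> t ^ 3)" .
    qed
  qed
  have Llim: "uniform_limit {0..1} (\<lambda>n u. (\<Sum>t=1..\<lfloor>real n * u\<rfloor>. ?e t ^ m * (D l \<omega> t - \<mu> l)) / real n) (\<lambda>_. 0) F"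
    if "m \<in> {1..K}" "l < ?d" for m l
  proof -
    have i: "Inl (m, l) \<in> lln_index" using that by (auto simp: lln_index_def)
    have eq: "lln (Inl (m, l)) (past t \<omega>) = ?e t ^ m * (D l \<omega> t - \<mu> l)" for t
      unfolding D_def lln_def by (simp add: shift_past past_at_0)
    show ?thesis
      using max_dev_uniform[OF F lim[OF i]] lln_score_mean[of m l] that unfolding eq by simp
  qed
  have avg: "((\<lambda>n. (\<Sum>t=1..int n. lln (Inr m) (past t \<omega>)) / real n) \<longlongrightarrow> (\<integral>x. lln (Inr m) x \<partial>law)) F" if "m \<le> 3" for m
    by (rule lln_average[OF F lim]) (use that in \<open>auto simp: lln_index_def\<close>)
  define C4 where "C4 = (\<integral>x. lln (Inr 0) x \<partial>law) + 1"
  have S1: "eventually (\<lambda>n. (\<Sum>t=1..int n. (1 + \<bar>?e t\<bar> ^ K) * Qv \<omega> t ^ (3 * K)) / real n \<le> C4) F"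
  proof -
    have "eventually (\<lambda>n. (\<Sum>t=1..int n. lln (Inr 0) (past t \<omega>)) / real n < C4) F"
      by (rule order_tendstoD(2)[OF avg]) (auto simp: C4_def)
    then show ?thesis by eventually_elim (simp add: lln_def Hf_past)
  qed
  have S2: "(\<Sum>t=1..int n. \<rho> ^ nat t * ((1 + \<bar>?e t\<bar> ^ K) * Qv \<omega> t ^ (3 * K))) \<le> c5" for n
    using wsum[of n] by (simp add: Hf_past)
  define b where "b n = 1 - (\<Sum>l<?d. \<delta> n l * \<mu> l) / 2" for n
  define eh where "eh n t = ?e t * (y n t / b n)" for n t
  have Db: "\<bar>D l \<omega> t\<bar> \<le> A1 / th_min * Qv \<omega> t" if "l < ?d" "1 \<le> t" for l t by (rule D_bound[OF reg that(1)])
  have A1t: "0 \<le> A1 / th_min" using A1 th_min(1) by simp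
  have bpos: "eventually (\<lambda>n. 1 / 2 \<le> b n) F"
    unfolding b_def
    by (rule perturbed_power_sums(1)[where e = ?e and D = "\<lambda>l t. D l \<omega> t" and y = y and Q = "Qv \<omega>" and \<delta> = \<delta> and \<mu> = \<mu> and d = ?d and K = K,
        OF F less_imp_le[OF rho(1)] less_imp_le[OF rho(2)] Qv_ge1 cd C2 A1t del exp])
       (rule Db Llim S1 S2 | assumption)+
  have hyp_a: "uniform_limit {0..1} (\<lambda>n u. (\<Sum>t=1..\<lfloor>real n * u\<rfloor>. eh n t ^ m - ?e t ^ m) / sqrt (real n)) (\<lambda>_. 0) F"
    if m: "m \<in> {1..K}" for m
    unfolding eh_def b_def
    by (rule perturbed_power_sums(2)[where e = ?e and D = "\<lambda>l t. D l \<omega> t" and y = y and Q = "Qv \<omega>" and \<delta> = \<delta> and \<mu> = \<mu> and d = ?d and K = K,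
        OF F less_imp_le[OF rho(1)] less_imp_le[OF rho(2)] Qv_ge1 cd C2 A1t del exp])
       (rule Db Llim S1 S2 m | assumption)+
  have b1: "((\<lambda>n. (\<Sum>t=1..int n. (?e t)\<^sup>2) / real n) \<longlongrightarrow> 1) F"
    using avg[of 2] integrable_now(2)[of "\<lambda>x. x\<^sup>2"] moment_le(2)[OF K2] var by (simp add: lln_def past_at_0)
  have b2: "((\<lambda>n. (\<Sum>t=1..int n. ?e t) / real n) \<longlongrightarrow> 0) F"
    using avg[of 1] integrable_now(2)[of "\<lambda>x. x"] moment_le(2)[of 1] K2 mean by (simp add: lln_def past_at_0)
  (* One unit for the strict inequality and one for the bound of x^m by 1 + x^K. *)
  define C3 where "C3 = (\<integral>x. lln (Inr 3) x \<partial>law) + 2"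
  have b3: "eventually (\<lambda>n. \<forall>m\<le>K. (\<Sum>t=1..int n. \<bar>?e t\<bar> ^ m) / real n \<le> C3) F"
  proof -
    have "eventually (\<lambda>n. (\<Sum>t=1..int n. lln (Inr 3) (past t \<omega>)) / real n < C3 - 1) F"
      by (rule order_tendstoD(2)[OF avg]) (auto simp: C3_def)
    with pos show ?thesis
    proof eventually_elim
      case (elim n)
      show ?case
      proof (intro allI impI)
        fix m assume m: "m \<le> K"
        have "(\<Sum>t=1..int n. \<bar>?e t\<bar> ^ m) \<le> (\<Sum>t=1..int n. 1 + \<bar>?e t\<bar> ^ K)"
          using m by (intro sum_mono power_mult_le_one_plus) auto
        also have "\<dots> = real n + (\<Sum>t=1..int n. \<bar>?e t\<bar> ^ K)" by (simp add: sum.distrib)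
        finally have "(\<Sum>t=1..int n. \<bar>?e t\<bar> ^ m) / real n \<le> (real n + (\<Sum>t=1..int n. \<bar>?e t\<bar> ^ K)) / real n"
          by (intro divide_right_mono) auto
        also have "\<dots> = 1 + (\<Sum>t=1..int n. \<bar>?e t\<bar> ^ K) / real n" using elim(1) by (simp add: add_divide_distrib)
        also have "\<dots> \<le> C3" using elim(2) by (simp add: lln_def past_at_0)
        finally show "(\<Sum>t=1..int n. \<bar>?e t\<bar> ^ m) / real n \<le> C3" .
      qed
    qed
  qed
  have main: "uniform_limit {0..1} (\<lambda>n u. 1 / sqrt (real n) *
       \<bar>partial_sum (eh n) k n u / sample_sd (eh n) n ^ k - partial_sum ?e k n u / sample_sd ?e n ^ k\<bar>) (\<lambda>_. 0) F"
    by (rule self_normalised_sums_close[OF F k hyp_a b1 b2 b3])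
  have "eventually (\<lambda>n. \<forall>u\<in>{0..1}. partial_sum (residual p q (th_hat n) (obs \<omega>)) k n u / sample_sd (residual p q (th_hat n) (obs \<omega>)) n ^ k
      = partial_sum (eh n) k n u / sample_sd (eh n) n ^ k) F"
    using bpos yok
  proof eventually_elim
    case (elim n)
    show ?case
    proof
      fix u :: real assume u: "u \<in> {0..1}"
      have "residual p q (th_hat n) (obs \<omega>) t = b n * eh n t" if "t \<in> {1..int n}" for t
        using elim that unfolding ok_def eh_def by auto
      then show "partial_sum (residual p q (th_hat n) (obs \<omega>)) k n u / sample_sd (residual p q (th_hat n) (obs \<omega>)) n ^ k
        = partial_sum (eh n) k n u / sample_sd (eh n) n ^ k"
        using elim(1) u by (intro self_normalised_scale[of n _ "b n"]) auto
    qed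
  qed
  then show ?thesis
    by (intro uniform_limit_cong[THEN iffD2, OF _ _ main]) (auto elim!: eventually_mono)
qed

end

section \<open>Passage to convergence in probability\<close>

text \<open>The statistic is a step function of \<open>u\<close>, so its supremum is a finite
  maximum and in particular measurable.\<close>

lemma sup_over_steps:
  fixes F :: "int \<Rightarrow> real"
  shows "(SUP u\<in>{0..1::real}. F \<lfloor>real n * u\<rfloor>) = Max ((\<lambda>j. F (int j)) ` {..n})"
proof -
  have "(\<lambda>u. F \<lfloor>real n * u\<rfloor>) ` {0..1} = (\<lambda>j. F (int j)) ` {..n}"
  proof (intro equalityI subsetI)
    fix z assume "z \<in> (\<lambda>u. F \<lfloor>real n * u\<rfloor>) ` {0..1}"
    then obtain u where u: "u \<in> {0..1}" "z = F \<lfloor>real n * u\<rfloor>" by auto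
    have "0 \<le> \<lfloor>real n * u\<rfloor>" using u by simp
    moreover have "\<lfloor>real n * u\<rfloor> \<le> int n" using u mult_left_le[of u "real n"] by (simp add: floor_le_iff)
    ultimately show "z \<in> (\<lambda>j. F (int j)) ` {..n}"
      using u(2) by (intro image_eqI[of _ _ "nat \<lfloor>real n * u\<rfloor>"]) auto
  next
    fix z assume "z \<in> (\<lambda>j. F (int j)) ` {..n}"
    then obtain j where j: "j \<le> n" "z = F (int j)" by auto
    show "z \<in> (\<lambda>u. F \<lfloor>real n * u\<rfloor>) ` {0..1}"
    proof (cases "n = 0")
      case True
      then show ?thesis using j by (intro image_eqI[of _ _ 0]) auto
    next
      case False
      then show ?thesis using j by (intro image_eqI[of _ _ "real j / real n"]) auto
    qed
  qed
  then show ?thesis by (simp add: cSup_eq_Max)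
qed

lemma garch_coeff_measurable:
  assumes "\<And>l. l < p + q + 1 \<Longrightarrow> (\<lambda>\<omega>. u \<omega> l) \<in> borel_measurable M"
  shows "(\<lambda>\<omega>. garch_coeff p q (u \<omega>) i) \<in> borel_measurable M"
proof (induction i rule: less_induct)
  case (less i)
  show ?case
  proof (cases "i = 0")
    case True
    show ?thesis unfolding True garch_coeff_0
      by (intro borel_measurable_divide borel_measurable_diff borel_measurable_sum borel_measurable_const assms) auto
  next
    case False
    have "(\<lambda>\<omega>. garch_coeff p q (u \<omega>) i) = (\<lambda>\<omega>. (if i \<le> p then u \<omega> i else 0) +
        (\<Sum>j=1..min (i - 1) q. u \<omega> (p + j) * garch_coeff p q (u \<omega>) (i - j)))"
      using False by (intro ext garch_coeff_pos_index) simp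
    also have "\<dots> \<in> borel_measurable M"
    proof (intro borel_measurable_add borel_measurable_sum borel_measurable_times)
      show "(\<lambda>\<omega>. if i \<le> p then u \<omega> i else 0) \<in> borel_measurable M" using assms[of i] by (cases "i \<le> p") auto
    qed (use False in \<open>auto intro!: assms less.IH\<close>)
    finally show ?thesis .
  qed
qed

lemma tendsto_0_via_subsequences:
  fixes a :: "nat \<Rightarrow> real"
  assumes "\<And>s. strict_mono (s :: nat \<Rightarrow> nat) \<Longrightarrow> \<exists>r. strict_mono (r :: nat \<Rightarrow> nat) \<and> (\<lambda>n. a (s (r n))) \<longlonglongrightarrow> 0"
  shows "a \<longlonglongrightarrow> 0"
proof (rule ccontr)
  assume "\<not> a \<longlonglongrightarrow> 0"
  then obtain e where e: "0 < e" "\<forall>N. \<exists>n\<ge>N. e \<le> \<bar>a n\<bar>" unfolding LIMSEQ_iff by (auto simp: not_less)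
  then have "infinite {n. e \<le> \<bar>a n\<bar>}" unfolding infinite_nat_iff_unbounded_le by auto
  then obtain s :: "nat \<Rightarrow> nat" where s: "strict_mono s" "\<And>n. e \<le> \<bar>a (s n)\<bar>" using infinite_enumerate by blast
  obtain r :: "nat \<Rightarrow> nat" where "(\<lambda>n. a (s (r n))) \<longlonglongrightarrow> 0" using assms[OF s(1)] by blast
  then have "eventually (\<lambda>n. \<bar>a (s (r n))\<bar> < e) sequentially"
    using e(1) order_tendstoD(2)[OF tendsto_rabs_zero] by blast
  then show False using s(2) by (auto simp: eventually_sequentially not_less[symmetric])
qed

lemma (in prob_space) prob_tendsto_0_AE:
  assumes m: "\<And>n. A n \<in> sets M" and ae: "AE \<omega> in M. eventually (\<lambda>n. \<omega> \<notin> A n) sequentially"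
  shows "(\<lambda>n. measure M (A n)) \<longlonglongrightarrow> 0"
proof -
  have "(\<lambda>n. \<integral>\<omega>. indicator (A n) \<omega> \<partial>M) \<longlonglongrightarrow> (\<integral>\<omega>. 0 \<partial>M :: real)"
  proof (rule integral_dominated_convergence[where w = "\<lambda>_. 1"])
    show "AE \<omega> in M. (\<lambda>n. indicator (A n) \<omega>) \<longlonglongrightarrow> (0::real)"
      using ae
    proof eventually_elim
      case (elim \<omega>)
      then show ?case by (intro tendsto_eventually) (auto elim: eventually_mono)
    qed
  qed (use m in \<open>auto simp: indicator_def\<close>)
  then show ?thesis using m by simp
qed

lemma max_norm_measurable:
  assumes "\<And>l. l < d \<Longrightarrow> (\<lambda>\<omega>. v \<omega> l) \<in> borel_measurable M"
  shows "(\<lambda>\<omega>. max_norm d (v \<omega>)) \<in> borel_measurable M"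
  unfolding max_norm_def using assms by (intro borel_measurable_Max borel_measurable_abs) auto

theorem theorem1p4:
  fixes M :: "'a measure" and p q k :: nat and \<theta> :: "nat \<Rightarrow> real"
    and \<epsilon> X \<sigma> :: "int \<Rightarrow> 'a \<Rightarrow> real"
    and u_lo u_hi \<rho>\<^sub>0 \<zeta> :: real
    and \<theta>_hat :: "nat \<Rightarrow> 'a \<Rightarrow> nat \<Rightarrow> real"
  assumes "prob_space M" and "p \<ge> 1" and "q \<ge> 1" and "k \<ge> 1"
    and "\<theta> 0 > 0" and "\<forall>i\<in>{1..p + q}. \<theta> i \<ge> 0"
    and "iid_process M \<epsilon>"
    and "integrable M (\<epsilon> 0)" and "integrable M (\<lambda>\<omega>. (\<epsilon> 0 \<omega>)\<^sup>2)"
    and "prob_space.expectation M (\<epsilon> 0) = 0" and "prob_space.variance M (\<epsilon> 0) = 1"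
    and "bougerol_picard M p q \<theta> \<epsilon>"
    and "stationary_garch M p q \<theta> \<epsilon> X \<sigma>"
    and "0 < u_lo" and "u_lo < u_hi" and "0 < \<rho>\<^sub>0" and "\<rho>\<^sub>0 < 1" and "real q * u_lo < \<rho>\<^sub>0"
    and "\<theta> \<in> Euclidean_space (p + q + 1) interior_of param_set p q u_lo u_hi \<rho>\<^sub>0"
    and "\<forall>n. \<forall>\<omega>\<in>space M. \<theta>_hat n \<omega> \<in> topspace (Euclidean_space (p + q + 1))"
    and "\<forall>n. \<forall>i<p + q + 1. (\<lambda>\<omega>. \<theta>_hat n \<omega> i) \<in> borel_measurable
           (vimage_algebra (space M) (\<lambda>\<omega>. \<lambda>t\<in>{0..int n}. X t \<omega>) (\<Pi>\<^sub>M t\<in>{0..int n}. borel))"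
    and "bounded_in_prob M (\<lambda>n \<omega>. sqrt (real n) * max_norm (p + q + 1) (\<lambda>i. \<theta>_hat n \<omega> i - \<theta> i))"
    and "\<not> (\<exists>c. AE \<omega> in M. \<epsilon> 0 \<omega> = c)"
    and "\<zeta> > 0"
    and "((\<lambda>x. x powr (- \<zeta>) * measure M {\<omega> \<in> space M. \<bar>\<epsilon> 0 \<omega>\<bar> \<le> x}) \<longlongrightarrow> 0) (at_right 0)"
    and "integrable M (\<lambda>\<omega>. \<bar>\<epsilon> 0 \<omega>\<bar> ^ max k 2)"
  shows "null_in_prob M (\<lambda>n \<omega>. SUP u\<in>{0..1::real}. 1 / sqrt (real n) *
           \<bar>partial_sum (residual p q (\<theta>_hat n \<omega>) (\<lambda>t. X t \<omega>)) k n u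
              / sample_sd (residual p q (\<theta>_hat n \<omega>) (\<lambda>t. X t \<omega>)) n ^ k
            - partial_sum (\<lambda>t. \<epsilon> t \<omega>) k n u / sample_sd (\<lambda>t. \<epsilon> t \<omega>) n ^ k\<bar>)"
proof -
  interpret I: iid_seq M \<epsilon> by (rule iid_seq.intro[OF assms(1) iid_seq_axioms.intro[OF assms(7)]])
  let ?d = "p + q + 1"
  have par: "\<theta> \<in> param_set p q u_lo u_hi \<rho>\<^sub>0" by (rule subsetD[OF interior_of_subset assms(19)])
  have th: "0 < \<theta> l" if "l < ?d" for l
  proof -
    have "u_lo \<le> \<theta> l" using par that unfolding param_set_def by simp
    with assms(14) show ?thesis by simp
  qed
  have T1: "(\<Sum>j=1..q. \<theta> (p + j)) < 1" using par assms(17) by (simp add: param_set_def)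
  from assms(13) obtain f where f: "f \<in> borel_measurable seqM" "\<And>t. AE \<omega> in M. \<sigma> t \<omega> = f (\<lambda>i. \<epsilon> (t - 1 - int i) \<omega>)"
    unfolding stationary_garch_def by blast
  have sf: "AE \<omega> in M. \<forall>t. \<sigma> t \<omega> = f (I.past (t - 1) \<omega>)"
    unfolding AE_all_countable I.past_def using f(2) by blast
  have ge: "AE \<omega> in M. \<forall>t. \<sigma> t \<omega> \<ge> 0 \<and> X t \<omega> = \<sigma> t \<omega> * \<epsilon> t \<omega> \<and>
        (\<sigma> t \<omega>)\<^sup>2 = \<theta> 0 + (\<Sum>i=1..p. \<theta> i * (X (t - int i) \<omega>)\<^sup>2) + (\<Sum>j=1..q. \<theta> (p + j) * (\<sigma> (t - int j) \<omega>)\<^sup>2)"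
    using assms(13) unfolding stationary_garch_def garch_equations_def by blast
  have Xf: "AE \<omega> in M. \<forall>t. X t \<omega> = f (I.past (t - 1) \<omega>) * \<epsilon> t \<omega>"
    using sf ge by eventually_elim metis
  have eqs: "AE \<omega> in M. \<forall>t. 0 \<le> f (I.past (t - 1) \<omega>) \<and> (f (I.past (t - 1) \<omega>))\<^sup>2 = \<theta> 0
       + (\<Sum>i=1..p. \<theta> i * (f (I.past (t - int i - 1) \<omega>) * \<epsilon> (t - int i) \<omega>)\<^sup>2)
       + (\<Sum>j=1..q. \<theta> (p + j) * (f (I.past (t - int j - 1) \<omega>))\<^sup>2)"
    using sf ge Xf
  proof eventually_elim
    case (elim \<omega>)
    have s: "f (I.past (t - 1) \<omega>) = \<sigma> t \<omega>" for t using elim(1) by simp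
    have x: "f (I.past (t - 1) \<omega>) * \<epsilon> t \<omega> = X t \<omega>" for t using elim(3) by simp
    show ?case unfolding x unfolding s using elim(2) by blast
  qed
  have lyap: "lyapunov_exponent M p q \<theta> \<epsilon> < 0" using assms(12) by (simp add: bougerol_picard_def)
  have cg: "causal_garch M \<epsilon> p q \<theta> f"
    by (rule causal_garch.intro[OF I.iid_seq_axioms causal_garch_axioms.intro[OF assms(2,3) th f(1) assms(9) lyap eqs]])
  define K where "K = max k 2"
  have gm: "garch_moments M \<epsilon> p q \<theta> f K"
    by (rule garch_moments.intro[OF cg garch_moments_axioms.intro[OF T1]]) (use assms(26) in \<open>auto simp: K_def\<close>)
  obtain s r C where gc: "garch_constants M \<epsilon> p q \<theta> f K s r C" using garch_moments.constants_exist[OF gm] by blast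
  interpret G: garch_constants M \<epsilon> p q \<theta> f K s r C by (rule gc)
  have XG: "AE \<omega> in M. \<forall>t. X t \<omega> = G.obs \<omega> t" using Xf by (simp add: G.obs_def G.sig_def)
  have var: "(\<integral>\<omega>. (\<epsilon> 0 \<omega>)\<^sup>2 \<partial>M) = 1" using assms(10,11) by simp
  have Xm[measurable]: "X t \<in> borel_measurable M" for t
  proof -
    have "(\<lambda>\<omega>. (X t \<omega>, \<sigma> t \<omega>)) \<in> measurable M (borel \<Otimes>\<^sub>M borel)"
      using assms(13) unfolding stationary_garch_def strictly_stationary_def by blast
    from measurable_compose[OF this measurable_fst] show ?thesis by simp
  qed
  have hat_meas: "(\<lambda>\<omega>. \<theta>_hat n \<omega> l) \<in> borel_measurable M" if "l < ?d" for n l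
  proof -
    let ?g = "\<lambda>\<omega>. \<lambda>t\<in>{0..int n}. X t \<omega>" and ?N = "\<Pi>\<^sub>M t\<in>{0..int n}. (borel :: real measure)"
    have g: "?g \<in> measurable M ?N" by (intro measurable_restrict) simp
    then have "sets (vimage_algebra (space M) ?g ?N) \<subseteq> sets M" by (simp add: measurable_iff_sets)
    then have "subalgebra M (vimage_algebra (space M) ?g ?N)" by (simp add: subalgebra_def)
    from measurable_from_subalg[OF this] assms(21) that show ?thesis by blast
  qed
  define R where "R n \<omega> = residual p q (\<theta>_hat n \<omega>) (\<lambda>t. X t \<omega>)" for n \<omega>
  have Rm: "(\<lambda>\<omega>. R n \<omega> t) \<in> borel_measurable M" for n t
    unfolding R_def residual_def using hat_meas
    by (intro borel_measurable_divide measurable_compose[OF _ borel_measurable_sqrt] borel_measurable_add borel_measurable_sum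
        borel_measurable_times borel_measurable_power garch_coeff_measurable Xm) auto
  define Y where "Y n \<omega> j = 1 / sqrt (real n) * \<bar>(\<Sum>t=1..j. (R n \<omega> t - sample_mean (R n \<omega>) n) ^ k) / sample_sd (R n \<omega>) n ^ k
      - (\<Sum>t=1..j. (\<epsilon> t \<omega> - sample_mean (\<lambda>t. \<epsilon> t \<omega>) n) ^ k) / sample_sd (\<lambda>t. \<epsilon> t \<omega>) n ^ k\<bar>" for n \<omega> and j :: int
  define Z where "Z n \<omega> = (SUP u\<in>{0..1::real}. 1 / sqrt (real n) *
           \<bar>partial_sum (R n \<omega>) k n u / sample_sd (R n \<omega>) n ^ k - partial_sum (\<lambda>t. \<epsilon> t \<omega>) k n u / sample_sd (\<lambda>t. \<epsilon> t \<omega>) n ^ k\<bar>)" for n \<omega>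
  have ZY: "Z n \<omega> = Max ((\<lambda>j. Y n \<omega> (int j)) ` {..n})" for n \<omega>
  proof -
    have "Z n \<omega> = (SUP u\<in>{0..1::real}. Y n \<omega> \<lfloor>real n * u\<rfloor>)"
      unfolding Z_def Y_def partial_sum_def by (rule refl)
    then show ?thesis by (simp only: sup_over_steps)
  qed
  have mean_m: "(\<lambda>\<omega>. sample_mean (g \<omega>) n) \<in> borel_measurable M" and sd_m: "(\<lambda>\<omega>. sample_sd (g \<omega>) n) \<in> borel_measurable M"
    if "\<And>t. (\<lambda>\<omega>. g \<omega> t) \<in> borel_measurable M" for g :: "'a \<Rightarrow> int \<Rightarrow> real" and n
  proof -
    show 1: "(\<lambda>\<omega>. sample_mean (g \<omega>) n) \<in> borel_measurable M"
      unfolding sample_mean_def by (intro borel_measurable_divide borel_measurable_sum that borel_measurable_const)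
    show "(\<lambda>\<omega>. sample_sd (g \<omega>) n) \<in> borel_measurable M"
      unfolding sample_sd_def partial_sum_def
      by (intro measurable_compose[OF _ borel_measurable_sqrt] borel_measurable_divide borel_measurable_sum borel_measurable_power borel_measurable_diff that 1 borel_measurable_const)
  qed
  have Ym: "(\<lambda>\<omega>. Y n \<omega> j) \<in> borel_measurable M" for n j
    unfolding Y_def
    by (intro borel_measurable_times borel_measurable_abs borel_measurable_diff borel_measurable_divide borel_measurable_sum
        borel_measurable_power mean_m sd_m Rm I.eps_measurable borel_measurable_const)
  have Zm[measurable]: "Z n \<in> borel_measurable M" for n
    unfolding ZY by (intro borel_measurable_Max Ym) auto
  define B where "B n \<omega> = sqrt (real n) * max_norm ?d (\<lambda>i. \<theta>_hat n \<omega> i - \<theta> i)" for n \<omega>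
  have Bm[measurable]: "B n \<in> borel_measurable M" for n
    unfolding B_def by (intro borel_measurable_times max_norm_measurable borel_measurable_diff hat_meas borel_measurable_const)
  (* The condition on the estimator enters the pathwise estimate through the filter, which is
     restricted to the sample sizes n with B n \<omega> \<le> c. Almost sure convergence of the
     averages is available along subsequences, and these suffice. *)
  have key: "(\<lambda>n. measure M {\<omega> \<in> space M. \<delta> < \<bar>Z n \<omega>\<bar> \<and> B n \<omega> \<le> c}) \<longlonglongrightarrow> 0" if del: "0 < \<delta>" for \<delta> c
  proof (rule tendsto_0_via_subsequences)
    fix ss :: "nat \<Rightarrow> nat" assume ss: "strict_mono ss"
    let ?A = "\<lambda>n. {\<omega> \<in> space M. \<delta> < \<bar>Z n \<omega>\<bar> \<and> B n \<omega> \<le> c}"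
    have fin: "finite G.lln_index" by (simp add: G.lln_index_def)
    have "\<exists>r. strict_mono r \<and> (AE \<omega> in M. \<forall>i\<in>G.lln_index. (\<lambda>n. I.max_dev (G.lln i) (ss (r n)) \<omega>) \<longlonglongrightarrow> 0)"
      by (rule I.max_dev_AE_subseq[OF fin _ _ ss]) (auto intro: G.lln_measurable G.lln_integrable)
    then obtain rr where rr: "strict_mono rr" "AE \<omega> in M. \<forall>i\<in>G.lln_index. (\<lambda>n. I.max_dev (G.lln i) (ss (rr n)) \<omega>) \<longlonglongrightarrow> 0"
      by blast
    define F0 where "F0 = filtermap (\<lambda>n. ss (rr n)) sequentially"
    have F0: "F0 \<le> sequentially"
      unfolding F0_def using filterlim_subseq[OF strict_mono_o[OF ss rr(1)]] by (simp add: filterlim_def comp_def)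
    have "AE \<omega> in M. eventually (\<lambda>n. \<omega> \<notin> ?A (ss (rr n))) sequentially"
      using rr(2) G.AE_regular G.AE_weighted_sum_bounded XG
    proof eventually_elim
      case (elim \<omega>)
      define F where "F = inf F0 (principal {n. B n \<omega> \<le> c})"
      have FF0: "F \<le> F0" by (simp add: F_def)
      then have F: "F \<le> sequentially" using F0 by (rule order_trans)
      obtain c5 where c5: "\<And>n. (\<Sum>t=1..int n. G.\<rho> ^ nat t * G.Hf (I.past t \<omega>)) \<le> c5" using elim(3) by blast
      have lim: "((\<lambda>n. I.max_dev (G.lln i) n \<omega>) \<longlongrightarrow> 0) F" if "i \<in> G.lln_index" for i
      proof (rule tendsto_mono[OF FF0])
        show "((\<lambda>n. I.max_dev (G.lln i) n \<omega>) \<longlongrightarrow> 0) F0"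
          unfolding F0_def filterlim_filtermap using elim(1) that by blast
      qed
      have X: "(\<lambda>t. X t \<omega>) = G.obs \<omega>" using elim(4) by (intro ext) simp
      have ev: "eventually (\<lambda>n. sqrt (real n) * max_norm ?d (\<lambda>l. \<theta>_hat n \<omega> l - \<theta> l) \<le> c) F"
        unfolding F_def eventually_inf_principal B_def by simp
      have "uniform_limit {0..1} (\<lambda>n u. 1 / sqrt (real n) *
           \<bar>partial_sum (R n \<omega>) k n u / sample_sd (R n \<omega>) n ^ k - partial_sum (\<lambda>t. \<epsilon> t \<omega>) k n u / sample_sd (\<lambda>t. \<epsilon> t \<omega>) n ^ k\<bar>) (\<lambda>_. 0) F"
        unfolding R_def X
        by (rule G.residual_sums_close_on_path[OF elim(2) F lim c5 assms(10) var assms(4) K_def ev])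
      from uniform_limitD[OF this del] have "eventually (\<lambda>n. \<bar>Z n \<omega>\<bar> \<le> \<delta>) F"
      proof eventually_elim
        case (elim n)
        have le: "1 / sqrt (real n) * \<bar>partial_sum (R n \<omega>) k n u / sample_sd (R n \<omega>) n ^ k - partial_sum (\<lambda>t. \<epsilon> t \<omega>) k n u / sample_sd (\<lambda>t. \<epsilon> t \<omega>) n ^ k\<bar> \<le> \<delta>"
          if "u \<in> {0..1}" for u using elim[rule_format, OF that] by (simp add: dist_real_def)
        have "Z n \<omega> \<le> \<delta>" unfolding Z_def by (rule cSUP_least) (use le in auto)
        moreover have "0 \<le> Z n \<omega>"
        proof -
          have "0 \<le> Y n \<omega> (int 0)" by (simp add: Y_def)
          also have "\<dots> \<le> Z n \<omega>" unfolding ZY by (rule Max_ge) (auto intro!: image_eqI[of _ _ 0])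
          finally show ?thesis .
        qed
        ultimately show ?case by simp
      qed
      then have "eventually (\<lambda>n. B n \<omega> \<le> c \<longrightarrow> \<bar>Z n \<omega>\<bar> \<le> \<delta>) F0" unfolding F_def eventually_inf_principal by simp
      then have "eventually (\<lambda>n. B (ss (rr n)) \<omega> \<le> c \<longrightarrow> \<bar>Z (ss (rr n)) \<omega>\<bar> \<le> \<delta>) sequentially"
        unfolding F0_def eventually_filtermap .
      then show ?case by eventually_elim auto
    qed
    then have "(\<lambda>n. measure M (?A (ss (rr n)))) \<longlonglongrightarrow> 0" by (intro I.prob_tendsto_0_AE) measurable
    with rr(1) show "\<exists>r. strict_mono r \<and> (\<lambda>n. measure M (?A (ss (r n)))) \<longlonglongrightarrow> 0" by blast
  qed
  (* Tightness of the estimation error provides c such that the excluded event has probability at most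
     \<eta> / 2. *)
  have "(\<lambda>n. measure M {\<omega> \<in> space M. \<bar>Z n \<omega>\<bar> > \<delta>}) \<longlonglongrightarrow> 0" if del: "0 < \<delta>" for \<delta>
  proof (rule LIMSEQ_I)
    fix \<eta> :: real assume eta: "0 < \<eta>"
    obtain c where c: "\<forall>\<^sub>F n in sequentially. measure M {\<omega> \<in> space M. \<bar>B n \<omega>\<bar> > c} \<le> \<eta> / 2"
      using assms(22) eta unfolding bounded_in_prob_def B_def by (meson half_gt_zero)
    have "\<forall>\<^sub>F n in sequentially. measure M {\<omega> \<in> space M. \<delta> < \<bar>Z n \<omega>\<bar> \<and> B n \<omega> \<le> c} < \<eta> / 2"
      using eta by (intro order_tendstoD(2)[OF key[OF del]]) simp
    with c have "\<forall>\<^sub>F n in sequentially. norm (measure M {\<omega> \<in> space M. \<bar>Z n \<omega>\<bar> > \<delta>} - 0) < \<eta>"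
    proof eventually_elim
      case (elim n)
      have "measure M {\<omega> \<in> space M. \<bar>Z n \<omega>\<bar> > \<delta>}
        \<le> measure M ({\<omega> \<in> space M. \<delta> < \<bar>Z n \<omega>\<bar> \<and> B n \<omega> \<le> c} \<union> {\<omega> \<in> space M. \<bar>B n \<omega>\<bar> > c})"
        by (intro I.finite_measure_mono) auto
      also have "\<dots> \<le> measure M {\<omega> \<in> space M. \<delta> < \<bar>Z n \<omega>\<bar> \<and> B n \<omega> \<le> c} + measure M {\<omega> \<in> space M. \<bar>B n \<omega>\<bar> > c}"
        by (intro measure_Un_le) auto
      also have "\<dots> < \<eta>" using elim by linarith
      finally show ?case by simp
    qed
    then show "\<exists>n0. \<forall>n\<ge>n0. norm (measure M {\<omega> \<in> space M. \<bar>Z n \<omega>\<bar> > \<delta>} - 0) < \<eta>" by (simp only: eventually_sequentially)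
  qed
  then have "null_in_prob M Z" unfolding null_in_prob_def using Zm by blast
  then show ?thesis unfolding Z_def[abs_def] R_def .
qed

end
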